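(* Let $\alpha\in\mathbb{R}$, $0<s\le1$, and let $b=\frac12+$ (that is, $b>\frac12$ is any number sufficiently close to $\frac12$, how close being allowed to depend on $s$ and $\alpha$). There exist $\sigma>0$ and a constant $C>0$ such that for all $0<T<1$ and all $u,v\in X_{s,b}$ with compact time support in $[-T,T]$, $$\|\partial_x(uv)\|_{X_{s,b-1}}\le C\,T^\sigma\,\|u\|_{X_{s,b}}\,\|v\|_{X_{s,b}} .$$
   Context: Notation. $\hat f(\xi,\mu,\tau)$ is the space-time Fourier transform of $f(x,y,t)$, $(x,y,t)\in\mathbb{R}^3$ (kernel $e^{-i(x\xi+y\mu+t\tau)}$). Let $\omega(\xi,\mu)=\xi^5-\alpha\xi^3+\frac{\mu^2}{\xi}$. Let $\chi_0(\lambda)=\mathbf 1_{[0,1]}(|\lambda|)$ and $\chi_j(\lambda)=\mathbf 1_{[2^{j-1},2^j]}(|\lambda|)$ for $j\ge1$. For $s,b\in\mathbb{R}$, the space $X_{s,b}$ is defined by the norm $$\|f\|_{X_{s,b}}=\sum_{j\ge0}2^{jb}\Big\|\chi_j(\tau-\omega(\xi,\mu))\Big(1+|\xi|^2+\frac{|\mu|}{|\xi|}\Big)^s\hat f(\xi,\mu,\tau)\Big\|_{L^2_{\xi,\mu,\tau}} .$$ *)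

theory Defs
  imports "HOL-Analysis.Analysis"
begin

text \<open>
  Points of \<open>\<real>\<^sup>3\<close> are triples \<open>(x, y, t)\<close>, respectively \<open>(\<xi>, \<mu>, \<tau>)\<close> on the Fourier side; the inner
  product of the product type is \<open>x * \<xi> + y * \<mu> + t * \<tau>\<close>.
\<close>

type_synonym R3 = "real \<times> real \<times> real"

fun iter_partial :: "R3 list \<Rightarrow> (R3 \<Rightarrow> complex) \<Rightarrow> R3 \<Rightarrow> complex" where
  "iter_partial [] \<phi> = \<phi>"
| "iter_partial (e # es) \<phi> = (\<lambda>p. frechet_derivative (iter_partial es \<phi>) (at p) e)"

definition schwartz :: "(R3 \<Rightarrow> complex) \<Rightarrow> bool" where
  "schwartz \<phi> \<longleftrightarrow> (\<forall>es \<in> lists Basis.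
      (\<forall>p. iter_partial es \<phi> differentiable (at p)) \<and>
      (\<forall>n::nat. bounded (range (\<lambda>p. norm p ^ n *\<^sub>R iter_partial es \<phi> p))))"

definition fourier :: "(R3 \<Rightarrow> complex) \<Rightarrow> R3 \<Rightarrow> complex" where
  "fourier \<phi> q = (LINT p|lborel. exp (- \<i> * complex_of_real (p \<bullet> q)) * \<phi> p)"

text \<open>
  Distributions are functionals on Schwartz functions.  Continuity is not recorded: for the
  functionals \<open>dist_of f\<close> of tempered functions \<open>f\<close>, and for their derivatives, it is automatic
  (uniform boundedness principle).
\<close>

type_synonym dist = "(R3 \<Rightarrow> complex) \<Rightarrow> complex"

definition tempered_fun :: "(R3 \<Rightarrow> complex) \<Rightarrow> bool" where
  "tempered_fun f \<longleftrightarrow> f \<in> borel_measurable lborel \<and>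
     (\<forall>\<phi>. schwartz \<phi> \<longrightarrow> integrable lborel (\<lambda>p. f p * \<phi> p))"

definition dist_of :: "(R3 \<Rightarrow> complex) \<Rightarrow> dist" where
  "dist_of f = (\<lambda>\<phi>. LINT p|lborel. f p * \<phi> p)"

definition dist_dx :: "dist \<Rightarrow> dist" where
  "dist_dx D = (\<lambda>\<phi>. - D (\<lambda>p. frechet_derivative \<phi> (at p) (1, 0, 0)))"

text \<open>
  The Fourier transform of a distribution is given by duality.  The function \<open>F\<close> below is
  determined by \<open>D\<close> almost everywhere.
\<close>

definition has_fourier :: "dist \<Rightarrow> (R3 \<Rightarrow> complex) \<Rightarrow> bool" where
  "has_fourier D F \<longleftrightarrow> tempered_fun F \<and>
     (\<forall>\<phi>. schwartz \<phi> \<longrightarrow> D (fourier \<phi>) = dist_of F \<phi>)"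

definition L2norm :: "(R3 \<Rightarrow> complex) \<Rightarrow> ennreal" where
  "L2norm f = (let I = (\<integral>\<^sup>+ p. ennreal ((norm (f p))\<^sup>2) \<partial>lborel)
               in if I = \<infinity> then \<infinity> else ennreal (sqrt (enn2real I)))"

text \<open>
  In \<open>\<omega>\<close> and in the weight, the convention \<open>x / 0 = 0\<close> only matters on the null set \<open>\<xi> = 0\<close>.
\<close>

definition \<omega> :: "real \<Rightarrow> real \<Rightarrow> real \<Rightarrow> real" where
  "\<omega> \<alpha> \<xi> \<mu> = \<xi> ^ 5 - \<alpha> * \<xi> ^ 3 + \<mu>\<^sup>2 / \<xi>"

definition dyadic_cutoff :: "nat \<Rightarrow> real \<Rightarrow> real" where
  "dyadic_cutoff j r = (if j = 0 then indicator {0..1} \<bar>r\<bar>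
           else indicator {2 ^ (j - 1)..2 ^ j} \<bar>r\<bar>)"

definition Xnorm_hat :: "real \<Rightarrow> real \<Rightarrow> real \<Rightarrow> (R3 \<Rightarrow> complex) \<Rightarrow> ennreal" where
  "Xnorm_hat \<alpha> s b F = (\<Sum>j. ennreal (2 powr (real j * b)) *
     L2norm (\<lambda>(\<xi>, \<mu>, \<tau>). complex_of_real
       (dyadic_cutoff j (\<tau> - \<omega> \<alpha> \<xi> \<mu>) * (1 + \<bar>\<xi>\<bar>\<^sup>2 + \<bar>\<mu>\<bar> / \<bar>\<xi>\<bar>) powr s) * F (\<xi>, \<mu>, \<tau>)))"

text \<open>
  Since \<open>F\<close> is unique almost everywhere, the infimum is over a single value, or is \<open>\<infinity>\<close> if the
  Fourier transform of \<open>D\<close> is not a function.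
\<close>

definition Xnorm :: "real \<Rightarrow> real \<Rightarrow> real \<Rightarrow> dist \<Rightarrow> ennreal" where
  "Xnorm \<alpha> s b D = (INF F \<in> {F. has_fourier D F}. Xnorm_hat \<alpha> s b F)"

text \<open>
  The functions in \<open>X\<^bsub>s,b\<^esub>\<close>.  For \<open>s, b \<ge> 0\<close> all elements of \<open>X\<^bsub>s,b\<^esub>\<close> are of this kind, and
  are square integrable by Plancherel's theorem, because the weights are at least \<open>1\<close>; in
  particular, the product of two of them is integrable.
\<close>

definition Xspace :: "real \<Rightarrow> real \<Rightarrow> real \<Rightarrow> (R3 \<Rightarrow> complex) set" where
  "Xspace \<alpha> s b = {f. tempered_fun f \<and> Xnorm \<alpha> s b (dist_of f) < \<infinity>}"

definition time_support_in :: "real set \<Rightarrow> (R3 \<Rightarrow> complex) \<Rightarrow> bool" where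
  "time_support_in S f \<longleftrightarrow> (AE (x, y, t) in lborel. t \<notin> S \<longrightarrow> f (x, y, t) = 0)"

end

theory Submission
  imports Defs "HOL-Probability.Probability"
begin

text \<open>
  By duality the estimate without time localisation reduces to a trilinear bound for functions
  supported in slabs \<open>|\<tau> - \<omega>(\<xi>,\<mu>)| \<le> M\<^sub>i\<close>, namely \<open>(M\<^sub>1 M\<^sub>2 M\<^sub>3)\<^bsup>29/60\<^esup>\<close> times the \<open>L\<^sup>2\<close> norms.
  Since \<open>\<omega>\<close> is odd, one may take \<open>\<xi>\<^sub>2\<close> to be the smallest frequency.  If some \<open>M\<^sub>i\<close> exceeds
  \<open>|\<xi>\<^sub>1|\<^bsup>11/4\<^esup> |\<xi>\<^sub>2|\<close>, Cauchy--Schwarz and the measure of the intersection of two slabs, which is quadratic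
  in \<open>\<mu>\<close>, suffice.  Otherwise the resonance function, whose two terms almost cancel, confines the
  frequencies to a thin set and a Loomis--Whitney argument applies.

  The exponent \<open>29/60 < 1/2\<close> leaves room for a power of \<open>T\<close>: time support in \<open>[-T,T]\<close> and Bessel's inequality
  at fixed time give \<open>\<parallel>U\<parallel>\<^sub>2 \<le> T\<^bsup>1/2\<^esup> \<parallel>u\<parallel>\<close> for the Fourier transform \<open>U\<close>, and interpolation with
  the \<open>X\<^bsub>s,b\<^esub>\<close> norm gains \<open>T\<^bsup>1/120\<^esup>\<close> on the factor that carries no weight.  That the Fourier transform of a
  product is a convolution, and the \<open>L\<^sup>2\<close> bounds, are derived by testing with Gaussians only.
\<close>

section \<open>Trilinear estimates\<close>

text \<open>Where the threshold and the exponent come from. Let N be the size of the large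
  frequencies and N^a times the small frequency the threshold between the two cases. A modulation M
  above the threshold confines the small frequency to length M / N^a; the squared form then
  contributes N^(5/2 - a), so a > 5/2 is required. Below the threshold the resonance identity
  localises up to an error N^(a - 2), the squared form contributes N^(a - 3), and a < 3 is required.
  The choice 11/4 is the midpoint. In the second case the bound is M1 M2 N^(-1/4), while M1 and M2
  are at most of order N^(15/4). Giving up the power 1/30 of M1 M2 costs exactly N^(1/4). This
  produces (M1 M2 M3)^(29/30) for the square of the form, hence 29/60 for the form itself. On the
  analytic side Plancherel's identity is avoided: every L2 statement is an inequality, obtained from
  Schur's test for a Gaussian kernel and Fatou's lemma. The functions are only tempered, so
  inversion is available only after regularisation, and limits only almost everywhere along
  subsequences.\<close>

lemma nn_integral_lborel_reflect:
  fixes f :: "'a::euclidean_space \<Rightarrow> ennreal"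
  assumes [measurable]: "f \<in> borel_measurable borel"
  shows "(\<integral>\<^sup>+x. f (c - x) \<partial>lborel) = (\<integral>\<^sup>+x. f x \<partial>lborel)"
proof -
  have "(\<integral>\<^sup>+x. f x \<partial>lborel) =
      (\<integral>\<^sup>+x. f x \<partial>density (distr lborel borel (\<lambda>x. c + (-1) *\<^sub>R x)) (\<lambda>_. \<bar>-1::real\<bar> ^ DIM('a)))"
    by (subst lborel_affine[of "-1" c]) (auto simp: one_ennreal_def)
  also have "\<dots> = (\<integral>\<^sup>+x. f (c - x) \<partial>lborel)"
    by (simp add: nn_integral_density nn_integral_distr)
  finally show ?thesis by simp
qed

lemma nn_integral_lborel_translate:
  fixes f :: "'a::euclidean_space \<Rightarrow> ennreal"
  assumes [measurable]: "f \<in> borel_measurable borel"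
  shows "(\<integral>\<^sup>+x. f (c + x) \<partial>lborel) = (\<integral>\<^sup>+x. f x \<partial>lborel)"
proof -
  have "(\<integral>\<^sup>+x. f x \<partial>lborel) = (\<integral>\<^sup>+x. f x \<partial>distr lborel borel ((+) c))"
    by (simp add: lborel_distr_plus)
  also have "\<dots> = (\<integral>\<^sup>+x. f (c + x) \<partial>lborel)"
    by (simp add: nn_integral_distr)
  finally show ?thesis by simp
qed

section \<open>Trilinear forms: two kernel criteria and the symmetries\<close>

definition tri :: "('a::euclidean_space \<Rightarrow> 'a \<Rightarrow> ennreal) \<Rightarrow> ('a \<Rightarrow> ennreal) \<Rightarrow> ('a \<Rightarrow> ennreal) \<Rightarrow> ('a \<Rightarrow> ennreal) \<Rightarrow> ennreal" where
  "tri k f g h = (\<integral>\<^sup>+x. \<integral>\<^sup>+y. k x y * (f x * g y * h (- x - y)) \<partial>lborel \<partial>lborel)"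

abbreviation sqint :: "('a::euclidean_space \<Rightarrow> ennreal) \<Rightarrow> ennreal" where
  "sqint f \<equiv> (\<integral>\<^sup>+x. (f x)\<^sup>2 \<partial>lborel)"

lemma lborel_Fubini:
  fixes f :: "'a::euclidean_space \<Rightarrow> 'b::euclidean_space \<Rightarrow> ennreal"
  assumes [measurable]: "case_prod f \<in> borel_measurable (lborel \<Otimes>\<^sub>M lborel)"
  shows "(\<integral>\<^sup>+x. \<integral>\<^sup>+y. f x y \<partial>lborel \<partial>lborel) = (\<integral>\<^sup>+y. \<integral>\<^sup>+x. f x y \<partial>lborel \<partial>lborel)"
  by (rule lborel_pair.Fubini'[symmetric]) simp

text \<open>Cauchy--Schwarz twice: in \<open>x\<close>, which splits off \<open>f\<close>, and then
  in \<open>y\<close> for fixed \<open>x\<close>, which splits off the square integral of a row of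
  the kernel. The remaining double integral of \<open>(g y * h (- x - y))\<^sup>2\<close> factorises
  because \<open>- x - y\<close> runs through Lebesgue measure as \<open>x\<close> does.\<close>

lemma tri_P:
  fixes k :: "'a::euclidean_space \<Rightarrow> 'a \<Rightarrow> ennreal"
  assumes k[measurable]: "case_prod k \<in> borel_measurable (lborel \<Otimes>\<^sub>M lborel)"
    and [measurable]: "f \<in> borel_measurable borel" "g \<in> borel_measurable borel" "h \<in> borel_measurable borel"
    and B: "\<And>x. (\<integral>\<^sup>+y. (k x y)\<^sup>2 \<partial>lborel) \<le> B"
  shows "(tri k f g h)\<^sup>2 \<le> B * sqint f * sqint g * sqint h"
proof -
  have km[measurable]: "k x \<in> borel_measurable borel" for x
    using measurable_compose[OF measurable_Pair1'[of x lborel lborel] k] by simp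
  define G where "G x = (\<integral>\<^sup>+y. k x y * (g y * h (- x - y)) \<partial>lborel)" for x
  have [measurable]: "G \<in> borel_measurable borel" unfolding G_def by measurable
  have "tri k f g h = (\<integral>\<^sup>+x. f x * G x \<partial>lborel)"
    unfolding tri_def G_def
    by (subst nn_integral_cmult[symmetric]) (auto intro!: nn_integral_cong simp: ac_simps)
  then have 1: "(tri k f g h)\<^sup>2 \<le> sqint f * sqint G"
    using Cauchy_Schwarz_nn_integral[of f lborel G] by simp
  have "sqint G \<le> (\<integral>\<^sup>+x. B * (\<integral>\<^sup>+y. (g y * h (- x - y))\<^sup>2 \<partial>lborel) \<partial>lborel)"
  proof (intro nn_integral_mono)
    fix x
    have "(G x)\<^sup>2 \<le> (\<integral>\<^sup>+y. (k x y)\<^sup>2 \<partial>lborel) * (\<integral>\<^sup>+y. (g y * h (- x - y))\<^sup>2 \<partial>lborel)"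
      unfolding G_def by (rule Cauchy_Schwarz_nn_integral) measurable
    also have "\<dots> \<le> B * (\<integral>\<^sup>+y. (g y * h (- x - y))\<^sup>2 \<partial>lborel)"
      by (intro mult_right_mono B) auto
    finally show "(G x)\<^sup>2 \<le> B * (\<integral>\<^sup>+y. (g y * h (- x - y))\<^sup>2 \<partial>lborel)" .
  qed
  also have "\<dots> = B * (\<integral>\<^sup>+y. \<integral>\<^sup>+x. (g y * h (- x - y))\<^sup>2 \<partial>lborel \<partial>lborel)"
    by (subst nn_integral_cmult, measurable) (subst lborel_Fubini, auto)
  also have "(\<lambda>y. \<integral>\<^sup>+x. (g y * h (- x - y))\<^sup>2 \<partial>lborel) = (\<lambda>y. (g y)\<^sup>2 * sqint h)"
  proof
    fix y
    have "(\<integral>\<^sup>+x. (g y * h (- x - y))\<^sup>2 \<partial>lborel) = (g y)\<^sup>2 * (\<integral>\<^sup>+x. (h (- y - x))\<^sup>2 \<partial>lborel)"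
      by (subst nn_integral_cmult[symmetric]) (auto simp: power_mult_distrib diff_diff_eq add.commute minus_diff_commute intro!: nn_integral_cong)
    then show "(\<integral>\<^sup>+x. (g y * h (- x - y))\<^sup>2 \<partial>lborel) = (g y)\<^sup>2 * sqint h"
      by (simp add: nn_integral_lborel_reflect[where f="\<lambda>x. (h x)\<^sup>2"])
  qed
  also have "(\<integral>\<^sup>+y. (g y)\<^sup>2 * sqint h \<partial>lborel) = sqint g * sqint h"
    by (rule nn_integral_multc) measurable
  finally show ?thesis using 1
    by (smt (verit) mult.assoc mult.left_commute mult_left_mono order_trans zero_le)
qed

text \<open>A criterion of Loomis--Whitney type. After Cauchy--Schwarz in \<open>z\<close>, the
  square of \<open>G z\<close> is a double integral over \<open>x\<close> and \<open>y\<close>.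
  Pairing \<open>g x\<close> with \<open>h (- z - y)\<close> instead of \<open>h (- z - x)\<close>,
  and then substituting for \<open>y\<close>, frees the arguments of \<open>g\<close> and
  \<open>h\<close> from \<open>z\<close>, so that \<open>z\<close> is integrated over the two kernel
  factors alone.\<close>

lemma tri_Q:
  fixes k :: "'a::euclidean_space \<Rightarrow> 'a \<Rightarrow> ennreal"
  assumes k[measurable]: "case_prod k \<in> borel_measurable (lborel \<Otimes>\<^sub>M lborel)"
    and [measurable]: "f \<in> borel_measurable borel" "g \<in> borel_measurable borel" "h \<in> borel_measurable borel"
    and B: "\<And>x y. (\<integral>\<^sup>+z. k z x * k z (- z - y) \<partial>lborel) \<le> B"
  shows "(tri k f g h)\<^sup>2 \<le> B * sqint f * sqint g * sqint h"
proof -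
  have km[measurable]: "k x \<in> borel_measurable borel" for x
    using measurable_compose[OF measurable_Pair1'[of x lborel lborel] k] by simp
  define G where "G z = (\<integral>\<^sup>+x. k z x * (g x * h (- z - x)) \<partial>lborel)" for z
  have [measurable]: "G \<in> borel_measurable borel" unfolding G_def by measurable
  have "tri k f g h = (\<integral>\<^sup>+x. f x * G x \<partial>lborel)"
    unfolding tri_def G_def
    by (subst nn_integral_cmult[symmetric]) (auto intro!: nn_integral_cong simp: ac_simps)
  then have 1: "(tri k f g h)\<^sup>2 \<le> sqint f * sqint G"
    using Cauchy_Schwarz_nn_integral[of f lborel G] by simp
  define H where "H z x y = k z x * k z y * ((g x)\<^sup>2 * (h (- z - y))\<^sup>2)" for z x y
  have [measurable]: "(\<lambda>(z, x, y). H z x y) \<in> borel_measurable (lborel \<Otimes>\<^sub>M lborel \<Otimes>\<^sub>M lborel)"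
    unfolding H_def by measurable
  have 2: "(G z)\<^sup>2 \<le> (\<integral>\<^sup>+x. \<integral>\<^sup>+y. H z x y \<partial>lborel \<partial>lborel)" for z
  proof -
    have "2 * (G z)\<^sup>2 = (\<integral>\<^sup>+x. \<integral>\<^sup>+y. 2 * ((k z x * (g x * h (- z - x))) * (k z y * (g y * h (- z - y)))) \<partial>lborel \<partial>lborel)"
      unfolding power2_eq_square G_def
      by (simp add: nn_integral_cmult nn_integral_multc)
    also have "\<dots> \<le> (\<integral>\<^sup>+x. \<integral>\<^sup>+y. (H z x y + H z y x) \<partial>lborel \<partial>lborel)"
    proof (intro nn_integral_mono)
      fix x y
      \<comment> \<open>The four factors are regrouped crosswise before 2ab \<le> a^2 + b^2 is
        applied. The two resulting terms are mirror images under exchanging \<open>x\<close> and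
        \<open>y\<close>, so their integrals agree.\<close>
      have "2 * ((k z x * (g x * h (- z - x))) * (k z y * (g y * h (- z - y))))
        = k z x * k z y * (2 * ((g x * h (- z - y)) * (g y * h (- z - x))))"
        by (simp add: ac_simps)
      also have "\<dots> \<le> k z x * k z y * ((g x * h (- z - y))\<^sup>2 + (g y * h (- z - x))\<^sup>2)"
        using sum_of_squares_ge_ennreal[of "g x * h (- z - y)" "g y * h (- z - x)"]
        by (intro mult_left_mono) (auto simp: mult.assoc)
      also have "\<dots> = H z x y + H z y x"
        by (simp add: H_def power_mult_distrib distrib_left ac_simps)
      finally show "2 * ((k z x * (g x * h (- z - x))) * (k z y * (g y * h (- z - y)))) \<le> H z x y + H z y x" .
    qed
    also have "\<dots> = (\<integral>\<^sup>+x. \<integral>\<^sup>+y. H z x y \<partial>lborel \<partial>lborel) + (\<integral>\<^sup>+x. \<integral>\<^sup>+y. H z y x \<partial>lborel \<partial>lborel)"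
      by (simp add: nn_integral_add)
    also have "(\<integral>\<^sup>+x. \<integral>\<^sup>+y. H z y x \<partial>lborel \<partial>lborel) = (\<integral>\<^sup>+x. \<integral>\<^sup>+y. H z x y \<partial>lborel \<partial>lborel)"
      by (rule lborel_Fubini) measurable
    finally have "2 * (G z)\<^sup>2 \<le> 2 * (\<integral>\<^sup>+x. \<integral>\<^sup>+y. H z x y \<partial>lborel \<partial>lborel)" by (simp add: mult_2)
    then show ?thesis by (subst (asm) ennreal_mult_le_mult_iff) auto
  qed
  have "sqint G \<le> (\<integral>\<^sup>+z. \<integral>\<^sup>+x. \<integral>\<^sup>+y. H z x y \<partial>lborel \<partial>lborel \<partial>lborel)"
    by (intro nn_integral_mono 2)
  \<comment> \<open>Replacing \<open>y\<close> by \<open>- z - y\<close> turns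
    \<open>h (- z - y)\<close> into \<open>h y\<close> and moves \<open>z\<close> into the second
    kernel factor.\<close>
  also have "\<dots> = (\<integral>\<^sup>+z. \<integral>\<^sup>+x. \<integral>\<^sup>+y. H z x (- z - y) \<partial>lborel \<partial>lborel \<partial>lborel)"
    by (intro nn_integral_cong nn_integral_lborel_reflect[symmetric]) measurable
  also have "\<dots> = (\<integral>\<^sup>+x. \<integral>\<^sup>+z. \<integral>\<^sup>+y. H z x (- z - y) \<partial>lborel \<partial>lborel \<partial>lborel)"
    unfolding H_def by (rule lborel_Fubini) measurable
  also have "\<dots> = (\<integral>\<^sup>+x. \<integral>\<^sup>+y. \<integral>\<^sup>+z. H z x (- z - y) \<partial>lborel \<partial>lborel \<partial>lborel)"
    unfolding H_def by (intro nn_integral_cong lborel_Fubini) measurable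
  also have "\<dots> \<le> (\<integral>\<^sup>+x. \<integral>\<^sup>+y. B * ((g x)\<^sup>2 * (h y)\<^sup>2) \<partial>lborel \<partial>lborel)"
    unfolding H_def by (intro nn_integral_mono) (auto simp: nn_integral_multc intro!: mult_right_mono B)
  also have "\<dots> = B * (sqint g * sqint h)"
    by (simp add: nn_integral_cmult nn_integral_multc)
  finally show ?thesis using 1
    by (smt (verit) mult.assoc mult.left_commute mult_left_mono order_trans zero_le)
qed

text \<open>The points \<open>x\<close>, \<open>y\<close> and \<open>- x - y\<close> sum to zero, so
  the form is invariant under permuting its three functions if the kernel is permuted accordingly.
  This transposition and that of \<open>tri_rot\<close> generate all permutations.\<close>

lemma tri_swap:
  assumes k[measurable]: "case_prod k \<in> borel_measurable (lborel \<Otimes>\<^sub>M lborel)"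
    and [measurable]: "f \<in> borel_measurable borel" "g \<in> borel_measurable borel" "h \<in> borel_measurable borel"
  shows "tri k f g h = tri (\<lambda>x y. k y x) g f h"
proof -
  have "tri k f g h = (\<integral>\<^sup>+y. \<integral>\<^sup>+x. k x y * (f x * g y * h (- x - y)) \<partial>lborel \<partial>lborel)"
    unfolding tri_def by (rule lborel_Fubini) measurable
  also have "\<dots> = tri (\<lambda>x y. k y x) g f h"
    unfolding tri_def by (auto simp: ac_simps minus_diff_commute intro!: nn_integral_cong)
  finally show ?thesis .
qed

lemma tri_rot:
  assumes k[measurable]: "case_prod k \<in> borel_measurable (lborel \<Otimes>\<^sub>M lborel)"
    and [measurable]: "f \<in> borel_measurable borel" "g \<in> borel_measurable borel" "h \<in> borel_measurable borel"
  shows "tri k f g h = tri (\<lambda>x y. k x (- x - y)) f h g"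
  unfolding tri_def
proof (rule nn_integral_cong)
  fix x
  have [measurable]: "k x \<in> borel_measurable borel"
    using measurable_compose[OF measurable_Pair1'[of x lborel lborel] k] by simp
  show "(\<integral>\<^sup>+y. k x y * (f x * g y * h (- x - y)) \<partial>lborel) =
      (\<integral>\<^sup>+y. k x (- x - y) * (f x * h y * g (- x - y)) \<partial>lborel)"
    using nn_integral_lborel_reflect[of "\<lambda>y. k x y * (f x * g y * h (- x - y))" "-x"]
    by (simp add: ac_simps)
qed

lemma tri_mono: "(\<And>x y. k x y \<le> k' x y) \<Longrightarrow> tri k f g h \<le> tri k' f g h"
  unfolding tri_def by (intro nn_integral_mono mult_right_mono) auto

lemma nn_integral_R3:
  fixes f :: "R3 \<Rightarrow> ennreal"
  assumes [measurable]: "f \<in> borel_measurable borel"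
  shows "(\<integral>\<^sup>+p. f p \<partial>lborel) = (\<integral>\<^sup>+x. \<integral>\<^sup>+y. \<integral>\<^sup>+t. f (x, y, t) \<partial>lborel \<partial>lborel \<partial>lborel)"
proof -
  have "(\<integral>\<^sup>+p. f p \<partial>lborel) = (\<integral>\<^sup>+p. f p \<partial>(lborel \<Otimes>\<^sub>M lborel))"
    by (simp only: lborel_prod)
  also have "\<dots> = (\<integral>\<^sup>+x. \<integral>\<^sup>+q. f (x, q) \<partial>lborel \<partial>lborel)"
    by (subst lborel.nn_integral_fst[symmetric]) (simp_all add: lborel_prod)
  also have "\<dots> = (\<integral>\<^sup>+x. \<integral>\<^sup>+q. f (x, q) \<partial>(lborel \<Otimes>\<^sub>M lborel) \<partial>lborel)"
    by (simp only: lborel_prod)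
  also have "\<dots> = (\<integral>\<^sup>+x. \<integral>\<^sup>+y. \<integral>\<^sup>+t. f (x, y, t) \<partial>lborel \<partial>lborel \<partial>lborel)"
    by (subst lborel.nn_integral_fst[symmetric]) (simp_all add: lborel_prod)
  finally show ?thesis .
qed

section \<open>Quadratic sublevel sets and intersections of two slabs\<close>

lemma emeasure_lborel_diam:
  fixes S :: "real set"
  assumes "\<And>a b. a \<in> S \<Longrightarrow> b \<in> S \<Longrightarrow> a \<le> b \<Longrightarrow> b - a \<le> L" "L \<ge> 0"
  shows "emeasure lborel S \<le> ennreal L"
proof (cases "S = {}")
  case False
  then obtain x where x: "x \<in> S" by auto
  have bd: "bdd_below S"
  proof
    fix y assume "y \<in> S"
    then show "x - L \<le> y" using assms(1)[of y x] x assms(2) by (cases "y \<le> x") auto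
  qed
  have "S \<subseteq> {Inf S..Inf S + L}"
  proof
    fix y assume y: "y \<in> S"
    have "y - L \<le> Inf S"
    proof (rule cInf_greatest)
      fix z assume "z \<in> S" then show "y - L \<le> z" using assms(1)[of z y] y assms(2) by (cases "z \<le> y") auto
    qed (use y in auto)
    then show "y \<in> {Inf S..Inf S + L}" using cInf_lower[OF y bd] by auto
  qed
  then have "emeasure lborel S \<le> emeasure lborel {Inf S..Inf S + L}" by (rule emeasure_mono) auto
  then show ?thesis using assms(2) by simp
qed simp

text \<open>After completing the square, the values of \<open>(x - c)\<^sup>2\<close> at two points
  of the set differ by at most 2 M / \<bar>A\<bar>. On one side of the vertex \<open>c\<close> the
  squared distance of two points is at most this difference, so either half has diameter at most
  sqrt (2 M / \<bar>A\<bar>). The constant 3 is 2 sqrt 2 rounded up.\<close>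

lemma emeasure_quadratic_sublevel:
  fixes A B C M :: real
  assumes A: "A \<noteq> 0" and M: "M \<ge> 0"
  shows "emeasure lborel {x. \<bar>A * x\<^sup>2 + B * x + C\<bar> \<le> M} \<le> ennreal (3 * sqrt (M / \<bar>A\<bar>))"
proof -
  define c where "c = - B / (2 * A)"
  define S where "S = {x. \<bar>A * x\<^sup>2 + B * x + C\<bar> \<le> M}"
  have sq: "A * x\<^sup>2 + B * x + C = A * (x - c)\<^sup>2 + (C - A * c\<^sup>2)" for x
    using A by (simp add: c_def field_simps power2_eq_square)
  have key: "\<bar>(b - c)\<^sup>2 - (a - c)\<^sup>2\<bar> \<le> 2 * (M / \<bar>A\<bar>)" if "a \<in> S" "b \<in> S" for a b
  proof -
    have "\<bar>A * ((b - c)\<^sup>2 - (a - c)\<^sup>2)\<bar> \<le> 2 * M"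
      using that unfolding S_def sq by (auto simp: algebra_simps abs_le_iff)
    then have "\<bar>A\<bar> * \<bar>(b - c)\<^sup>2 - (a - c)\<^sup>2\<bar> \<le> 2 * M" by (simp only: abs_mult)
    then show ?thesis using A by (simp add: field_simps)
  qed
  have L: "b - a \<le> sqrt (2 * (M / \<bar>A\<bar>))" if "a \<in> S" "b \<in> S" "a \<le> b" "a \<ge> c \<or> b \<le> c" for a b
  proof (rule real_le_rsqrt)
    have "(b - a)\<^sup>2 \<le> \<bar>(b - c)\<^sup>2 - (a - c)\<^sup>2\<bar>"
    proof (cases "a \<ge> c")
      case True
      then have "0 \<le> 2 * ((b - a) * (a - c))" using that by auto
      also have "2 * ((b - a) * (a - c)) = (b - c)\<^sup>2 - (a - c)\<^sup>2 - (b - a)\<^sup>2"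
        by (simp add: power2_eq_square algebra_simps)
      finally show ?thesis by simp
    next
      case False
      then have "0 \<le> 2 * ((b - a) * (c - b))" using that by auto
      also have "2 * ((b - a) * (c - b)) = (a - c)\<^sup>2 - (b - c)\<^sup>2 - (b - a)\<^sup>2"
        by (simp add: power2_eq_square algebra_simps)
      finally show ?thesis by simp
    qed
    then show "(b - a)\<^sup>2 \<le> 2 * (M / \<bar>A\<bar>)" using key[OF that(1,2)] by simp
  qed
  have "S = (S \<inter> {c..}) \<union> (S \<inter> {..c})" by auto
  moreover have [measurable]: "S \<in> sets borel" unfolding S_def by measurable
  ultimately have "emeasure lborel S \<le> emeasure lborel (S \<inter> {c..}) + emeasure lborel (S \<inter> {..c})"
    by (metis emeasure_subadditive sets_lborel sets.Int[OF \<open>S \<in> sets borel\<close>] atLeast_borel atMost_borel)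
  also have "\<dots> \<le> ennreal (sqrt (2 * (M / \<bar>A\<bar>))) + ennreal (sqrt (2 * (M / \<bar>A\<bar>)))"
    using M by (intro add_mono emeasure_lborel_diam L) auto
  also have "\<dots> = ennreal (2 * sqrt 2 * sqrt (M / \<bar>A\<bar>))"
    using M by (subst ennreal_plus[symmetric]) (auto simp: real_sqrt_mult[symmetric] real_sqrt_divide)
  also have "\<dots> \<le> ennreal (3 * sqrt (M / \<bar>A\<bar>))"
  proof (intro ennreal_leI mult_right_mono)
    have "sqrt 2 \<le> 3 / 2" by (rule real_le_lsqrt) (auto simp: power2_eq_square)
    then show "2 * sqrt 2 \<le> 3" by simp
  qed (use M in auto)
  finally show ?thesis unfolding S_def .
qed

text \<open>Integration in \<open>\<tau>\<close> costs the smaller of the two widths. Integration in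
  \<open>\<mu>\<close> costs the square root of the larger one, because the two centres differ by a
  quadratic polynomial in \<open>\<mu>\<close> that must be at most \<open>M + M'\<close>. The power
  3/4 of the product is a weaker bound, but symmetric in the widths and still below the final
  exponent 29/30.\<close>

lemma two_slab:
  fixes K :: "real \<Rightarrow> ennreal" and \<Omega>1 \<Omega>2 :: "real \<Rightarrow> real \<Rightarrow> real"
  assumes [measurable]: "K \<in> borel_measurable borel"
    and [measurable]: "case_prod \<Omega>1 \<in> borel_measurable (borel \<Otimes>\<^sub>M borel)"
    and [measurable]: "case_prod \<Omega>2 \<in> borel_measurable (borel \<Otimes>\<^sub>M borel)"
    and M: "M \<ge> 1" "M' \<ge> 1"
    and q: "\<And>\<xi>. K \<xi> \<noteq> 0 \<Longrightarrow> \<exists>A B C. A \<noteq> 0 \<and> 1 / \<bar>A\<bar> \<le> R \<and> (\<forall>\<mu>. \<Omega>1 \<xi> \<mu> - \<Omega>2 \<xi> \<mu> = A * \<mu>\<^sup>2 + B * \<mu> + C)"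
  shows "(\<integral>\<^sup>+x. (case x of (\<xi>, \<mu>, \<tau>) \<Rightarrow>
      if \<bar>\<tau> - \<Omega>1 \<xi> \<mu>\<bar> \<le> M \<and> \<bar>\<tau> - \<Omega>2 \<xi> \<mu>\<bar> \<le> M' then K \<xi> else 0) \<partial>lborel)
    \<le> ennreal (9 * (M * M') powr (3/4) * sqrt R) * (\<integral>\<^sup>+\<xi>. K \<xi> \<partial>lborel)"
proof -
  have [measurable]: "(\<lambda>x. \<Omega>1 (f x) (g x)) \<in> borel_measurable N" "(\<lambda>x. \<Omega>2 (f x) (g x)) \<in> borel_measurable N"
    if [measurable]: "f \<in> borel_measurable N" "g \<in> borel_measurable N" for f g and N :: "'n measure"
    using measurable_compose[OF measurable_Pair[OF that] assms(2)]
      measurable_compose[OF measurable_Pair[OF that] assms(3)] by simp_all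
  define m where "m = min M M'"
  have mM: "m \<ge> 1" "M + M' \<le> 2 * max M M'" "m * max M M' = M * M'" using M by (auto simp: m_def min_def max_def)
  have inner: "(\<integral>\<^sup>+\<tau>. (if \<bar>\<tau> - \<Omega>1 \<xi> \<mu>\<bar> \<le> M \<and> \<bar>\<tau> - \<Omega>2 \<xi> \<mu>\<bar> \<le> M' then K \<xi> else 0) \<partial>lborel)
      \<le> (K \<xi> * ennreal (2 * m)) * indicator {\<mu>. \<bar>\<Omega>1 \<xi> \<mu> - \<Omega>2 \<xi> \<mu>\<bar> \<le> M + M'} \<mu>" for \<xi> \<mu>
  proof -
    \<comment> \<open>The centre of the narrower slab. If both conditions on \<open>\<tau>\<close>
      can hold, the two centres are at most \<open>M + M'\<close> apart.\<close>
    define c where "c = (if M \<le> M' then \<Omega>1 \<xi> \<mu> else \<Omega>2 \<xi> \<mu>)"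
    have "(\<integral>\<^sup>+\<tau>. (if \<bar>\<tau> - \<Omega>1 \<xi> \<mu>\<bar> \<le> M \<and> \<bar>\<tau> - \<Omega>2 \<xi> \<mu>\<bar> \<le> M' then K \<xi> else 0) \<partial>lborel)
      \<le> (\<integral>\<^sup>+\<tau>. K \<xi> * indicator {\<mu>. \<bar>\<Omega>1 \<xi> \<mu> - \<Omega>2 \<xi> \<mu>\<bar> \<le> M + M'} \<mu> * indicator {c - m..c + m} \<tau> \<partial>lborel)"
      by (intro nn_integral_mono) (auto simp: c_def m_def indicator_def)
    also have "\<dots> = (K \<xi> * indicator {\<mu>. \<bar>\<Omega>1 \<xi> \<mu> - \<Omega>2 \<xi> \<mu>\<bar> \<le> M + M'} \<mu>) * ennreal (2 * m)"
      using mM by (subst nn_integral_cmult) auto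
    finally show ?thesis by (simp add: ac_simps)
  qed
  have mid: "(\<integral>\<^sup>+\<mu>. (K \<xi> * ennreal (2 * m)) * indicator {\<mu>. \<bar>\<Omega>1 \<xi> \<mu> - \<Omega>2 \<xi> \<mu>\<bar> \<le> M + M'} \<mu> \<partial>lborel)
     \<le> ennreal (9 * (M * M') powr (3/4) * sqrt R) * K \<xi>" for \<xi>
  proof (cases "K \<xi> = 0")
    case False
    then obtain A B C where A: "A \<noteq> 0" "1 / \<bar>A\<bar> \<le> R" and e: "\<And>\<mu>. \<Omega>1 \<xi> \<mu> - \<Omega>2 \<xi> \<mu> = A * \<mu>\<^sup>2 + B * \<mu> + C"
      using q by metis
    have R: "0 \<le> R" using A by (meson abs_ge_zero divide_nonneg_nonneg order_trans zero_le_one)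
    have "(\<integral>\<^sup>+\<mu>. (K \<xi> * ennreal (2 * m)) * indicator {\<mu>. \<bar>\<Omega>1 \<xi> \<mu> - \<Omega>2 \<xi> \<mu>\<bar> \<le> M + M'} \<mu> \<partial>lborel)
       = (K \<xi> * ennreal (2 * m)) * emeasure lborel {\<mu>. \<bar>A * \<mu>\<^sup>2 + B * \<mu> + C\<bar> \<le> M + M'}"
      unfolding e by (subst nn_integral_cmult_indicator) auto
    also have "\<dots> \<le> (K \<xi> * ennreal (2 * m)) * ennreal (3 * sqrt ((M + M') / \<bar>A\<bar>))"
      using M by (intro mult_left_mono emeasure_quadratic_sublevel A) auto
    also have "\<dots> = K \<xi> * ennreal (2 * m * (3 * sqrt ((M + M') / \<bar>A\<bar>)))"
      using mM M by (subst ennreal_mult) (auto simp: mult.assoc)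
    also have "\<dots> \<le> K \<xi> * ennreal (9 * (M * M') powr (3/4) * sqrt R)"
    proof (intro mult_left_mono ennreal_leI)
      define x where "x = max M M'"
      have x: "x \<ge> m" "x \<ge> 1" using M by (auto simp: x_def m_def)
      have "(M + M') / \<bar>A\<bar> \<le> (2 * x) * R"
        using mult_mono[of "M + M'" "2 * x" "1 / \<bar>A\<bar>" R] A M mM by (auto simp: x_def)
      then have "sqrt ((M + M') / \<bar>A\<bar>) \<le> sqrt (2 * x * R)" by simp
      also have "\<dots> = sqrt 2 * sqrt x * sqrt R" by (simp add: real_sqrt_mult)
      also have "\<dots> \<le> 3 / 2 * sqrt x * sqrt R"
        using R x real_le_lsqrt[of "3/2" 2] by (intro mult_right_mono) (auto simp: power2_eq_square)
      finally have 1: "2 * m * (3 * sqrt ((M + M') / \<bar>A\<bar>)) \<le> 2 * m * (3 * (3 / 2 * sqrt x * sqrt R))"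
        using mM by (intro mult_left_mono) auto
      \<comment> \<open>A quarter power of the smaller width is traded for one of the larger. The
        constant 9 is 2 * 3 * 3/2, with 3/2 in place of sqrt 2.\<close>
      have "m * sqrt x \<le> (M * M') powr (3/4)"
      proof -
        have "m * sqrt x = m powr (3/4) * m powr (1/4) * x powr (1/2)"
          using mM x by (simp add: powr_add[symmetric] powr_half_sqrt)
        also have "\<dots> \<le> m powr (3/4) * x powr (1/4) * x powr (1/2)"
          using mM x by (intro mult_right_mono mult_left_mono powr_mono2) auto
        also have "\<dots> = (m * x) powr (3/4)"
          using mM x by (simp add: powr_mult mult.assoc powr_add[symmetric])
        finally show ?thesis using mM by (simp add: x_def)
      qed
      then have "9 * (m * sqrt x) * sqrt R \<le> 9 * (M * M') powr (3/4) * sqrt R"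
        using R by (intro mult_right_mono) auto
      then show "2 * m * (3 * sqrt ((M + M') / \<bar>A\<bar>)) \<le> 9 * (M * M') powr (3/4) * sqrt R"
        using 1 by (simp add: mult_ac)
    qed simp
    finally show ?thesis by (simp add: ac_simps)
  qed simp
  have "(\<integral>\<^sup>+x. (case x of (\<xi>, \<mu>, \<tau>) \<Rightarrow>
      if \<bar>\<tau> - \<Omega>1 \<xi> \<mu>\<bar> \<le> M \<and> \<bar>\<tau> - \<Omega>2 \<xi> \<mu>\<bar> \<le> M' then K \<xi> else 0) \<partial>lborel)
    = (\<integral>\<^sup>+\<xi>. \<integral>\<^sup>+\<mu>. \<integral>\<^sup>+\<tau>. (if \<bar>\<tau> - \<Omega>1 \<xi> \<mu>\<bar> \<le> M \<and> \<bar>\<tau> - \<Omega>2 \<xi> \<mu>\<bar> \<le> M' then K \<xi> else 0) \<partial>lborel \<partial>lborel \<partial>lborel)"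
    by (subst nn_integral_R3) (auto simp: borel_prod[symmetric])
  also have "\<dots> \<le> (\<integral>\<^sup>+\<xi>. \<integral>\<^sup>+\<mu>. (K \<xi> * ennreal (2 * m)) * indicator {\<mu>. \<bar>\<Omega>1 \<xi> \<mu> - \<Omega>2 \<xi> \<mu>\<bar> \<le> M + M'} \<mu> \<partial>lborel \<partial>lborel)"
    by (intro nn_integral_mono inner)
  also have "\<dots> \<le> (\<integral>\<^sup>+\<xi>. ennreal (9 * (M * M') powr (3/4) * sqrt R) * K \<xi> \<partial>lborel)"
    by (intro nn_integral_mono mid)
  also have "\<dots> = ennreal (9 * (M * M') powr (3/4) * sqrt R) * (\<integral>\<^sup>+\<xi>. K \<xi> \<partial>lborel)"
    by (rule nn_integral_cmult) simp
  finally show ?thesis .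
qed

definition slab :: "real \<Rightarrow> real \<Rightarrow> R3 set" where
  "slab \<alpha> M = {x. \<bar>snd (snd x) - \<omega> \<alpha> (fst x) (fst (snd x))\<bar> \<le> M}"

lemma measurable_fst_borel[measurable (raw)]:
  fixes f :: "'n \<Rightarrow> 'a::second_countable_topology \<times> 'b::second_countable_topology"
  shows "f \<in> borel_measurable N \<Longrightarrow> (\<lambda>x. fst (f x)) \<in> borel_measurable N"
  unfolding borel_prod[symmetric] by (rule measurable_compose[OF _ measurable_fst])

lemma measurable_snd_borel[measurable (raw)]:
  fixes f :: "'n \<Rightarrow> 'a::second_countable_topology \<times> 'b::second_countable_topology"
  shows "f \<in> borel_measurable N \<Longrightarrow> (\<lambda>x. snd (f x)) \<in> borel_measurable N"
  unfolding borel_prod[symmetric] by (rule measurable_compose[OF _ measurable_snd])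

lemma \<omega>_measurable[measurable (raw)]:
  assumes [measurable]: "f \<in> borel_measurable N" "g \<in> borel_measurable N"
  shows "(\<lambda>x. \<omega> \<alpha> (f x) (g x)) \<in> borel_measurable N"
  unfolding \<omega>_def by measurable

lemma slab_measurable[measurable (raw)]:
  assumes [measurable]: "f \<in> borel_measurable N"
  shows "Measurable.pred N (\<lambda>x. f x \<in> slab \<alpha> M)"
  unfolding slab_def mem_Collect_eq by measurable

text \<open>For fixed \<open>x = (a, b, c)\<close> the difference of the centres has the leading
  coefficient 1/\<xi> - 1/(a + \<xi>) = a / (\<xi> (a + \<xi>)). When \<xi> is the smallest
  frequency, \<bar>\<xi>\<bar> \<le> \<bar>a\<bar> and \<bar>a + \<xi>\<bar> \<le> 2 \<bar>a\<bar>,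
  so its reciprocal is at most 2 \<bar>a\<bar>.\<close>

lemma P_kernel:
  fixes K :: "real \<Rightarrow> ennreal" and x :: R3
  assumes [measurable]: "K \<in> borel_measurable borel" and M: "M2 \<ge> 1" "M3 \<ge> 1"
    and K: "\<And>\<xi>. K \<xi> \<noteq> 0 \<Longrightarrow> \<xi> \<noteq> 0 \<and> \<bar>\<xi>\<bar> \<le> \<bar>fst x\<bar> \<and> \<bar>\<xi>\<bar> \<le> \<bar>fst x + \<xi>\<bar>"
  shows "(\<integral>\<^sup>+y. (if y \<in> slab \<alpha> M2 \<and> - x - y \<in> slab \<alpha> M3 then K (fst y) else 0) \<partial>lborel)
    \<le> ennreal (9 * (M2 * M3) powr (3/4) * sqrt (2 * \<bar>fst x\<bar>)) * (\<integral>\<^sup>+\<xi>. K \<xi> \<partial>lborel)"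
proof -
  obtain a b c where x: "x = (a, b, c)" by (cases x)
  define \<Omega>2 where "\<Omega>2 \<xi> \<mu> = - c - \<omega> \<alpha> (- a - \<xi>) (- b - \<mu>)" for \<xi> \<mu>
  have "(\<integral>\<^sup>+y. (if y \<in> slab \<alpha> M2 \<and> - x - y \<in> slab \<alpha> M3 then K (fst y) else 0) \<partial>lborel)
     = (\<integral>\<^sup>+x. (case x of (\<xi>, \<mu>, \<tau>) \<Rightarrow>
      if \<bar>\<tau> - \<omega> \<alpha> \<xi> \<mu>\<bar> \<le> M2 \<and> \<bar>\<tau> - \<Omega>2 \<xi> \<mu>\<bar> \<le> M3 then K \<xi> else 0) \<partial>lborel)"
    by (intro nn_integral_cong) (auto simp: slab_def x \<Omega>2_def abs_le_iff)
  also have "\<dots> \<le> ennreal (9 * (M2 * M3) powr (3/4) * sqrt (2 * \<bar>a\<bar>)) * (\<integral>\<^sup>+\<xi>. K \<xi> \<partial>lborel)"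
  proof (rule two_slab)
    fix \<xi> assume "K \<xi> \<noteq> 0"
    with K[of \<xi>] have \<xi>: "\<xi> \<noteq> 0" "\<bar>\<xi>\<bar> \<le> \<bar>a\<bar>" "\<bar>\<xi>\<bar> \<le> \<bar>a + \<xi>\<bar>" by (auto simp: x)
    then have nz: "a \<noteq> 0" "a + \<xi> \<noteq> 0" by auto
    define A where "A = a / (\<xi> * (a + \<xi>))"
    have A: "A = 1 / \<xi> - 1 / (a + \<xi>)" using nz \<xi> by (simp add: A_def field_simps)
    have "1 / \<bar>A\<bar> = \<bar>\<xi>\<bar> * (\<bar>a + \<xi>\<bar> / \<bar>a\<bar>)" using nz by (simp add: A_def abs_mult)
    also have "\<dots> \<le> \<bar>a\<bar> * 2" using \<xi> nz by (intro mult_mono) (auto simp: field_simps)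
    finally have "1 / \<bar>A\<bar> \<le> 2 * \<bar>a\<bar>" by simp
    moreover have "A \<noteq> 0" using nz \<xi> by (simp add: A_def)
    moreover have "\<omega> \<alpha> \<xi> \<mu> - \<Omega>2 \<xi> \<mu> = A * \<mu>\<^sup>2 + (- 2 * b / (a + \<xi>)) * \<mu> +
        (\<xi>^5 - \<alpha> * \<xi>^3 + c + ((-a-\<xi>)^5 - \<alpha> * (-a-\<xi>)^3) - b\<^sup>2 / (a + \<xi>))" for \<mu>
    proof -
      have "(- b - \<mu>)\<^sup>2 / (- a - \<xi>) = - ((b + \<mu>)\<^sup>2 / (a + \<xi>))"
        by (simp add: power2_eq_square divide_minus_right[symmetric] algebra_simps del: divide_minus_right)
      also have "(b + \<mu>)\<^sup>2 / (a + \<xi>) = b\<^sup>2 / (a + \<xi>) + 2 * b / (a + \<xi>) * \<mu> + \<mu>\<^sup>2 * (1 / (a + \<xi>))"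
        by (simp add: power2_sum add_divide_distrib)
      finally show ?thesis by (simp add: \<Omega>2_def \<omega>_def A algebra_simps)
    qed
    ultimately show "\<exists>A B C. A \<noteq> 0 \<and> 1 / \<bar>A\<bar> \<le> 2 * \<bar>a\<bar> \<and> (\<forall>\<mu>. \<omega> \<alpha> \<xi> \<mu> - \<Omega>2 \<xi> \<mu> = A * \<mu>\<^sup>2 + B * \<mu> + C)"
      by blast
  qed (use M in \<open>auto simp: \<Omega>2_def\<close>)
  finally show ?thesis by (simp add: x)
qed

text \<open>Here the leading coefficient is 1/(a + \<xi>) - 1/(d + \<xi>), which might cancel.
  Opposite signs of the denominators exclude this: its absolute value is then the sum of two
  reciprocals, and the reciprocal of that sum is at most the smaller of \<bar>a + \<xi>\<bar> and
  \<bar>d + \<xi>\<bar>, hence at most 2 min \<bar>a\<bar> \<bar>d\<bar>.\<close>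

lemma Q_kernel:
  fixes K :: "real \<Rightarrow> ennreal" and x y :: R3
  assumes [measurable]: "K \<in> borel_measurable borel" and M: "M1 \<ge> 1" "M3 \<ge> 1"
    and K: "\<And>\<xi>. K \<xi> \<noteq> 0 \<Longrightarrow> (fst x + \<xi>) * (fst y + \<xi>) < 0 \<and> \<bar>\<xi>\<bar> \<le> \<bar>fst x\<bar> \<and> \<bar>\<xi>\<bar> \<le> \<bar>fst y\<bar>"
  shows "(\<integral>\<^sup>+z. (if - z - x \<in> slab \<alpha> M3 \<and> - z - y \<in> slab \<alpha> M1 then K (fst z) else 0) \<partial>lborel)
    \<le> ennreal (9 * (M3 * M1) powr (3/4) * sqrt (2 * min \<bar>fst x\<bar> \<bar>fst y\<bar>)) * (\<integral>\<^sup>+\<xi>. K \<xi> \<partial>lborel)"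
proof -
  obtain a b c where x: "x = (a, b, c)" by (cases x)
  obtain d e f where y: "y = (d, e, f)" by (cases y)
  define \<Omega>1 where "\<Omega>1 \<xi> \<mu> = - c - \<omega> \<alpha> (- a - \<xi>) (- b - \<mu>)" for \<xi> \<mu>
  define \<Omega>2 where "\<Omega>2 \<xi> \<mu> = - f - \<omega> \<alpha> (- d - \<xi>) (- e - \<mu>)" for \<xi> \<mu>
  have com: "- \<xi> - a = - a - \<xi>" for \<xi> a :: real by simp
  have "(\<integral>\<^sup>+z. (if - z - x \<in> slab \<alpha> M3 \<and> - z - y \<in> slab \<alpha> M1 then K (fst z) else 0) \<partial>lborel)
     = (\<integral>\<^sup>+x. (case x of (\<xi>, \<mu>, \<tau>) \<Rightarrow>
      if \<bar>\<tau> - \<Omega>1 \<xi> \<mu>\<bar> \<le> M3 \<and> \<bar>\<tau> - \<Omega>2 \<xi> \<mu>\<bar> \<le> M1 then K \<xi> else 0) \<partial>lborel)"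
    by (intro nn_integral_cong) (auto simp: slab_def x y \<Omega>1_def \<Omega>2_def abs_le_iff com)
  also have "\<dots> \<le> ennreal (9 * (M3 * M1) powr (3/4) * sqrt (2 * min \<bar>a\<bar> \<bar>d\<bar>)) * (\<integral>\<^sup>+\<xi>. K \<xi> \<partial>lborel)"
  proof (rule two_slab)
    fix \<xi> assume "K \<xi> \<noteq> 0"
    with K[of \<xi>] have \<xi>: "(a + \<xi>) * (d + \<xi>) < 0" "\<bar>\<xi>\<bar> \<le> \<bar>a\<bar>" "\<bar>\<xi>\<bar> \<le> \<bar>d\<bar>" by (auto simp: x y)
    then have nz: "a + \<xi> \<noteq> 0" "d + \<xi> \<noteq> 0" by auto
    define A where "A = 1 / (a + \<xi>) - 1 / (d + \<xi>)"
    have abs: "\<bar>A\<bar> = 1 / \<bar>a + \<xi>\<bar> + 1 / \<bar>d + \<xi>\<bar>"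
    proof (cases "a + \<xi> > 0")
      case True
      with \<xi> have "d + \<xi> < 0" by (simp add: mult_less_0_iff)
      then have "A > 0" "\<bar>d + \<xi>\<bar> = - (d + \<xi>)" "\<bar>a + \<xi>\<bar> = a + \<xi>" using True unfolding A_def
        by (auto intro!: order.strict_trans[of "1 / (d + \<xi>)" 0 "1 / (a + \<xi>)"])
      then show ?thesis by (simp only: divide_minus_right) (simp add: A_def)
    next
      case False
      with \<xi> have "d + \<xi> > 0" "a + \<xi> < 0" by (auto simp: mult_less_0_iff)
      then have "A < 0" "\<bar>a + \<xi>\<bar> = - (a + \<xi>)" "\<bar>d + \<xi>\<bar> = d + \<xi>" unfolding A_def
        by (auto intro!: order.strict_trans[of "1 / (a + \<xi>)" 0 "1 / (d + \<xi>)"])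
      then show ?thesis by (simp only: divide_minus_right) (simp add: A_def)
    qed
    have p: "1 / \<bar>a + \<xi>\<bar> > 0" "1 / \<bar>d + \<xi>\<bar> > 0" using nz by auto
    have Ap: "\<bar>A\<bar> > 0" using abs p by linarith
    have "1 / \<bar>A\<bar> \<le> 1 / (1 / \<bar>a + \<xi>\<bar>)" using abs p Ap by (intro divide_left_mono mult_pos_pos) linarith+
    then have 1: "1 / \<bar>A\<bar> \<le> 2 * \<bar>a\<bar>" using \<xi> by simp
    have "1 / \<bar>A\<bar> \<le> 1 / (1 / \<bar>d + \<xi>\<bar>)" using abs p Ap by (intro divide_left_mono mult_pos_pos) linarith+
    then have "1 / \<bar>A\<bar> \<le> 2 * \<bar>d\<bar>" using \<xi> by simp
    with 1 have "1 / \<bar>A\<bar> \<le> 2 * min \<bar>a\<bar> \<bar>d\<bar>" by (simp add: min_def)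
    moreover have "A \<noteq> 0" using Ap by auto
    moreover have "\<Omega>1 \<xi> \<mu> - \<Omega>2 \<xi> \<mu> = A * \<mu>\<^sup>2 + (2 * b / (a + \<xi>) - 2 * e / (d + \<xi>)) * \<mu> +
        (f - c - ((-a-\<xi>)^5 - \<alpha> * (-a-\<xi>)^3) + ((-d-\<xi>)^5 - \<alpha> * (-d-\<xi>)^3)  + b\<^sup>2 / (a + \<xi>) - e\<^sup>2 / (d + \<xi>))" for \<mu>
    proof -
      have *: "(- b - \<mu>)\<^sup>2 / (- a - \<xi>) = - (b\<^sup>2 / (a + \<xi>) + 2 * b / (a + \<xi>) * \<mu> + \<mu>\<^sup>2 * (1 / (a + \<xi>)))" for b a
      proof -
        have "(- b - \<mu>)\<^sup>2 / (- a - \<xi>) = - ((b + \<mu>)\<^sup>2 / (a + \<xi>))"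
          by (simp add: power2_eq_square divide_minus_right[symmetric] algebra_simps del: divide_minus_right)
        also have "(b + \<mu>)\<^sup>2 / (a + \<xi>) = b\<^sup>2 / (a + \<xi>) + 2 * b / (a + \<xi>) * \<mu> + \<mu>\<^sup>2 * (1 / (a + \<xi>))"
          by (simp add: power2_sum add_divide_distrib)
        finally show ?thesis .
      qed
      show ?thesis unfolding \<Omega>1_def \<Omega>2_def \<omega>_def * A_def by (simp add: algebra_simps)
    qed
    ultimately show "\<exists>A B C. A \<noteq> 0 \<and> 1 / \<bar>A\<bar> \<le> 2 * min \<bar>a\<bar> \<bar>d\<bar> \<and> (\<forall>\<mu>. \<Omega>1 \<xi> \<mu> - \<Omega>2 \<xi> \<mu> = A * \<mu>\<^sup>2 + B * \<mu> + C)"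
      by blast
  qed (use M in \<open>auto simp: \<Omega>1_def \<Omega>2_def\<close>)
  finally show ?thesis by (simp add: x y)
qed

section \<open>Frequency regions with one modulation above the threshold\<close>

lemma ennreal_mult3:
  "a \<ge> 0 \<Longrightarrow> b \<ge> 0 \<Longrightarrow> c \<ge> 0 \<Longrightarrow> ennreal a * (ennreal b * ennreal c) = ennreal (a * (b * c))"
  by (simp add: ennreal_mult)

lemma min_le_powr:
  fixes a b \<theta> :: real
  assumes "a \<ge> 0" "b \<ge> 0" "0 \<le> \<theta>" "\<theta> \<le> 1"
  shows "min a b \<le> a powr (1 - \<theta>) * b powr \<theta>"
proof (cases "min a b = 0")
  case False
  then have "min a b > 0" using assms by (auto simp: min_def)
  then have "min a b = min a b powr (1 - \<theta>) * min a b powr \<theta>" by (simp add: powr_add[symmetric])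
  also have "\<dots> \<le> a powr (1 - \<theta>) * b powr \<theta>" using \<open>min a b > 0\<close> assms by (intro mult_mono powr_mono2) auto
  finally show ?thesis .
qed simp

text \<open>The second of the frequencies \<open>\<xi>\<^sub>1, \<xi>\<^sub>2, \<xi>\<^sub>3 = - \<xi>\<^sub>1 - \<xi>\<^sub>2\<close> is the smallest.\<close>

definition adm :: "R3 \<Rightarrow> R3 \<Rightarrow> bool" where
  "adm x y \<longleftrightarrow> fst y \<noteq> 0 \<and> \<bar>fst y\<bar> \<le> \<bar>fst x\<bar> \<and> \<bar>fst y\<bar> \<le> \<bar>fst x + fst y\<bar>"

lemma adm_measurable[measurable (raw)]:
  assumes [measurable]: "f \<in> borel_measurable N" "g \<in> borel_measurable N"
  shows "Measurable.pred N (\<lambda>x. adm (f x) (g x))"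
  unfolding adm_def by measurable

text \<open>\<open>tri_P\<close> is applied to the kernel restricted to the slabs that carry
  \<open>g\<close> and \<open>h\<close>. The function \<open>L\<close> bounds the small frequency in
  terms of the large one; a negative value of \<open>L\<close> encodes that no pair with this large
  frequency satisfies \<open>Q\<close>. The constant 26 is 9 * 2 * sqrt 2 rounded up.\<close>

lemma region_P:
  fixes f g h :: "R3 \<Rightarrow> ennreal"
  assumes [measurable]: "f \<in> borel_measurable borel" "g \<in> borel_measurable borel" "h \<in> borel_measurable borel"
    and [measurable]: "Measurable.pred (lborel \<Otimes>\<^sub>M lborel) (case_prod Q)"
    and M: "M2 \<ge> 1" "M3 \<ge> 1"
    and sup: "\<And>x. x \<notin> slab \<alpha> M2 \<Longrightarrow> g x = 0" "\<And>x. x \<notin> slab \<alpha> M3 \<Longrightarrow> h x = 0"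
    and Q: "\<And>x y. Q x y \<Longrightarrow> adm x y \<and> \<bar>fst y\<bar> \<le> L \<bar>fst x\<bar>"
    and B: "\<And>N. N \<ge> 0 \<Longrightarrow> L N \<ge> 0 \<Longrightarrow> 26 * (M2 * M3) powr (3/4) * sqrt N * N\<^sup>2 * min N (L N) \<le> B"
  shows "(tri (\<lambda>x y. if Q x y then ennreal \<bar>fst x\<bar> else 0) f g h)\<^sup>2 \<le> ennreal B * sqint f * sqint g * sqint h"
proof -
  define k where "k x y = (if Q x y \<and> y \<in> slab \<alpha> M2 \<and> - x - y \<in> slab \<alpha> M3 then ennreal \<bar>fst x\<bar> else 0)" for x y
  have "tri (\<lambda>x y. if Q x y then ennreal \<bar>fst x\<bar> else 0) f g h = tri k f g h"
    unfolding tri_def k_def by (intro nn_integral_cong) (auto simp: sup)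
  also have "(tri k f g h)\<^sup>2 \<le> ennreal B * sqint f * sqint g * sqint h"
  proof (rule tri_P)
    have [measurable]: "Measurable.pred (lborel \<Otimes>\<^sub>M lborel) (\<lambda>p. Q (fst p) (snd p))"
      using assms(4) by (simp add: case_prod_beta')
    show "case_prod k \<in> borel_measurable (lborel \<Otimes>\<^sub>M lborel)"
      unfolding k_def case_prod_beta' by measurable
    fix x :: R3
    let ?N = "\<bar>fst x\<bar>"
    define K where "K \<xi> = (if \<xi> \<noteq> 0 \<and> \<bar>\<xi>\<bar> \<le> ?N \<and> \<bar>\<xi>\<bar> \<le> \<bar>fst x + \<xi>\<bar> \<and> \<bar>\<xi>\<bar> \<le> L ?N then ennreal (?N\<^sup>2) else 0)" for \<xi>
    have "(\<integral>\<^sup>+y. (k x y)\<^sup>2 \<partial>lborel) \<le> (\<integral>\<^sup>+y. (if y \<in> slab \<alpha> M2 \<and> - x - y \<in> slab \<alpha> M3 then K (fst y) else 0) \<partial>lborel)"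
      using Q[of x] by (intro nn_integral_mono) (auto simp: k_def K_def adm_def ennreal_power)
    also have "\<dots> \<le> ennreal (9 * (M2 * M3) powr (3/4) * sqrt (2 * ?N)) * (\<integral>\<^sup>+\<xi>. K \<xi> \<partial>lborel)"
      by (rule P_kernel) (use M in \<open>auto simp: K_def split: if_splits\<close>)
    also have "\<dots> \<le> ennreal B"
    proof (cases "L ?N \<ge> 0")
      case True
      have "(\<integral>\<^sup>+\<xi>. K \<xi> \<partial>lborel) \<le> (\<integral>\<^sup>+\<xi>. ennreal (?N\<^sup>2) * indicator {- min ?N (L ?N)..min ?N (L ?N)} \<xi> \<partial>lborel)"
        by (intro nn_integral_mono) (auto simp: K_def indicator_def)
      also have "\<dots> = ennreal (?N\<^sup>2) * ennreal (2 * min ?N (L ?N))"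
        using True by (subst nn_integral_cmult_indicator) (simp_all add: emeasure_lborel_Icc_eq min_def)
      finally have "ennreal (9 * (M2 * M3) powr (3/4) * sqrt (2 * ?N)) * (\<integral>\<^sup>+\<xi>. K \<xi> \<partial>lborel)
        \<le> ennreal (9 * (M2 * M3) powr (3/4) * sqrt (2 * ?N)) * (ennreal (?N\<^sup>2) * ennreal (2 * min ?N (L ?N)))"
        by (rule mult_left_mono) simp
      also have "\<dots> = ennreal (9 * (M2 * M3) powr (3/4) * sqrt (2 * ?N) * (?N\<^sup>2 * (2 * min ?N (L ?N))))"
        using True by (intro ennreal_mult3) auto
      also have "\<dots> \<le> ennreal B"
      proof (rule ennreal_leI)
        have s2: "sqrt 2 \<le> 13 / 9" by (rule real_le_lsqrt) (auto simp: power2_eq_square)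
        have "9 * (M2 * M3) powr (3/4) * sqrt (2 * ?N) * (?N\<^sup>2 * (2 * min ?N (L ?N)))
          = sqrt 2 * (18 * (M2 * M3) powr (3/4) * sqrt ?N * ?N\<^sup>2 * min ?N (L ?N))"
          by (simp add: real_sqrt_mult)
        also have "\<dots> \<le> 13 / 9 * (18 * (M2 * M3) powr (3/4) * sqrt ?N * ?N\<^sup>2 * min ?N (L ?N))"
          using True by (intro mult_right_mono s2) auto
        also have "\<dots> \<le> B" using B[of ?N] True by (simp add: mult_ac)
        finally show "9 * (M2 * M3) powr (3/4) * sqrt (2 * ?N) * (?N\<^sup>2 * (2 * min ?N (L ?N))) \<le> B" .
      qed
      finally show ?thesis .
    next
      case False
      then have "K = (\<lambda>_. 0)" by (auto simp: K_def fun_eq_iff)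
      then show ?thesis by simp
    qed
    finally show "(\<integral>\<^sup>+y. (k x y)\<^sup>2 \<partial>lborel) \<le> ennreal B" .
  qed simp_all
  finally show ?thesis .
qed


text \<open>The wide slab is now that of the small frequency, so the measure bound has to come from
  the slabs of \<open>f\<close> and \<open>h\<close>. For this purpose \<open>tri_Q\<close> is
  applied with the small frequency as the variable of integration. The sign \<open>\<sigma>\<close>
  serves \<open>Q_kernel\<close>: if all large frequencies \<open>fst x\<close> have the same sign,
  the two denominators there have opposite signs.\<close>

lemma region_Q:
  fixes f g h :: "R3 \<Rightarrow> ennreal"
  assumes [measurable]: "f \<in> borel_measurable borel" "g \<in> borel_measurable borel" "h \<in> borel_measurable borel"
    and [measurable]: "Measurable.pred (lborel \<Otimes>\<^sub>M lborel) (case_prod Q)"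
    and M: "M1 \<ge> 1" "M2 \<ge> 1" "M3 \<ge> 1"
    and sup: "\<And>x. x \<notin> slab \<alpha> M1 \<Longrightarrow> f x = 0" "\<And>x. x \<notin> slab \<alpha> M3 \<Longrightarrow> h x = 0"
    and Q: "\<And>x y. Q x y \<Longrightarrow> adm x y \<and> \<sigma> * fst x > 0 \<and> \<bar>fst x\<bar> \<ge> 2 \<and> \<bar>fst x\<bar> powr (11/4) * \<bar>fst y\<bar> \<le> M2"
  shows "(tri (\<lambda>x y. if Q x y then ennreal \<bar>fst x\<bar> else 0) f g h)\<^sup>2
    \<le> ennreal (162 * (M1 * M2 * M3) powr (29/30)) * sqint f * sqint g * sqint h"
proof -
  define k where "k z x = (if Q x z \<and> x \<in> slab \<alpha> M1 \<and> - z - x \<in> slab \<alpha> M3 then ennreal \<bar>fst x\<bar> else 0)" for x z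
  have Qm[measurable]: "Measurable.pred (lborel \<Otimes>\<^sub>M lborel) (\<lambda>p. Q (fst p) (snd p))"
    using assms(4) by (simp add: case_prod_beta')
  have Qm'[measurable]: "Measurable.pred (lborel \<Otimes>\<^sub>M lborel) (\<lambda>p. Q (snd p) (fst p))"
    using measurable_compose[OF measurable_pair_swap' Qm] by (simp add: case_prod_beta')
  have "tri (\<lambda>x y. if Q x y then ennreal \<bar>fst x\<bar> else 0) f g h = tri (\<lambda>z x. if Q x z then ennreal \<bar>fst x\<bar> else 0) g f h"
    by (rule tri_swap) (unfold case_prod_beta', measurable)
  also have "\<dots> = tri k g f h"
    unfolding tri_def k_def by (intro nn_integral_cong) (auto simp: sup)
  also have "(tri k g f h)\<^sup>2 \<le> ennreal (162 * (M1 * M2 * M3) powr (29/30)) * sqint g * sqint f * sqint h"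
  proof (rule tri_Q)
    show "case_prod k \<in> borel_measurable (lborel \<Otimes>\<^sub>M lborel)"
      unfolding k_def case_prod_beta' by measurable
    fix x y :: R3
    define a d P m where "a = \<bar>fst x\<bar>" "d = \<bar>fst y\<bar>" "P = a * d" "m = min a d"
    \<comment> \<open>Each of the two kernel factors bounds \<bar>\<xi>\<bar> by \<open>M2\<close>
      divided by the power 11/4 of its own large frequency. The geometric mean of the two bounds
      involves only the product \<open>P\<close>. The second large frequency is at least
      \<open>d / 2\<close>, and the factor 3 absorbs this since 2 powr (11/4) \<le> 9.\<close>
    define L where "L = 3 * M2 * P powr (-11/8)"
    define K where "K \<xi> = (if (fst x + \<xi>) * (fst y + \<xi>) < 0 \<and> \<bar>\<xi>\<bar> \<le> a \<and> \<bar>\<xi>\<bar> \<le> d \<and> \<bar>\<xi>\<bar> \<le> L then ennreal (2 * P) else 0)" for \<xi>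
    have nn: "a \<ge> 0" "d \<ge> 0" "P \<ge> 0" "m \<ge> 0" "L \<ge> 0" using M by (auto simp: a_d_P_m_def L_def)
    have pt: "k z x * k z (- z - y) \<le> (if - z - x \<in> slab \<alpha> M3 \<and> - z - y \<in> slab \<alpha> M1 then K (fst z) else 0)
        \<and> a \<ge> 2 \<and> d \<ge> 1" if k: "k z x * k z (- z - y) \<noteq> 0" for z
    proof -
      define \<xi> where "\<xi> = fst z"
      from k have q: "Q x z" "Q (- z - y) z" and s: "- z - x \<in> slab \<alpha> M3" "- z - y \<in> slab \<alpha> M1"
        by (auto simp: k_def split: if_splits)
      have q1: "\<xi> \<noteq> 0" "\<bar>\<xi>\<bar> \<le> a" "\<bar>\<xi>\<bar> \<le> \<bar>fst x + \<xi>\<bar>" "\<sigma> * fst x > 0" "a \<ge> 2" "a powr (11/4) * \<bar>\<xi>\<bar> \<le> M2"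
        using Q[OF q(1)] by (auto simp: adm_def \<xi>_def a_d_P_m_def)
      have q2: "\<bar>\<xi>\<bar> \<le> \<bar>- \<xi> - fst y\<bar>" "\<bar>\<xi>\<bar> \<le> d" "\<sigma> * (- \<xi> - fst y) > 0" "\<bar>- \<xi> - fst y\<bar> \<ge> 2" "\<bar>- \<xi> - fst y\<bar> powr (11/4) * \<bar>\<xi>\<bar> \<le> M2"
        using Q[OF q(2)] by (auto simp: adm_def \<xi>_def a_d_P_m_def)
      have d2: "d \<le> 2 * \<bar>- \<xi> - fst y\<bar>" "\<bar>- \<xi> - fst y\<bar> \<le> 2 * d" using q2(1,2) unfolding a_d_P_m_def by (simp_all add: abs_if split: if_splits)
      have d1: "d \<ge> 1" using q2(4) d2 by linarith
      have "\<sigma> * (fst x + \<xi>) > 0"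
      proof (cases "\<sigma> > 0")
        case True
        then have "fst x > 0" using q1(4) by (simp add: zero_less_mult_iff)
        then have "fst x + \<xi> > 0" using q1 by (auto simp: a_d_P_m_def)
        then show ?thesis using True by simp
      next
        case False
        then have "\<sigma> < 0" "fst x < 0" using q1(4) by (auto simp: zero_less_mult_iff)
        then have "fst x + \<xi> < 0" using q1 by (auto simp: a_d_P_m_def)
        then show ?thesis using \<open>\<sigma> < 0\<close> by (rule mult_neg_neg[rotated])
      qed
      moreover have "\<sigma> * (fst y + \<xi>) < 0" using q2(3) by (simp add: algebra_simps)
      ultimately have sg: "(fst x + \<xi>) * (fst y + \<xi>) < 0" by (auto simp: zero_less_mult_iff mult_less_0_iff)
      have "(d / 2) powr (11/4) * \<bar>\<xi>\<bar> \<le> M2"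
        using d2 nn by (intro order_trans[OF _ q2(5)] mult_right_mono powr_mono2) auto
      then have "(a powr (11/4) * \<bar>\<xi>\<bar>) * ((d / 2) powr (11/4) * \<bar>\<xi>\<bar>) \<le> M2 * M2"
        using q1(6) M by (intro mult_mono) auto
      also have "(a powr (11/4) * \<bar>\<xi>\<bar>) * ((d / 2) powr (11/4) * \<bar>\<xi>\<bar>) = P powr (11/4) / 2 powr (11/4) * \<bar>\<xi>\<bar>\<^sup>2"
        using nn by (simp add: a_d_P_m_def powr_mult powr_divide power2_eq_square)
      finally have "P powr (11/4) * \<bar>\<xi>\<bar>\<^sup>2 \<le> 2 powr (11/4) * (M2 * M2)" by (simp add: field_simps)
      also have "(2::real) powr (11/4) \<le> 2 powr 3" by (intro powr_mono) auto
      then have "2 powr (11/4) * (M2 * M2) \<le> 9 * (M2 * M2)" by (intro mult_right_mono) auto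
      finally have "(P powr (11/8) * \<bar>\<xi>\<bar>)\<^sup>2 \<le> (3 * M2)\<^sup>2"
        by (simp add: power_mult_distrib powr_power power2_eq_square powr_add[symmetric] mult_ac)
      then have "P powr (11/8) * \<bar>\<xi>\<bar> \<le> 3 * M2" by (rule power2_le_imp_le) (use M in simp)
      moreover have "P > 0" using q1(5) d1 by (auto simp: a_d_P_m_def)
      ultimately have "\<bar>\<xi>\<bar> \<le> L" by (simp add: L_def powr_minus field_simps)
      moreover have "k z x * k z (- z - y) = ennreal (a * \<bar>- \<xi> - fst y\<bar>)"
        using k nn(1) by (auto simp: k_def a_d_P_m_def \<xi>_def ennreal_mult split: if_splits)
      moreover have "a * \<bar>- \<xi> - fst y\<bar> \<le> 2 * P" using mult_left_mono[OF d2(2) nn(1)] by (simp add: a_d_P_m_def)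
      ultimately show ?thesis using s sg q1 q2 d1 by (auto simp: K_def \<xi>_def ennreal_leI)
    qed
    show "(\<integral>\<^sup>+z. k z x * k z (- z - y) \<partial>lborel) \<le> ennreal (162 * (M1 * M2 * M3) powr (29/30))"
    proof (cases "\<exists>z. k z x * k z (- z - y) \<noteq> 0")
      case True
      with pt have ad: "a \<ge> 2" "d \<ge> 1" by auto
      have P: "P \<ge> 1" using mult_mono[of 1 a 1 d] ad by (simp add: a_d_P_m_def)
      have "(\<integral>\<^sup>+z. k z x * k z (- z - y) \<partial>lborel)
        \<le> (\<integral>\<^sup>+z. (if - z - x \<in> slab \<alpha> M3 \<and> - z - y \<in> slab \<alpha> M1 then K (fst z) else 0) \<partial>lborel)"
        using pt by (intro nn_integral_mono) (metis zero_le)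
      also have "\<dots> \<le> ennreal (9 * (M3 * M1) powr (3/4) * sqrt (2 * min \<bar>fst x\<bar> \<bar>fst y\<bar>)) * (\<integral>\<^sup>+\<xi>. K \<xi> \<partial>lborel)"
        by (rule Q_kernel) (use M in \<open>auto simp: K_def a_d_P_m_def split: if_splits\<close>)
      also have "(\<integral>\<^sup>+\<xi>. K \<xi> \<partial>lborel) \<le> (\<integral>\<^sup>+\<xi>. ennreal (2 * P) * indicator {- min m L..min m L} \<xi> \<partial>lborel)"
        by (intro nn_integral_mono) (auto simp: K_def indicator_def a_d_P_m_def(4))
      also have "\<dots> = ennreal (2 * P) * ennreal (2 * min m L)"
        using nn by (subst nn_integral_cmult_indicator) (simp_all add: emeasure_lborel_Icc_eq min_def)
      also have "ennreal (9 * (M3 * M1) powr (3/4) * sqrt (2 * min \<bar>fst x\<bar> \<bar>fst y\<bar>)) * (ennreal (2 * P) * ennreal (2 * min m L))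
        = ennreal (9 * (M3 * M1) powr (3/4) * sqrt (2 * m) * (2 * P * (2 * min m L)))"
        using nn by (subst ennreal_mult3) (auto simp: a_d_P_m_def)
      also have "\<dots> \<le> ennreal (162 * (M1 * M2 * M3) powr (29/30))"
      proof (rule ennreal_leI)
        have m: "m \<le> P powr (1/2)"
        proof -
          have "m\<^sup>2 \<le> P" using nn by (auto simp: a_d_P_m_def power2_eq_square min_def mult_mono)
          then show ?thesis using nn by (simp add: powr_half_sqrt real_le_rsqrt)
        qed
        have s1: "sqrt m \<le> P powr (1/4)"
        proof -
          have "sqrt m \<le> sqrt (P powr (1/2))" using m by simp
          also have "\<dots> = P powr (1/4)" using P by (simp add: powr_half_sqrt[symmetric] powr_powr)
          finally show ?thesis .
        qed
        have s2: "min m L \<le> P powr (1/60) * (3 * M2 powr (29/30) * P powr (-319/240))"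
        proof -
          have "min m L \<le> m powr (1 - 29/30) * L powr (29/30)" using nn by (intro min_le_powr) auto
          also have "m powr (1 - 29/30) \<le> (P powr (1/2)) powr (1 - 29/30)" using nn m by (intro powr_mono2) auto
          also have "(P powr (1/2)) powr (1 - 29/30) = P powr (1/60)" by (simp add: powr_powr)
          also have "L powr (29/30) = 3 powr (29/30) * M2 powr (29/30) * P powr (-319/240)"
            using M P by (simp add: L_def powr_mult powr_powr)
          also have "3 powr (29/30) * M2 powr (29/30) * P powr (-319/240) \<le> 3 * M2 powr (29/30) * P powr (-319/240)"
            using powr_mono[of "29/30" 1 "3::real"] by (intro mult_right_mono) auto
          finally show ?thesis by (simp add: mult_left_mono mult_right_mono)
        qed
        have M13: "(M3 * M1) powr (3/4) \<le> (M1 * M3) powr (29/30)"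
          using M mult_mono[of 1 M1 1 M3] by (simp add: mult.commute powr_mono)
        have "9 * (M3 * M1) powr (3/4) * sqrt (2 * m) * (2 * P * (2 * min m L))
          = sqrt 2 * (36 * ((M3 * M1) powr (3/4) * sqrt m * P * min m L))" by (simp add: real_sqrt_mult)
        also have "\<dots> \<le> 3/2 * (36 * ((M3 * M1) powr (3/4) * sqrt m * P * min m L))"
          using nn real_le_lsqrt[of "3/2" 2] by (intro mult_right_mono) (auto simp: power2_eq_square)
        also have "\<dots> \<le> 3/2 * (36 * ((M1 * M3) powr (29/30) * P powr (1/4) * P * (P powr (1/60) * (3 * M2 powr (29/30) * P powr (-319/240)))))"
          using nn M by (intro mult_left_mono mult_mono s1 s2 M13) auto
        also have "\<dots> = 162 * ((M1 * M3) powr (29/30) * M2 powr (29/30)) * (P powr (1/4) * P powr 1 * (P powr (1/60) * P powr (-319/240)))"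
          using P by simp
        \<comment> \<open>1/4 + 1 + 1/60 - (11/8) (29/30) = -1/16. The exponent is negative and
          \<open>P \<ge> 1\<close>, so the frequencies disappear from the bound.\<close>
        also have "P powr (1/4) * P powr 1 * (P powr (1/60) * P powr (-319/240)) = P powr (-1/16)"
          by (simp only: powr_add[symmetric]) simp
        also have "(M1 * M3) powr (29/30) * M2 powr (29/30) = (M1 * M2 * M3) powr (29/30)"
          using M by (simp add: powr_mult)
        also have "162 * (M1 * M2 * M3) powr (29/30) * P powr (-1/16) \<le> 162 * (M1 * M2 * M3) powr (29/30) * 1"
          using powr_mono[of "-1/16" 0 P] P by (intro mult_left_mono) auto
        finally show "9 * (M3 * M1) powr (3/4) * sqrt (2 * m) * (2 * P * (2 * min m L)) \<le> 162 * (M1 * M2 * M3) powr (29/30)"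
          by simp
      qed
      finally show ?thesis by (simp add: mult_left_mono)
    next
      case False
      then have "(\<lambda>z. k z x * k z (- z - y)) = (\<lambda>_. 0)" by auto
      then show ?thesis by simp
    qed
  qed simp_all
  finally show ?thesis by (simp add: mult_ac)
qed

section \<open>All modulations below the threshold: the Loomis--Whitney region\<close>

lemma nn_integral_subst_le:
  fixes \<phi> :: "real \<Rightarrow> ennreal"
  assumes [measurable]: "\<phi> \<in> borel_measurable borel"
    and g: "\<And>x. x \<in> {a..b} \<Longrightarrow> (g has_real_derivative g' x) (at x)"
    and cont: "continuous_on {a..b} g'"
    and d: "\<And>x. x \<in> {a..b} \<Longrightarrow> d \<le> g' x" "d > 0"
  shows "(\<integral>\<^sup>+x. \<phi> (g x) * indicator {a..b} x \<partial>lborel) \<le> ennreal (1 / d) * (\<integral>\<^sup>+x. \<phi> x \<partial>lborel)"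
proof (cases "a < b")
  case True
  have gm[measurable]: "(\<lambda>x. g x * indicator {a..b} x) \<in> borel_measurable borel"
  proof -
    have "continuous_on {a..b} g" using g by (rule has_real_derivative_imp_continuous_on)
    then have "set_borel_measurable borel {a..b} g" using atLeastAtMost_borel set_measurable_continuous_on by blast
    then show ?thesis by (simp add: set_borel_measurable_def mult.commute)
  qed
  have gm'[measurable]: "(\<lambda>x. g' x * indicator {a..b} x) \<in> borel_measurable borel"
  proof -
    have "set_borel_measurable borel {a..b} g'" using cont using atLeastAtMost_borel set_measurable_continuous_on by blast
    then show ?thesis by (simp add: set_borel_measurable_def mult.commute)
  qed
  have "(\<lambda>x. \<phi> (g x * indicator {a..b} x) * ennreal (g' x * indicator {a..b} x)) \<in> borel_measurable borel"
    by measurable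
  also have "(\<lambda>x. \<phi> (g x * indicator {a..b} x) * ennreal (g' x * indicator {a..b} x)) = (\<lambda>x. \<phi> (g x) * g' x * indicator {a..b} x)"
    by (auto simp: indicator_def fun_eq_iff)
  finally have [measurable]: "(\<lambda>x. \<phi> (g x) * g' x * indicator {a..b} x) \<in> borel_measurable borel" .
  have "(\<integral>\<^sup>+x. \<phi> (g x) * indicator {a..b} x \<partial>lborel) \<le> (\<integral>\<^sup>+x. ennreal (1 / d) * (\<phi> (g x) * g' x * indicator {a..b} x) \<partial>lborel)"
  proof (intro nn_integral_mono)
    fix x
    show "\<phi> (g x) * indicator {a..b} x \<le> ennreal (1 / d) * (\<phi> (g x) * g' x * indicator {a..b} x)"
    proof (cases "x \<in> {a..b}")
      case True
      have "1 \<le> 1 / d * g' x" using d(1)[OF True] d(2) by (simp add: field_simps)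
      then have "ennreal 1 \<le> ennreal (1 / d * g' x)" by (rule ennreal_leI)
      then have "\<phi> (g x) * 1 \<le> \<phi> (g x) * ennreal (1 / d * g' x)"
        by (intro mult_left_mono) simp_all
      also have "\<dots> = ennreal (1 / d) * (\<phi> (g x) * g' x)"
        using d by (subst ennreal_mult') (auto simp: ac_simps)
      finally show ?thesis using True by simp
    qed simp
  qed
  also have "\<dots> = ennreal (1 / d) * (\<integral>\<^sup>+x. \<phi> (g x) * g' x * indicator {a..b} x \<partial>lborel)"
    by (rule nn_integral_cmult) simp
  also have "(\<integral>\<^sup>+x. \<phi> (g x) * g' x * indicator {a..b} x \<partial>lborel) = (\<integral>\<^sup>+x. \<phi> x * indicator {g a..g b} x \<partial>lborel)"
    by (rule nn_integral_substitution_aux[symmetric]) (use assms True in \<open>auto intro: order_trans[of 0 d]\<close>)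
  also have "\<dots> \<le> (\<integral>\<^sup>+x. \<phi> x \<partial>lborel)"
    by (intro nn_integral_mono) (auto simp: indicator_def)
  finally show ?thesis by (simp add: mult_left_mono)
next
  case False
  have "AE x in lborel. x \<noteq> a" by (rule AE_lborel_singleton)
  then have "(\<integral>\<^sup>+x. \<phi> (g x) * indicator {a..b} x \<partial>lborel) = (\<integral>\<^sup>+x. 0 \<partial>(lborel :: real measure))"
    using False by (intro nn_integral_cong_AE) (auto elim!: eventually_mono simp: indicator_def)
  then show ?thesis by simp
qed

text \<open>After \<open>\<tau>\<close> has been eliminated, the remaining constraint says that a decreasing and an increasing function of \<open>\<xi>\<close>, built from these two, nearly agree.\<close>

definition lw_s :: "real \<Rightarrow> real \<Rightarrow> real \<Rightarrow> real \<Rightarrow> real" where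
  "lw_s \<alpha> \<xi>0 \<rho> \<xi> = (\<xi>0 - \<xi>) * sqrt (5 * (\<xi>\<^sup>2 - \<xi> * \<xi>0 + \<xi>0\<^sup>2) - 3 * \<alpha> - \<rho> / (\<xi>0 * \<xi> * (\<xi>0 - \<xi>)))"

definition lw_w :: "real \<Rightarrow> real \<Rightarrow> real \<Rightarrow> real" where
  "lw_w \<alpha> \<eta> \<xi> = (\<xi> + \<eta>) * sqrt (5 * (\<xi>\<^sup>2 + \<xi> * \<eta> + \<eta>\<^sup>2) - 3 * \<alpha>)"

text \<open>\<open>Q\<close> is the radicand of \<open>lw_s\<close>, and the last expression is the
  numerator of the derivative of \<open>lw_s\<close> over \<open>2 * sqrt Q\<close>. The main term
  \<xi>^2 - \<xi> \<xi>0 + \<xi>0^2 lies between 3/4 and 3 times \<xi>0^2, while the hypothesis on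
  \<open>E\<close> keeps the contributions of \<alpha> and \<rho> to \<open>Q\<close> below \<xi>0^2
  / 2 and to the numerator below \<xi>0^2.\<close>

lemma lw_Q_bounds:
  fixes \<alpha> \<xi>0 \<rho> \<xi> E :: real
  assumes "\<xi>0 > 0" "\<xi>0 / 2 \<le> \<xi>" "\<xi> \<le> 2 * \<xi>0" "\<xi> \<noteq> \<xi>0"
    and "\<bar>\<rho>\<bar> \<le> E * \<bar>\<xi>0 - \<xi>\<bar>" "E \<ge> 0" "6 * \<bar>\<alpha>\<bar> + 4 * E / \<xi>0\<^sup>2 \<le> \<xi>0\<^sup>2"
  defines "Q \<equiv> 5 * (\<xi>\<^sup>2 - \<xi> * \<xi>0 + \<xi>0\<^sup>2) - 3 * \<alpha> - \<rho> / (\<xi>0 * \<xi> * (\<xi>0 - \<xi>))"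
  shows "\<xi>0\<^sup>2 \<le> Q" "Q \<le> 16 * \<xi>0\<^sup>2"
    "- 10 * (\<xi>\<^sup>2 - \<xi> * \<xi>0 + \<xi>0\<^sup>2) + 5 * (\<xi>0 - \<xi>) * (2 * \<xi> - \<xi>0) + 6 * \<alpha> + \<rho> / (\<xi>\<^sup>2 * (\<xi>0 - \<xi>)) \<le> 0"
proof -
  have pos: "\<xi> > 0" "\<bar>\<xi>0 - \<xi>\<bar> > 0" using assms by auto
  have r: "\<bar>\<rho> / (\<xi>0 - \<xi>)\<bar> \<le> E" using assms(5) pos by (simp add: field_simps)
  have "\<bar>\<rho> / (\<xi>0 * \<xi> * (\<xi>0 - \<xi>))\<bar> = \<bar>\<rho> / (\<xi>0 - \<xi>)\<bar> * (1 / (\<xi>0 * \<xi>))"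
    using pos assms(1) by (simp add: abs_mult)
  also have "\<dots> \<le> E * (1 / (\<xi>0 * (\<xi>0 / 2)))"
    using pos assms r by (intro mult_mono divide_left_mono mult_left_mono) auto
  finally have 1: "\<bar>\<rho> / (\<xi>0 * \<xi> * (\<xi>0 - \<xi>))\<bar> \<le> 2 * E / \<xi>0\<^sup>2" by (simp add: power2_eq_square mult.commute[of E])
  have "\<bar>\<rho> / (\<xi>\<^sup>2 * (\<xi>0 - \<xi>))\<bar> = \<bar>\<rho> / (\<xi>0 - \<xi>)\<bar> * (1 / \<xi>\<^sup>2)"
    using pos assms(1) by (simp add: abs_mult)
  also have "\<dots> \<le> E * (1 / (\<xi>0 / 2)\<^sup>2)"
    using pos assms r by (intro mult_mono divide_left_mono power_mono) auto
  finally have 2: "\<bar>\<rho> / (\<xi>\<^sup>2 * (\<xi>0 - \<xi>))\<bar> \<le> 4 * E / \<xi>0\<^sup>2" by (simp add: power2_eq_square mult.commute[of E])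
  have E: "4 * E / \<xi>0\<^sup>2 = 2 * (2 * E / \<xi>0\<^sup>2)" "2 * E / \<xi>0\<^sup>2 \<ge> 0" using assms by auto
  have lo: "\<xi>\<^sup>2 - \<xi> * \<xi>0 + \<xi>0\<^sup>2 \<ge> 3 / 4 * \<xi>0\<^sup>2"
    using zero_le_power2[of "\<xi> - \<xi>0 / 2"] by (simp add: power2_eq_square field_simps)
  have "(\<xi> + \<xi>0) * (2 * \<xi>0 - \<xi>) \<ge> 0" using assms pos by simp
  then have hi: "\<xi>\<^sup>2 - \<xi> * \<xi>0 + \<xi>0\<^sup>2 \<le> 3 * \<xi>0\<^sup>2" by (simp add: power2_eq_square algebra_simps)
  show "\<xi>0\<^sup>2 \<le> Q" using 1 E assms(7) lo unfolding Q_def by argo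
  show "Q \<le> 16 * \<xi>0\<^sup>2" using 1 E assms(7) hi unfolding Q_def by argo
  have "- 10 * (\<xi>\<^sup>2 - \<xi> * \<xi>0 + \<xi>0\<^sup>2) + 5 * (\<xi>0 - \<xi>) * (2 * \<xi> - \<xi>0) = - 5 * (4 * (\<xi> - 5 / 8 * \<xi>0)\<^sup>2 + 23 / 16 * \<xi>0\<^sup>2)"
    by (simp add: power2_eq_square algebra_simps)
  also have "\<dots> \<le> - \<xi>0\<^sup>2" using zero_le_power2[of "\<xi> - 5 / 8 * \<xi>0"] zero_le_power2[of \<xi>0] by argo
  finally show "- 10 * (\<xi>\<^sup>2 - \<xi> * \<xi>0 + \<xi>0\<^sup>2) + 5 * (\<xi>0 - \<xi>) * (2 * \<xi> - \<xi>0) + 6 * \<alpha> + \<rho> / (\<xi>\<^sup>2 * (\<xi>0 - \<xi>)) \<le> 0"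
    using 2 assms(7) by argo
qed

lemma DERIV_mult_sqrt:
  fixes f g :: "real \<Rightarrow> real"
  assumes "(f has_real_derivative d1) (at x)" "(g has_real_derivative d2) (at x)" "g x > 0"
  shows "((\<lambda>x. f x * sqrt (g x)) has_real_derivative (d1 * sqrt (g x) + f x * (d2 / (2 * sqrt (g x))))) (at x)"
proof -
  have "((\<lambda>x. sqrt (g x)) has_real_derivative (inverse (sqrt (g x)) / 2 * d2)) (at x)"
    by (rule DERIV_chain2[OF DERIV_real_sqrt assms(2)]) (use assms in auto)
  from DERIV_mult[OF assms(1) this] show ?thesis
    using assms(3) by (simp add: field_simps)
qed

text \<open>In the numerator of the derivative the two contributions of \<open>\<rho>\<close>
  combine into the single term \<open>\<rho> / (\<xi>\<^sup>2 * (\<xi>0 - \<xi>))\<close>. The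
  assumption that \<open>\<rho>\<close> is at most \<open>E\<close> times the distance to \<xi>0
  compensates its singularity, so \<open>lw_s\<close> decreases on either side of \<xi>0.\<close>

lemma lw_s_deriv:
  fixes \<alpha> \<xi>0 \<rho> \<xi> E :: real
  assumes "\<xi>0 > 0" "\<xi>0 / 2 \<le> \<xi>" "\<xi> \<le> 2 * \<xi>0" "\<xi> \<noteq> \<xi>0"
    and "\<bar>\<rho>\<bar> \<le> E * \<bar>\<xi>0 - \<xi>\<bar>" "E \<ge> 0" "6 * \<bar>\<alpha>\<bar> + 4 * E / \<xi>0\<^sup>2 \<le> \<xi>0\<^sup>2"
  shows "\<exists>D\<le>0. (lw_s \<alpha> \<xi>0 \<rho> has_real_derivative D) (at \<xi>)"
proof -
  define Q where "Q = 5 * (\<xi>\<^sup>2 - \<xi> * \<xi>0 + \<xi>0\<^sup>2) - 3 * \<alpha> - \<rho> / (\<xi>0 * \<xi> * (\<xi>0 - \<xi>))"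
  define v where "v = \<xi>0 * \<xi> * (\<xi>0 - \<xi>)"
  define Q' where "Q' = 5 * (2 * \<xi> - \<xi>0) + \<rho> * (\<xi>0 * (\<xi>0 - 2 * \<xi>)) / (v * v)"
  note b = lw_Q_bounds[OF assms, folded Q_def]
  have Q0: "Q > 0" using b(1) assms(1) by (meson less_le_trans zero_less_power)
  have nz: "\<xi> \<noteq> 0" "\<xi>0 - \<xi> \<noteq> 0" "\<xi>0 \<noteq> 0" using assms by auto
  have "v \<noteq> 0" using nz by (simp add: v_def)
  have dv: "((\<lambda>\<xi>. \<xi>0 * \<xi> * (\<xi>0 - \<xi>)) has_real_derivative \<xi>0 * (\<xi>0 - 2 * \<xi>)) (at \<xi>)"
    by (auto intro!: derivative_eq_intros simp: algebra_simps)
  have d5: "((\<lambda>\<xi>. 5 * (\<xi>\<^sup>2 - \<xi> * \<xi>0 + \<xi>0\<^sup>2) - 3 * \<alpha>) has_real_derivative 5 * (2 * \<xi> - \<xi>0)) (at \<xi>)"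
    by (auto intro!: derivative_eq_intros)
  have "((\<lambda>\<xi>. \<rho> / (\<xi>0 * \<xi> * (\<xi>0 - \<xi>))) has_real_derivative (0 * v - \<rho> * (\<xi>0 * (\<xi>0 - 2 * \<xi>))) / (v * v)) (at \<xi>)"
    unfolding v_def by (rule DERIV_divide[OF DERIV_const dv]) (use \<open>v \<noteq> 0\<close> in \<open>simp add: v_def\<close>)
  from DERIV_diff[OF d5 this]
  have dQ: "((\<lambda>\<xi>. 5 * (\<xi>\<^sup>2 - \<xi> * \<xi>0 + \<xi>0\<^sup>2) - 3 * \<alpha> - \<rho> / (\<xi>0 * \<xi> * (\<xi>0 - \<xi>))) has_real_derivative Q') (at \<xi>)"
    by (simp add: Q'_def)
  have d0: "((\<lambda>\<xi>. \<xi>0 - \<xi>) has_real_derivative -1) (at \<xi>)" by (auto intro!: derivative_eq_intros)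
  have "(lw_s \<alpha> \<xi>0 \<rho> has_real_derivative (- sqrt Q + (\<xi>0 - \<xi>) * (Q' / (2 * sqrt Q)))) (at \<xi>)"
    using DERIV_mult_sqrt[OF d0 dQ] Q0 unfolding lw_s_def[abs_def] by (simp add: Q_def)
  moreover have "- sqrt Q + (\<xi>0 - \<xi>) * (Q' / (2 * sqrt Q)) = (- 2 * Q + (\<xi>0 - \<xi>) * Q') / (2 * sqrt Q)"
    using Q0 by (simp add: field_simps)
  moreover have "- 2 * Q + (\<xi>0 - \<xi>) * Q' = - 10 * (\<xi>\<^sup>2 - \<xi> * \<xi>0 + \<xi>0\<^sup>2) + 5 * (\<xi>0 - \<xi>) * (2 * \<xi> - \<xi>0) + 6 * \<alpha> + \<rho> / (\<xi>\<^sup>2 * (\<xi>0 - \<xi>))"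
  proof -
    define d where "d = \<xi>0 - \<xi>"
    have x0: "\<xi>0 = d + \<xi>" "d \<noteq> 0" "d + \<xi> \<noteq> 0" using nz by (auto simp: d_def)
    have "2 * (\<rho> / v) + (\<xi>0 - \<xi>) * (\<rho> * (\<xi>0 * (\<xi>0 - 2 * \<xi>)) / (v * v)) = \<rho> / (\<xi>\<^sup>2 * (\<xi>0 - \<xi>))"
      using nz x0(2,3) unfolding v_def x0(1) by (simp add: divide_simps power2_eq_square) (simp add: algebra_simps)
    then show ?thesis unfolding Q_def Q'_def v_def[symmetric] by (simp add: algebra_simps)
  qed
  ultimately show ?thesis using b(3) Q0 by (metis divide_nonpos_pos mult_pos_pos real_sqrt_gt_0_iff zero_less_numeral)
qed

text \<open>The radicand is at least \<xi>^2, because \<xi>^2 + \<xi> \<eta> + \<eta>^2 \<ge> (3/4)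
  \<xi>^2 and 5 * 3/4 - 2 \<ge> 1. In the product rule the first term is thus at least \<xi>, and
  the second is nonnegative as \<bar>\<eta>\<bar> \<le> \<xi>.\<close>

lemma lw_w_deriv:
  fixes \<alpha> \<eta> \<xi> :: real
  assumes "\<xi> > 0" "\<bar>\<eta>\<bar> \<le> \<xi>" "3 * \<bar>\<alpha>\<bar> \<le> 2 * \<xi>\<^sup>2"
  shows "\<exists>D\<ge>\<xi>. (lw_w \<alpha> \<eta> has_real_derivative D) (at \<xi>)" "\<xi> \<le> sqrt (5 * (\<xi>\<^sup>2 + \<xi> * \<eta> + \<eta>\<^sup>2) - 3 * \<alpha>)"
proof -
  define S where "S = 5 * (\<xi>\<^sup>2 + \<xi> * \<eta> + \<eta>\<^sup>2) - 3 * \<alpha>"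
  have "\<xi>\<^sup>2 + \<xi> * \<eta> + \<eta>\<^sup>2 \<ge> 3 / 4 * \<xi>\<^sup>2"
    using zero_le_power2[of "\<eta> + \<xi> / 2"] by (simp add: power2_eq_square field_simps)
  then have S1: "S \<ge> \<xi>\<^sup>2" using assms unfolding S_def by argo
  then have S0: "S > 0" using assms(1) by (meson less_le_trans zero_less_power)
  have sq: "sqrt S \<ge> \<xi>" using S1 by (rule real_le_rsqrt)
  then show "\<xi> \<le> sqrt (5 * (\<xi>\<^sup>2 + \<xi> * \<eta> + \<eta>\<^sup>2) - 3 * \<alpha>)" by (simp add: S_def)
  have dS: "((\<lambda>\<xi>. 5 * (\<xi>\<^sup>2 + \<xi> * \<eta> + \<eta>\<^sup>2) - 3 * \<alpha>) has_real_derivative 5 * (2 * \<xi> + \<eta>)) (at \<xi>)"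
    by (auto intro!: derivative_eq_intros)
  have d0: "((\<lambda>\<xi>. \<xi> + \<eta>) has_real_derivative 1) (at \<xi>)" by (auto intro!: derivative_eq_intros)
  have "(lw_w \<alpha> \<eta> has_real_derivative (sqrt S + (\<xi> + \<eta>) * (5 * (2 * \<xi> + \<eta>) / (2 * sqrt S)))) (at \<xi>)"
    using DERIV_mult_sqrt[OF d0 dS] S0 unfolding lw_w_def[abs_def] by (simp add: S_def)
  moreover have "0 \<le> (\<xi> + \<eta>) * (5 * (2 * \<xi> + \<eta>) / (2 * sqrt S))"
    using assms S0 by (intro mult_nonneg_nonneg divide_nonneg_nonneg) auto
  ultimately show "\<exists>D\<ge>\<xi>. (lw_w \<alpha> \<eta> has_real_derivative D) (at \<xi>)"
    using sq by (intro exI[of _ "sqrt S + (\<xi> + \<eta>) * (5 * (2 * \<xi> + \<eta>) / (2 * sqrt S))"] conjI) linarith+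
qed

text \<open>The difference of \<open>lw_w\<close> and \<open>lw_s\<close> has derivative at least
  \<open>\<xi>0 / 2\<close>, while at both end points it lies within \<open>\<delta>\<close> of
  \<open>e\<close>; the mean value theorem does the rest. Both points must lie on the same side of
  \<xi>0, where the radicand of \<open>lw_s\<close> is singular. Between them the distance to \<xi>0
  is at least the smaller of its two end values, so the bound on \<open>\<rho>\<close>
  persists.\<close>

lemma lw_diam:
  fixes \<alpha> \<xi>0 \<rho> \<eta> e E \<delta> a b :: real
  assumes \<xi>0: "\<xi>0 > 0" and ab: "\<xi>0 / 2 \<le> a" "a \<le> b" "b \<le> 2 * \<xi>0" and side: "a > \<xi>0 \<or> b < \<xi>0"
    and \<rho>: "\<bar>\<rho>\<bar> \<le> E * \<bar>\<xi>0 - a\<bar>" "\<bar>\<rho>\<bar> \<le> E * \<bar>\<xi>0 - b\<bar>" "E \<ge> 0" "6 * \<bar>\<alpha>\<bar> + 4 * E / \<xi>0\<^sup>2 \<le> \<xi>0\<^sup>2"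
    and \<eta>: "\<bar>\<eta>\<bar> \<le> a"
    and D: "\<bar>lw_s \<alpha> \<xi>0 \<rho> a + e - lw_w \<alpha> \<eta> a\<bar> \<le> \<delta>" "\<bar>lw_s \<alpha> \<xi>0 \<rho> b + e - lw_w \<alpha> \<eta> b\<bar> \<le> \<delta>"
  shows "b - a \<le> 4 * \<delta> / \<xi>0"
proof (cases "a = b")
  case True
  then show ?thesis using D \<xi>0 by simp
next
  case False
  define F where "F \<xi> = lw_w \<alpha> \<eta> \<xi> - lw_s \<alpha> \<xi>0 \<rho> \<xi>" for \<xi>
  have "\<exists>d\<ge>\<xi>0 / 2. (F has_real_derivative d) (at \<xi>)" if "a \<le> \<xi>" "\<xi> \<le> b" for \<xi>
  proof -
    have "\<bar>\<xi>0 - \<xi>\<bar> \<ge> \<bar>\<xi>0 - a\<bar> \<or> \<bar>\<xi>0 - \<xi>\<bar> \<ge> \<bar>\<xi>0 - b\<bar>" using side that by auto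
    then have "\<bar>\<rho>\<bar> \<le> E * \<bar>\<xi>0 - \<xi>\<bar>" using \<rho> by (meson mult_left_mono order_trans)
    moreover have "\<xi>0 / 2 \<le> \<xi>" "\<xi> \<le> 2 * \<xi>0" "\<xi> \<noteq> \<xi>0" using that ab side by auto
    ultimately obtain d1 where d1: "d1 \<le> 0" "(lw_s \<alpha> \<xi>0 \<rho> has_real_derivative d1) (at \<xi>)"
      using lw_s_deriv[OF \<xi>0 _ _ _ _ \<rho>(3,4)] by metis
    have pos: "\<xi> > 0" "\<bar>\<eta>\<bar> \<le> \<xi>" using that ab \<xi>0 \<eta> by auto
    have "0 \<le> 4 * E / \<xi>0\<^sup>2" using \<rho>(3) by simp
    then have "3 * \<bar>\<alpha>\<bar> \<le> 1 / 2 * \<xi>0\<^sup>2" using \<rho>(4) by linarith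
    also have "1 / 2 * \<xi>0\<^sup>2 = 2 * (\<xi>0 / 2)\<^sup>2" by (simp add: power2_eq_square)
    also have "\<dots> \<le> 2 * \<xi>\<^sup>2" using that ab \<xi>0 by (intro mult_left_mono power_mono) auto
    finally obtain d2 where d2: "d2 \<ge> \<xi>" "(lw_w \<alpha> \<eta> has_real_derivative d2) (at \<xi>)"
      using lw_w_deriv(1)[of \<xi> \<eta> \<alpha>] pos by metis
    have "(F has_real_derivative (d2 - d1)) (at \<xi>)" unfolding F_def[abs_def] by (intro derivative_intros d1 d2)
    then show ?thesis using d1 d2 that ab by (intro exI[of _ "d2 - d1"]) auto
  qed
  then obtain F' where F': "\<And>\<xi>. a \<le> \<xi> \<Longrightarrow> \<xi> \<le> b \<Longrightarrow> F' \<xi> \<ge> \<xi>0 / 2 \<and> (F has_real_derivative F' \<xi>) (at \<xi>)" by metis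
  obtain z where z: "a < z" "z < b" "F b - F a = (b - a) * F' z"
    using MVT2[of a b F F'] F' False ab by auto
  have "(b - a) * (\<xi>0 / 2) \<le> F b - F a" unfolding z(3) using F'[of z] z ab by (intro mult_left_mono) auto
  also have "\<dots> \<le> 2 * \<delta>" using D unfolding F_def by argo
  finally show ?thesis using \<xi>0 by (simp add: field_simps)
qed

text \<open>The resonance function is a b / (a + b) times a difference of squares w^2 - r^2, where r
  = m / a - n / b is the difference of slopes and w^2 = (a + b)^2 (5 (a^2 + a b + b^2) - 3
  \<alpha>). When the right-hand side of the latter is positive, this factorises, which is how
  \<open>lw_point\<close> uses it.\<close>

lemma \<omega>_resonance:
  fixes a b m n \<alpha> :: real
  assumes "a \<noteq> 0" "b \<noteq> 0" "a + b \<noteq> 0"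
  shows "\<omega> \<alpha> (a + b) (m + n) - \<omega> \<alpha> a m - \<omega> \<alpha> b n =
    a * b * (a + b) * (5 * (a\<^sup>2 + a * b + b\<^sup>2) - 3 * \<alpha>) - a * b / (a + b) * (m / a - n / b)\<^sup>2"
proof -
  have 1: "(a + b)^5 - \<alpha> * (a + b)^3 - (a^5 - \<alpha> * a^3) - (b^5 - \<alpha> * b^3) = a * b * (a + b) * (5 * (a\<^sup>2 + a * b + b\<^sup>2) - 3 * \<alpha>)"
    by algebra
  have "(m / a - n / b)\<^sup>2 = (m * b - n * a)\<^sup>2 / (a\<^sup>2 * b\<^sup>2)"
    using assms by (simp add: field_simps)
  then have "a * b / (a + b) * (m / a - n / b)\<^sup>2 = (m * b - n * a)\<^sup>2 / (a * b * (a + b))"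
    using assms by (simp add: power2_eq_square)
  also have "\<dots> = m\<^sup>2 / a + n\<^sup>2 / b - (m + n)\<^sup>2 / (a + b)"
    using assms by (simp add: divide_simps) algebra
  finally show ?thesis using 1 unfolding \<omega>_def by simp
qed

lemma \<omega>_odd: "\<omega> \<alpha> (- \<xi>) (- \<mu>) = - \<omega> \<alpha> \<xi> \<mu>"
  unfolding \<omega>_def by (simp add: power_minus_odd)

text \<open>In fourth powers: 2^11 = 2048 \<le> 2401 = 7^4.\<close>

lemma powr_11_4_double:
  fixes t :: real
  assumes "t \<ge> 0"
  shows "(2 * t) powr (11/4) \<le> 7 * t powr (11/4)"
proof -
  have "((2::real) powr (11/4)) ^ Suc 3 \<le> 7 ^ Suc 3"
    by (simp add: powr_power)
  then have "(2::real) powr (11/4) \<le> 7" by (rule power_le_imp_le_base) simp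
  then show ?thesis using assms by (simp add: powr_mult mult_right_mono)
qed

lemma powr_11_4:
  fixes t :: real
  assumes "t > 0"
  shows "t powr (11/4) = t powr (3/4) * t\<^sup>2"
proof -
  have "t powr (11/4) = t powr (3/4 + 2)" by simp
  also have "\<dots> = t powr (3/4) * t powr 2" by (rule powr_add)
  finally show ?thesis using assms by simp
qed

text \<open>The pointwise content of the last region. (\<xi>, \<mu>, \<tau>) is the variable of
  integration in \<open>tri_Q\<close>, the points with \<eta> and with \<xi>0 are its two fixed
  points. For the triple \<xi>, \<xi>0 - \<xi>, \<xi>0 the resonance identity expresses the slope
  difference exactly through \<open>\<rho>\<close>, so \<open>lw_s\<close> equals \<mu>/\<xi> -
  \<mu>0/\<xi>0, and adding \<mu>0/\<xi>0 - \<nu>/\<eta> gives the slope difference r of the triple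
  \<xi>, \<eta>, \<xi> + \<eta>. For the latter triple the identity reads w^2 - r^2 up to a factor,
  with w = \<open>lw_w\<close>, and small modulations force w - r to be of order \<xi> powr (3/4).
  Constants: frequencies of a triple are comparable up to a factor 2, which costs 7 in the power
  11/4; then 9 = 1 + 1 + 7, 63 = 9 * 7 and 504 = 2 * 4 * 63.\<close>

lemma lw_point:
  fixes \<alpha> \<xi> \<mu> \<tau> \<eta> \<nu> \<kappa> \<xi>0 \<mu>0 \<tau>0 M1 M2 M3 :: real
  assumes big: "\<xi> \<ge> 504 + 12 * \<bar>\<alpha>\<bar>"
    and adm: "\<eta> \<noteq> 0" "\<bar>\<eta>\<bar> \<le> \<xi>" "\<bar>\<eta>\<bar> \<le> \<bar>\<xi> + \<eta>\<bar>" "\<xi> \<noteq> \<xi>0" "\<bar>\<xi>0 - \<xi>\<bar> \<le> \<xi>" "\<bar>\<xi>0 - \<xi>\<bar> \<le> \<bar>\<xi>0\<bar>"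
    and sl: "\<bar>\<tau> - \<omega> \<alpha> \<xi> \<mu>\<bar> \<le> M1" "\<bar>\<kappa> - \<omega> \<alpha> \<eta> \<nu>\<bar> \<le> M2" "\<bar>\<tau> + \<kappa> - \<omega> \<alpha> (\<xi> + \<eta>) (\<mu> + \<nu>)\<bar> \<le> M3"
      "\<bar>\<tau>0 - \<tau> - \<omega> \<alpha> (\<xi>0 - \<xi>) (\<mu>0 - \<mu>)\<bar> \<le> M2" "\<bar>\<tau>0 - \<omega> \<alpha> \<xi>0 \<mu>0\<bar> \<le> M3"
    and M: "M1 \<le> \<xi> powr (11/4) * \<bar>\<eta>\<bar>" "M2 \<le> \<xi> powr (11/4) * \<bar>\<eta>\<bar>" "M3 \<le> \<bar>\<xi> + \<eta>\<bar> powr (11/4) * \<bar>\<eta>\<bar>"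
      "M1 \<le> \<xi> powr (11/4) * \<bar>\<xi>0 - \<xi>\<bar>" "M2 \<le> \<xi> powr (11/4) * \<bar>\<xi>0 - \<xi>\<bar>" "M3 \<le> \<bar>\<xi>0\<bar> powr (11/4) * \<bar>\<xi>0 - \<xi>\<bar>"
    and r: "\<mu> / \<xi> \<ge> \<nu> / \<eta>" and q: "\<mu> / \<xi> \<ge> (\<mu>0 - \<mu>) / (\<xi>0 - \<xi>)"
  defines "\<rho> \<equiv> \<omega> \<alpha> \<xi>0 \<mu>0 - (\<omega> \<alpha> \<xi> \<mu> + \<omega> \<alpha> (\<xi>0 - \<xi>) (\<mu>0 - \<mu>))"
  defines "E \<equiv> 63 * \<xi>0 powr (11/4)"
  shows "\<xi>0 > 0" "\<xi>0 / 2 \<le> \<xi>" "\<xi> \<le> 2 * \<xi>0" "6 * \<bar>\<alpha>\<bar> + 4 * E / \<xi>0\<^sup>2 \<le> \<xi>0\<^sup>2"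
    "\<bar>\<rho>\<bar> \<le> E * \<bar>\<xi>0 - \<xi>\<bar>"
    "\<xi>0\<^sup>2 \<le> \<mu> / \<xi> - (\<mu>0 - \<mu>) / (\<xi>0 - \<xi>)" "\<mu> / \<xi> - (\<mu>0 - \<mu>) / (\<xi>0 - \<xi>) \<le> 4 * \<xi>0\<^sup>2"
    "\<bar>lw_s \<alpha> \<xi>0 \<rho> \<xi> + (\<mu>0 / \<xi>0 - \<nu> / \<eta>) - lw_w \<alpha> \<eta> \<xi>\<bar> \<le> 18 * \<xi>0 powr (3/4)"
    "M1 \<le> 14 * \<xi>0 powr (15/4)" "M2 \<le> 14 * \<xi>0 powr (15/4)"
proof -
  define d where "d = \<xi>0 - \<xi>"
  have \<xi>: "\<xi> \<ge> 504" "\<xi> > 0" using big by auto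
  have \<xi>0nn: "\<xi>0 \<ge> 0" using adm(5) by auto
  with adm(6) adm(4) show \<xi>0: "\<xi>0 > 0" by (cases "\<xi>0 = 0") auto
  show h1: "\<xi>0 / 2 \<le> \<xi>" using adm(5) by auto
  show h2: "\<xi> \<le> 2 * \<xi>0" using adm(6) \<xi>0 by auto
  have dnz: "d \<noteq> 0" "\<xi> + d = \<xi>0" using adm(4) by (auto simp: d_def)
  have s3: "\<xi> + \<eta> > 0" using adm by auto
  have b2: "\<xi> powr (11/4) \<le> 7 * \<xi>0 powr (11/4)"
    using h2 \<xi> \<xi>0 powr_11_4_double[of \<xi>0] by (intro order_trans[OF powr_mono2[of "11/4" \<xi> "2 * \<xi>0"]]) auto
  have b3: "\<xi>0 powr (11/4) \<le> 7 * \<xi> powr (11/4)"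
    using h1 \<xi> \<xi>0 powr_11_4_double[of \<xi>] by (intro order_trans[OF powr_mono2[of "11/4" \<xi>0 "2 * \<xi>"]]) auto
  have b4: "\<bar>\<xi> + \<eta>\<bar> powr (11/4) \<le> 7 * \<xi> powr (11/4)"
    using adm \<xi> s3 powr_11_4_double[of \<xi>] by (intro order_trans[OF powr_mono2[of "11/4" "\<bar>\<xi> + \<eta>\<bar>" "2 * \<xi>"]]) auto
  \<comment> \<open>From \<xi> \<le> 2 \<xi>0 one gets \<xi>0 \<ge> 252 + 6 \<bar>\<alpha>\<bar>. As
    3/4 \<le> 1, the left-hand side is at most (252 + 6 \<bar>\<alpha>\<bar>) \<xi>0.\<close>
  show H: "6 * \<bar>\<alpha>\<bar> + 4 * E / \<xi>0\<^sup>2 \<le> \<xi>0\<^sup>2"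
  proof -
    have x: "\<xi>0 \<ge> 252 + 6 * \<bar>\<alpha>\<bar>" "\<xi>0 \<ge> 1" using big h2 by auto
    have "\<xi>0 powr (11/4) / \<xi>0\<^sup>2 = \<xi>0 powr (3/4)" using \<xi>0 by (simp add: powr_11_4)
    also have "\<dots> \<le> \<xi>0 powr 1" using x by (intro powr_mono) auto
    finally have "4 * E / \<xi>0\<^sup>2 \<le> 252 * \<xi>0" using \<xi>0 by (simp add: E_def)
    moreover have "6 * \<bar>\<alpha>\<bar> \<le> 6 * \<bar>\<alpha>\<bar> * \<xi>0" using x mult_left_mono[of 1 \<xi>0 "6 * \<bar>\<alpha>\<bar>"] by simp
    moreover have "(252 + 6 * \<bar>\<alpha>\<bar>) * \<xi>0 \<le> \<xi>0 * \<xi>0" using x by (intro mult_right_mono) auto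
    ultimately show ?thesis by (simp add: power2_eq_square algebra_simps)
  qed
  have "\<bar>\<rho>\<bar> \<le> M1 + M2 + M3" unfolding \<rho>_def using sl by linarith
  also have "\<dots> \<le> 9 * (\<xi> powr (11/4) * \<bar>d\<bar>)"
  proof -
    have "\<bar>\<xi>0\<bar> powr (11/4) * \<bar>d\<bar> \<le> 7 * \<xi> powr (11/4) * \<bar>d\<bar>" using b3 \<xi>0 by (intro mult_right_mono) auto
    then show ?thesis using M unfolding d_def by linarith
  qed
  also have "\<dots> \<le> 9 * (7 * \<xi>0 powr (11/4) * \<bar>d\<bar>)" by (intro mult_left_mono mult_right_mono b2) auto
  finally show \<rho>b: "\<bar>\<rho>\<bar> \<le> E * \<bar>\<xi>0 - \<xi>\<bar>" by (simp add: E_def d_def)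
  define qq where "qq = \<mu> / \<xi> - (\<mu>0 - \<mu>) / d"
  define Qs where "Qs = 5 * (\<xi>\<^sup>2 - \<xi> * \<xi>0 + \<xi>0\<^sup>2) - 3 * \<alpha> - \<rho> / (\<xi>0 * \<xi> * (\<xi>0 - \<xi>))"
  have qq: "qq \<ge> 0" using q by (simp add: qq_def d_def)
  have E0: "E \<ge> 0" by (simp add: E_def)
  note Qb = lw_Q_bounds[OF \<xi>0 h1 h2 adm(4) \<rho>b E0 H, folded Qs_def]
  have "\<rho> = \<xi> * d * \<xi>0 * (5 * (\<xi>\<^sup>2 + \<xi> * d + d\<^sup>2) - 3 * \<alpha>) - \<xi> * d / \<xi>0 * qq\<^sup>2"
    using \<omega>_resonance[of \<xi> d \<alpha> \<mu> "\<mu>0 - \<mu>"] \<xi> dnz \<xi>0 by (simp add: \<rho>_def qq_def d_def)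
  then have "\<rho> / (\<xi>0 * \<xi> * d) = (5 * (\<xi>\<^sup>2 + \<xi> * d + d\<^sup>2) - 3 * \<alpha>) - qq\<^sup>2 / \<xi>0\<^sup>2"
    using \<xi> dnz(1) \<xi>0 by (simp add: divide_simps power2_eq_square) (simp add: algebra_simps)
  \<comment> \<open>The radicand of \<open>lw_s\<close> is an exact square; the sign assumption on
    the slope difference selects the root.\<close>
  then have Qs: "Qs = (qq / \<xi>0)\<^sup>2" unfolding Qs_def d_def[symmetric]
    by (simp add: power_divide) (simp add: d_def power2_eq_square algebra_simps)
  then have sQs: "sqrt Qs = qq / \<xi>0" using qq \<xi>0 by simp
  have m1: "\<xi>0\<^sup>2 * \<xi>0\<^sup>2 \<le> \<xi>0\<^sup>2 * Qs" by (rule mult_left_mono[OF Qb(1)]) simp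
  have m2: "\<xi>0\<^sup>2 * Qs \<le> \<xi>0\<^sup>2 * (16 * \<xi>0\<^sup>2)" by (rule mult_left_mono[OF Qb(2)]) simp
  have "\<xi>0\<^sup>2 * Qs = qq\<^sup>2" using Qs \<xi>0 by (simp add: power_divide)
  with m1 m2 have "(\<xi>0\<^sup>2)\<^sup>2 \<le> qq\<^sup>2" "qq\<^sup>2 \<le> (4 * \<xi>0\<^sup>2)\<^sup>2" by (simp_all add: power2_eq_square algebra_simps)
  then have "\<xi>0\<^sup>2 \<le> qq" "qq \<le> 4 * \<xi>0\<^sup>2" using qq by (auto intro: power2_le_imp_le)
  then show "\<xi>0\<^sup>2 \<le> \<mu> / \<xi> - (\<mu>0 - \<mu>) / (\<xi>0 - \<xi>)" "\<mu> / \<xi> - (\<mu>0 - \<mu>) / (\<xi>0 - \<xi>) \<le> 4 * \<xi>0\<^sup>2"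
    by (simp_all add: qq_def d_def)
  define rr where "rr = \<mu> / \<xi> - \<nu> / \<eta>"
  have rr: "rr \<ge> 0" using r by (simp add: rr_def)
  have "lw_s \<alpha> \<xi>0 \<rho> \<xi> = d * (qq / \<xi>0)" unfolding lw_s_def Qs_def[symmetric] sQs by (simp add: d_def)
  also have "\<dots> = \<mu> / \<xi> - \<mu>0 / \<xi>0"
    unfolding qq_def using \<xi> dnz(1) \<xi>0 by (simp add: divide_simps) (simp add: d_def algebra_simps)
  finally have s: "lw_s \<alpha> \<xi>0 \<rho> \<xi> + (\<mu>0 / \<xi>0 - \<nu> / \<eta>) = rr" by (simp add: rr_def)
  define S where "S = 5 * (\<xi>\<^sup>2 + \<xi> * \<eta> + \<eta>\<^sup>2) - 3 * \<alpha>"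
  define w where "w = lw_w \<alpha> \<eta> \<xi>"
  have "3 * \<bar>\<alpha>\<bar> \<le> 1 * \<xi>" using big by auto
  also have "\<dots> \<le> 2 * \<xi> * \<xi>" using \<xi> by (intro mult_right_mono) auto
  finally have al: "3 * \<bar>\<alpha>\<bar> \<le> 2 * \<xi>\<^sup>2" by (simp add: power2_eq_square)
  have sS: "\<xi> \<le> sqrt S" using lw_w_deriv(2)[OF \<xi>(2) adm(2) al] by (simp add: S_def)
  then have S0: "S \<ge> 0" using \<xi> by (metis less_le_trans less_imp_le real_sqrt_gt_0_iff)
  have w: "w \<ge> (\<xi> + \<eta>) * \<xi>" "w\<^sup>2 = (\<xi> + \<eta>)\<^sup>2 * S"
    unfolding w_def lw_w_def S_def[symmetric] using sS s3 S0 by (auto simp: power_mult_distrib)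
  define R where "R = \<omega> \<alpha> (\<xi> + \<eta>) (\<mu> + \<nu>) - \<omega> \<alpha> \<xi> \<mu> - \<omega> \<alpha> \<eta> \<nu>"
  have "\<bar>R\<bar> \<le> M1 + M2 + M3" unfolding R_def using sl by linarith
  also have "\<dots> \<le> 9 * (\<xi> powr (11/4) * \<bar>\<eta>\<bar>)"
  proof -
    have "\<bar>\<xi> + \<eta>\<bar> powr (11/4) * \<bar>\<eta>\<bar> \<le> 7 * \<xi> powr (11/4) * \<bar>\<eta>\<bar>" using b4 by (intro mult_right_mono) auto
    then show ?thesis using M by linarith
  qed
  finally have Rb: "\<bar>R\<bar> \<le> 9 * \<xi> powr (11/4) * \<bar>\<eta>\<bar>" by simp
  have "R = \<xi> * \<eta> * (\<xi> + \<eta>) * S - \<xi> * \<eta> / (\<xi> + \<eta>) * rr\<^sup>2"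
    unfolding R_def S_def rr_def using \<xi> adm(1) s3 by (intro \<omega>_resonance) auto
  also have "\<dots> = \<xi> * \<eta> / (\<xi> + \<eta>) * ((\<xi> + \<eta>)\<^sup>2 * S - rr\<^sup>2)"
    using s3 by (simp add: power2_eq_square right_diff_distrib)
  also have "\<dots> = \<xi> * \<eta> / (\<xi> + \<eta>) * ((w - rr) * (w + rr))"
    unfolding w(2)[symmetric] by (simp add: power2_eq_square algebra_simps)
  finally have Req: "R = \<xi> * \<eta> / (\<xi> + \<eta>) * ((w - rr) * (w + rr))" .
  have "w > 0" using w(1) mult_pos_pos[OF s3 \<xi>(2)] by linarith
  with rr have "w + rr > 0" by linarith
  then have R: "\<bar>R\<bar> = \<xi> * \<bar>\<eta>\<bar> / (\<xi> + \<eta>) * (\<bar>w - rr\<bar> * (w + rr))"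
    using \<xi> s3 unfolding Req by (simp add: abs_mult)
  \<comment> \<open>Since \<open>rr\<close> is nonnegative, \<open>w + rr\<close> is at least
    \<open>(\<xi> + \<eta>) * \<xi>\<close>. Cancelling \<bar>\<eta>\<bar> leaves 11/4 - 2 = 3/4 as
    the order of \<open>w - rr\<close>.\<close>
  have "\<bar>w - rr\<bar> * \<xi>\<^sup>2 * \<bar>\<eta>\<bar> = \<xi> * \<bar>\<eta>\<bar> / (\<xi> + \<eta>) * (\<bar>w - rr\<bar> * ((\<xi> + \<eta>) * \<xi>))"
    using s3 by (simp add: power2_eq_square)
  also have "\<dots> \<le> \<xi> * \<bar>\<eta>\<bar> / (\<xi> + \<eta>) * (\<bar>w - rr\<bar> * (w + rr))"
    using w(1) rr \<xi> s3 by (intro mult_left_mono) auto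
  also have "\<dots> \<le> 9 * \<xi> powr (11/4) * \<bar>\<eta>\<bar>" using R Rb by simp
  finally have "\<bar>w - rr\<bar> * \<xi>\<^sup>2 \<le> 9 * \<xi> powr (11/4)" using adm(1) by simp
  also have "\<xi> powr (11/4) = \<xi> powr (3/4) * \<xi>\<^sup>2" using \<xi> by (simp add: powr_11_4)
  finally have "\<bar>w - rr\<bar> \<le> 9 * \<xi> powr (3/4)" using \<xi> by simp
  also have "\<xi> powr (3/4) \<le> (2 * \<xi>0) powr (3/4)" using h2 \<xi> by (intro powr_mono2) auto
  also have "\<dots> \<le> 2 powr 1 * \<xi>0 powr (3/4)" using \<xi>0 unfolding powr_mult by (intro mult_right_mono powr_mono) auto
  finally show "\<bar>lw_s \<alpha> \<xi>0 \<rho> \<xi> + (\<mu>0 / \<xi>0 - \<nu> / \<eta>) - lw_w \<alpha> \<eta> \<xi>\<bar> \<le> 18 * \<xi>0 powr (3/4)"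
    unfolding s w_def by simp
  have "\<xi> powr (11/4) * \<bar>\<xi>0 - \<xi>\<bar> \<le> 7 * \<xi>0 powr (11/4) * (2 * \<xi>0)"
    using b2 adm(5) h2 by (intro mult_mono) auto
  also have "\<dots> = 14 * (\<xi>0 powr (11/4) * \<xi>0 powr 1)" using \<xi>0 by simp
  also have "\<dots> = 14 * \<xi>0 powr (15/4)" by (simp only: powr_add[symmetric]) simp
  finally show "M1 \<le> 14 * \<xi>0 powr (15/4)" "M2 \<le> 14 * \<xi>0 powr (15/4)" using M by auto
qed


lemma lw_s_measurable[measurable (raw)]:
  assumes [measurable]: "f \<in> borel_measurable N" "g \<in> borel_measurable N"
  shows "(\<lambda>x. lw_s \<alpha> \<xi>0 (f x) (g x)) \<in> borel_measurable N"
  unfolding lw_s_def by measurable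

lemma lw_w_measurable[measurable (raw)]:
  assumes [measurable]: "g \<in> borel_measurable N"
  shows "(\<lambda>x. lw_w \<alpha> \<eta> (g x)) \<in> borel_measurable N"
  unfolding lw_w_def by measurable

text \<open>For fixed \<xi> and \<mu> the measure in \<tau> depends only on h =
  \<open>hh \<xi> \<mu>\<close>, and \<open>S\<close> only on h and \<xi>. So \<mu> is replaced by h
  as a variable, with Jacobian twice the slope difference, hence at least 2 \<xi>0^2. With h frozen,
  \<open>S\<close> confines \<xi> to two sets of diameter at most 4 \<delta> / \<xi>0, one on each
  side of \<xi>0. What remains is the integral in h of the measure in \<tau>, at most (2 M1) (2
  M2).\<close>

lemma lw_measure:
  fixes \<alpha> \<eta> \<xi>0 \<mu>0 \<tau>0 e E \<delta> M1 M2 \<omega>0 :: real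
  assumes \<xi>0: "\<xi>0 > 0" and E: "E \<ge> 0" "6 * \<bar>\<alpha>\<bar> + 4 * E / \<xi>0\<^sup>2 \<le> \<xi>0\<^sup>2" and \<delta>: "\<delta> \<ge> 0" and M: "M1 \<ge> 0" "M2 \<ge> 0"
  defines "hh \<equiv> \<lambda>\<xi> \<mu>. \<omega> \<alpha> \<xi> \<mu> + \<omega> \<alpha> (\<xi>0 - \<xi>) (\<mu>0 - \<mu>)"
  defines "S \<equiv> \<lambda>h \<xi>. \<xi>0 / 2 \<le> \<xi> \<and> \<xi> \<le> 2 * \<xi>0 \<and> \<xi> \<noteq> \<xi>0 \<and> \<bar>\<eta>\<bar> \<le> \<xi> \<and> \<bar>\<omega>0 - h\<bar> \<le> E * \<bar>\<xi>0 - \<xi>\<bar>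
      \<and> \<bar>lw_s \<alpha> \<xi>0 (\<omega>0 - h) \<xi> + e - lw_w \<alpha> \<eta> \<xi>\<bar> \<le> \<delta>"
  shows "(\<integral>\<^sup>+z. (case z of (\<xi>, \<mu>, \<tau>) \<Rightarrow> if S (hh \<xi> \<mu>) \<xi> \<and> \<xi>0\<^sup>2 \<le> \<mu> / \<xi> - (\<mu>0 - \<mu>) / (\<xi>0 - \<xi>) \<and> \<mu> / \<xi> - (\<mu>0 - \<mu>) / (\<xi>0 - \<xi>) \<le> 4 * \<xi>0\<^sup>2
      \<and> \<bar>\<tau> - \<omega> \<alpha> \<xi> \<mu>\<bar> \<le> M1 \<and> \<bar>\<tau>0 - \<tau> - \<omega> \<alpha> (\<xi>0 - \<xi>) (\<mu>0 - \<mu>)\<bar> \<le> M2 then 1 else 0) \<partial>lborel)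
     \<le> ennreal (16 * M1 * M2 * \<delta> / \<xi>0 ^ 3)"
proof -
  \<comment> \<open>The measure in \<tau> after translating \<tau> by
    \<open>\<omega> \<alpha> \<xi> \<mu>\<close>. Only the sum \<open>hh \<xi> \<mu>\<close> of the
    two dispersion values survives.\<close>
  define \<psi> :: "real \<Rightarrow> ennreal" where "\<psi> h = (\<integral>\<^sup>+a. (if \<bar>a\<bar> \<le> M1 \<and> \<bar>\<tau>0 - a - h\<bar> \<le> M2 then 1 else 0) \<partial>lborel)" for h
  define \<phi> where "\<phi> \<xi> h = (if S h \<xi> then \<psi> h else 0)" for \<xi> h
  define q where "q \<xi> \<mu> = \<mu> / \<xi> - (\<mu>0 - \<mu>) / (\<xi>0 - \<xi>)" for \<xi> \<mu>
  have [measurable]: "\<psi> \<in> borel_measurable borel" unfolding \<psi>_def by measurable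
  have Sm[measurable]: "Measurable.pred N (\<lambda>x. S (f x) (g x))" if [measurable]: "f \<in> borel_measurable N" "g \<in> borel_measurable N" for f g and N :: "'n measure"
    unfolding S_def by measurable
  have hm[measurable]: "(\<lambda>x. hh (f x) (g x)) \<in> borel_measurable N" if [measurable]: "f \<in> borel_measurable N" "g \<in> borel_measurable N" for f g and N :: "'n measure"
    unfolding hh_def by measurable
  have [measurable]: "(\<lambda>x. \<phi> (f x) (g x)) \<in> borel_measurable N" if [measurable]: "f \<in> borel_measurable N" "g \<in> borel_measurable N" for f g and N :: "'n measure"
    unfolding \<phi>_def by measurable
  have \<tau>int: "(\<integral>\<^sup>+\<tau>. (if S (hh \<xi> \<mu>) \<xi> \<and> \<xi>0\<^sup>2 \<le> q \<xi> \<mu> \<and> q \<xi> \<mu> \<le> 4 * \<xi>0\<^sup>2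
      \<and> \<bar>\<tau> - \<omega> \<alpha> \<xi> \<mu>\<bar> \<le> M1 \<and> \<bar>\<tau>0 - \<tau> - \<omega> \<alpha> (\<xi>0 - \<xi>) (\<mu>0 - \<mu>)\<bar> \<le> M2 then 1 else 0) \<partial>lborel)
     = \<phi> \<xi> (hh \<xi> \<mu>) * indicator {\<mu>. \<xi>0\<^sup>2 \<le> q \<xi> \<mu> \<and> q \<xi> \<mu> \<le> 4 * \<xi>0\<^sup>2} \<mu>" (is "?L = _") for \<xi> \<mu>
  proof (cases "S (hh \<xi> \<mu>) \<xi> \<and> \<xi>0\<^sup>2 \<le> q \<xi> \<mu> \<and> q \<xi> \<mu> \<le> 4 * \<xi>0\<^sup>2")
    case True
    have "?L = (\<integral>\<^sup>+\<tau>. (if \<bar>\<tau> - \<omega> \<alpha> \<xi> \<mu>\<bar> \<le> M1 \<and> \<bar>\<tau>0 - \<tau> - \<omega> \<alpha> (\<xi>0 - \<xi>) (\<mu>0 - \<mu>)\<bar> \<le> M2 then 1 else 0) \<partial>lborel)"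
      using True by (intro nn_integral_cong) auto
    also have "\<dots> = (\<integral>\<^sup>+a. (if \<bar>(\<omega> \<alpha> \<xi> \<mu> + a) - \<omega> \<alpha> \<xi> \<mu>\<bar> \<le> M1 \<and> \<bar>\<tau>0 - (\<omega> \<alpha> \<xi> \<mu> + a) - \<omega> \<alpha> (\<xi>0 - \<xi>) (\<mu>0 - \<mu>)\<bar> \<le> M2 then 1 else 0) \<partial>lborel)"
      by (subst nn_integral_lborel_translate[where c = "\<omega> \<alpha> \<xi> \<mu>"]) auto
    also have "\<dots> = \<psi> (hh \<xi> \<mu>)" unfolding \<psi>_def hh_def
      by (intro nn_integral_cong) (simp add: algebra_simps)
    finally show ?thesis using True by (simp add: \<phi>_def)
  qed (auto simp: \<phi>_def intro!: nn_integral_zero')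
  have \<mu>int: "(\<integral>\<^sup>+\<mu>. \<phi> \<xi> (hh \<xi> \<mu>) * indicator {\<mu>. \<xi>0\<^sup>2 \<le> q \<xi> \<mu> \<and> q \<xi> \<mu> \<le> 4 * \<xi>0\<^sup>2} \<mu> \<partial>lborel)
     \<le> ennreal (1 / (2 * \<xi>0\<^sup>2)) * (\<integral>\<^sup>+h. \<phi> \<xi> h \<partial>lborel)" for \<xi>
  proof (cases "\<xi>0 / 2 \<le> \<xi> \<and> \<xi> \<noteq> \<xi>0")
    case True
    then have nz: "\<xi> \<noteq> 0" "\<xi>0 - \<xi> \<noteq> 0" using \<xi>0 by auto
    \<comment> \<open>The slope difference is affine in \<mu> with slope \<open>k\<close>, so the
      admissible \<mu> form an interval whose orientation depends on the sign of
      \<open>k\<close>.\<close>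
    define k where "k = \<xi>0 / (\<xi> * (\<xi>0 - \<xi>))"
    have k: "k \<noteq> 0" using nz \<xi>0 by (simp add: k_def)
    define c where "c = \<mu>0 / (\<xi>0 - \<xi>)"
    have q: "q \<xi> \<mu> = k * \<mu> - c" for \<mu>
      using nz by (simp add: q_def k_def c_def divide_simps) (simp add: algebra_simps)
    define a b where "a = min ((\<xi>0\<^sup>2 + c) / k) ((4 * \<xi>0\<^sup>2 + c) / k)" "b = max ((\<xi>0\<^sup>2 + c) / k) ((4 * \<xi>0\<^sup>2 + c) / k)"
    have ab: "{\<mu>. \<xi>0\<^sup>2 \<le> q \<xi> \<mu> \<and> q \<xi> \<mu> \<le> 4 * \<xi>0\<^sup>2} = {a..b}"
    proof (cases "k > 0")
      case True
      have "(\<xi>0\<^sup>2 + c) / k \<le> (4 * \<xi>0\<^sup>2 + c) / k" using True by (intro divide_right_mono) auto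
      then show ?thesis using True unfolding a_b_def q by (auto simp: field_simps)
    next
      case False
      then have "k < 0" using k by auto
      then have "(4 * \<xi>0\<^sup>2 + c) / k \<le> (\<xi>0\<^sup>2 + c) / k" by (intro divide_right_mono_neg) auto
      then show ?thesis using \<open>k < 0\<close> unfolding a_b_def q by (auto simp: field_simps)
    qed
    show ?thesis unfolding ab
    proof (rule nn_integral_subst_le[where g' = "\<lambda>\<mu>. 2 * q \<xi> \<mu>"])
      show "((\<lambda>\<mu>. hh \<xi> \<mu>) has_real_derivative 2 * q \<xi> x) (at x)" for x
      proof -
        have "((\<lambda>\<mu>. (\<xi> ^ 5 - \<alpha> * \<xi> ^ 3 + \<mu>\<^sup>2 * (1 / \<xi>)) + ((\<xi>0 - \<xi>) ^ 5 - \<alpha> * (\<xi>0 - \<xi>) ^ 3 + (\<mu>0 - \<mu>)\<^sup>2 * (1 / (\<xi>0 - \<xi>))))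
          has_real_derivative 2 * x * (1 / \<xi>) - 2 * (\<mu>0 - x) * (1 / (\<xi>0 - \<xi>))) (at x)"
          by (rule derivative_eq_intros refl)+ (simp add: minus_divide_left)
        then show ?thesis unfolding hh_def \<omega>_def q_def by (simp add: right_diff_distrib diff_divide_distrib)
      qed
      show "continuous_on {a..b} (\<lambda>\<mu>. 2 * q \<xi> \<mu>)"
        unfolding q by (intro continuous_intros)
      show "2 * \<xi>0\<^sup>2 \<le> 2 * q \<xi> x" if "x \<in> {a..b}" for x
        using that unfolding ab[symmetric] by simp
    qed (use \<xi>0 in auto)
  next
    case False
    then have "\<phi> \<xi> h = 0" for h by (auto simp: \<phi>_def S_def)
    then show ?thesis by simp
  qed
  have \<xi>int: "(\<integral>\<^sup>+\<xi>. \<phi> \<xi> h \<partial>lborel) \<le> ennreal (8 * \<delta> / \<xi>0) * \<psi> h" for h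
  proof -
    have 1: "emeasure lborel {\<xi>. S h \<xi> \<and> \<xi> < \<xi>0} \<le> ennreal (4 * \<delta> / \<xi>0)"
    proof (rule emeasure_lborel_diam)
      fix a b assume "a \<in> {\<xi>. S h \<xi> \<and> \<xi> < \<xi>0}" "b \<in> {\<xi>. S h \<xi> \<and> \<xi> < \<xi>0}" "a \<le> b"
      then show "b - a \<le> 4 * \<delta> / \<xi>0"
        by (intro lw_diam[OF \<xi>0 _ _ _ _ _ _ E, where \<rho> = "\<omega>0 - h" and \<eta> = \<eta> and e = e]) (auto simp: S_def)
    qed (use \<xi>0 \<delta> in auto)
    have 2: "emeasure lborel {\<xi>. S h \<xi> \<and> \<xi> > \<xi>0} \<le> ennreal (4 * \<delta> / \<xi>0)"
    proof (rule emeasure_lborel_diam)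
      fix a b assume "a \<in> {\<xi>. S h \<xi> \<and> \<xi> > \<xi>0}" "b \<in> {\<xi>. S h \<xi> \<and> \<xi> > \<xi>0}" "a \<le> b"
      then show "b - a \<le> 4 * \<delta> / \<xi>0"
        by (intro lw_diam[OF \<xi>0 _ _ _ _ _ _ E, where \<rho> = "\<omega>0 - h" and \<eta> = \<eta> and e = e]) (auto simp: S_def)
    qed (use \<xi>0 \<delta> in auto)
    have "(\<integral>\<^sup>+\<xi>. \<phi> \<xi> h \<partial>lborel) \<le> (\<integral>\<^sup>+\<xi>. \<psi> h * (indicator {\<xi>. S h \<xi> \<and> \<xi> < \<xi>0} \<xi> + indicator {\<xi>. S h \<xi> \<and> \<xi> > \<xi>0} \<xi>) \<partial>lborel)"
      by (intro nn_integral_mono) (auto simp: \<phi>_def indicator_def S_def)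
    also have "\<dots> = \<psi> h * (emeasure lborel {\<xi>. S h \<xi> \<and> \<xi> < \<xi>0} + emeasure lborel {\<xi>. S h \<xi> \<and> \<xi> > \<xi>0})"
      by (subst nn_integral_cmult, simp, subst nn_integral_add) auto
    also have "\<dots> \<le> \<psi> h * (ennreal (4 * \<delta> / \<xi>0) + ennreal (4 * \<delta> / \<xi>0))"
      by (intro mult_left_mono add_mono 1 2) auto
    also have "ennreal (4 * \<delta> / \<xi>0) + ennreal (4 * \<delta> / \<xi>0) = ennreal (8 * \<delta> / \<xi>0)"
      using \<xi>0 \<delta> by (subst ennreal_plus[symmetric]) auto
    finally show ?thesis by (simp add: mult.commute)
  qed
  have \<psi>int: "(\<integral>\<^sup>+h. \<psi> h \<partial>lborel) \<le> ennreal (4 * M1 * M2)"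
  proof -
    have "(\<integral>\<^sup>+h. \<psi> h \<partial>lborel) = (\<integral>\<^sup>+a. \<integral>\<^sup>+h. (if \<bar>a\<bar> \<le> M1 \<and> \<bar>\<tau>0 - a - h\<bar> \<le> M2 then 1 else 0) \<partial>lborel \<partial>lborel)"
      unfolding \<psi>_def by (rule lborel_Fubini) measurable
    also have "\<dots> \<le> (\<integral>\<^sup>+a. \<integral>\<^sup>+h. indicator {-M1..M1} a * indicator {\<tau>0 - a - M2..\<tau>0 - a + M2} h \<partial>lborel \<partial>lborel)"
      by (intro nn_integral_mono) (auto simp: indicator_def)
    also have "\<dots> = (\<integral>\<^sup>+a. indicator {-M1..M1} a * ennreal (2 * M2) \<partial>lborel)"
      using M by (intro nn_integral_cong) (subst nn_integral_cmult, auto simp: emeasure_lborel_Icc_eq)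
    also have "\<dots> = ennreal (2 * M1) * ennreal (2 * M2)"
      using M by (subst nn_integral_multc) (auto simp: emeasure_lborel_Icc_eq)
    also have "\<dots> = ennreal (4 * M1 * M2)" using M by (simp add: ennreal_mult[symmetric])
    finally show ?thesis .
  qed
  have "(\<integral>\<^sup>+z. (case z of (\<xi>, \<mu>, \<tau>) \<Rightarrow> if S (hh \<xi> \<mu>) \<xi> \<and> \<xi>0\<^sup>2 \<le> \<mu> / \<xi> - (\<mu>0 - \<mu>) / (\<xi>0 - \<xi>) \<and> \<mu> / \<xi> - (\<mu>0 - \<mu>) / (\<xi>0 - \<xi>) \<le> 4 * \<xi>0\<^sup>2
      \<and> \<bar>\<tau> - \<omega> \<alpha> \<xi> \<mu>\<bar> \<le> M1 \<and> \<bar>\<tau>0 - \<tau> - \<omega> \<alpha> (\<xi>0 - \<xi>) (\<mu>0 - \<mu>)\<bar> \<le> M2 then 1 else 0) \<partial>lborel)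
    = (\<integral>\<^sup>+\<xi>. \<integral>\<^sup>+\<mu>. \<phi> \<xi> (hh \<xi> \<mu>) * indicator {\<mu>. \<xi>0\<^sup>2 \<le> q \<xi> \<mu> \<and> q \<xi> \<mu> \<le> 4 * \<xi>0\<^sup>2} \<mu> \<partial>lborel \<partial>lborel)"
    unfolding \<tau>int[symmetric] unfolding q_def
    by (subst nn_integral_R3) (auto simp: case_prod_beta')
  also have "\<dots> \<le> (\<integral>\<^sup>+\<xi>. ennreal (1 / (2 * \<xi>0\<^sup>2)) * (\<integral>\<^sup>+h. \<phi> \<xi> h \<partial>lborel) \<partial>lborel)"
    by (intro nn_integral_mono \<mu>int)
  also have "\<dots> = ennreal (1 / (2 * \<xi>0\<^sup>2)) * (\<integral>\<^sup>+\<xi>. \<integral>\<^sup>+h. \<phi> \<xi> h \<partial>lborel \<partial>lborel)"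
    by (rule nn_integral_cmult) measurable
  also have "(\<integral>\<^sup>+\<xi>. \<integral>\<^sup>+h. \<phi> \<xi> h \<partial>lborel \<partial>lborel) = (\<integral>\<^sup>+h. \<integral>\<^sup>+\<xi>. \<phi> \<xi> h \<partial>lborel \<partial>lborel)"
    by (rule lborel_Fubini) measurable
  also have "\<dots> \<le> (\<integral>\<^sup>+h. ennreal (8 * \<delta> / \<xi>0) * \<psi> h \<partial>lborel)"
    by (intro nn_integral_mono \<xi>int)
  also have "\<dots> = ennreal (8 * \<delta> / \<xi>0) * (\<integral>\<^sup>+h. \<psi> h \<partial>lborel)"
    by (rule nn_integral_cmult) measurable
  also have "\<dots> \<le> ennreal (8 * \<delta> / \<xi>0) * ennreal (4 * M1 * M2)"
    by (intro mult_left_mono \<psi>int) auto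
  also have "ennreal (1 / (2 * \<xi>0\<^sup>2)) * (ennreal (8 * \<delta> / \<xi>0) * ennreal (4 * M1 * M2)) = ennreal (16 * M1 * M2 * \<delta> / \<xi>0 ^ 3)"
    using \<xi>0 \<delta> M by (subst ennreal_mult3) (auto simp: power2_eq_square power3_eq_cube)
  finally show ?thesis by (simp add: mult_left_mono)
qed

text \<open>\<open>tri_Q\<close> is applied with the large frequency \<open>fst x\<close> as the
  variable of integration. \<open>lw_point\<close> places the integrand in the set measured by
  \<open>lw_measure\<close>, and its bounds on \<open>M1\<close> and \<open>M2\<close> are what
  allows the exponent 1 of \<open>M1 * M2\<close> to be lowered to 29/30.\<close>

lemma region_LW:
  fixes f g h :: "R3 \<Rightarrow> ennreal"
  assumes [measurable]: "f \<in> borel_measurable borel" "g \<in> borel_measurable borel" "h \<in> borel_measurable borel"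
    and [measurable]: "Measurable.pred (lborel \<Otimes>\<^sub>M lborel) (case_prod Q)"
    and M: "M1 \<ge> 1" "M2 \<ge> 1" "M3 \<ge> 1"
    and sup: "\<And>x. x \<notin> slab \<alpha> M1 \<Longrightarrow> f x = 0" "\<And>x. x \<notin> slab \<alpha> M2 \<Longrightarrow> g x = 0" "\<And>x. x \<notin> slab \<alpha> M3 \<Longrightarrow> h x = 0"
    and Q: "\<And>x y. Q x y \<Longrightarrow> adm x y \<and> fst x \<ge> 504 + 12 * \<bar>\<alpha>\<bar> \<and> fst (snd x) / fst x \<ge> fst (snd y) / fst y \<and>
      M1 \<le> fst x powr (11/4) * \<bar>fst y\<bar> \<and> M2 \<le> fst x powr (11/4) * \<bar>fst y\<bar> \<and> M3 \<le> \<bar>fst x + fst y\<bar> powr (11/4) * \<bar>fst y\<bar>"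
  shows "(tri (\<lambda>x y. if Q x y then ennreal \<bar>fst x\<bar> else 0) f g h)\<^sup>2
    \<le> ennreal (2304 * (M1 * M2 * M3) powr (29/30)) * sqint f * sqint g * sqint h"
proof -
  define k where "k z x = (if Q z x \<and> z \<in> slab \<alpha> M1 \<and> x \<in> slab \<alpha> M2 \<and> - z - x \<in> slab \<alpha> M3 then ennreal \<bar>fst z\<bar> else 0)" for z x
  have Qm[measurable]: "Measurable.pred (lborel \<Otimes>\<^sub>M lborel) (\<lambda>p. Q (fst p) (snd p))"
    using assms(4) by (simp add: case_prod_beta')
  have "tri (\<lambda>x y. if Q x y then ennreal \<bar>fst x\<bar> else 0) f g h = tri k f g h"
    unfolding tri_def k_def by (intro nn_integral_cong) (auto simp: sup)
  also have "(tri k f g h)\<^sup>2 \<le> ennreal (2304 * (M1 * M2 * M3) powr (29/30)) * sqint f * sqint g * sqint h"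
  proof (rule tri_Q)
    show "case_prod k \<in> borel_measurable (lborel \<Otimes>\<^sub>M lborel)"
      unfolding k_def case_prod_beta' by measurable
    fix x y :: R3
    obtain \<eta> \<nu> \<kappa> where x: "x = (\<eta>, \<nu>, \<kappa>)" by (cases x)
    \<comment> \<open>The sign is reversed so that \<open>- z - y\<close> becomes the difference of
      (\<xi>0, \<mu>0, \<tau>0) and \<open>z\<close>.\<close>
    obtain \<xi>0 \<mu>0 \<tau>0 where y: "y = - (\<xi>0, \<mu>0, \<tau>0)" by (metis minus_minus prod_cases3)
    define \<omega>0 where "\<omega>0 = \<omega> \<alpha> \<xi>0 \<mu>0"
    define E where "E = 63 * \<xi>0 powr (11/4)"
    define e where "e = \<mu>0 / \<xi>0 - \<nu> / \<eta>"
    define \<delta> where "\<delta> = 18 * \<xi>0 powr (3/4)"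
    define S where "S h \<xi> \<longleftrightarrow> \<xi>0 / 2 \<le> \<xi> \<and> \<xi> \<le> 2 * \<xi>0 \<and> \<xi> \<noteq> \<xi>0 \<and> \<bar>\<eta>\<bar> \<le> \<xi> \<and> \<bar>\<omega>0 - h\<bar> \<le> E * \<bar>\<xi>0 - \<xi>\<bar>
      \<and> \<bar>lw_s \<alpha> \<xi>0 (\<omega>0 - h) \<xi> + e - lw_w \<alpha> \<eta> \<xi>\<bar> \<le> \<delta>" for h \<xi>
    define W where "W = (\<lambda>(\<xi>, \<mu>, \<tau>). if S (\<omega> \<alpha> \<xi> \<mu> + \<omega> \<alpha> (\<xi>0 - \<xi>) (\<mu>0 - \<mu>)) \<xi> \<and> \<xi>0\<^sup>2 \<le> \<mu> / \<xi> - (\<mu>0 - \<mu>) / (\<xi>0 - \<xi>) \<and> \<mu> / \<xi> - (\<mu>0 - \<mu>) / (\<xi>0 - \<xi>) \<le> 4 * \<xi>0\<^sup>2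
      \<and> \<bar>\<tau> - \<omega> \<alpha> \<xi> \<mu>\<bar> \<le> M1 \<and> \<bar>\<tau>0 - \<tau> - \<omega> \<alpha> (\<xi>0 - \<xi>) (\<mu>0 - \<mu>)\<bar> \<le> M2 then 1 else 0 :: ennreal)"
    have pt: "\<xi>0 > 0 \<and> 6 * \<bar>\<alpha>\<bar> + 4 * E / \<xi>0\<^sup>2 \<le> \<xi>0\<^sup>2 \<and> M1 \<le> 14 * \<xi>0 powr (15/4) \<and> M2 \<le> 14 * \<xi>0 powr (15/4)
        \<and> k z x * k z (- z - y) \<le> ennreal (4 * \<xi>0\<^sup>2) * W z" if nz: "k z x * k z (- z - y) \<noteq> 0" for z
    proof -
      obtain \<xi> \<mu> \<tau> where z: "z = (\<xi>, \<mu>, \<tau>)" by (cases z)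
      have zy: "- z - y = (\<xi>0 - \<xi>, \<mu>0 - \<mu>, \<tau>0 - \<tau>)" "- z - (- z - y) = y" by (auto simp: z y)
      have q: "Q z x" "Q z (- z - y)" and s: "z \<in> slab \<alpha> M1" "x \<in> slab \<alpha> M2" "- z - x \<in> slab \<alpha> M3" "- z - y \<in> slab \<alpha> M2" "y \<in> slab \<alpha> M3"
        using nz zy(2) by (auto simp: k_def split: if_splits)
      have "\<omega> \<alpha> (- \<xi> - \<eta>) (- \<mu> - \<nu>) = - \<omega> \<alpha> (\<xi> + \<eta>) (\<mu> + \<nu>)"
        using \<omega>_odd[of \<alpha> "\<xi> + \<eta>" "\<mu> + \<nu>"] by simp
      then have s3: "\<bar>\<tau> + \<kappa> - \<omega> \<alpha> (\<xi> + \<eta>) (\<mu> + \<nu>)\<bar> \<le> M3"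
        using s(3) by (simp add: slab_def x z \<omega>_odd abs_le_iff)
      have s5: "\<bar>\<tau>0 - \<omega> \<alpha> \<xi>0 \<mu>0\<bar> \<le> M3" using s(5) by (simp add: slab_def y \<omega>_odd abs_le_iff)
      have big: "504 + 12 * \<bar>\<alpha>\<bar> \<le> \<xi>" using Q[OF q(1)] by (simp add: z)
      have \<xi>p: "\<xi> > 0" using big by auto
      have pr: "\<eta> \<noteq> 0" "\<bar>\<eta>\<bar> \<le> \<xi>" "\<bar>\<eta>\<bar> \<le> \<bar>\<xi> + \<eta>\<bar>" "\<xi> \<noteq> \<xi>0" "\<bar>\<xi>0 - \<xi>\<bar> \<le> \<xi>" "\<bar>\<xi>0 - \<xi>\<bar> \<le> \<bar>\<xi>0\<bar>"
        using Q[OF q(1)] Q[OF q(2)] \<xi>p unfolding zy(1) by (auto simp: adm_def x z)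
      have sl: "\<bar>\<tau> - \<omega> \<alpha> \<xi> \<mu>\<bar> \<le> M1" "\<bar>\<kappa> - \<omega> \<alpha> \<eta> \<nu>\<bar> \<le> M2" "\<bar>\<tau>0 - \<tau> - \<omega> \<alpha> (\<xi>0 - \<xi>) (\<mu>0 - \<mu>)\<bar> \<le> M2"
        using s unfolding zy(1) by (auto simp: slab_def x z)
      have Ms: "M1 \<le> \<xi> powr (11/4) * \<bar>\<eta>\<bar>" "M2 \<le> \<xi> powr (11/4) * \<bar>\<eta>\<bar>" "M3 \<le> \<bar>\<xi> + \<eta>\<bar> powr (11/4) * \<bar>\<eta>\<bar>"
        "M1 \<le> \<xi> powr (11/4) * \<bar>\<xi>0 - \<xi>\<bar>" "M2 \<le> \<xi> powr (11/4) * \<bar>\<xi>0 - \<xi>\<bar>" "M3 \<le> \<bar>\<xi>0\<bar> powr (11/4) * \<bar>\<xi>0 - \<xi>\<bar>"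
        and sg: "\<mu> / \<xi> \<ge> \<nu> / \<eta>" "\<mu> / \<xi> \<ge> (\<mu>0 - \<mu>) / (\<xi>0 - \<xi>)"
        using Q[OF q(1)] Q[OF q(2)] unfolding zy(1) by (auto simp: x z)
      note P = lw_point[OF big pr sl(1,2) s3 sl(3) s5 Ms sg]
      have "W z = 1" unfolding W_def z S_def using P sl pr by (simp add: \<omega>0_def E_def e_def \<delta>_def)
      moreover have "k z x * k z (- z - y) = ennreal (\<xi> * \<xi>)"
        using nz \<xi>p by (auto simp: k_def z ennreal_mult split: if_splits)
      moreover have "\<xi> * \<xi> \<le> 4 * \<xi>0\<^sup>2"
        using mult_mono[OF P(3) P(3)] P(1) \<xi>p by (simp add: power2_eq_square)
      ultimately show ?thesis using P(1,4,9,10) by (simp add: E_def ennreal_leI)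
    qed
    show "(\<integral>\<^sup>+z. k z x * k z (- z - y) \<partial>lborel) \<le> ennreal (2304 * (M1 * M2 * M3) powr (29/30))"
    proof (cases "\<exists>z. k z x * k z (- z - y) \<noteq> 0")
      case True
      then have \<xi>0: "\<xi>0 > 0" "6 * \<bar>\<alpha>\<bar> + 4 * E / \<xi>0\<^sup>2 \<le> \<xi>0\<^sup>2" "M1 \<le> 14 * \<xi>0 powr (15/4)" "M2 \<le> 14 * \<xi>0 powr (15/4)" using pt by auto
      have [measurable]: "W \<in> borel_measurable borel" unfolding W_def S_def case_prod_beta' by measurable
      have "(\<integral>\<^sup>+z. k z x * k z (- z - y) \<partial>lborel) \<le> (\<integral>\<^sup>+z. ennreal (4 * \<xi>0\<^sup>2) * W z \<partial>lborel)"
        using pt by (intro nn_integral_mono) (metis zero_le)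
      also have "\<dots> = ennreal (4 * \<xi>0\<^sup>2) * (\<integral>\<^sup>+z. W z \<partial>lborel)" by (rule nn_integral_cmult) simp
      also have "(\<integral>\<^sup>+z. W z \<partial>lborel) \<le> ennreal (16 * M1 * M2 * \<delta> / \<xi>0 ^ 3)"
        unfolding W_def S_def by (rule lw_measure) (use \<xi>0 M in \<open>auto simp: E_def \<delta>_def\<close>)
      \<comment> \<open>1152 = 4 * 16 * 18, and the powers of \<xi>0 add up to 2 + 3/4 - 3 =
        -1/4.\<close>
      also have "ennreal (4 * \<xi>0\<^sup>2) * ennreal (16 * M1 * M2 * \<delta> / \<xi>0 ^ 3) = ennreal (1152 * (M1 * M2) * \<xi>0 powr (-1/4))"
      proof -
        have "\<xi>0 powr (3/4) = \<xi>0 powr (-1/4) * \<xi>0" using \<xi>0(1) by (simp add: powr_mult_base mult.commute)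
        then have "4 * \<xi>0\<^sup>2 * (16 * M1 * M2 * \<delta> / \<xi>0 ^ 3) = 1152 * (M1 * M2) * \<xi>0 powr (-1/4)"
          using \<xi>0(1) by (simp add: \<delta>_def power2_eq_square power3_eq_cube)
        then show ?thesis using \<xi>0 by (subst ennreal_mult'[symmetric]) auto
      qed
      also have "\<dots> \<le> ennreal (2304 * (M1 * M2 * M3) powr (29/30))"
      proof (rule ennreal_leI)
        have M12: "M1 * M2 \<ge> 1" using mult_mono[of 1 M1 1 M2] M by simp
        \<comment> \<open>The power 1/30 of M1 M2 is at most 2 \<xi>0 powr (1/4), because (15/4 +
          15/4) / 30 = 1/4. This cancels the available decay exactly and fixes the exponent
          29/30.\<close>
        have "M1 * M2 = (M1 * M2) powr (29/30) * (M1 * M2) powr (1/30)" using M12 by (simp add: powr_add[symmetric])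
        also have "(M1 * M2) powr (1/30) \<le> ((14 * \<xi>0 powr (15/4)) * (14 * \<xi>0 powr (15/4))) powr (1/30)"
          using \<xi>0 M by (intro powr_mono2 mult_mono) auto
        also have "((14 * \<xi>0 powr (15/4)) * (14 * \<xi>0 powr (15/4))) powr (1/30) = 196 powr (1/30) * (\<xi>0 powr (15/4) * \<xi>0 powr (15/4)) powr (1/30)"
          by (simp add: powr_mult[symmetric])
        also have "(\<xi>0 powr (15/4) * \<xi>0 powr (15/4)) powr (1/30) = \<xi>0 powr (1/4)"
          by (simp add: powr_add[symmetric] powr_powr)
        also have "(196::real) powr (1/30) \<le> 2"
        proof -
          have "((196::real) powr (1/30)) ^ Suc 29 \<le> 2 ^ Suc 29" by (simp add: powr_power)
          then show ?thesis by (rule power_le_imp_le_base) simp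
        qed
        finally have "M1 * M2 \<le> (M1 * M2) powr (29/30) * (2 * \<xi>0 powr (1/4))" by (simp add: mult_left_mono mult_right_mono)
        then have "1152 * (M1 * M2) * \<xi>0 powr (-1/4) \<le> 1152 * ((M1 * M2) powr (29/30) * (2 * \<xi>0 powr (1/4))) * \<xi>0 powr (-1/4)"
          by (intro mult_right_mono mult_left_mono) auto
        also have "\<dots> = 2304 * (M1 * M2) powr (29/30) * (\<xi>0 powr (1/4) * \<xi>0 powr (-1/4))" by simp
        also have "\<xi>0 powr (1/4) * \<xi>0 powr (-1/4) = 1" using \<xi>0(1) by (simp add: powr_add[symmetric])
        also have "2304 * (M1 * M2) powr (29/30) * 1 \<le> 2304 * (M1 * M2 * M3) powr (29/30)"
          using M M12 mult_left_mono[of 1 M3 "M1 * M2"] by (simp add: powr_mono2)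
        finally show "1152 * (M1 * M2) * \<xi>0 powr (-1/4) \<le> 2304 * (M1 * M2 * M3) powr (29/30)" .
      qed
      finally show ?thesis by (simp add: mult_left_mono)
    next
      case False
      then have "(\<lambda>z. k z x * k z (- z - y)) = (\<lambda>_. 0)" by auto
      then show ?thesis by simp
    qed
  qed simp_all
  finally show ?thesis .
qed

section \<open>Assembling the frequency regions\<close>

lemma tri_add:
  assumes [measurable]: "case_prod k \<in> borel_measurable (lborel \<Otimes>\<^sub>M lborel)" "case_prod k' \<in> borel_measurable (lborel \<Otimes>\<^sub>M lborel)"
    "f \<in> borel_measurable borel" "g \<in> borel_measurable borel" "h \<in> borel_measurable borel"
  shows "tri (\<lambda>x y. k x y + k' x y) f g h = tri k f g h + tri k' f g h"
proof -
  have [measurable]: "k x \<in> borel_measurable borel" "k' x \<in> borel_measurable borel" for x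
    using measurable_compose[OF measurable_Pair1'[of x lborel lborel] assms(1)]
      measurable_compose[OF measurable_Pair1'[of x lborel lborel] assms(2)] by simp_all
  show ?thesis unfolding tri_def distrib_right
    by (simp add: nn_integral_add)
qed

lemma ennreal_square_add_le: "(a + b)\<^sup>2 \<le> 2 * a\<^sup>2 + 2 * (b::ennreal)\<^sup>2"
proof -
  have "(a + b)\<^sup>2 = a\<^sup>2 + b\<^sup>2 + 2 * a * b" by (rule power2_sum)
  also have "\<dots> \<le> a\<^sup>2 + b\<^sup>2 + (a\<^sup>2 + b\<^sup>2)" by (intro add_left_mono sum_of_squares_ge_ennreal)
  finally show ?thesis by (simp add: mult_2 ac_simps)
qed

lemma tri_split:
  fixes X :: ennreal and c1 c2 :: real
  assumes [measurable]: "case_prod k1 \<in> borel_measurable (lborel \<Otimes>\<^sub>M lborel)" "case_prod k2 \<in> borel_measurable (lborel \<Otimes>\<^sub>M lborel)"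
    "f \<in> borel_measurable borel" "g \<in> borel_measurable borel" "h \<in> borel_measurable borel"
    and le: "\<And>x y. k x y \<le> k1 x y + k2 x y"
    and b: "(tri k1 f g h)\<^sup>2 \<le> ennreal c1 * X" "(tri k2 f g h)\<^sup>2 \<le> ennreal c2 * X" and c: "c1 \<ge> 0" "c2 \<ge> 0"
  shows "(tri k f g h)\<^sup>2 \<le> ennreal (2 * c1 + 2 * c2) * X"
proof -
  have "tri k f g h \<le> tri (\<lambda>x y. k1 x y + k2 x y) f g h" by (intro tri_mono le)
  also have "\<dots> = tri k1 f g h + tri k2 f g h" by (rule tri_add) measurable
  finally have "(tri k f g h)\<^sup>2 \<le> (tri k1 f g h + tri k2 f g h)\<^sup>2" by (intro power_mono) auto
  also have "\<dots> \<le> 2 * (tri k1 f g h)\<^sup>2 + 2 * (tri k2 f g h)\<^sup>2" by (rule ennreal_square_add_le)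
  also have "\<dots> \<le> 2 * (ennreal c1 * X) + 2 * (ennreal c2 * X)" by (intro add_mono mult_left_mono b) auto
  also have "\<dots> = ennreal (2 * c1 + 2 * c2) * X"
    using c by (simp add: distrib_right ennreal_mult mult.assoc)
  finally show ?thesis .
qed

text \<open>Transport along a measure preserving map that respects the relation between the three
  arguments. It serves the two reflections by which the signs in the Loomis--Whitney region are
  normalised.\<close>

lemma tri_map:
  fixes T :: "'a::euclidean_space \<Rightarrow> 'a"
  assumes k[measurable]: "case_prod k \<in> borel_measurable (lborel \<Otimes>\<^sub>M lborel)"
    and [measurable]: "f \<in> borel_measurable borel" "g \<in> borel_measurable borel" "h \<in> borel_measurable borel"
    and T[measurable]: "T \<in> borel_measurable borel"
    and inv: "\<And>F. F \<in> borel_measurable borel \<Longrightarrow> (\<integral>\<^sup>+x. F (T x) \<partial>lborel) = (\<integral>\<^sup>+x. F x \<partial>lborel)"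
    and add: "\<And>x y. T (- x - y) = - T x - T y"
  shows "tri k f g h = tri (\<lambda>x y. k (T x) (T y)) (\<lambda>x. f (T x)) (\<lambda>x. g (T x)) (\<lambda>x. h (T x))"
proof -
  have km[measurable]: "k x \<in> borel_measurable borel" for x
    using measurable_compose[OF measurable_Pair1'[of x lborel lborel] k] by simp
  have "tri k f g h = (\<integral>\<^sup>+x. \<integral>\<^sup>+y. k (T x) y * (f (T x) * g y * h (- T x - y)) \<partial>lborel \<partial>lborel)"
    unfolding tri_def by (rule inv[symmetric]) measurable
  also have "\<dots> = (\<integral>\<^sup>+x. \<integral>\<^sup>+y. k (T x) (T y) * (f (T x) * g (T y) * h (- T x - T y)) \<partial>lborel \<partial>lborel)"
    by (intro nn_integral_cong inv[symmetric]) measurable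
  finally show ?thesis unfolding tri_def add .
qed

lemma AE_fst_neq: "AE y in (lborel :: R3 measure). fst y \<noteq> c"
proof -
  have "emeasure lborel {y :: R3. fst y = c} = (\<integral>\<^sup>+y. indicator {y :: R3. fst y = c} y \<partial>lborel)"
    by (subst nn_integral_indicator) auto
  also have "\<dots> = (\<integral>\<^sup>+x. \<integral>\<^sup>+y. \<integral>\<^sup>+t. indicator {y :: R3. fst y = c} (x, y, t) \<partial>lborel \<partial>lborel \<partial>lborel)"
    by (rule nn_integral_R3) measurable
  also have "\<dots> = (\<integral>\<^sup>+x. 0 \<partial>(lborel :: real measure))"
    using AE_lborel_singleton[of c] by (intro nn_integral_cong_AE) (auto elim!: eventually_mono)
  finally have "emeasure lborel {y :: R3. fst y = c} = 0" by simp
  then show ?thesis by (intro AE_I[of _ _ "{y. fst y = c}"]) auto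
qed

text \<open>Pairs for which one of the three frequencies vanishes form a null set. Off this set one
  of the frequencies can be chosen as the nonzero smallest one, and no weight involves a division by
  zero.\<close>

lemma tri_mono_AE:
  fixes f g h :: "R3 \<Rightarrow> ennreal"
  assumes "\<And>x y. fst x \<noteq> 0 \<Longrightarrow> fst y \<noteq> 0 \<Longrightarrow> fst x + fst y \<noteq> 0 \<Longrightarrow> k x y \<le> k' x y"
  shows "tri k f g h \<le> tri k' f g h"
  unfolding tri_def
proof (rule nn_integral_mono_AE)
  show "AE x in lborel. (\<integral>\<^sup>+y. k x y * (f x * g y * h (- x - y)) \<partial>lborel) \<le> (\<integral>\<^sup>+y. k' x y * (f x * g y * h (- x - y)) \<partial>lborel)"
    using AE_fst_neq[of 0]
  proof eventually_elim
    case (elim x)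
    have "AE y :: R3 in lborel. fst y \<noteq> 0 \<and> fst y \<noteq> - fst x" by (intro AE_conjI AE_fst_neq)
    then have "AE y in lborel. k x y * (f x * g y * h (- x - y)) \<le> k' x y * (f x * g y * h (- x - y))"
    proof eventually_elim
      fix y :: R3 assume y: "fst y \<noteq> 0 \<and> fst y \<noteq> - fst x"
      then have "fst x + fst y \<noteq> 0" by auto
      then show "k x y * (f x * g y * h (- x - y)) \<le> k' x y * (f x * g y * h (- x - y))"
        using assms[of x y] y elim by (intro mult_right_mono) auto
    qed
    then show ?case by (rule nn_integral_mono_AE)
  qed
qed

lemma R3_reflect_mu:
  fixes F :: "R3 \<Rightarrow> ennreal"
  assumes [measurable]: "F \<in> borel_measurable borel"
  shows "(\<integral>\<^sup>+x. F (fst x, - fst (snd x), snd (snd x)) \<partial>lborel) = (\<integral>\<^sup>+x. F x \<partial>lborel)"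
proof -
  have "(\<integral>\<^sup>+x. F (fst x, - fst (snd x), snd (snd x)) \<partial>lborel) = (\<integral>\<^sup>+x. \<integral>\<^sup>+y. \<integral>\<^sup>+t. F (x, - y, t) \<partial>lborel \<partial>lborel \<partial>lborel)"
    by (subst nn_integral_R3) auto
  also have "\<dots> = (\<integral>\<^sup>+x. \<integral>\<^sup>+y. \<integral>\<^sup>+t. F (x, y, t) \<partial>lborel \<partial>lborel \<partial>lborel)"
    by (intro nn_integral_cong nn_integral_lborel_reflect[where c = "0::real", simplified]) measurable
  also have "\<dots> = (\<integral>\<^sup>+x. F x \<partial>lborel)" by (rule nn_integral_R3[symmetric]) simp
  finally show ?thesis .
qed

lemma adm_swap: "adm (- x - y) y \<longleftrightarrow> adm x y"
  by (auto simp: adm_def abs_if)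

text \<open>The kernel is dominated by nine pieces: low frequencies (\<open>ka\<close>); the
  modulation of the first, third or second function above the threshold (\<open>kb\<close>,
  \<open>kc\<close>, \<open>kd\<close>); all three below it (\<open>ke\<close>). \<open>kd\<close>
  is split by the sign of \<open>fst x\<close>, as \<open>region_Q\<close> requires.
  \<open>ke\<close> is split by this sign and by the order of the two slopes, and reflections carry
  its four pieces to the one treated in \<open>region_LW\<close>. Every splitting doubles the
  constants of the squared forms.\<close>

lemma tri_adm:
  fixes \<alpha> :: real
  shows "\<exists>C>0. \<forall>f g h M1 M2 M3. f \<in> borel_measurable borel \<longrightarrow> g \<in> borel_measurable borel \<longrightarrow> h \<in> borel_measurable borel \<longrightarrow>
    M1 \<ge> 1 \<longrightarrow> M2 \<ge> 1 \<longrightarrow> M3 \<ge> 1 \<longrightarrow> (\<forall>x. x \<notin> slab \<alpha> M1 \<longrightarrow> f x = 0) \<longrightarrow> (\<forall>x. x \<notin> slab \<alpha> M2 \<longrightarrow> g x = 0) \<longrightarrow>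
    (\<forall>x. x \<notin> slab \<alpha> M3 \<longrightarrow> h x = 0) \<longrightarrow>
    (tri (\<lambda>x y. if adm x y then ennreal \<bar>fst x\<bar> else 0) f g h)\<^sup>2
      \<le> ennreal (C * (M1 * M2 * M3) powr (29/30)) * (sqint f * sqint g * sqint h)"
proof -
  \<comment> \<open>Up to \<open>C0\<close> the frequencies are bounded and crude estimates suffice;
    beyond it the largeness assumption of \<open>lw_point\<close> holds.\<close>
  define C0 where "C0 = 504 + 12 * \<bar>\<alpha>\<bar>"
  have C0: "C0 \<ge> 504" by (simp add: C0_def)
  define CP where "CP = 26 * C0 ^ 4"
  have CP: "CP \<ge> 26" using C0 one_le_power[of C0 4] by (simp add: CP_def)
  define C where "C = 2000 * CP + 2000000"
  have CC: "C > 0" using CP by (simp add: C_def)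
  show ?thesis
  proof (intro exI[of _ C] conjI allI impI)
    fix f g h :: "R3 \<Rightarrow> ennreal" and M1 M2 M3 :: real
    assume f[measurable]: "f \<in> borel_measurable borel" and g[measurable]: "g \<in> borel_measurable borel" and h[measurable]: "h \<in> borel_measurable borel"
      and M: "M1 \<ge> 1" "M2 \<ge> 1" "M3 \<ge> 1"
      and "\<forall>x. x \<notin> slab \<alpha> M1 \<longrightarrow> f x = 0" "\<forall>x. x \<notin> slab \<alpha> M2 \<longrightarrow> g x = 0" "\<forall>x. x \<notin> slab \<alpha> M3 \<longrightarrow> h x = 0"
    then have sf: "\<And>x. x \<notin> slab \<alpha> M1 \<Longrightarrow> f x = 0" and sg: "\<And>x. x \<notin> slab \<alpha> M2 \<Longrightarrow> g x = 0" and sh: "\<And>x. x \<notin> slab \<alpha> M3 \<Longrightarrow> h x = 0" by auto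
    define Y where "Y = (M1 * M2 * M3) powr (29/30)"
    define X where "X = sqint f * sqint g * sqint h"
    have Y0: "Y \<ge> 0" by (simp add: Y_def)
    have M23: "(M2 * M3) powr (3/4) \<le> (M2 * M3) powr (29/30)" "(M2 * M3) powr (29/30) \<le> Y"
      "(M2 * M1) powr (3/4) \<le> (M2 * M1) powr (29/30)"
    proof -
      have a: "M2 * M3 \<ge> 1" "M2 * M1 \<ge> 1" using M mult_mono[of 1 M2 1] by auto
      then show "(M2 * M3) powr (3/4) \<le> (M2 * M3) powr (29/30)" "(M2 * M1) powr (3/4) \<le> (M2 * M1) powr (29/30)" by (auto intro!: powr_mono)
      have "1 * (M2 * M3) \<le> M1 * (M2 * M3)" using a M by (intro mult_right_mono) auto
      then show "(M2 * M3) powr (29/30) \<le> Y" using a unfolding Y_def by (intro powr_mono2) (auto simp: mult.assoc)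
    qed
    define ka where "ka x y = (if adm x y \<and> \<bar>fst x\<bar> \<le> C0 then ennreal \<bar>fst x\<bar> else 0)" for x y :: R3
    have ka: "(tri ka f g h)\<^sup>2 \<le> ennreal (CP * Y) * X"
    proof -
      have "(tri ka f g h)\<^sup>2 \<le> ennreal (CP * Y) * sqint f * sqint g * sqint h"
        unfolding ka_def
      proof (rule region_P[where ?M2.0 = M2 and ?M3.0 = M3 and \<alpha> = \<alpha> and L = "\<lambda>N. if N \<le> C0 then C0 else -1"])
        fix N :: real assume N: "N \<ge> 0" "(if N \<le> C0 then C0 else - 1) \<ge> 0"
        then have NC: "N \<le> C0" by (auto split: if_splits)
        have "26 * (M2 * M3) powr (3/4) * sqrt N * N\<^sup>2 * min N (if N \<le> C0 then C0 else - 1)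
          \<le> 26 * Y * C0 * C0\<^sup>2 * C0"
        proof (intro mult_mono)
          show "sqrt N \<le> C0" using NC N C0 by (intro real_le_lsqrt) (auto simp: power2_eq_square intro: order_trans[of N "C0 * 1"] mult_mono)
        qed (use M23 N NC C0 Y0 in \<open>auto intro: power_mono\<close>)
        also have "\<dots> = CP * Y" by (simp add: CP_def power2_eq_square power4_eq_xxxx)
        finally show "26 * (M2 * M3) powr (3/4) * sqrt N * N\<^sup>2 * min N (if N \<le> C0 then C0 else - 1) \<le> CP * Y" .
      qed (use M sg sh in \<open>auto simp: adm_def case_prod_beta'\<close>)
      then show ?thesis by (simp add: X_def mult.assoc)
    qed
    \<comment> \<open>1/2 + 2 + 1/30 - (11/4) (29/30) = -1/8, so the power of \<open>N\<close> is
      harmless for \<open>N \<ge> 1\<close>. Here \<open>m1\<close> is the modulation above the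
      threshold.\<close>
    have PB: "26 * (M2 * m3) powr (3/4) * sqrt N * N\<^sup>2 * min N (if N \<ge> 1 then m1 / N powr (11/4) else - 1) \<le> 26 * (M2 * m3 * m1) powr (29/30)"
      if N: "N \<ge> 0" "(if N \<ge> 1 then m1 / N powr (11/4) else - 1) \<ge> 0" and m: "m3 \<ge> 1" "m1 \<ge> 1" and mm: "(M2 * m3) powr (3/4) \<le> (M2 * m3) powr (29/30)" for N m1 m3
    proof -
      have N1: "N \<ge> 1" using N by (auto split: if_splits)
      have "min N (m1 / N powr (11/4)) \<le> N powr (1 - 29/30) * (m1 / N powr (11/4)) powr (29/30)"
        using N1 m by (intro min_le_powr) auto
      also have "(m1 / N powr (11/4)) powr (29/30) = m1 powr (29/30) / N powr (319/120)"
        using N1 m by (simp add: powr_divide powr_powr)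
      also have "\<dots> = m1 powr (29/30) * N powr (- (319/120))" by (simp only: powr_minus_divide) simp
      also have "N powr (1 - 29/30) * (m1 powr (29/30) * N powr (- (319/120))) = m1 powr (29/30) * (N powr (1 - 29/30) * N powr (- (319/120)))"
        by (simp only: mult_ac)
      also have "N powr (1 - 29/30) * N powr (- (319/120)) = N powr (-21/8)"
        by (simp only: powr_add[symmetric]) simp
      finally have mn: "min N (m1 / N powr (11/4)) \<le> m1 powr (29/30) * N powr (-21/8)" .
      have "sqrt N * N\<^sup>2 * min N (m1 / N powr (11/4)) \<le> sqrt N * N\<^sup>2 * (m1 powr (29/30) * N powr (-21/8))"
        using N1 by (intro mult_left_mono mn) auto
      also have "sqrt N = N powr (1/2)" using N1 by (simp add: powr_half_sqrt)
      also have "N\<^sup>2 = N powr 2" using N1 by simp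
      also have "N powr (1/2) * N powr 2 * (m1 powr (29/30) * N powr (-21/8)) = m1 powr (29/30) * (N powr (1/2) * N powr 2 * N powr (-21/8))"
        by simp
      also have "N powr (1/2) * N powr 2 * N powr (-21/8) = N powr (-1/8)" by (simp only: powr_add[symmetric]) simp
      also have "m1 powr (29/30) * N powr (-1/8) \<le> m1 powr (29/30) * 1"
        using powr_mono[of "-1/8" 0 N] N1 by (intro mult_left_mono) auto
      finally have 1: "sqrt N * N\<^sup>2 * min N (m1 / N powr (11/4)) \<le> m1 powr (29/30)"
        using N1 by (simp add: powr_half_sqrt)
      have "26 * (M2 * m3) powr (3/4) * (sqrt N * N\<^sup>2 * min N (m1 / N powr (11/4))) \<le> 26 * (M2 * m3) powr (29/30) * m1 powr (29/30)"
        using 1 mm m N1 by (intro mult_mono) auto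
      also have "\<dots> = 26 * (M2 * m3 * m1) powr (29/30)" using M m by (simp add: powr_mult)
      finally show ?thesis using N1 by (simp add: mult.assoc)
    qed
    define kb where "kb m x y = (if adm x y \<and> \<bar>fst x\<bar> \<ge> 1 \<and> \<bar>fst x\<bar> powr (11/4) * \<bar>fst y\<bar> \<le> m then ennreal \<bar>fst x\<bar> else 0)" for m and x y :: R3
    have kbm[measurable]: "case_prod (kb m) \<in> borel_measurable (lborel \<Otimes>\<^sub>M lborel)" for m
      unfolding kb_def case_prod_beta' by measurable
    have kb: "(tri (kb M1) f g h)\<^sup>2 \<le> ennreal (26 * Y) * X"
    proof -
      have "(tri (kb M1) f g h)\<^sup>2 \<le> ennreal (26 * (M2 * M3 * M1) powr (29/30)) * sqint f * sqint g * sqint h"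
        unfolding kb_def
      proof (rule region_P[where ?M2.0 = M2 and ?M3.0 = M3 and \<alpha> = \<alpha> and L = "\<lambda>N. if N \<ge> 1 then M1 / N powr (11/4) else -1"])
        show "adm x y \<and> \<bar>fst y\<bar> \<le> (if 1 \<le> \<bar>fst x\<bar> then M1 / \<bar>fst x\<bar> powr (11 / 4) else - 1)"
          if "adm x y \<and> 1 \<le> \<bar>fst x\<bar> \<and> \<bar>fst x\<bar> powr (11 / 4) * \<bar>fst y\<bar> \<le> M1" for x y :: R3
          using that by (auto simp: field_simps)
      qed (use M sg sh PB M23(1) in \<open>auto simp: case_prod_beta'\<close>)
      then show ?thesis by (simp add: X_def Y_def mult_ac)
    qed
    have kb': "(tri (kb M3) h g f)\<^sup>2 \<le> ennreal (26 * Y) * X"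
    proof -
      have "(tri (kb M3) h g f)\<^sup>2 \<le> ennreal (26 * (M2 * M1 * M3) powr (29/30)) * sqint h * sqint g * sqint f"
        unfolding kb_def
      proof (rule region_P[where ?M2.0 = M2 and ?M3.0 = M1 and \<alpha> = \<alpha> and L = "\<lambda>N. if N \<ge> 1 then M3 / N powr (11/4) else -1"])
        show "adm x y \<and> \<bar>fst y\<bar> \<le> (if 1 \<le> \<bar>fst x\<bar> then M3 / \<bar>fst x\<bar> powr (11 / 4) else - 1)"
          if "adm x y \<and> 1 \<le> \<bar>fst x\<bar> \<and> \<bar>fst x\<bar> powr (11 / 4) * \<bar>fst y\<bar> \<le> M3" for x y :: R3
          using that by (auto simp: field_simps)
      qed (use M sg sf PB M23(3) in \<open>auto simp: case_prod_beta'\<close>)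
      then show ?thesis by (simp add: X_def Y_def mult_ac)
    qed
    define kc where "kc x y = (if adm x y \<and> \<bar>fst x\<bar> \<ge> 2 \<and> \<bar>fst x + fst y\<bar> powr (11/4) * \<bar>fst y\<bar> \<le> M3 then ennreal \<bar>fst x\<bar> else 0)" for x y :: R3
    have kcm[measurable]: "case_prod kc \<in> borel_measurable (lborel \<Otimes>\<^sub>M lborel)"
      unfolding kc_def case_prod_beta' by measurable
    have kcm'[measurable]: "case_prod (\<lambda>x y. kc y x) \<in> borel_measurable (lborel \<Otimes>\<^sub>M lborel)" "case_prod (\<lambda>x y. kc (- x - y) x) \<in> borel_measurable (lborel \<Otimes>\<^sub>M lborel)"
      unfolding kc_def case_prod_beta' by measurable
    have kc: "(tri kc f g h)\<^sup>2 \<le> ennreal (104 * Y) * X"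
    proof -
      have "tri kc f g h = tri (\<lambda>x y. kc y x) g f h" by (rule tri_swap) measurable
      also have "\<dots> = tri (\<lambda>x y. kc (- x - y) x) g h f" by (rule tri_rot) measurable
      also have "\<dots> = tri (\<lambda>x y. kc (- y - x) y) h g f" by (rule tri_swap) measurable
      \<comment> \<open>After the first and third functions have been exchanged, the kernel is the
        size of the third frequency, which is at most twice the first. The two copies of
        \<open>kb M3\<close> account for this factor.\<close>
      also have "\<dots> \<le> tri (\<lambda>x y. kb M3 x y + kb M3 x y) h g f"
      proof (rule tri_mono)
        fix x y :: R3
        show "kc (- y - x) y \<le> kb M3 x y + kb M3 x y"
        proof (cases "kc (- y - x) y = 0")
          case False
          then have a: "adm (- x - y) y" "\<bar>fst (- y - x)\<bar> \<ge> 2" "\<bar>fst (- y - x) + fst y\<bar> powr (11/4) * \<bar>fst y\<bar> \<le> M3"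
            by (auto simp: kc_def minus_diff_commute split: if_splits)
          then have adm: "adm x y" by (simp add: adm_swap)
          have le: "\<bar>- fst y - fst x\<bar> \<le> \<bar>fst x\<bar> + \<bar>fst x\<bar>" using adm by (auto simp: adm_def)
          then have "kb M3 x y = ennreal \<bar>fst x\<bar>" using a adm by (auto simp: kb_def)
          moreover have "kc (- y - x) y = ennreal \<bar>- fst y - fst x\<bar>" using False by (auto simp: kc_def split: if_splits)
          ultimately show ?thesis using le by (simp add: ennreal_plus[symmetric] ennreal_leI del: ennreal_plus)
        qed simp
      qed
      finally have "(tri kc f g h)\<^sup>2 \<le> (tri (\<lambda>x y. kb M3 x y + kb M3 x y) h g f)\<^sup>2" by (intro power_mono) auto
      also have "\<dots> \<le> ennreal (2 * (26 * Y) + 2 * (26 * Y)) * X"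
        by (rule tri_split[OF kbm kbm h g f order_refl kb' kb']) (use Y0 in auto)
      finally show ?thesis by simp
    qed
    define kd where "kd \<sigma> x y = (if adm x y \<and> \<sigma> * fst x > 0 \<and> \<bar>fst x\<bar> \<ge> 2 \<and> \<bar>fst x\<bar> powr (11/4) * \<bar>fst y\<bar> \<le> M2 then ennreal \<bar>fst x\<bar> else 0)" for \<sigma> and x y :: R3
    have kdm[measurable]: "case_prod (kd \<sigma>) \<in> borel_measurable (lborel \<Otimes>\<^sub>M lborel)" for \<sigma>
      unfolding kd_def case_prod_beta' by measurable
    have kd: "(tri (kd \<sigma>) f g h)\<^sup>2 \<le> ennreal (162 * Y) * X" for \<sigma>
    proof -
      have "(tri (kd \<sigma>) f g h)\<^sup>2 \<le> ennreal (162 * (M1 * M2 * M3) powr (29/30)) * sqint f * sqint g * sqint h"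
        unfolding kd_def by (rule region_Q[where \<alpha> = \<alpha> and \<sigma> = \<sigma>]) (use M sf sh in \<open>auto simp: case_prod_beta'\<close>)
      then show ?thesis by (simp add: X_def Y_def mult_ac)
    qed
    define ke where "ke \<sigma> \<rho> x y = (if adm x y \<and> \<sigma> * fst x \<ge> C0 \<and> \<rho> * (fst (snd x) / fst x) \<ge> \<rho> * (fst (snd y) / fst y) \<and>
      M1 \<le> \<bar>fst x\<bar> powr (11/4) * \<bar>fst y\<bar> \<and> M2 \<le> \<bar>fst x\<bar> powr (11/4) * \<bar>fst y\<bar> \<and> M3 \<le> \<bar>fst x + fst y\<bar> powr (11/4) * \<bar>fst y\<bar> then ennreal \<bar>fst x\<bar> else 0)" for \<sigma> \<rho> :: real and x y :: R3
    have kem[measurable]: "case_prod (ke \<sigma> \<rho>) \<in> borel_measurable (lborel \<Otimes>\<^sub>M lborel)" for \<sigma> \<rho>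
      unfolding ke_def case_prod_beta' by measurable
    have ke11: "(tri (ke 1 1) f g h)\<^sup>2 \<le> ennreal (2304 * Y) * (sqint f * sqint g * sqint h)"
      if [measurable]: "f \<in> borel_measurable borel" "g \<in> borel_measurable borel" "h \<in> borel_measurable borel"
        and "\<And>x. x \<notin> slab \<alpha> M1 \<Longrightarrow> f x = 0" "\<And>x. x \<notin> slab \<alpha> M2 \<Longrightarrow> g x = 0" "\<And>x. x \<notin> slab \<alpha> M3 \<Longrightarrow> h x = 0" for f g h
    proof -
      have "(tri (ke 1 1) f g h)\<^sup>2 \<le> ennreal (2304 * (M1 * M2 * M3) powr (29/30)) * sqint f * sqint g * sqint h"
        unfolding ke_def
      proof (rule region_LW[where \<alpha> = \<alpha>], goal_cases)
        case (11 x y)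
        then have "fst x \<ge> 504 + 12 * \<bar>\<alpha>\<bar>" "\<bar>fst x\<bar> = fst x" using C0 by (auto simp: C0_def)
        then show ?case using 11 by simp
      qed (use M that in \<open>auto simp: case_prod_beta'\<close>)
      then show ?thesis by (simp add: Y_def mult_ac)
    qed
    \<comment> \<open>A bound for the kernel \<open>k\<close> passes to its image \<open>k'\<close>
      under a map \<open>T\<close> that preserves the measure and all slabs.\<close>
    have rfl: "(tri k' f g h)\<^sup>2 \<le> ennreal (2304 * Y) * (sqint f * sqint g * sqint h)"
      if T[measurable]: "T \<in> borel_measurable borel"
        and inv: "\<And>F. F \<in> borel_measurable borel \<Longrightarrow> (\<integral>\<^sup>+x. F (T x) \<partial>lborel) = (\<integral>\<^sup>+x. F x \<partial>lborel)"
        and add: "\<And>x y. T (- x - y) = - T x - T y"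
        and sl: "\<And>x M. T x \<in> slab \<alpha> M \<longleftrightarrow> x \<in> slab \<alpha> M"
        and km[measurable]: "case_prod k' \<in> borel_measurable (lborel \<Otimes>\<^sub>M lborel)"
        and ke: "\<And>x y. k' (T x) (T y) = k x y"
        and b: "\<And>f g h. f \<in> borel_measurable borel \<Longrightarrow> g \<in> borel_measurable borel \<Longrightarrow> h \<in> borel_measurable borel \<Longrightarrow>
          (\<And>x. x \<notin> slab \<alpha> M1 \<Longrightarrow> f x = 0) \<Longrightarrow> (\<And>x. x \<notin> slab \<alpha> M2 \<Longrightarrow> g x = 0) \<Longrightarrow> (\<And>x. x \<notin> slab \<alpha> M3 \<Longrightarrow> h x = 0) \<Longrightarrow>
          (tri k f g h)\<^sup>2 \<le> ennreal (2304 * Y) * (sqint f * sqint g * sqint h)"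
        and fgh[measurable]: "f \<in> borel_measurable borel" "g \<in> borel_measurable borel" "h \<in> borel_measurable borel"
        and s: "\<And>x. x \<notin> slab \<alpha> M1 \<Longrightarrow> f x = 0" "\<And>x. x \<notin> slab \<alpha> M2 \<Longrightarrow> g x = 0" "\<And>x. x \<notin> slab \<alpha> M3 \<Longrightarrow> h x = 0"
      for T :: "R3 \<Rightarrow> R3" and k k' f g h
    proof -
      have "tri k' f g h = tri k (\<lambda>x. f (T x)) (\<lambda>x. g (T x)) (\<lambda>x. h (T x))"
        using tri_map[OF km fgh T inv add] by (simp add: ke)
      also have "(tri k (\<lambda>x. f (T x)) (\<lambda>x. g (T x)) (\<lambda>x. h (T x)))\<^sup>2
        \<le> ennreal (2304 * Y) * (sqint (\<lambda>x. f (T x)) * sqint (\<lambda>x. g (T x)) * sqint (\<lambda>x. h (T x)))"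
        by (rule b) (auto simp: s sl)
      also have "\<dots> = ennreal (2304 * Y) * (sqint f * sqint g * sqint h)"
        using inv[of "\<lambda>x. (f x)\<^sup>2"] inv[of "\<lambda>x. (g x)\<^sup>2"] inv[of "\<lambda>x. (h x)\<^sup>2"] by simp
      finally show ?thesis .
    qed
    \<comment> \<open>Reflecting \<mu> leaves \<open>\<omega>\<close> unchanged and reverses the
      order of the two slopes.\<close>
    have ke12: "(tri (ke 1 (-1)) f g h)\<^sup>2 \<le> ennreal (2304 * Y) * (sqint f * sqint g * sqint h)"
      if m: "f \<in> borel_measurable borel" "g \<in> borel_measurable borel" "h \<in> borel_measurable borel"
        and s: "\<And>x. x \<notin> slab \<alpha> M1 \<Longrightarrow> f x = 0" "\<And>x. x \<notin> slab \<alpha> M2 \<Longrightarrow> g x = 0" "\<And>x. x \<notin> slab \<alpha> M3 \<Longrightarrow> h x = 0" for f g h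
    proof (rule rfl[where k = "ke 1 1" and T = "\<lambda>x. (fst x, - fst (snd x), snd (snd x))"])
      show "ke 1 (- 1) (fst x, - fst (snd x), snd (snd x)) (fst y, - fst (snd y), snd (snd y)) = ke 1 1 x y" for x y
        by (simp add: ke_def adm_def)
      show "((fst x, - fst (snd x), snd (snd x)) \<in> slab \<alpha> M) = (x \<in> slab \<alpha> M)" for x M
        by (simp add: slab_def \<omega>_def)
    qed (use R3_reflect_mu ke11 m s in auto)
    \<comment> \<open>Reflection in the origin preserves the slabs because \<open>\<omega>\<close>
      is odd. It changes the sign of the frequencies but not the slopes.\<close>
    have ke2: "(tri (ke (-1) \<rho>) f g h)\<^sup>2 \<le> ennreal (2304 * Y) * (sqint f * sqint g * sqint h)"
      if b: "\<And>f g h. f \<in> borel_measurable borel \<Longrightarrow> g \<in> borel_measurable borel \<Longrightarrow> h \<in> borel_measurable borel \<Longrightarrow>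
          (\<And>x. x \<notin> slab \<alpha> M1 \<Longrightarrow> f x = 0) \<Longrightarrow> (\<And>x. x \<notin> slab \<alpha> M2 \<Longrightarrow> g x = 0) \<Longrightarrow> (\<And>x. x \<notin> slab \<alpha> M3 \<Longrightarrow> h x = 0) \<Longrightarrow>
          (tri (ke 1 \<rho>) f g h)\<^sup>2 \<le> ennreal (2304 * Y) * (sqint f * sqint g * sqint h)"
      for \<rho>
    proof (rule rfl[where k = "ke 1 \<rho>" and T = uminus])
      show "ke (- 1) \<rho> (- x) (- y) = ke 1 \<rho> x y" for x y
      proof -
        have "\<bar>- fst x - fst y\<bar> = \<bar>fst x + fst y\<bar>" by arith
        then show ?thesis by (simp add: ke_def adm_def)
      qed
      show "(- x \<in> slab \<alpha> M) = (x \<in> slab \<alpha> M)" for x :: R3 and M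
        by (auto simp: slab_def \<omega>_odd abs_le_iff)
      show "(\<integral>\<^sup>+x. F (- x) \<partial>lborel) = (\<integral>\<^sup>+x. F x \<partial>lborel)" if "F \<in> borel_measurable borel" for F :: "R3 \<Rightarrow> ennreal"
        using nn_integral_lborel_reflect[OF that, of 0] by simp
    qed (use b f g h sf sg sh in auto)
    note e = ke11[OF f g h sf sg sh] ke12[OF f g h sf sg sh] ke2[OF ke11] ke2[OF ke12]
    note e = e[folded X_def]
    have kam: "case_prod ka \<in> borel_measurable (lborel \<Otimes>\<^sub>M lborel)"
      unfolding ka_def case_prod_beta' by measurable
    have s1: "(tri (\<lambda>x y. ke 1 1 x y + ke 1 (-1) x y) f g h)\<^sup>2 \<le> ennreal (2 * (2304 * Y) + 2 * (2304 * Y)) * X"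
      by (rule tri_split[OF kem kem f g h order_refl e(1,2)]) (use Y0 in auto)
    have s2: "(tri (\<lambda>x y. ke (-1) 1 x y + ke (-1) (-1) x y) f g h)\<^sup>2 \<le> ennreal (2 * (2304 * Y) + 2 * (2304 * Y)) * X"
      by (rule tri_split[OF kem kem f g h order_refl e(3,4)]) (use Y0 in auto)
    have s3: "(tri (\<lambda>x y. kd 1 x y + kd (-1) x y) f g h)\<^sup>2 \<le> ennreal (2 * (162 * Y) + 2 * (162 * Y)) * X"
      by (rule tri_split[OF kdm kdm f g h order_refl kd kd]) (use Y0 in auto)
    have s4: "(tri (\<lambda>x y. kb M1 x y + kc x y) f g h)\<^sup>2 \<le> ennreal (2 * (26 * Y) + 2 * (104 * Y)) * X"
      by (rule tri_split[OF kbm kcm f g h order_refl kb kc]) (use Y0 in auto)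
    have s5: "(tri (\<lambda>x y. (ke 1 1 x y + ke 1 (-1) x y) + (ke (-1) 1 x y + ke (-1) (-1) x y)) f g h)\<^sup>2
      \<le> ennreal (2 * (2 * (2304 * Y) + 2 * (2304 * Y)) + 2 * (2 * (2304 * Y) + 2 * (2304 * Y))) * X"
      by (rule tri_split[OF _ _ f g h order_refl s1 s2]) (use Y0 in auto)
    have s6: "(tri (\<lambda>x y. (kd 1 x y + kd (-1) x y) + (kb M1 x y + kc x y)) f g h)\<^sup>2
      \<le> ennreal (2 * (2 * (162 * Y) + 2 * (162 * Y)) + 2 * (2 * (26 * Y) + 2 * (104 * Y))) * X"
      by (rule tri_split[OF _ _ f g h order_refl s3 s4]) (use Y0 in auto)
    have s7: "(tri (\<lambda>x y. ((ke 1 1 x y + ke 1 (-1) x y) + (ke (-1) 1 x y + ke (-1) (-1) x y)) + ((kd 1 x y + kd (-1) x y) + (kb M1 x y + kc x y))) f g h)\<^sup>2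
      \<le> ennreal (2 * (2 * (2 * (2304 * Y) + 2 * (2304 * Y)) + 2 * (2 * (2304 * Y) + 2 * (2304 * Y))) + 2 * (2 * (2 * (162 * Y) + 2 * (162 * Y)) + 2 * (2 * (26 * Y) + 2 * (104 * Y)))) * X"
      by (rule tri_split[OF _ _ f g h order_refl s5 s6]) (use Y0 in auto)
    have "(tri (\<lambda>x y. if adm x y then ennreal \<bar>fst x\<bar> else 0) f g h)\<^sup>2
      \<le> ennreal (2 * (CP * Y) + 2 * (2 * (2 * (2 * (2304 * Y) + 2 * (2304 * Y)) + 2 * (2 * (2304 * Y) + 2 * (2304 * Y))) + 2 * (2 * (2 * (162 * Y) + 2 * (162 * Y)) + 2 * (2 * (26 * Y) + 2 * (104 * Y))))) * X"
    proof (rule tri_split[OF kam _ f g h _ ka s7])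
      fix x y :: R3
      define K where "K = (ke 1 1 x y + ke 1 (-1) x y) + (ke (-1) 1 x y + ke (-1) (-1) x y) + ((kd 1 x y + kd (-1) x y) + (kb M1 x y + kc x y))"
      have "ennreal \<bar>fst x\<bar> \<le> ka x y + K" if a: "adm x y"
      proof (cases "\<bar>fst x\<bar> \<le> C0")
        case True
        then have "ka x y = ennreal \<bar>fst x\<bar>" using a by (simp add: ka_def)
        then show ?thesis by simp
      next
        case False
        have le: "ennreal \<bar>fst x\<bar> \<le> K" if "ennreal \<bar>fst x\<bar> \<in> {ke 1 1 x y, ke 1 (-1) x y, ke (-1) 1 x y, ke (-1) (-1) x y, kd 1 x y, kd (-1) x y, kb M1 x y, kc x y}"
        proof -
          have "ke 1 1 x y \<le> K" "ke 1 (-1) x y \<le> K" "ke (-1) 1 x y \<le> K" "ke (-1) (-1) x y \<le> K" "kd 1 x y \<le> K" "kd (-1) x y \<le> K" "kb M1 x y \<le> K" "kc x y \<le> K"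
            unfolding K_def by (auto intro: add_increasing add_increasing2)
          then show ?thesis using that by auto
        qed
        have sgn: "fst x > C0 \<or> - fst x > C0" using False by auto
        have "ennreal \<bar>fst x\<bar> \<in> {ke 1 1 x y, ke 1 (-1) x y, ke (-1) 1 x y, ke (-1) (-1) x y, kd 1 x y, kd (-1) x y, kb M1 x y, kc x y}"
        proof (cases "\<bar>fst x\<bar> powr (11/4) * \<bar>fst y\<bar> \<le> M1")
          case True
          then have "kb M1 x y = ennreal \<bar>fst x\<bar>" using a False C0 by (simp add: kb_def)
          then show ?thesis by simp
        next
          case M1: False
          show ?thesis
          proof (cases "\<bar>fst x + fst y\<bar> powr (11/4) * \<bar>fst y\<bar> \<le> M3")
            case True
            then have "kc x y = ennreal \<bar>fst x\<bar>" using a False C0 by (simp add: kc_def)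
            then show ?thesis by simp
          next
            case M3: False
            show ?thesis
            proof (cases "\<bar>fst x\<bar> powr (11/4) * \<bar>fst y\<bar> \<le> M2")
              case True
              then have "kd 1 x y = ennreal \<bar>fst x\<bar> \<or> kd (-1) x y = ennreal \<bar>fst x\<bar>" using sgn a False C0 by (auto simp: kd_def)
              then show ?thesis by auto
            next
              case M2: False
              have "fst (snd x) / fst x \<ge> fst (snd y) / fst y \<or> - (fst (snd x) / fst x) \<ge> - (fst (snd y) / fst y)" by auto
              then have "ke 1 1 x y = ennreal \<bar>fst x\<bar> \<or> ke 1 (-1) x y = ennreal \<bar>fst x\<bar> \<or> ke (-1) 1 x y = ennreal \<bar>fst x\<bar> \<or> ke (-1) (-1) x y = ennreal \<bar>fst x\<bar>"
                using sgn a M1 M2 M3 by (auto simp: ke_def)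
              then show ?thesis by (elim disjE) auto
            qed
          qed
        qed
        from le[OF this] show ?thesis by (simp add: add_increasing)
      qed
      then show "(if adm x y then ennreal \<bar>fst x\<bar> else 0) \<le> ka x y + ((ke 1 1 x y + ke 1 (-1) x y) + (ke (-1) 1 x y + ke (-1) (-1) x y) + ((kd 1 x y + kd (-1) x y) + (kb M1 x y + kc x y)))"
        unfolding K_def by auto
    qed (use Y0 CP in auto)
    also have "\<dots> \<le> ennreal (C * Y) * X"
    proof (intro mult_right_mono ennreal_leI)
      have "0 \<le> CP * Y" using CP Y0 by auto
      then show "2 * (CP * Y) + 2 * (2 * (2 * (2 * (2304 * Y) + 2 * (2304 * Y)) + 2 * (2 * (2304 * Y) + 2 * (2304 * Y))) + 2 * (2 * (2 * (162 * Y) + 2 * (162 * Y)) + 2 * (2 * (26 * Y) + 2 * (104 * Y)))) \<le> C * Y"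
        using Y0 by (simp add: C_def distrib_right)
    qed simp
    finally show "(tri (\<lambda>x y. if adm x y then ennreal \<bar>fst x\<bar> else 0) f g h)\<^sup>2
      \<le> ennreal (C * (M1 * M2 * M3) powr (29/30)) * (sqint f * sqint g * sqint h)"
      by (simp add: X_def Y_def)
  qed (rule CC)
qed

text \<open>Almost everywhere one of the three frequencies is smallest. If it is the first or the
  second, \<open>adm\<close> holds directly or with exchanged arguments. If it is the third, the
  larger of the other two is at most twice \<open>\<bar>fst x\<bar>\<close>, which costs two copies
  of the kernel.\<close>

lemma tri_max:
  fixes \<alpha> :: real
  shows "\<exists>C>0. \<forall>f g h M1 M2 M3. f \<in> borel_measurable borel \<longrightarrow> g \<in> borel_measurable borel \<longrightarrow> h \<in> borel_measurable borel \<longrightarrow>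
    M1 \<ge> 1 \<longrightarrow> M2 \<ge> 1 \<longrightarrow> M3 \<ge> 1 \<longrightarrow> (\<forall>x. x \<notin> slab \<alpha> M1 \<longrightarrow> f x = 0) \<longrightarrow> (\<forall>x. x \<notin> slab \<alpha> M2 \<longrightarrow> g x = 0) \<longrightarrow>
    (\<forall>x. x \<notin> slab \<alpha> M3 \<longrightarrow> h x = 0) \<longrightarrow>
    (tri (\<lambda>x y. ennreal (max \<bar>fst x\<bar> \<bar>fst y\<bar>)) f g h)\<^sup>2
      \<le> ennreal (C * (M1 * M2 * M3) powr (29/30)) * (sqint f * sqint g * sqint h)"
proof -
  obtain C where C: "C > 0" and K: "\<And>f g h M1 M2 M3. f \<in> borel_measurable borel \<Longrightarrow> g \<in> borel_measurable borel \<Longrightarrow> h \<in> borel_measurable borel \<Longrightarrow>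
    M1 \<ge> 1 \<Longrightarrow> M2 \<ge> 1 \<Longrightarrow> M3 \<ge> 1 \<Longrightarrow> (\<forall>x. x \<notin> slab \<alpha> M1 \<longrightarrow> f x = 0) \<Longrightarrow> (\<forall>x. x \<notin> slab \<alpha> M2 \<longrightarrow> g x = 0) \<Longrightarrow>
    (\<forall>x. x \<notin> slab \<alpha> M3 \<longrightarrow> h x = 0) \<Longrightarrow>
    (tri (\<lambda>x y. if adm x y then ennreal \<bar>fst x\<bar> else 0) f g h)\<^sup>2
      \<le> ennreal (C * (M1 * M2 * M3) powr (29/30)) * (sqint f * sqint g * sqint h)"
    using tri_adm[of \<alpha>] by blast
  show ?thesis
  proof (intro exI[of _ "22 * C"] conjI allI impI)
    fix f g h :: "R3 \<Rightarrow> ennreal" and M1 M2 M3 :: real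
    assume m: "f \<in> borel_measurable borel" "g \<in> borel_measurable borel" "h \<in> borel_measurable borel"
      and M: "M1 \<ge> 1" "M2 \<ge> 1" "M3 \<ge> 1"
      and s: "\<forall>x. x \<notin> slab \<alpha> M1 \<longrightarrow> f x = 0" "\<forall>x. x \<notin> slab \<alpha> M2 \<longrightarrow> g x = 0" "\<forall>x. x \<notin> slab \<alpha> M3 \<longrightarrow> h x = 0"
    define Y where "Y = C * (M1 * M2 * M3) powr (29/30)"
    define X where "X = sqint f * sqint g * sqint h"
    have Y0: "Y \<ge> 0" using C by (simp add: Y_def)
    define k where "k x y = (if adm x y then ennreal \<bar>fst x\<bar> else 0)" for x y
    have km[measurable]: "case_prod k \<in> borel_measurable (lborel \<Otimes>\<^sub>M lborel)"
      "case_prod (\<lambda>x y. k y x) \<in> borel_measurable (lborel \<Otimes>\<^sub>M lborel)"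
      "case_prod (\<lambda>x y. k x (- x - y)) \<in> borel_measurable (lborel \<Otimes>\<^sub>M lborel)"
      unfolding k_def case_prod_beta' by measurable
    have 1: "(tri k f g h)\<^sup>2 \<le> ennreal Y * X"
      using K[OF m M s] by (simp add: k_def[abs_def] Y_def X_def)
    have 2: "(tri (\<lambda>x y. k y x) f g h)\<^sup>2 \<le> ennreal Y * X"
      using K[OF m(2,1,3) M(2,1,3) s(2,1,3)] tri_swap[OF km(2) m] by (simp add: k_def[abs_def] Y_def X_def mult_ac)
    have 3: "(tri (\<lambda>x y. k x (- x - y)) f g h)\<^sup>2 \<le> ennreal Y * X"
      using K[OF m(1,3,2) M(1,3,2) s(1,3,2)] tri_rot[OF km(3) m] by (simp add: k_def[abs_def] Y_def X_def mult_ac)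
    have 4: "(tri (\<lambda>x y. k x (- x - y) + k x (- x - y)) f g h)\<^sup>2 \<le> ennreal (2 * Y + 2 * Y) * X"
      by (rule tri_split[OF km(3) km(3) m order_refl 3 3]) (use Y0 in auto)
    have 5: "(tri (\<lambda>x y. k x y + k y x) f g h)\<^sup>2 \<le> ennreal (2 * Y + 2 * Y) * X"
      by (rule tri_split[OF km(1,2) m order_refl 1 2]) (use Y0 in auto)
    have 6: "(tri (\<lambda>x y. (k x y + k y x) + (k x (- x - y) + k x (- x - y))) f g h)\<^sup>2 \<le> ennreal (2 * (2 * Y + 2 * Y) + 2 * (2 * Y + 2 * Y)) * X"
      by (rule tri_split[OF _ _ m order_refl 5 4]) (use Y0 in auto)
    have "tri (\<lambda>x y. ennreal (max \<bar>fst x\<bar> \<bar>fst y\<bar>)) f g h \<le> tri (\<lambda>x y. (k x y + k y x) + (k x (- x - y) + k x (- x - y))) f g h"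
    proof (rule tri_mono_AE)
      fix x y :: R3 assume nz: "fst x \<noteq> 0" "fst y \<noteq> 0" "fst x + fst y \<noteq> 0"
      consider "adm x y" | "adm y x" | "\<not> adm x y" "\<not> adm y x" by blast
      then show "ennreal (max \<bar>fst x\<bar> \<bar>fst y\<bar>) \<le> (k x y + k y x) + (k x (- x - y) + k x (- x - y))"
      proof cases
        case 1
        then have "ennreal (max \<bar>fst x\<bar> \<bar>fst y\<bar>) = k x y" by (simp add: k_def adm_def max_def)
        then show ?thesis by (simp add: add.assoc)
      next
        case 2
        then have "ennreal (max \<bar>fst x\<bar> \<bar>fst y\<bar>) = k y x" by (simp add: k_def adm_def max_def)
        then show ?thesis by (simp add: add_increasing add.assoc)
      next
        case 3
        then have a: "\<bar>fst x + fst y\<bar> < \<bar>fst x\<bar>" "\<bar>fst x + fst y\<bar> < \<bar>fst y\<bar>"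
          using nz by (auto simp: adm_def add.commute)
        have e: "\<bar>- fst x - fst y\<bar> = \<bar>fst x + fst y\<bar>" "- fst x - fst y \<noteq> 0" using nz by arith+
        have "adm x (- x - y)" using a e by (simp add: adm_def)
        then have k3: "k x (- x - y) = ennreal \<bar>fst x\<bar>" by (simp add: k_def)
        have "max \<bar>fst x\<bar> \<bar>fst y\<bar> \<le> \<bar>fst x\<bar> + \<bar>fst x\<bar>" using a by linarith
        then have "ennreal (max \<bar>fst x\<bar> \<bar>fst y\<bar>) \<le> k x (- x - y) + k x (- x - y)"
          unfolding k3 by (simp add: ennreal_plus[symmetric] ennreal_leI del: ennreal_plus)
        then show ?thesis by (simp add: add_increasing)
      qed
    qed
    then have "(tri (\<lambda>x y. ennreal (max \<bar>fst x\<bar> \<bar>fst y\<bar>)) f g h)\<^sup>2 \<le> (tri (\<lambda>x y. (k x y + k y x) + (k x (- x - y) + k x (- x - y))) f g h)\<^sup>2"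
      by (intro power_mono) auto
    also note 6
    also have "ennreal (2 * (2 * Y + 2 * Y) + 2 * (2 * Y + 2 * Y)) * X \<le> ennreal (22 * Y) * X"
      using Y0 by (intro mult_right_mono ennreal_leI) auto
    finally show "(tri (\<lambda>x y. ennreal (max \<bar>fst x\<bar> \<bar>fst y\<bar>)) f g h)\<^sup>2
      \<le> ennreal (22 * C * (M1 * M2 * M3) powr (29/30)) * (sqint f * sqint g * sqint h)"
      by (simp add: X_def Y_def mult.assoc)
  qed (use C in simp)
qed

section \<open>L2 norms and the sum over dyadic modulations\<close>

definition esqrt :: "ennreal \<Rightarrow> ennreal" where
  "esqrt I = (if I = \<infinity> then \<infinity> else ennreal (sqrt (enn2real I)))"

lemma esqrt_power2: "(esqrt I)\<^sup>2 = I"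
proof (cases I)
  case (real r)
  then show ?thesis by (simp add: esqrt_def ennreal_power)
qed (simp add: esqrt_def power2_eq_square ennreal_top_mult)

lemma ennreal_power2_le_iff: "a\<^sup>2 \<le> b\<^sup>2 \<longleftrightarrow> a \<le> (b::ennreal)"
proof
  assume a: "a\<^sup>2 \<le> b\<^sup>2"
  show "a \<le> b"
  proof (cases "b = \<top>")
    case False
    then obtain s where s: "b = ennreal s" "s \<ge> 0" by (metis ennreal_cases)
    have "a \<noteq> \<top>"
    proof
      assume "a = \<top>"
      then have "a\<^sup>2 = \<top>" by (simp add: power2_eq_square ennreal_top_mult)
      then show False using a s by (simp add: ennreal_power top_unique)
    qed
    then obtain r where r: "a = ennreal r" "r \<ge> 0" by (metis ennreal_cases)
    have "r\<^sup>2 \<le> s\<^sup>2" using a r s by (simp add: ennreal_power)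
    then show ?thesis using r s by (auto intro: ennreal_leI power2_le_imp_le)
  qed simp
qed (simp add: power_mono)

lemma ennreal_power2_eq_iff: "a\<^sup>2 = b\<^sup>2 \<longleftrightarrow> a = (b::ennreal)"
  by (metis ennreal_power2_le_iff order_antisym order_refl)

lemma esqrt_mult: "esqrt (a * b) = esqrt a * esqrt b"
  by (subst ennreal_power2_eq_iff[symmetric]) (simp add: power_mult_distrib esqrt_power2)

lemma esqrt_mono: "a \<le> b \<Longrightarrow> esqrt a \<le> esqrt b"
  by (subst ennreal_power2_le_iff[symmetric]) (simp add: esqrt_power2)

lemma esqrt_power2': "esqrt (a\<^sup>2) = a"
  by (subst ennreal_power2_eq_iff[symmetric]) (simp add: esqrt_power2)

lemma esqrt_ennreal: "a \<ge> 0 \<Longrightarrow> esqrt (ennreal a) = ennreal (sqrt a)"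
  by (simp add: esqrt_def)

definition nrm :: "(R3 \<Rightarrow> ennreal) \<Rightarrow> ennreal" where
  "nrm f = esqrt (sqint f)"

lemma nrm_mono: "(\<And>x. f x \<le> g x) \<Longrightarrow> nrm f \<le> nrm g"
  unfolding nrm_def by (intro esqrt_mono nn_integral_mono power_mono) auto

lemma L2norm_eq_nrm: "L2norm F = nrm (\<lambda>x. ennreal (norm (F x)))"
  by (simp add: L2norm_def nrm_def esqrt_def Let_def ennreal_power)

lemma tri_nrm:
  fixes \<alpha> :: real
  shows "\<exists>C>0. \<forall>f g h (j1::nat) (j2::nat) (j3::nat). f \<in> borel_measurable borel \<longrightarrow> g \<in> borel_measurable borel \<longrightarrow> h \<in> borel_measurable borel \<longrightarrow>
    (\<forall>x. x \<notin> slab \<alpha> (2 ^ j1) \<longrightarrow> f x = 0) \<longrightarrow> (\<forall>x. x \<notin> slab \<alpha> (2 ^ j2) \<longrightarrow> g x = 0) \<longrightarrow>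
    (\<forall>x. x \<notin> slab \<alpha> (2 ^ j3) \<longrightarrow> h x = 0) \<longrightarrow>
    tri (\<lambda>x y. ennreal (max \<bar>fst x\<bar> \<bar>fst y\<bar>)) f g h
      \<le> ennreal (C * 2 powr (real j3 * (29/60))) * ((ennreal (2 powr (real j1 * (29/60))) * nrm f) * (ennreal (2 powr (real j2 * (29/60))) * nrm g) * nrm h)"
proof -
  obtain C where C: "C > 0" and K: "\<And>f g h M1 M2 M3. f \<in> borel_measurable borel \<Longrightarrow> g \<in> borel_measurable borel \<Longrightarrow> h \<in> borel_measurable borel \<Longrightarrow>
    M1 \<ge> 1 \<Longrightarrow> M2 \<ge> 1 \<Longrightarrow> M3 \<ge> 1 \<Longrightarrow> (\<forall>x. x \<notin> slab \<alpha> M1 \<longrightarrow> f x = 0) \<Longrightarrow> (\<forall>x. x \<notin> slab \<alpha> M2 \<longrightarrow> g x = 0) \<Longrightarrow>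
    (\<forall>x. x \<notin> slab \<alpha> M3 \<longrightarrow> h x = 0) \<Longrightarrow>
    (tri (\<lambda>x y. ennreal (max \<bar>fst x\<bar> \<bar>fst y\<bar>)) f g h)\<^sup>2
      \<le> ennreal (C * (M1 * M2 * M3) powr (29/30)) * (sqint f * sqint g * sqint h)"
    using tri_max[of \<alpha>] by blast
  show ?thesis
  proof (intro exI[of _ "sqrt C"] conjI allI impI)
    fix f g h :: "R3 \<Rightarrow> ennreal" and j1 j2 j3 :: nat
    assume m: "f \<in> borel_measurable borel" "g \<in> borel_measurable borel" "h \<in> borel_measurable borel"
      and s: "\<forall>x. x \<notin> slab \<alpha> (2 ^ j1) \<longrightarrow> f x = 0" "\<forall>x. x \<notin> slab \<alpha> (2 ^ j2) \<longrightarrow> g x = 0" "\<forall>x. x \<notin> slab \<alpha> (2 ^ j3) \<longrightarrow> h x = 0"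
    define T where "T = tri (\<lambda>x y. ennreal (max \<bar>fst x\<bar> \<bar>fst y\<bar>)) f g h"
    have "T\<^sup>2 \<le> ennreal (C * (2 ^ j1 * 2 ^ j2 * 2 ^ j3) powr (29/30)) * (sqint f * sqint g * sqint h)"
      unfolding T_def by (rule K[OF m _ _ _ s]) auto
    then have "T \<le> esqrt (ennreal (C * (2 ^ j1 * 2 ^ j2 * 2 ^ j3) powr (29/30)) * (sqint f * sqint g * sqint h))"
      by (metis esqrt_mono esqrt_power2')
    also have "\<dots> = ennreal (sqrt (C * (2 ^ j1 * 2 ^ j2 * 2 ^ j3) powr (29/30))) * (nrm f * nrm g * nrm h)"
      using C by (simp add: esqrt_mult nrm_def esqrt_ennreal)
    also have "sqrt (C * (2 ^ j1 * 2 ^ j2 * 2 ^ j3) powr (29/30)) = sqrt C * 2 powr (real j3 * (29/60)) * (2 powr (real j1 * (29/60)) * 2 powr (real j2 * (29/60)))"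
    proof -
      have e: "sqrt ((2 ^ j) powr (29/30)) = 2 powr (real j * (29/60))" for j :: nat
      proof -
        have "(2 ^ j) powr (29/30) = (2::real) powr (real j * (29/60)) * 2 powr (real j * (29/60))"
          by (simp add: powr_realpow[symmetric] powr_powr powr_add[symmetric] mult.commute)
        then show ?thesis by simp
      qed
      show ?thesis by (simp add: powr_mult real_sqrt_mult e)
    qed
    finally show "T \<le> ennreal (sqrt C * 2 powr (real j3 * (29/60))) * ((ennreal (2 powr (real j1 * (29/60))) * nrm f) * (ennreal (2 powr (real j2 * (29/60))) * nrm g) * nrm h)"
      using C by (simp add: ennreal_mult mult_ac)
  qed (use C in simp)
qed

definition cut :: "real \<Rightarrow> nat \<Rightarrow> R3 \<Rightarrow> ennreal" where
  "cut \<alpha> j x = ennreal (dyadic_cutoff j (snd (snd x) - \<omega> \<alpha> (fst x) (fst (snd x))))"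

definition wt :: "R3 \<Rightarrow> real" where
  "wt x = 1 + \<bar>fst x\<bar>\<^sup>2 + \<bar>fst (snd x)\<bar> / \<bar>fst x\<bar>"

lemma dyadic_cutoff_measurable[measurable]: "dyadic_cutoff j \<in> borel_measurable borel"
  unfolding dyadic_cutoff_def by measurable

lemma cut_measurable[measurable (raw)]:
  assumes [measurable]: "f \<in> borel_measurable N"
  shows "(\<lambda>x. cut \<alpha> j (f x)) \<in> borel_measurable N"
  unfolding cut_def by measurable

lemma wt_measurable[measurable (raw)]:
  assumes [measurable]: "f \<in> borel_measurable N"
  shows "(\<lambda>x. wt (f x)) \<in> borel_measurable N"
  unfolding wt_def by measurable

lemma cut_cases: "cut \<alpha> j x = 0 \<or> cut \<alpha> j x = 1"
  by (auto simp: cut_def dyadic_cutoff_def indicator_def)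

lemma cut_slab: "x \<notin> slab \<alpha> (2 ^ j) \<Longrightarrow> cut \<alpha> j x = 0"
  by (auto simp: cut_def dyadic_cutoff_def indicator_def slab_def)

lemma cut_cover: "\<exists>j. cut \<alpha> j x = 1"
proof -
  define r where "r = \<bar>snd (snd x) - \<omega> \<alpha> (fst x) (fst (snd x))\<bar>"
  obtain n where n: "r < 2 ^ n" using real_arch_pow[of 2 r] by auto
  define j where "j = (LEAST n. r \<le> 2 ^ n)"
  have j: "r \<le> 2 ^ j" unfolding j_def by (rule LeastI[of _ n]) (use n in simp)
  have "cut \<alpha> j x = 1"
  proof (cases "j = 0")
    case True
    then show ?thesis using j by (simp add: cut_def dyadic_cutoff_def indicator_def r_def)
  next
    case False
    then have "\<not> r \<le> 2 ^ (j - 1)" unfolding j_def by (intro not_less_Least) auto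
    then show ?thesis using j False by (simp add: cut_def dyadic_cutoff_def indicator_def r_def)
  qed
  then show ?thesis ..
qed

text \<open>The closed dyadic shells share their end points, so the cutoffs add up to at least 1
  rather than to 1. For upper bounds the inequality is enough.\<close>

lemma le_suminf_cut: "f x \<le> (\<Sum>j. cut \<alpha> j x * f x)"
proof -
  obtain j where "cut \<alpha> j x = 1" using cut_cover by blast
  then have "f x = (\<Sum>i\<in>{j}. cut \<alpha> i x * f x)" by simp
  also have "\<dots> \<le> (\<Sum>i. cut \<alpha> i x * f x)" by (rule sum_le_suminf) auto
  finally show ?thesis .
qed

lemma cut_uminus: "cut \<alpha> j (- x) = cut \<alpha> j x"
  by (simp add: cut_def dyadic_cutoff_def \<omega>_odd abs_minus_commute)

text \<open>The exponent \<open>29/60\<close> is half of the exponent \<open>29/30\<close> in the squared trilinear estimate.\<close>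

definition Zn :: "real \<Rightarrow> (R3 \<Rightarrow> ennreal) \<Rightarrow> ennreal" where
  "Zn \<alpha> f = (\<Sum>j. ennreal (2 powr (real j * (29/60))) * nrm (\<lambda>x. cut \<alpha> j x * f x))"

lemma suminf_prod_ennreal:
  fixes a b :: "nat \<Rightarrow> ennreal"
  shows "k * ((\<Sum>i. a i) * (\<Sum>j. b j) * c) = (\<Sum>i. \<Sum>j. k * (a i * b j * c))"
proof -
  have "(\<Sum>j. k * (a i * b j * c)) = (k * c * (\<Sum>j. b j)) * a i" for i
  proof -
    have "(\<Sum>j. k * (a i * b j * c)) = (\<Sum>j. (k * c * a i) * b j)"
      by (intro arg_cong[of _ _ suminf] ext) (simp only: mult_ac)
    then show ?thesis by (simp only: ennreal_suminf_cmult) (simp only: mult_ac)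
  qed
  then show ?thesis by (simp only: ennreal_suminf_cmult) (simp only: mult_ac)
qed

text \<open>Only \<open>f\<close> and \<open>g\<close> are decomposed. The third function keeps its
  single index, because the output norm of the bilinear estimate is itself a sum over that
  index.\<close>

lemma tri_Zn:
  fixes \<alpha> :: real
  shows "\<exists>C>0. \<forall>f g h (j3::nat). f \<in> borel_measurable borel \<longrightarrow> g \<in> borel_measurable borel \<longrightarrow> h \<in> borel_measurable borel \<longrightarrow>
    (\<forall>x. x \<notin> slab \<alpha> (2 ^ j3) \<longrightarrow> h x = 0) \<longrightarrow>
    tri (\<lambda>x y. ennreal (max \<bar>fst x\<bar> \<bar>fst y\<bar>)) f g h \<le> ennreal (C * 2 powr (real j3 * (29/60))) * (Zn \<alpha> f * Zn \<alpha> g * nrm h)"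
proof -
  obtain C where C: "C > 0" and K: "\<And>f g h j1 j2 j3. f \<in> borel_measurable borel \<Longrightarrow> g \<in> borel_measurable borel \<Longrightarrow> h \<in> borel_measurable borel \<Longrightarrow>
    (\<forall>x. x \<notin> slab \<alpha> (2 ^ j1) \<longrightarrow> f x = 0) \<Longrightarrow> (\<forall>x. x \<notin> slab \<alpha> (2 ^ j2) \<longrightarrow> g x = 0) \<Longrightarrow>
    (\<forall>x. x \<notin> slab \<alpha> (2 ^ j3) \<longrightarrow> h x = 0) \<Longrightarrow>
    tri (\<lambda>x y. ennreal (max \<bar>fst x\<bar> \<bar>fst y\<bar>)) f g h
      \<le> ennreal (C * 2 powr (real j3 * (29/60))) * ((ennreal (2 powr (real j1 * (29/60))) * nrm f) * (ennreal (2 powr (real j2 * (29/60))) * nrm g) * nrm h)"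
    using tri_nrm[of \<alpha>] by blast
  show ?thesis
  proof (intro exI[of _ C] conjI allI impI C)
    fix f g h :: "R3 \<Rightarrow> ennreal" and j3 :: nat
    assume m[measurable]: "f \<in> borel_measurable borel" "g \<in> borel_measurable borel" "h \<in> borel_measurable borel"
      and s: "\<forall>x. x \<notin> slab \<alpha> (2 ^ j3) \<longrightarrow> h x = 0"
    define f' g' where "f' j x = cut \<alpha> j x * f x" "g' j x = cut \<alpha> j x * g x" for j x
    have [measurable]: "f' j \<in> borel_measurable borel" "g' j \<in> borel_measurable borel" for j
      unfolding f'_g'_def by measurable
    let ?k = "\<lambda>x y :: R3. ennreal (max \<bar>fst x\<bar> \<bar>fst y\<bar>)"
    let ?c = "ennreal (C * 2 powr (real j3 * (29/60)))"
    have "tri ?k f g h \<le> (\<integral>\<^sup>+x. \<integral>\<^sup>+y. ?k x y * ((\<Sum>i. f' i x) * (\<Sum>j. g' j y) * h (- x - y)) \<partial>lborel \<partial>lborel)"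
      unfolding tri_def f'_g'_def by (intro nn_integral_mono mult_left_mono mult_right_mono mult_mono le_suminf_cut) auto
    also have "\<dots> = (\<integral>\<^sup>+x. \<integral>\<^sup>+y. (\<Sum>i. \<Sum>j. ?k x y * (f' i x * g' j y * h (- x - y))) \<partial>lborel \<partial>lborel)"
      by (simp only: suminf_prod_ennreal)
    also have "\<dots> = (\<Sum>i. \<Sum>j. tri ?k (f' i) (g' j) h)"
    proof -
      define F where "F i j x y = ?k x y * (f' i x * g' j y * h (- x - y))" for i j x y
      have [measurable]: "(\<lambda>p. F i j (a p) (b p)) \<in> borel_measurable N"
        if [measurable]: "a \<in> borel_measurable N" "b \<in> borel_measurable N" for i j a b and N :: "'n measure"
        unfolding F_def by measurable
      have "(\<integral>\<^sup>+y. (\<Sum>i. \<Sum>j. F i j x y) \<partial>lborel) = (\<Sum>i. \<Sum>j. \<integral>\<^sup>+y. F i j x y \<partial>lborel)" for x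
      proof -
        have "(\<integral>\<^sup>+y. (\<Sum>i. \<Sum>j. F i j x y) \<partial>lborel) = (\<Sum>i. \<integral>\<^sup>+y. (\<Sum>j. F i j x y) \<partial>lborel)"
          by (rule nn_integral_suminf) measurable
        also have "\<dots> = (\<Sum>i. \<Sum>j. \<integral>\<^sup>+y. F i j x y \<partial>lborel)"
          by (intro arg_cong[of _ _ suminf] ext nn_integral_suminf) measurable
        finally show ?thesis .
      qed
      then have "(\<integral>\<^sup>+x. \<integral>\<^sup>+y. (\<Sum>i. \<Sum>j. F i j x y) \<partial>lborel \<partial>lborel) = (\<integral>\<^sup>+x. (\<Sum>i. \<Sum>j. \<integral>\<^sup>+y. F i j x y \<partial>lborel) \<partial>lborel)"
        by simp
      also have "\<dots> = (\<Sum>i. \<integral>\<^sup>+x. (\<Sum>j. \<integral>\<^sup>+y. F i j x y \<partial>lborel) \<partial>lborel)"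
        by (rule nn_integral_suminf) measurable
      also have "\<dots> = (\<Sum>i. \<Sum>j. \<integral>\<^sup>+x. \<integral>\<^sup>+y. F i j x y \<partial>lborel \<partial>lborel)"
        by (intro arg_cong[of _ _ suminf] ext nn_integral_suminf) measurable
      finally show ?thesis unfolding tri_def F_def .
    qed
    also have "\<dots> \<le> (\<Sum>i. \<Sum>j. ?c * ((ennreal (2 powr (real i * (29/60))) * nrm (f' i)) * (ennreal (2 powr (real j * (29/60))) * nrm (g' j)) * nrm h))"
      by (intro suminf_le K summableI allI) (auto simp: f'_g'_def cut_slab s)
    also have "\<dots> = ?c * (Zn \<alpha> f * Zn \<alpha> g * nrm h)"
      unfolding Zn_def f'_g'_def by (rule suminf_prod_ennreal[symmetric])
    finally show "tri ?k f g h \<le> ?c * (Zn \<alpha> f * Zn \<alpha> g * nrm h)" .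
  qed
qed

section \<open>Weights, duality and the bilinear estimate on the Fourier side\<close>

lemma wt_ge_1: "wt x \<ge> 1"
  by (simp add: wt_def)

text \<open>The output weight is singular at output frequency 0, and the factor from the
  x-derivative repairs this: multiplied by \<bar>\<xi>\<bar>, it becomes \<bar>\<xi>\<bar> (1 +
  \<xi>^2) + \<bar>\<mu>\<bar>. With \<open>N\<close> and \<open>W\<close> the larger input
  frequency and weight, the first term is at most (2 N) (4 W) and the second at most 2 N W, whence
  10. This settles s = 1. For smaller s the remaining power 1 - s of \<bar>\<xi>\<bar> is bounded by
  that of 10 N, which is where \<open>s \<le> 1\<close> enters.\<close>

lemma weight_ineq:
  fixes x y :: R3
  assumes nz: "fst x \<noteq> 0" "fst y \<noteq> 0" and s: "0 < s" "s \<le> 1"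
  shows "\<bar>fst (x + y)\<bar> * wt (x + y) powr s \<le> 10 * max \<bar>fst x\<bar> \<bar>fst y\<bar> * (wt x powr s + wt y powr s)"
proof (cases "fst x + fst y = 0")
  case True
  then show ?thesis by simp
next
  case False
  define N where "N = max \<bar>fst x\<bar> \<bar>fst y\<bar>"
  define \<xi> where "\<xi> = \<bar>fst x + fst y\<bar>"
  define W where "W = max (wt x) (wt y)"
  have N: "\<bar>fst x\<bar> \<le> N" "\<bar>fst y\<bar> \<le> N" "N > 0" "\<xi> \<le> 2 * N" "\<xi> > 0"
    using nz False by (auto simp: N_def \<xi>_def)
  have W: "wt x \<le> W" "wt y \<le> W" "W \<ge> 1" using wt_ge_1[of x] by (auto simp: W_def)
  have w: "1 + (fst x)\<^sup>2 \<le> wt x" "1 + (fst y)\<^sup>2 \<le> wt y" by (auto simp: wt_def)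
  have m: "\<bar>fst (snd x)\<bar> \<le> N * wt x" "\<bar>fst (snd y)\<bar> \<le> N * wt y"
  proof -
    have "\<bar>fst (snd x)\<bar> = \<bar>fst x\<bar> * (\<bar>fst (snd x)\<bar> / \<bar>fst x\<bar>)" using nz by simp
    also have "\<dots> \<le> N * wt x" using N by (intro mult_mono) (auto simp: wt_def)
    finally show "\<bar>fst (snd x)\<bar> \<le> N * wt x" .
    have "\<bar>fst (snd y)\<bar> = \<bar>fst y\<bar> * (\<bar>fst (snd y)\<bar> / \<bar>fst y\<bar>)" using nz by simp
    also have "\<dots> \<le> N * wt y" using N by (intro mult_mono) (auto simp: wt_def)
    finally show "\<bar>fst (snd y)\<bar> \<le> N * wt y" .
  qed
  have NW: "N * wt x \<le> N * W" "N * wt y \<le> N * W" using W N by (auto intro!: mult_left_mono)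
  have "\<xi>\<^sup>2 \<le> 2 * (fst x)\<^sup>2 + 2 * (fst y)\<^sup>2"
    using zero_le_power2[of "fst x - fst y"] by (simp add: \<xi>_def power2_eq_square algebra_simps)
  then have "1 + \<xi>\<^sup>2 \<le> 4 * W" using w W by linarith
  then have "\<xi> * (1 + \<xi>\<^sup>2) \<le> (2 * N) * (4 * W)" using N by (intro mult_mono) auto
  moreover have "\<bar>fst (snd x) + fst (snd y)\<bar> \<le> 2 * (N * W)" using m NW by linarith
  moreover have "\<xi> * wt (x + y) = \<xi> * (1 + \<xi>\<^sup>2) + \<bar>fst (snd x) + fst (snd y)\<bar>"
    using N(5) unfolding wt_def \<xi>_def by (simp add: distrib_left)
  ultimately have b: "\<xi> * wt (x + y) \<le> 10 * (N * W)" by simp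
  have "\<xi> * wt (x + y) powr s = \<xi> powr (1 - s) * (\<xi> * wt (x + y)) powr s"
    using N(5) wt_ge_1[of "x + y"] by (simp add: powr_mult powr_add[symmetric] mult.assoc[symmetric])
  also have "\<dots> \<le> (10 * N) powr (1 - s) * (10 * (N * W)) powr s"
  proof (intro mult_mono)
    show "\<xi> powr (1 - s) \<le> (10 * N) powr (1 - s)" by (rule powr_mono2) (use N s in auto)
    show "(\<xi> * wt (x + y)) powr s \<le> (10 * (N * W)) powr s"
      by (rule powr_mono2) (use N s b wt_ge_1[of "x + y"] in auto)
  qed auto
  also have "\<dots> = 10 * N * W powr s"
    using N W by (simp add: powr_mult powr_add[symmetric] mult.assoc[symmetric])
      (simp add: mult.assoc mult.left_commute[of _ "N powr _"] powr_add[symmetric])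
  also have "W powr s \<le> wt x powr s + wt y powr s" by (auto simp: W_def max_def)
  finally show ?thesis using N by (simp add: \<xi>_def N_def mult_left_mono)
qed

text \<open>The natural test function is \<open>H\<close> itself, but its norm can only be cancelled
  when it is finite. So \<open>H\<close> is cut off in size and support, and Fatou's lemma removes
  the cutoff. Finiteness of \<open>H x\<close> ensures that the truncations eventually agree with
  \<open>H\<close> at every point.\<close>

lemma nrm_duality:
  assumes [measurable]: "H \<in> borel_measurable borel" and fin: "\<And>x. H x < \<infinity>"
    and B: "\<And>h. h \<in> borel_measurable borel \<Longrightarrow> (\<integral>\<^sup>+x. H x * h x \<partial>lborel) \<le> B * nrm h"
  shows "nrm H \<le> B"
proof -
  define h where "h n x = (if H x \<le> of_nat n \<and> norm x \<le> real n then H x else 0)" for n x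
  have hm[measurable]: "h n \<in> borel_measurable borel" for n
    unfolding h_def by measurable
  have b: "sqint (h n) \<le> B\<^sup>2" for n
  proof -
    have "sqint (h n) \<le> (\<integral>\<^sup>+x. ennreal ((real n)\<^sup>2) * indicator (cball (0::R3) (real n)) x \<partial>lborel)"
    proof (rule nn_integral_mono)
      fix x :: R3
      show "(h n x)\<^sup>2 \<le> ennreal ((real n)\<^sup>2) * indicator (cball 0 (real n)) x"
        using power_mono[of "H x" "of_nat n" 2]
        by (auto simp: h_def indicator_def ennreal_of_nat_eq_real_of_nat ennreal_power)
    qed
    also have "\<dots> < \<infinity>"
      using emeasure_lborel_cball_finite[of "0::R3" "real n"]
      by (subst nn_integral_cmult_indicator) (auto simp: ennreal_mult_less_top)
    finally have f: "sqint (h n) < \<infinity>" .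
    have "sqint (h n) \<le> (\<integral>\<^sup>+x. H x * h n x \<partial>lborel)"
      by (intro nn_integral_mono) (auto simp: h_def power2_eq_square)
    also have "\<dots> \<le> B * nrm (h n)" by (rule B) simp
    finally have le: "nrm (h n) * nrm (h n) \<le> B * nrm (h n)"
      by (metis esqrt_power2 nrm_def power2_eq_square)
    have "nrm (h n) \<noteq> \<top>" using f esqrt_power2[of "sqint (h n)"] by (auto simp: nrm_def power2_eq_square ennreal_top_mult)
    then have "nrm (h n) \<le> B"
    proof (cases "nrm (h n) = 0")
      case False
      then show ?thesis using le \<open>nrm (h n) \<noteq> \<top>\<close>
        by (subst (asm) (1 2) mult.commute) (simp add: ennreal_mult_le_mult_iff)
    qed simp
    then show ?thesis by (metis esqrt_power2 nrm_def power_mono zero_le)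
  qed
  have "sqint H \<le> (\<integral>\<^sup>+x. liminf (\<lambda>n. (h n x)\<^sup>2) \<partial>lborel)"
  proof (intro nn_integral_mono)
    fix x
    obtain r where r: "H x = ennreal r" using fin[of x] by (metis ennreal_cases less_irrefl infinity_ennreal_def)
    obtain n where n: "r \<le> real n" "norm x \<le> real n" using real_arch_simple[of "max r (norm x)"] by auto
    have "\<forall>\<^sub>F m in sequentially. (H x)\<^sup>2 \<le> (h m x)\<^sup>2"
      using eventually_ge_at_top[of n]
    proof eventually_elim
      case (elim m)
      then have "H x \<le> of_nat m" "norm x \<le> real m" using n r by (auto simp: ennreal_of_nat_eq_real_of_nat ennreal_leI)
      then show ?case by (simp add: h_def)
    qed
    then show "(H x)\<^sup>2 \<le> liminf (\<lambda>n. (h n x)\<^sup>2)" by (rule Liminf_bounded)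
  qed
  also have "\<dots> \<le> liminf (\<lambda>n. sqint (h n))" by (rule nn_integral_liminf) measurable
  also have "\<dots> \<le> B\<^sup>2" using b by (intro Liminf_le) auto
  finally show ?thesis by (metis esqrt_mono esqrt_power2' nrm_def)
qed

definition econv :: "(R3 \<Rightarrow> ennreal) \<Rightarrow> (R3 \<Rightarrow> ennreal) \<Rightarrow> R3 \<Rightarrow> ennreal" where
  "econv f g q = (\<integral>\<^sup>+p. f p * g (q - p) \<partial>lborel)"

lemma econv_measurable[measurable]:
  assumes [measurable]: "f \<in> borel_measurable borel" "g \<in> borel_measurable borel"
  shows "econv f g \<in> borel_measurable borel"
  unfolding econv_def by measurable

text \<open>A dyadic piece of the output is paired with a test function \<open>h\<close>. The
  substitution \<open>q = p + y\<close> gives a trilinear form whose third function is the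
  reflection of \<open>h\<close> times the cutoff; since \<open>cut\<close> is even, that function
  lives on a single slab. \<open>weight_ineq\<close> then moves the weight to one of the two
  inputs.\<close>

lemma bilinear_piece:
  fixes \<alpha> s :: real
  assumes s: "0 < s" "s \<le> 1"
  shows "\<exists>C>0. \<forall>f g (j::nat). f \<in> borel_measurable borel \<longrightarrow> g \<in> borel_measurable borel \<longrightarrow> (\<forall>q. econv f g q < \<infinity>) \<longrightarrow>
    nrm (\<lambda>q. cut \<alpha> j q * (ennreal (\<bar>fst q\<bar> * wt q powr s) * econv f g q))
      \<le> ennreal (C * 2 powr (real j * (29/60))) *
        (Zn \<alpha> (\<lambda>x. ennreal (wt x powr s) * f x) * Zn \<alpha> g + Zn \<alpha> f * Zn \<alpha> (\<lambda>x. ennreal (wt x powr s) * g x))"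
proof -
  obtain C where C: "C > 0" and K: "\<And>f g h j3. f \<in> borel_measurable borel \<Longrightarrow> g \<in> borel_measurable borel \<Longrightarrow> h \<in> borel_measurable borel \<Longrightarrow>
    (\<forall>x. x \<notin> slab \<alpha> (2 ^ j3) \<longrightarrow> h x = 0) \<Longrightarrow>
    tri (\<lambda>x y. ennreal (max \<bar>fst x\<bar> \<bar>fst y\<bar>)) f g h \<le> ennreal (C * 2 powr (real j3 * (29/60))) * (Zn \<alpha> f * Zn \<alpha> g * nrm h)"
    using tri_Zn[of \<alpha>] by blast
  show ?thesis
  proof (intro exI[of _ "10 * C"] conjI allI impI)
    fix f g :: "R3 \<Rightarrow> ennreal" and j :: nat
    assume m[measurable]: "f \<in> borel_measurable borel" "g \<in> borel_measurable borel" and fin: "\<forall>q. econv f g q < \<infinity>"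
    define W where "W x = ennreal (wt x powr s)" for x
    have [measurable]: "W \<in> borel_measurable borel" unfolding W_def by measurable
    let ?k = "\<lambda>x y :: R3. ennreal (max \<bar>fst x\<bar> \<bar>fst y\<bar>)"
    define B where "B = ennreal (10 * C * 2 powr (real j * (29/60))) * (Zn \<alpha> (\<lambda>x. W x * f x) * Zn \<alpha> g + Zn \<alpha> f * Zn \<alpha> (\<lambda>x. W x * g x))"
    have "nrm (\<lambda>q. cut \<alpha> j q * (ennreal (\<bar>fst q\<bar> * wt q powr s) * econv f g q)) \<le> B"
    proof (rule nrm_duality)
      show "cut \<alpha> j x * (ennreal (\<bar>fst x\<bar> * wt x powr s) * econv f g x) < \<infinity>" for x
        using fin[rule_format, of x] cut_cases[of \<alpha> j x] by (elim disjE) (simp_all add: ennreal_mult_less_top)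
      fix h :: "R3 \<Rightarrow> ennreal" assume [measurable]: "h \<in> borel_measurable borel"
      define h' where "h' x = cut \<alpha> j x * h (- x)" for x
      have [measurable]: "h' \<in> borel_measurable borel" unfolding h'_def by measurable
      define \<phi> where "\<phi> q = cut \<alpha> j q * ennreal (\<bar>fst q\<bar> * wt q powr s) * h q" for q
      have [measurable]: "\<phi> \<in> borel_measurable borel" unfolding \<phi>_def by measurable
      have "(\<integral>\<^sup>+q. cut \<alpha> j q * (ennreal (\<bar>fst q\<bar> * wt q powr s) * econv f g q) * h q \<partial>lborel)
        = (\<integral>\<^sup>+q. \<integral>\<^sup>+p. \<phi> q * (f p * g (q - p)) \<partial>lborel \<partial>lborel)"
        unfolding econv_def \<phi>_def by (intro nn_integral_cong) (simp add: nn_integral_cmult[symmetric] nn_integral_multc[symmetric] mult_ac)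
      also have "\<dots> = (\<integral>\<^sup>+p. \<integral>\<^sup>+q. \<phi> q * (f p * g (q - p)) \<partial>lborel \<partial>lborel)"
        by (rule lborel_Fubini) measurable
      also have "\<dots> = (\<integral>\<^sup>+p. \<integral>\<^sup>+y. \<phi> (p + y) * (f p * g (p + y - p)) \<partial>lborel \<partial>lborel)"
        by (intro nn_integral_cong nn_integral_lborel_translate[symmetric]) measurable
      also have "\<dots> = tri (\<lambda>x y. ennreal (\<bar>fst (x + y)\<bar> * wt (x + y) powr s)) f g h'"
        unfolding tri_def h'_def \<phi>_def
      proof (intro nn_integral_cong)
        fix p y :: R3
        have "- p - y = - (p + y)" by simp
        then show "cut \<alpha> j (p + y) * ennreal (\<bar>fst (p + y)\<bar> * wt (p + y) powr s) * h (p + y) * (f p * g (p + y - p)) =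
          ennreal (\<bar>fst (p + y)\<bar> * wt (p + y) powr s) * (f p * g y * (cut \<alpha> j (- p - y) * h (- (- p - y))))"
          by (simp only: cut_uminus minus_minus add_diff_cancel_left') (simp only: mult_ac)
      qed
      also have "\<dots> \<le> tri (\<lambda>x y. ennreal 10 * (?k x y * W x) + ennreal 10 * (?k x y * W y)) f g h'"
      proof (rule tri_mono_AE)
        fix x y :: R3 assume "fst x \<noteq> 0" "fst y \<noteq> 0"
        from weight_ineq[OF this s]
        have "ennreal (\<bar>fst (x + y)\<bar> * wt (x + y) powr s) \<le> ennreal (10 * (max \<bar>fst x\<bar> \<bar>fst y\<bar> * wt x powr s) + 10 * (max \<bar>fst x\<bar> \<bar>fst y\<bar> * wt y powr s))"
          by (intro ennreal_leI) (simp add: distrib_left mult.assoc)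
        also have "\<dots> = ennreal 10 * (?k x y * W x) + ennreal 10 * (?k x y * W y)"
          unfolding W_def by (subst ennreal_plus) (auto simp only: ennreal_mult' ennreal_mult abs_ge_zero zero_le_numeral powr_ge_zero max.coboundedI1 mult_nonneg_nonneg)
        finally show "ennreal (\<bar>fst (x + y)\<bar> * wt (x + y) powr s) \<le> ennreal 10 * (?k x y * W x) + ennreal 10 * (?k x y * W y)" .
      qed
      also have "\<dots> = tri (\<lambda>x y. ennreal 10 * (?k x y * W x)) f g h' + tri (\<lambda>x y. ennreal 10 * (?k x y * W y)) f g h'"
        by (rule tri_add) (unfold case_prod_beta', measurable)
      also have "tri (\<lambda>x y. ennreal 10 * (?k x y * W x)) f g h' = ennreal 10 * tri ?k (\<lambda>x. W x * f x) g h'"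
        unfolding tri_def by (simp add: nn_integral_cmult[symmetric] mult_ac)
      also have "tri (\<lambda>x y. ennreal 10 * (?k x y * W y)) f g h' = ennreal 10 * tri ?k f (\<lambda>x. W x * g x) h'"
        unfolding tri_def by (simp add: nn_integral_cmult[symmetric] mult_ac)
      also have "ennreal 10 * tri ?k (\<lambda>x. W x * f x) g h' + ennreal 10 * tri ?k f (\<lambda>x. W x * g x) h'
        \<le> ennreal 10 * (ennreal (C * 2 powr (real j * (29/60))) * (Zn \<alpha> (\<lambda>x. W x * f x) * Zn \<alpha> g * nrm h'))
         + ennreal 10 * (ennreal (C * 2 powr (real j * (29/60))) * (Zn \<alpha> f * Zn \<alpha> (\<lambda>x. W x * g x) * nrm h'))"
        by (intro add_mono mult_left_mono K) (auto simp: h'_def cut_slab)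
      also have "\<dots> = B * nrm h'"
        using C unfolding B_def by (simp add: ennreal_mult distrib_left distrib_right mult_ac)
      also have "nrm h' \<le> nrm (\<lambda>x. h (- x))"
        unfolding h'_def using cut_cases by (intro nrm_mono) (metis mult_1 mult_zero_left order_refl zero_le)
      also have "nrm (\<lambda>x. h (- x)) = nrm h"
        using nn_integral_lborel_reflect[of "\<lambda>x. (h x)\<^sup>2" 0] by (simp add: nrm_def)
      finally show "(\<integral>\<^sup>+q. cut \<alpha> j q * (ennreal (\<bar>fst q\<bar> * wt q powr s) * econv f g q) * h q \<partial>lborel) \<le> B * nrm h"
        by (simp add: mult_left_mono)
    qed measurable
    then show "nrm (\<lambda>q. cut \<alpha> j q * (ennreal (\<bar>fst q\<bar> * wt q powr s) * econv f g q))
      \<le> ennreal (10 * C * 2 powr (real j * (29/60))) *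
        (Zn \<alpha> (\<lambda>x. ennreal (wt x powr s) * f x) * Zn \<alpha> g + Zn \<alpha> f * Zn \<alpha> (\<lambda>x. ennreal (wt x powr s) * g x))"
      by (simp add: B_def W_def)
  qed (use C in simp)
qed

definition Xn :: "real \<Rightarrow> real \<Rightarrow> real \<Rightarrow> (R3 \<Rightarrow> ennreal) \<Rightarrow> ennreal" where
  "Xn \<alpha> s b f = (\<Sum>j. ennreal (2 powr (real j * b)) * nrm (\<lambda>x. cut \<alpha> j x * (ennreal (wt x powr s) * f x)))"

lemma Xnorm_hat_eq: "Xnorm_hat \<alpha> s b F = Xn \<alpha> s b (\<lambda>x. ennreal (norm (F x)))"
proof -
  have "dyadic_cutoff j r \<ge> 0" for j r by (simp add: dyadic_cutoff_def)
  then show ?thesis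
    unfolding Xnorm_hat_def Xn_def L2norm_eq_nrm
    by (simp add: case_prod_beta' norm_mult cut_def wt_def ennreal_mult mult.assoc)
qed

lemma Xn_mono: "(\<And>x. f x \<le> g x) \<Longrightarrow> Xn \<alpha> s b f \<le> Xn \<alpha> s b g"
  unfolding Xn_def by (intro suminf_le summableI mult_left_mono nrm_mono allI) auto

lemma Zn_wt_le_Xn: "b \<ge> 1/2 \<Longrightarrow> Zn \<alpha> (\<lambda>x. ennreal (wt x powr s) * f x) \<le> Xn \<alpha> s b f"
  unfolding Zn_def Xn_def by (intro suminf_le summableI mult_right_mono ennreal_leI powr_mono mult_left_mono allI) auto

lemma suminf_powr_finite:
  fixes c :: real
  assumes "c < 0"
  shows "\<exists>K>0. (\<Sum>j. ennreal (2 powr (real j * c))) = ennreal K"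
proof -
  have r: "0 < (2::real) powr c" "(2::real) powr c < 1" using assms by (auto simp: powr_less_one)
  have "(\<lambda>j. 2 powr (real j * c)) = (\<lambda>j. ((2::real) powr c) ^ j)"
    by (simp add: powr_power mult.commute)
  then have "(\<lambda>j. 2 powr (real j * c)) sums (1 / (1 - 2 powr c))"
    using geometric_sums[of "2 powr c"] r by simp
  then have "(\<Sum>j. ennreal (2 powr (real j * c))) = ennreal (1 / (1 - 2 powr c))"
    by (intro suminf_ennreal_eq) auto
  moreover have "1 / (1 - 2 powr c) > 0" using r by simp
  ultimately show ?thesis by blast
qed

text \<open>The sum over the output pieces is geometric with ratio 2 powr (b - 1 + 29/60), which is
  below 1 exactly for b < 1/2 + 1/60. In each term one input appears only in \<open>Zn\<close>, that
  is without weight and with an exponent below \<open>b\<close>; this slack is what is later turned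
  into a power of \<open>T\<close>.\<close>

lemma bilinear_hat:
  fixes \<alpha> s b :: real
  assumes s: "0 < s" "s \<le> 1" and b: "1/2 < b" "b < 1/2 + 1/60"
  shows "\<exists>C>0. \<forall>f g. f \<in> borel_measurable borel \<longrightarrow> g \<in> borel_measurable borel \<longrightarrow> (\<forall>q. econv f g q < \<infinity>) \<longrightarrow>
    Xn \<alpha> s (b - 1) (\<lambda>q. ennreal \<bar>fst q\<bar> * econv f g q) \<le> ennreal C * (Xn \<alpha> s b f * Zn \<alpha> g + Zn \<alpha> f * Xn \<alpha> s b g)"
proof -
  obtain C where C: "C > 0" and K: "\<And>f g j. f \<in> borel_measurable borel \<Longrightarrow> g \<in> borel_measurable borel \<Longrightarrow> (\<forall>q. econv f g q < \<infinity>) \<Longrightarrow>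
    nrm (\<lambda>q. cut \<alpha> j q * (ennreal (\<bar>fst q\<bar> * wt q powr s) * econv f g q))
      \<le> ennreal (C * 2 powr (real j * (29/60))) *
        (Zn \<alpha> (\<lambda>x. ennreal (wt x powr s) * f x) * Zn \<alpha> g + Zn \<alpha> f * Zn \<alpha> (\<lambda>x. ennreal (wt x powr s) * g x))"
    using bilinear_piece[OF s, of \<alpha>] by blast
  have "b - 1 + 29/60 < 0" using b by simp
  from suminf_powr_finite[OF this]
  obtain L where L: "L > 0" "(\<Sum>j. ennreal (2 powr (real j * (b - 1 + 29/60)))) = ennreal L"
    by blast
  show ?thesis
  proof (intro exI[of _ "C * L"] conjI allI impI)
    fix f g :: "R3 \<Rightarrow> ennreal"
    assume m: "f \<in> borel_measurable borel" "g \<in> borel_measurable borel" and fin: "\<forall>q. econv f g q < \<infinity>"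
    define X where "X = Xn \<alpha> s b f * Zn \<alpha> g + Zn \<alpha> f * Xn \<alpha> s b g"
    have "Xn \<alpha> s (b - 1) (\<lambda>q. ennreal \<bar>fst q\<bar> * econv f g q)
      \<le> (\<Sum>j. ennreal (2 powr (real j * (b - 1 + 29/60))) * (ennreal C * X))"
      unfolding Xn_def
    proof (intro suminf_le summableI allI)
      fix j
      have "nrm (\<lambda>x. cut \<alpha> j x * (ennreal (wt x powr s) * (ennreal \<bar>fst x\<bar> * econv f g x)))
        = nrm (\<lambda>q. cut \<alpha> j q * (ennreal (\<bar>fst q\<bar> * wt q powr s) * econv f g q))"
      proof -
        have "ennreal (wt x powr s) * (ennreal \<bar>fst x\<bar> * econv f g x) = ennreal (\<bar>fst x\<bar> * wt x powr s) * econv f g x" for x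
          by (subst ennreal_mult) (simp_all only: abs_ge_zero powr_ge_zero mult_ac)
        then show ?thesis by simp
      qed
      also have "\<dots> \<le> ennreal (C * 2 powr (real j * (29/60))) *
        (Zn \<alpha> (\<lambda>x. ennreal (wt x powr s) * f x) * Zn \<alpha> g + Zn \<alpha> f * Zn \<alpha> (\<lambda>x. ennreal (wt x powr s) * g x))"
        by (rule K[OF m fin])
      also have "\<dots> \<le> ennreal (C * 2 powr (real j * (29/60))) * X"
        unfolding X_def using b by (intro mult_left_mono add_mono mult_right_mono Zn_wt_le_Xn) auto
      finally have "ennreal (2 powr (real j * (b - 1))) * nrm (\<lambda>x. cut \<alpha> j x * (ennreal (wt x powr s) * (ennreal \<bar>fst x\<bar> * econv f g x)))
        \<le> ennreal (2 powr (real j * (b - 1))) * (ennreal (C * 2 powr (real j * (29/60))) * X)"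
        by (rule mult_left_mono) simp
      also have "\<dots> = ennreal (2 powr (real j * (b - 1)) * 2 powr (real j * (29/60))) * (ennreal C * X)"
        using C by (simp add: ennreal_mult mult_ac)
      also have "2 powr (real j * (b - 1)) * 2 powr (real j * (29/60)) = 2 powr (real j * (b - 1 + 29/60))"
        by (simp only: powr_add[symmetric] distrib_left)
      finally show "ennreal (2 powr (real j * (b - 1))) * nrm (\<lambda>x. cut \<alpha> j x * (ennreal (wt x powr s) * (ennreal \<bar>fst x\<bar> * econv f g x)))
        \<le> ennreal (2 powr (real j * (b - 1 + 29/60))) * (ennreal C * X)" .
    qed
    also have "\<dots> = ennreal (C * L) * X"
      using C L by (simp add: ennreal_suminf_multc ennreal_mult mult_ac)
    finally show "Xn \<alpha> s (b - 1) (\<lambda>q. ennreal \<bar>fst q\<bar> * econv f g q) \<le> ennreal (C * L) * (Xn \<alpha> s b f * Zn \<alpha> g + Zn \<alpha> f * Xn \<alpha> s b g)"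
      by (simp add: X_def)
  qed (use C L in simp)
qed

section \<open>Gaussian regularisation of the Fourier transform\<close>

text \<open>Obtained by scaling from the characteristic function of the standard normal
  distribution.\<close>

lemma real_gauss_ft:
  fixes t \<eta> :: real
  assumes "\<eta> > 0"
  shows "integrable lborel (\<lambda>x. exp (\<i> * complex_of_real (x * t)) * complex_of_real (exp (- \<eta> * (x * x) / 2)))"
    and "(\<integral>x. exp (\<i> * complex_of_real (x * t)) * complex_of_real (exp (- \<eta> * (x * x) / 2)) \<partial>lborel)
      = complex_of_real (sqrt (2 * pi / \<eta>) * exp (- (t * t) / (2 * \<eta>)))"
proof -
  interpret std: prob_space std_normal_distribution
    by (intro prob_space_normal_density) simp
  define c where "c = sqrt \<eta>"
  have c: "c > 0" "c * c = \<eta>" using assms by (auto simp: c_def)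
  define f where "f x = complex_of_real (std_normal_density x) * iexp ((t / c) * x)" for x
  have fi: "integrable lborel f"
  proof -
    have "integrable std_normal_distribution (\<lambda>x. iexp ((t / c) * x))"
      by (intro std.integrable_const_bound[where B = 1]) auto
    then show ?thesis unfolding f_def
      by (subst (asm) integrable_density) (auto simp: scaleR_conv_of_real std_normal_density_def)
  qed
  have "char std_normal_distribution (t / c) = complex_of_real (exp (- ((t / c)\<^sup>2) / 2))"
    by (simp add: char_std_normal_distribution)
  moreover have "char std_normal_distribution (t / c) = (\<integral>x. f x \<partial>lborel)"
    unfolding char_def f_def
    by (subst integral_density) (auto simp: scaleR_conv_of_real)
  ultimately have fv: "(\<integral>x. f x \<partial>lborel) = complex_of_real (exp (- ((t / c)\<^sup>2) / 2))" by simp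
  have fe: "complex_of_real (sqrt (2 * pi)) * f (0 + c * x) = exp (\<i> * complex_of_real (x * t)) * complex_of_real (exp (- \<eta> * (x * x) / 2))" for x
  proof -
    have "t / c * (c * x) = x * t" using c by simp
    moreover have "(c * x)\<^sup>2 = \<eta> * (x * x)" using c by (simp add: power2_eq_square mult_ac)
    ultimately show ?thesis by (simp add: f_def std_normal_density_def)
  qed
  have i1: "integrable lborel (\<lambda>x. f (0 + c * x))"
    using fi c by (intro lborel_integrable_real_affine) auto
  then show "integrable lborel (\<lambda>x. exp (\<i> * complex_of_real (x * t)) * complex_of_real (exp (- \<eta> * (x * x) / 2)))"
    unfolding fe[symmetric] by (rule integrable_mult_right)
  have "(\<integral>x. f x \<partial>lborel) = c *\<^sub>R (\<integral>x. f (0 + c * x) \<partial>lborel)"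
    using c by (subst lborel_integral_real_affine[of c _ 0]) auto
  then have v: "(\<integral>x. f (0 + c * x) \<partial>lborel) = complex_of_real (exp (- ((t / c)\<^sup>2) / 2)) / complex_of_real c"
    using c fv by (simp add: scaleR_conv_of_real field_simps)
  have "(\<integral>x. exp (\<i> * complex_of_real (x * t)) * complex_of_real (exp (- \<eta> * (x * x) / 2)) \<partial>lborel)
     = complex_of_real (sqrt (2 * pi)) * (\<integral>x. f (0 + c * x) \<partial>lborel)"
    unfolding fe[symmetric] by (rule integral_mult_right_zero)
  also have "\<dots> = complex_of_real (sqrt (2 * pi / \<eta>) * exp (- (t * t) / (2 * \<eta>)))"
    unfolding v using c assms by (simp add: real_sqrt_divide c_def power_divide power2_eq_square)
  finally show "(\<integral>x. exp (\<i> * complex_of_real (x * t)) * complex_of_real (exp (- \<eta> * (x * x) / 2)) \<partial>lborel)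
      = complex_of_real (sqrt (2 * pi / \<eta>) * exp (- (t * t) / (2 * \<eta>)))" .
qed

lemma gauss_ft:
  fixes z :: "'a::euclidean_space" and \<eta> :: real
  assumes \<eta>: "\<eta> > 0"
  shows "integrable lborel (\<lambda>p. exp (\<i> * complex_of_real (p \<bullet> z)) * complex_of_real (exp (- \<eta> * (p \<bullet> p) / 2)))"
    and "(\<integral>p. exp (\<i> * complex_of_real (p \<bullet> z)) * complex_of_real (exp (- \<eta> * (p \<bullet> p) / 2)) \<partial>lborel)
      = complex_of_real (sqrt (2 * pi / \<eta>) ^ DIM('a) * exp (- (z \<bullet> z) / (2 * \<eta>)))"
proof -
  interpret product_sigma_finite "\<lambda>_::'a. lborel :: real measure" ..
  define g where "g b x = exp (\<i> * complex_of_real (x * (z \<bullet> b))) * complex_of_real (exp (- \<eta> * (x * x) / 2))" for b x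
  define F where "F p = exp (\<i> * complex_of_real (p \<bullet> z)) * complex_of_real (exp (- \<eta> * (p \<bullet> p) / 2))" for p :: 'a
  have [measurable]: "F \<in> borel_measurable borel" unfolding F_def by measurable
  have Fg: "F (\<Sum>b\<in>Basis. f b *\<^sub>R b) = (\<Prod>b\<in>Basis. g b (f b))" for f
  proof -
    have 1: "(\<Sum>b\<in>Basis. f b *\<^sub>R b) \<bullet> z = (\<Sum>b\<in>Basis. f b * (z \<bullet> b))"
      by (simp add: inner_sum_left inner_commute[of z])
    have 2: "(\<Sum>b\<in>Basis. f b *\<^sub>R b) \<bullet> (\<Sum>b\<in>Basis. f b *\<^sub>R b) = (\<Sum>b\<in>Basis. f b * f b)"
      by (simp add: inner_sum_left inner_sum_right inner_Basis if_distrib cong: if_cong)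
    have "exp (\<i> * complex_of_real (\<Sum>b\<in>Basis. f b * (z \<bullet> b))) = (\<Prod>b\<in>Basis. exp (\<i> * complex_of_real (f b * (z \<bullet> b))))"
      by (simp only: of_real_sum sum_distrib_left exp_sum[OF finite_Basis])
    moreover have "- \<eta> * (\<Sum>b\<in>Basis. f b * f b) / 2 = (\<Sum>b\<in>Basis. - \<eta> * (f b * f b) / 2)"
      by (simp only: sum_distrib_left sum_divide_distrib)
    ultimately show ?thesis
      unfolding F_def 1 2 g_def by (simp only: exp_sum[OF finite_Basis] of_real_prod prod.distrib)
  qed
  have gi: "integrable lborel (g b)" for b using real_gauss_ft(1)[OF \<eta>, of "z \<bullet> b"] by (simp add: g_def[abs_def])
  have e: "(\<lambda>f. F (\<Sum>b\<in>Basis. f b *\<^sub>R b)) = (\<lambda>f. \<Prod>b\<in>Basis. g b (f b))" using Fg by auto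
  have m[measurable]: "(\<lambda>f. \<Sum>b\<in>Basis. f b *\<^sub>R b) \<in> measurable (\<Pi>\<^sub>M b\<in>(Basis::'a set). lborel) (borel :: 'a measure)"
    by measurable
  have "integrable (\<Pi>\<^sub>M b\<in>(Basis::'a set). lborel) (\<lambda>f. \<Prod>b\<in>Basis. g b (f b))"
    by (rule product_integrable_prod) (use gi in auto)
  then have "integrable lborel F"
    unfolding e[symmetric] by (subst lborel_eq) (simp add: integrable_distr_eq)
  then show "integrable lborel (\<lambda>p. exp (\<i> * complex_of_real (p \<bullet> z)) * complex_of_real (exp (- \<eta> * (p \<bullet> p) / 2)))"
    by (simp add: F_def[abs_def])
  have "(\<integral>p. F p \<partial>lborel) = (\<integral>f. (\<Prod>b\<in>Basis. g b (f b)) \<partial>(\<Pi>\<^sub>M b\<in>(Basis::'a set). lborel))"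
    by (subst lborel_eq) (simp add: integral_distr e)
  also have "\<dots> = (\<Prod>b\<in>Basis. \<integral>x. g b x \<partial>lborel)"
    by (rule product_integral_prod) (use gi in auto)
  also have "\<dots> = (\<Prod>b\<in>(Basis::'a set). complex_of_real (sqrt (2 * pi / \<eta>) * exp (- ((z \<bullet> b) * (z \<bullet> b)) / (2 * \<eta>))))"
    unfolding g_def by (subst real_gauss_ft(2)[OF \<eta>]) simp
  also have "\<dots> = complex_of_real (sqrt (2 * pi / \<eta>) ^ DIM('a) * (\<Prod>b\<in>(Basis::'a set). exp (- ((z \<bullet> b) * (z \<bullet> b)) / (2 * \<eta>))))"
    by (simp only: of_real_prod[symmetric] prod.distrib prod_constant)
  also have "(\<Prod>b\<in>(Basis::'a set). exp (- ((z \<bullet> b) * (z \<bullet> b)) / (2 * \<eta>))) = exp (- (z \<bullet> z) / (2 * \<eta>))"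
  proof -
    have "z \<bullet> z = (\<Sum>b\<in>Basis. (z \<bullet> b) * (z \<bullet> b))" by (rule euclidean_inner)
    then have "- (z \<bullet> z) / (2 * \<eta>) = (\<Sum>b\<in>Basis. - ((z \<bullet> b) * (z \<bullet> b)) / (2 * \<eta>))"
      by (simp only: sum_negf[symmetric] sum_divide_distrib)
    then show ?thesis by (simp only: exp_sum[OF finite_Basis])
  qed
  finally show "(\<integral>p. exp (\<i> * complex_of_real (p \<bullet> z)) * complex_of_real (exp (- \<eta> * (p \<bullet> p) / 2)) \<partial>lborel)
      = complex_of_real (sqrt (2 * pi / \<eta>) ^ DIM('a) * exp (- (z \<bullet> z) / (2 * \<eta>)))"
    by (simp add: F_def)
qed

text \<open>The transform of the Gaussian \<open>ge \<eta>\<close>, not normalised: its total mass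
  is \<open>(2 * pi) ^ DIM('a)\<close> for every \<open>\<eta>\<close>, and it concentrates at 0 as
  \<open>\<eta>\<close> tends to 0.\<close>

definition gk :: "real \<Rightarrow> 'a::euclidean_space \<Rightarrow> real" where
  "gk \<eta> z = sqrt (2 * pi / \<eta>) ^ DIM('a) * exp (- (z \<bullet> z) / (2 * \<eta>))"

abbreviation cis' :: "real \<Rightarrow> complex" where "cis' t \<equiv> exp (\<i> * complex_of_real t)"

definition ge :: "real \<Rightarrow> 'a::euclidean_space \<Rightarrow> real" where
  "ge \<eta> p = exp (- \<eta> * (p \<bullet> p) / 2)"

lemma gk_measurable[measurable]: "gk \<eta> \<in> borel_measurable borel" unfolding gk_def by measurable
lemma ge_measurable[measurable]: "ge \<eta> \<in> borel_measurable borel" unfolding ge_def by measurable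
lemma gk_nonneg: "\<eta> > 0 \<Longrightarrow> gk \<eta> z \<ge> 0" by (simp add: gk_def)
lemma ge_pos: "ge \<eta> p > 0" by (simp add: ge_def)
lemma ge_le_1: "\<eta> \<ge> 0 \<Longrightarrow> ge \<eta> p \<le> 1" by (simp add: ge_def)

lemma gk_le: "\<eta> > 0 \<Longrightarrow> gk \<eta> (z::'a::euclidean_space) \<le> sqrt (2 * pi / \<eta>) ^ DIM('a)"
  unfolding gk_def by (rule mult_right_le_one_le) auto

lemma gauss_ft':
  fixes z :: "'a::euclidean_space"
  assumes "\<eta> > 0"
  shows "integrable lborel (\<lambda>p. cis' (p \<bullet> z) * complex_of_real (ge \<eta> p))"
    "(\<integral>p. cis' (p \<bullet> z) * complex_of_real (ge \<eta> p) \<partial>lborel) = complex_of_real (gk \<eta> z)"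
  using gauss_ft[OF assms, of z] by (simp_all add: ge_def gk_def)

lemma ge_integrable: "\<eta> > 0 \<Longrightarrow> integrable lborel (ge \<eta> :: 'a::euclidean_space \<Rightarrow> real)"
  using gauss_ft'(1)[of \<eta> "0::'a"] integrable_Re[of lborel "\<lambda>p::'a. complex_of_real (ge \<eta> p)"] by simp

lemma gk_eq_ge: "\<eta> > 0 \<Longrightarrow> gk \<eta> (z::'a::euclidean_space) = sqrt (2 * pi / \<eta>) ^ DIM('a) * ge (1 / \<eta>) z"
  by (simp add: gk_def ge_def)

lemma gk_integrable: "\<eta> > 0 \<Longrightarrow> integrable lborel (gk \<eta> :: 'a::euclidean_space \<Rightarrow> real)"
proof -
  assume "\<eta> > 0"
  then have "gk \<eta> = (\<lambda>z::'a. sqrt (2 * pi / \<eta>) ^ DIM('a) * ge (1 / \<eta>) z)" by (auto simp: gk_eq_ge)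
  then show ?thesis using \<open>\<eta> > 0\<close> ge_integrable[of "1 / \<eta>", where 'a = 'a] by simp
qed

lemma gk_integral:
  assumes "\<eta> > 0"
  shows "(\<integral>z. gk \<eta> (z::'a::euclidean_space) \<partial>lborel) = (2 * pi) ^ DIM('a)"
proof -
  have "complex_of_real (\<integral>z. ge (1 / \<eta>) (z::'a) \<partial>lborel) = complex_of_real (gk (1 / \<eta>) (0::'a))"
    using gauss_ft'(2)[of "1 / \<eta>" "0::'a"] assms by simp
  then have e: "(\<integral>z. ge (1 / \<eta>) (z::'a) \<partial>lborel) = gk (1 / \<eta>) (0::'a)" by (simp only: of_real_eq_iff)
  have "(\<integral>z. gk \<eta> (z::'a) \<partial>lborel) = sqrt (2 * pi / \<eta>) ^ DIM('a) * gk (1 / \<eta>) (0::'a)"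
    unfolding e[symmetric] using assms by (simp add: gk_eq_ge)
  also have "\<dots> = (sqrt (2 * pi / \<eta>) * sqrt (2 * pi * \<eta>)) ^ DIM('a)"
    by (simp add: gk_def power_mult_distrib)
  also have "sqrt (2 * pi / \<eta>) * sqrt (2 * pi * \<eta>) = sqrt ((2 * pi) * (2 * pi))"
    using assms by (simp only: real_sqrt_mult[symmetric]) simp
  also have "\<dots> = 2 * pi" by (simp only: real_sqrt_abs2) simp
  finally show ?thesis .
qed

lemma gk_nn_integral:
  assumes "\<eta> > 0"
  shows "(\<integral>\<^sup>+z. ennreal (gk \<eta> (c - (z::'a::euclidean_space))) \<partial>lborel) = ennreal ((2 * pi) ^ DIM('a))"
proof -
  have "(\<integral>\<^sup>+z. ennreal (gk \<eta> (c - z)) \<partial>lborel) = (\<integral>\<^sup>+z. ennreal (gk \<eta> (z::'a)) \<partial>lborel)"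
    by (rule nn_integral_lborel_reflect) measurable
  also have "\<dots> = ennreal (\<integral>z. gk \<eta> (z::'a) \<partial>lborel)"
    by (rule nn_integral_eq_integral[OF gk_integrable]) (use assms gk_nonneg in auto)
  finally show ?thesis by (simp add: gk_integral assms)
qed

section \<open>Fubini's theorem with a Gaussian weight and Bessel's inequality\<close>

lemma integrable_lborel_pair:
  fixes f :: "'a::euclidean_space \<times> 'b::euclidean_space \<Rightarrow> complex"
  assumes [measurable]: "f \<in> borel_measurable borel"
    and "integrable lborel (\<lambda>x. \<integral>y. norm (f (x, y)) \<partial>lborel)" "\<And>x. integrable lborel (\<lambda>y. f (x, y))"
  shows "integrable lborel f"
proof -
  have "integrable (lborel \<Otimes>\<^sub>M lborel) f"
    by (rule lborel_pair.Fubini_integrable) (use assms in \<open>auto simp: lborel_prod\<close>)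
  then show ?thesis by (simp only: lborel_prod)
qed

lemma integral_lborel_pair:
  fixes f :: "'a::euclidean_space \<times> 'b::euclidean_space \<Rightarrow> complex"
  assumes "integrable lborel f"
  shows "(\<integral>p. f p \<partial>lborel) = (\<integral>x. \<integral>y. f (x, y) \<partial>lborel \<partial>lborel)"
    "(\<integral>p. f p \<partial>lborel) = (\<integral>y. \<integral>x. f (x, y) \<partial>lborel \<partial>lborel)"
    "integrable lborel (\<lambda>x. \<integral>y. f (x, y) \<partial>lborel)"
proof -
  have i: "integrable (lborel \<Otimes>\<^sub>M lborel) f" using assms by (simp only: lborel_prod)
  have i': "integrable (lborel \<Otimes>\<^sub>M lborel) (\<lambda>(x, y). f (x, y))" using i by simp
  have e: "(\<integral>p. f p \<partial>lborel) = (\<integral>p. f p \<partial>(lborel \<Otimes>\<^sub>M lborel))" by (simp only: lborel_prod)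
  show "(\<integral>p. f p \<partial>lborel) = (\<integral>x. \<integral>y. f (x, y) \<partial>lborel \<partial>lborel)"
    unfolding e by (rule lborel_pair.integral_fst'[OF i, symmetric])
  then show "(\<integral>p. f p \<partial>lborel) = (\<integral>y. \<integral>x. f (x, y) \<partial>lborel \<partial>lborel)"
    using lborel_pair.Fubini_integral[OF i'] by simp
  show "integrable lborel (\<lambda>x. \<integral>y. f (x, y) \<partial>lborel)"
    by (rule lborel_pair.integrable_fst'[OF i])
qed

lemma integrable_prod_mult:
  fixes f :: "'a::euclidean_space \<Rightarrow> complex" and g :: "'b::euclidean_space \<Rightarrow> complex"
  assumes f: "integrable lborel f" and g: "integrable lborel g"
  shows "integrable lborel (\<lambda>x. f (fst x) * g (snd x))"
    "(\<integral>x. f (fst x) * g (snd x) \<partial>lborel) = (\<integral>x. f x \<partial>lborel) * (\<integral>x. g x \<partial>lborel)"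
proof -
  have [measurable]: "f \<in> borel_measurable borel" "g \<in> borel_measurable borel" using f g by auto
  show i: "integrable lborel (\<lambda>x. f (fst x) * g (snd x))"
    by (rule integrable_lborel_pair) (use f g in \<open>auto simp: norm_mult\<close>)
  show "(\<integral>x. f (fst x) * g (snd x) \<partial>lborel) = (\<integral>x. f x \<partial>lborel) * (\<integral>x. g x \<partial>lborel)"
    by (subst integral_lborel_pair(1)[OF i]) simp
qed

lemma norm_cis'[simp]: "norm (cis' t) = 1"
  by simp

lemma integrable_mult_cis:
  fixes L :: "'b::euclidean_space \<Rightarrow> complex" and z :: "'b \<Rightarrow> real"
  assumes "integrable lborel L" and [measurable]: "z \<in> borel_measurable borel"
  shows "integrable lborel (\<lambda>Q. L Q * cis' (z Q))"
  by (rule Bochner_Integration.integrable_bound[OF assms(1)]) (use assms in \<open>auto simp: norm_mult\<close>)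

text \<open>The inner integral is merely bounded in \<open>p\<close>; the Gaussian factor makes the
  joint integrand absolutely integrable, so the order of integration may be exchanged. In the
  applications \<open>z Q\<close> is the difference of two frequencies.\<close>

lemma gauss_fubini:
  fixes L :: "'b::euclidean_space \<Rightarrow> complex" and z :: "'b \<Rightarrow> 'a::euclidean_space"
  assumes L: "integrable lborel L" and z[measurable]: "z \<in> borel_measurable borel" and \<eta>: "\<eta> > 0"
  shows "integrable lborel (\<lambda>p. complex_of_real (ge \<eta> p) * (\<integral>Q. L Q * cis' (p \<bullet> z Q) \<partial>lborel))"
    "(\<integral>p. complex_of_real (ge \<eta> p) * (\<integral>Q. L Q * cis' (p \<bullet> z Q) \<partial>lborel) \<partial>lborel) = (\<integral>Q. L Q * complex_of_real (gk \<eta> (z Q)) \<partial>lborel)"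
proof -
  have [measurable]: "L \<in> borel_measurable borel" using L by auto
  define h where "h = (\<lambda>x :: 'a \<times> 'b. complex_of_real (ge \<eta> (fst x)) * (L (snd x) * cis' (fst x \<bullet> z (snd x))))"
  have [measurable]: "h \<in> borel_measurable borel" unfolding h_def by measurable
  have i: "integrable lborel h"
  proof (rule integrable_lborel_pair)
    show "integrable lborel (\<lambda>x. \<integral>y. norm (h (x, y)) \<partial>lborel)"
      using ge_integrable[OF \<eta>, where 'a = 'a] by (simp add: h_def norm_mult less_imp_le[OF ge_pos])
    show "integrable lborel (\<lambda>y. h (x, y))" for x
      unfolding h_def by (auto intro!: integrable_mult_right integrable_mult_cis L)
  qed measurable
  show "integrable lborel (\<lambda>p. complex_of_real (ge \<eta> p) * (\<integral>Q. L Q * cis' (p \<bullet> z Q) \<partial>lborel))"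
    using integral_lborel_pair(3)[OF i] by (simp add: h_def)
  have "(\<integral>p. complex_of_real (ge \<eta> p) * (\<integral>Q. L Q * cis' (p \<bullet> z Q) \<partial>lborel) \<partial>lborel) = (\<integral>p. h p \<partial>lborel)"
    by (subst integral_lborel_pair(1)[OF i]) (simp add: h_def)
  also have "\<dots> = (\<integral>Q. (\<integral>p. L Q * (cis' (p \<bullet> z Q) * complex_of_real (ge \<eta> p)) \<partial>lborel) \<partial>lborel)"
    by (subst integral_lborel_pair(2)[OF i]) (simp add: h_def mult_ac)
  also have "\<dots> = (\<integral>Q. L Q * complex_of_real (gk \<eta> (z Q)) \<partial>lborel)"
    by (simp add: gauss_ft'(2)[OF \<eta>] gauss_ft'(1)[OF \<eta>])
  finally show "(\<integral>p. complex_of_real (ge \<eta> p) * (\<integral>Q. L Q * cis' (p \<bullet> z Q) \<partial>lborel) \<partial>lborel) = (\<integral>Q. L Q * complex_of_real (gk \<eta> (z Q)) \<partial>lborel)" .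
qed

text \<open>The inverse transform without the factor of \<open>2 * pi\<close>; that factor is placed
  in \<open>reg\<close> and in the constants of the L2 bounds.\<close>

definition ift :: "('a::euclidean_space \<Rightarrow> complex) \<Rightarrow> 'a \<Rightarrow> complex" where
  "ift G p = (\<integral>q. G q * cis' (p \<bullet> q) \<partial>lborel)"

lemma ift_measurable[measurable]:
  assumes [measurable]: "G \<in> borel_measurable borel"
  shows "ift G \<in> borel_measurable borel"
  unfolding ift_def[abs_def] by measurable

lemma cnj_cis': "cnj (cis' t) = cis' (- t)"
  by (simp add: exp_cnj)

lemma ge_tendsto_1:
  assumes "e \<longlonglongrightarrow> 0"
  shows "(\<lambda>k. ge (e k) p) \<longlonglongrightarrow> 1"
proof -
  have "(\<lambda>k. exp (- e k * (p \<bullet> p) / 2)) \<longlonglongrightarrow> exp (- 0 * (p \<bullet> p) / 2)"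
    by (intro tendsto_intros assms) auto
  then show ?thesis by (simp add: ge_def)
qed

text \<open>With the weight \<open>ge \<eta>\<close> the left-hand side is the double integral of
  G(q) and the conjugate of G(q') against \<open>gk \<eta> (q - q')\<close>. The kernel has the same
  mass for all \<open>\<eta>\<close>, so Schur's test gives a uniform bound. Fatou's lemma removes
  the weight.\<close>

lemma bessel:
  fixes G :: "'a::euclidean_space \<Rightarrow> complex"
  assumes G: "integrable lborel G"
  shows "(\<integral>\<^sup>+p. ennreal ((norm (ift G p))\<^sup>2) \<partial>lborel) \<le> ennreal ((2 * pi) ^ DIM('a)) * (\<integral>\<^sup>+q. ennreal ((norm (G q))\<^sup>2) \<partial>lborel)"
proof -
  have [measurable]: "G \<in> borel_measurable borel" using G by auto
  define L where "L = (\<lambda>Q :: 'a \<times> 'a. G (fst Q) * cnj (G (snd Q)))"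
  have Li: "integrable lborel L" unfolding L_def by (rule integrable_prod_mult) (use G in auto)
  have [measurable]: "L \<in> borel_measurable borel" using Li by auto
  define I where "I = (\<integral>\<^sup>+q. ennreal ((norm (G q))\<^sup>2) \<partial>lborel)"
  have eq: "ift G p * cnj (ift G p) = (\<integral>Q. L Q * cis' (p \<bullet> (fst Q - snd Q)) \<partial>lborel)" for p
  proof -
    have 1: "integrable lborel (\<lambda>q. G q * cis' (p \<bullet> q))" by (rule integrable_mult_cis[OF G]) measurable
    have 2: "integrable lborel (\<lambda>q. cnj (G q * cis' (p \<bullet> q)))" using 1 by (simp only: complex_integrable_cnj)
    have "ift G p * cnj (ift G p) = (\<integral>Q. (G (fst Q) * cis' (p \<bullet> fst Q)) * cnj (G (snd Q) * cis' (p \<bullet> snd Q)) \<partial>lborel)"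
    proof -
      have "cnj (ift G p) = (\<integral>q. cnj (G q * cis' (p \<bullet> q)) \<partial>lborel)"
        unfolding ift_def by (rule Bochner_Integration.integral_cnj[symmetric])
      then have "ift G p * cnj (ift G p) = ift G p * (\<integral>q. cnj (G q * cis' (p \<bullet> q)) \<partial>lborel)" by (rule arg_cong)
      also have "\<dots> = (\<integral>Q. (G (fst Q) * cis' (p \<bullet> fst Q)) * cnj (G (snd Q) * cis' (p \<bullet> snd Q)) \<partial>lborel)"
        unfolding ift_def by (rule integrable_prod_mult(2)[OF 1 2, symmetric])
      finally show ?thesis .
    qed
    also have "(\<lambda>Q. (G (fst Q) * cis' (p \<bullet> fst Q)) * cnj (G (snd Q) * cis' (p \<bullet> snd Q))) = (\<lambda>Q. L Q * cis' (p \<bullet> (fst Q - snd Q)))"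
    proof
      fix Q :: "'a \<times> 'a"
      have "cis' (p \<bullet> fst Q) * cis' (- (p \<bullet> snd Q)) = cis' (p \<bullet> (fst Q - snd Q))"
        by (simp add: exp_add[symmetric] inner_diff_right algebra_simps)
      then show "(G (fst Q) * cis' (p \<bullet> fst Q)) * cnj (G (snd Q) * cis' (p \<bullet> snd Q)) = L Q * cis' (p \<bullet> (fst Q - snd Q))"
        unfolding L_def complex_cnj_mult cnj_cis' by (metis mult.assoc mult.left_commute)
    qed
    finally show ?thesis .
  qed
  have main: "(\<integral>\<^sup>+p. ennreal (ge \<eta> p * (norm (ift G p))\<^sup>2) \<partial>lborel) \<le> ennreal ((2 * pi) ^ DIM('a)) * I" if \<eta>: "\<eta> > 0" for \<eta>
  proof -
    define R where "R p = ge \<eta> p * (norm (ift G p))\<^sup>2" for p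
    have R0: "R p \<ge> 0" for p by (simp add: R_def less_imp_le[OF ge_pos])
    have [measurable]: "R \<in> borel_measurable borel" unfolding R_def by measurable
    have RF: "complex_of_real (R p) = complex_of_real (ge \<eta> p) * (\<integral>Q. L Q * cis' (p \<bullet> (fst Q - snd Q)) \<partial>lborel)" for p
      unfolding eq[symmetric] R_def by (simp only: of_real_mult complex_norm_square)
    note gf = gauss_fubini[OF Li _ \<eta>, of "\<lambda>Q. fst Q - snd Q", folded RF]
    have Ri: "integrable lborel R"
      using integrable_Re[OF gf(1)] by simp
    have "ennreal (\<integral>p. R p \<partial>lborel) = ennreal (norm (\<integral>p. complex_of_real (R p) \<partial>lborel))"
      using R0 by (simp add: integral_nonneg)
    also have "\<dots> = ennreal (norm (\<integral>Q. L Q * complex_of_real (gk \<eta> (fst Q - snd Q)) \<partial>lborel))"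
      by (subst gf(2)) auto
    also have "\<dots> \<le> (\<integral>\<^sup>+Q. ennreal (norm (L Q * complex_of_real (gk \<eta> (fst Q - snd Q)))) \<partial>lborel)"
    proof (rule integral_norm_bound_ennreal)
      show "integrable lborel (\<lambda>Q. L Q * complex_of_real (gk \<eta> (fst Q - snd Q)))"
      proof (rule Bochner_Integration.integrable_bound[OF integrable_mult_left[OF Li, of "complex_of_real (sqrt (2 * pi / \<eta>) ^ DIM('a))"]])
        show "AE Q in lborel. norm (L Q * complex_of_real (gk \<eta> (fst Q - snd Q))) \<le> norm (L Q * complex_of_real (sqrt (2 * pi / \<eta>) ^ DIM('a)))"
          using gk_le[OF \<eta>, where 'a = 'a] gk_nonneg[OF \<eta>, where 'a = 'a] \<eta>
          by (auto simp: norm_mult norm_power intro!: mult_left_mono)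
      qed measurable
    qed
    also have "\<dots> = (\<integral>\<^sup>+q. \<integral>\<^sup>+q'. ennreal (norm (G q) * norm (G q') * gk \<eta> (q - q')) \<partial>lborel \<partial>lborel)"
    proof -
      have "(\<integral>\<^sup>+Q. ennreal (norm (L Q * complex_of_real (gk \<eta> (fst Q - snd Q)))) \<partial>lborel)
        = (\<integral>\<^sup>+Q. ennreal (norm (L Q * complex_of_real (gk \<eta> (fst Q - snd Q)))) \<partial>(lborel \<Otimes>\<^sub>M lborel))"
        by (simp only: lborel_prod)
      also have "\<dots> = (\<integral>\<^sup>+q. \<integral>\<^sup>+q'. ennreal (norm (L (q, q') * complex_of_real (gk \<eta> (fst (q, q') - snd (q, q'))))) \<partial>lborel \<partial>lborel)"
        by (subst lborel.nn_integral_fst[symmetric]) (simp_all add: lborel_prod)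
      finally show ?thesis using gk_nonneg[OF \<eta>, where 'a = 'a] by (simp add: L_def norm_mult)
    qed
    also have "\<dots> \<le> (\<integral>\<^sup>+q. \<integral>\<^sup>+q'. ennreal ((norm (G q))\<^sup>2 / 2) * ennreal (gk \<eta> (q - q')) + ennreal ((norm (G q'))\<^sup>2 / 2) * ennreal (gk \<eta> (q - q')) \<partial>lborel \<partial>lborel)"
    proof (intro nn_integral_mono)
      fix q q'
      have "norm (G q) * norm (G q') \<le> (norm (G q))\<^sup>2 / 2 + (norm (G q'))\<^sup>2 / 2"
        using sum_squares_bound[of "norm (G q)" "norm (G q')"] by simp
      then have "norm (G q) * norm (G q') * gk \<eta> (q - q') \<le> ((norm (G q))\<^sup>2 / 2 + (norm (G q'))\<^sup>2 / 2) * gk \<eta> (q - q')"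
        by (rule mult_right_mono) (rule gk_nonneg[OF \<eta>])
      then have "ennreal (norm (G q) * norm (G q') * gk \<eta> (q - q')) \<le> ennreal (((norm (G q))\<^sup>2 / 2 + (norm (G q'))\<^sup>2 / 2) * gk \<eta> (q - q'))"
        by (rule ennreal_leI)
      also have "\<dots> = ennreal ((norm (G q))\<^sup>2 / 2) * ennreal (gk \<eta> (q - q')) + ennreal ((norm (G q'))\<^sup>2 / 2) * ennreal (gk \<eta> (q - q'))"
      proof -
        have st: "ennreal ((a + b) * g) = ennreal a * ennreal g + ennreal b * ennreal g" if "a \<ge> 0" "b \<ge> 0" "g \<ge> 0" for a b g :: real
          using that by (simp add: distrib_right ennreal_mult)
        show ?thesis by (rule st) (auto intro: gk_nonneg[OF \<eta>])
      qed
      finally show "ennreal (norm (G q) * norm (G q') * gk \<eta> (q - q')) \<le> \<dots>" .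
    qed
    also have "\<dots> = (\<integral>\<^sup>+q. \<integral>\<^sup>+q'. ennreal ((norm (G q))\<^sup>2 / 2) * ennreal (gk \<eta> (q - q')) \<partial>lborel \<partial>lborel) +
        (\<integral>\<^sup>+q. \<integral>\<^sup>+q'. ennreal ((norm (G q'))\<^sup>2 / 2) * ennreal (gk \<eta> (q - q')) \<partial>lborel \<partial>lborel)"
      by (simp add: nn_integral_add)
    also have "(\<integral>\<^sup>+q. \<integral>\<^sup>+q'. ennreal ((norm (G q'))\<^sup>2 / 2) * ennreal (gk \<eta> (q - q')) \<partial>lborel \<partial>lborel)
       = (\<integral>\<^sup>+q'. \<integral>\<^sup>+q. ennreal ((norm (G q'))\<^sup>2 / 2) * ennreal (gk \<eta> (q - q')) \<partial>lborel \<partial>lborel)"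
      by (rule lborel_Fubini) measurable
    also have "(\<integral>\<^sup>+q. \<integral>\<^sup>+q'. ennreal ((norm (G q))\<^sup>2 / 2) * ennreal (gk \<eta> (q - q')) \<partial>lborel \<partial>lborel) = I / 2 * ennreal ((2 * pi) ^ DIM('a))"
    proof -
      have "(\<integral>\<^sup>+q. \<integral>\<^sup>+q'. ennreal ((norm (G q))\<^sup>2 / 2) * ennreal (gk \<eta> (q - q')) \<partial>lborel \<partial>lborel)
         = (\<integral>\<^sup>+q. ennreal ((norm (G q))\<^sup>2) / 2 * ennreal ((2 * pi) ^ DIM('a)) \<partial>lborel)"
        by (simp add: nn_integral_cmult gk_nn_integral[OF \<eta>] ennreal_divide_numeral)
      then show ?thesis by (simp add: nn_integral_multc nn_integral_divide I_def)
    qed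
    also have "(\<integral>\<^sup>+q'. \<integral>\<^sup>+q. ennreal ((norm (G q'))\<^sup>2 / 2) * ennreal (gk \<eta> (q - q')) \<partial>lborel \<partial>lborel) = I / 2 * ennreal ((2 * pi) ^ DIM('a))"
    proof -
      have s: "gk \<eta> (q - q') = gk \<eta> (q' - q)" for q q' :: 'a
        unfolding gk_def by (simp add: inner_diff_left inner_diff_right inner_commute algebra_simps)
      have "(\<integral>\<^sup>+q'. \<integral>\<^sup>+q. ennreal ((norm (G q'))\<^sup>2 / 2) * ennreal (gk \<eta> (q - q')) \<partial>lborel \<partial>lborel)
         = (\<integral>\<^sup>+q. ennreal ((norm (G q))\<^sup>2) / 2 * ennreal ((2 * pi) ^ DIM('a)) \<partial>lborel)"
        by (subst s) (simp add: nn_integral_cmult gk_nn_integral[OF \<eta>] ennreal_divide_numeral)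
      then show ?thesis by (simp add: nn_integral_multc nn_integral_divide I_def)
    qed
    also have "I / 2 * ennreal ((2 * pi) ^ DIM('a)) + I / 2 * ennreal ((2 * pi) ^ DIM('a)) = ennreal ((2 * pi) ^ DIM('a)) * I"
    proof -
      have "I / 2 + I / 2 = (I * 2) / 2" by (simp only: mult_2_right add_divide_distrib_ennreal)
      then have "I / 2 + I / 2 = I" by (simp add: ennreal_mult_divide_eq)
      then show ?thesis unfolding distrib_right[symmetric] by (simp only: mult.commute)
    qed
    finally have "ennreal (\<integral>p. R p \<partial>lborel) \<le> ennreal ((2 * pi) ^ DIM('a)) * I" .
    moreover have "(\<integral>\<^sup>+p. ennreal (R p) \<partial>lborel) = ennreal (\<integral>p. R p \<partial>lborel)"
      by (rule nn_integral_eq_integral[OF Ri]) (use R0 in auto)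
    ultimately show ?thesis by (simp only: R_def[symmetric])
  qed
  define e where "e k = 1 / real (Suc k)" for k
  have e0: "e \<longlonglongrightarrow> 0" unfolding e_def using LIMSEQ_inverse_real_of_nat by (simp add: inverse_eq_divide)
  have "(\<integral>\<^sup>+p. ennreal ((norm (ift G p))\<^sup>2) \<partial>lborel) = (\<integral>\<^sup>+p. liminf (\<lambda>k. ennreal (ge (e k) p * (norm (ift G p))\<^sup>2)) \<partial>lborel)"
  proof (intro nn_integral_cong)
    fix p
    have "(\<lambda>k. ennreal (ge (e k) p * (norm (ift G p))\<^sup>2)) \<longlonglongrightarrow> ennreal (1 * (norm (ift G p))\<^sup>2)"
      by (intro tendsto_intros ge_tendsto_1 e0)
    then show "ennreal ((norm (ift G p))\<^sup>2) = liminf (\<lambda>k. ennreal (ge (e k) p * (norm (ift G p))\<^sup>2))"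
      by (simp add: lim_imp_Liminf)
  qed
  also have "\<dots> \<le> liminf (\<lambda>k. \<integral>\<^sup>+p. ennreal (ge (e k) p * (norm (ift G p))\<^sup>2) \<partial>lborel)"
    by (rule nn_integral_liminf) measurable
  also have "\<dots> \<le> ennreal ((2 * pi) ^ DIM('a)) * I"
    using main by (intro Liminf_le) (auto simp: e_def)
  finally show ?thesis by (simp add: I_def)
qed

section \<open>Continuity of translations and convolution with Gaussians\<close>

lemma nn_integral_lborel_scale:
  fixes f :: "'a::euclidean_space \<Rightarrow> ennreal"
  assumes [measurable]: "f \<in> borel_measurable borel" and c: "c \<noteq> 0"
  shows "(\<integral>\<^sup>+x. f x \<partial>lborel) = ennreal (\<bar>c\<bar> ^ DIM('a)) * (\<integral>\<^sup>+x. f (c *\<^sub>R x) \<partial>lborel)"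
proof -
  have "(\<integral>\<^sup>+x. f x \<partial>lborel) = (\<integral>\<^sup>+x. f x \<partial>density (distr lborel borel (\<lambda>x. 0 + c *\<^sub>R x)) (\<lambda>_. ennreal (\<bar>c\<bar> ^ DIM('a))))"
    using lborel_affine[OF c, of "0::'a"] by simp
  also have "\<dots> = ennreal (\<bar>c\<bar> ^ DIM('a)) * (\<integral>\<^sup>+x. f (c *\<^sub>R x) \<partial>lborel)"
    by (simp add: nn_integral_density nn_integral_distr nn_integral_cmult)
  finally show ?thesis .
qed

lemma nn_integral_lborel_shift:
  fixes f :: "'a::euclidean_space \<Rightarrow> ennreal"
  assumes "f \<in> borel_measurable borel"
  shows "(\<integral>\<^sup>+x. f (x - c) \<partial>lborel) = (\<integral>\<^sup>+x. f x \<partial>lborel)"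
  using nn_integral_lborel_translate[OF assms, of "- c"] by simp

text \<open>A point of an open set stays in it after a small translation, so the integrand tends to
  0 pointwise. Finite measure supplies the dominating function.\<close>

lemma translation_open:
  fixes U :: "'a::euclidean_space set"
  assumes U: "open U" "emeasure lborel U < \<infinity>" and h: "h \<longlonglongrightarrow> 0"
  shows "(\<lambda>k. \<integral>\<^sup>+p. indicator U p * (1 - indicator U (p - h k)) \<partial>lborel) \<longlonglongrightarrow> 0"
proof -
  have [measurable]: "U \<in> sets borel" using U by auto
  have "(\<lambda>k. \<integral>\<^sup>+p. indicator U p * (1 - indicator U (p - h k)) \<partial>lborel) \<longlonglongrightarrow> (\<integral>\<^sup>+p. 0 \<partial>(lborel :: 'a measure))"
  proof (rule nn_integral_dominated_convergence[where w = "indicator U"])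
    show "AE p in lborel. (\<lambda>k. indicator U p * (1 - indicator U (p - h k))) \<longlonglongrightarrow> (0::ennreal)"
    proof (rule AE_I2)
      fix p :: 'a
      show "(\<lambda>k. indicator U p * (1 - indicator U (p - h k))) \<longlonglongrightarrow> (0::ennreal)"
      proof (cases "p \<in> U")
        case True
        have "(\<lambda>k. p - h k) \<longlonglongrightarrow> p - 0" by (intro tendsto_intros h)
        then have "\<forall>\<^sub>F k in sequentially. p - h k \<in> U" using topological_tendstoD[OF _ U(1)] True by simp
        then have "\<forall>\<^sub>F k in sequentially. indicator U p * (1 - indicator U (p - h k)) = (0::ennreal)"
          by eventually_elim simp
        then show ?thesis by (rule tendsto_eventually)
      qed simp
    qed
    show "(\<integral>\<^sup>+p. indicator U p \<partial>lborel) < \<infinity>" using U(2) by (subst nn_integral_indicator) auto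
  qed (auto simp: indicator_def)
  then show ?thesis by simp
qed

lemma tendsto_0_ennrealI:
  fixes X :: "nat \<Rightarrow> ennreal"
  assumes "\<And>e. e > 0 \<Longrightarrow> \<forall>\<^sub>F k in sequentially. X k \<le> ennreal e"
  shows "X \<longlonglongrightarrow> 0"
proof (rule order_tendstoI)
  fix a :: ennreal assume "0 < a"
  then obtain x where x: "0 < x" "x < a" using dense by blast
  then have "x \<noteq> \<top>" by (metis not_top_less top.not_eq_extremum top_greatest leD)
  then obtain r where r: "x = ennreal r" "r \<ge> 0" by (metis ennreal_cases)
  then have "r > 0" using x by auto
  from assms[OF this] show "\<forall>\<^sub>F k in sequentially. X k < a"
    by eventually_elim (use x r in auto)
qed (simp add: not_less)

definition tr :: "('a::euclidean_space \<Rightarrow> complex) \<Rightarrow> 'a \<Rightarrow> ennreal" where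
  "tr f h = (\<integral>\<^sup>+p. ennreal (norm (f (p - h) - f p)) \<partial>lborel)"

lemma tr_add:
  assumes [measurable]: "f \<in> borel_measurable borel" "g \<in> borel_measurable borel"
  shows "tr (\<lambda>x. f x + g x) h \<le> tr f h + tr g h"
proof -
  have "tr (\<lambda>x. f x + g x) h \<le> (\<integral>\<^sup>+p. ennreal (norm (f (p - h) - f p)) + ennreal (norm (g (p - h) - g p)) \<partial>lborel)"
    unfolding tr_def
  proof (intro nn_integral_mono)
    fix p
    have "norm (f (p - h) + g (p - h) - (f p + g p)) \<le> norm (f (p - h) - f p) + norm (g (p - h) - g p)"
      using norm_triangle_ineq[of "f (p - h) - f p" "g (p - h) - g p"] by (simp add: algebra_simps)
    then show "ennreal (norm (f (p - h) + g (p - h) - (f p + g p))) \<le> ennreal (norm (f (p - h) - f p)) + ennreal (norm (g (p - h) - g p))"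
      by (simp add: ennreal_plus[symmetric] ennreal_leI del: ennreal_plus)
  qed
  also have "\<dots> = tr f h + tr g h" unfolding tr_def by (rule nn_integral_add) measurable
  finally show ?thesis .
qed

lemma tr_le:
  assumes [measurable]: "f \<in> borel_measurable borel"
  shows "tr f h \<le> 2 * (\<integral>\<^sup>+p. ennreal (norm (f p)) \<partial>lborel)"
proof -
  have "tr f h \<le> (\<integral>\<^sup>+p. ennreal (norm (f (p - h))) + ennreal (norm (f p)) \<partial>lborel)"
    unfolding tr_def
    by (intro nn_integral_mono) (simp add: ennreal_plus[symmetric] ennreal_leI norm_triangle_ineq4 del: ennreal_plus)
  also have "\<dots> = (\<integral>\<^sup>+p. ennreal (norm (f (p - h))) \<partial>lborel) + (\<integral>\<^sup>+p. ennreal (norm (f p)) \<partial>lborel)"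
    by (rule nn_integral_add) measurable
  also have "(\<integral>\<^sup>+p. ennreal (norm (f (p - h))) \<partial>lborel) = (\<integral>\<^sup>+p. ennreal (norm (f p)) \<partial>lborel)"
    by (rule nn_integral_lborel_shift) measurable
  finally show ?thesis by (simp add: mult_2)
qed

text \<open>Induction over integrable functions. A set is approximated from outside by an open set,
  where \<open>translation_open\<close> applies in both directions of translation; sums follow from
  subadditivity of \<open>tr\<close>, and limits from its bound by twice the L1 norm.\<close>

lemma L1_translation:
  fixes f :: "'a::euclidean_space \<Rightarrow> complex"
  assumes "integrable lborel f" and h: "h \<longlonglongrightarrow> 0"
  shows "(\<lambda>k. tr f (h k)) \<longlonglongrightarrow> 0"
  using assms(1)
proof (induction rule: integrable_induct)
  case (base A c)
  have [measurable]: "A \<in> sets borel" using base by simp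
  show ?case
  proof (rule tendsto_0_ennrealI)
    fix e :: real assume e: "e > 0"
    \<comment> \<open>The estimate below adds up three terms of size \<open>d\<close>: one for the
      two translation errors of \<open>U\<close> together, and one each for \<open>U - A\<close> and
      its translate. The \<open>+ 1\<close> avoids a division by zero.\<close>
    define d where "d = e / (4 * (norm c + 1))"
    have nc: "norm c + 1 > 0" using norm_ge_zero[of c] by linarith
    have "norm c * (4 * d) = e * (norm c / (norm c + 1))" using nc by (simp add: d_def field_simps)
    also have "\<dots> \<le> e * 1" using e nc by (intro mult_left_mono) auto
    finally have d: "norm c * (4 * d) \<le> e" "d > 0" using e nc by (auto simp: d_def)
    obtain U where U: "open U" "A \<subseteq> U" "emeasure lborel (U - A) < d" using outer_regular_lborel[of A d] d by auto
    have [measurable]: "U \<in> sets borel" using U by auto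
    have "emeasure lborel U = emeasure lborel A + emeasure lborel (U - A)"
      using U by (subst plus_emeasure) (auto intro!: arg_cong[of _ _ "emeasure lborel"])
    also have "\<dots> < \<infinity>" using base U(3) by (simp add: less_top[symmetric]) (metis ennreal_less_top less_trans less_irrefl)
    finally have Uf: "emeasure lborel U < \<infinity>" .
    have h': "(\<lambda>k. - h k) \<longlonglongrightarrow> 0" using tendsto_minus[OF h] by simp
    have "(\<lambda>k. (\<integral>\<^sup>+p. indicator U p * (1 - indicator U (p - h k)) \<partial>lborel) + (\<integral>\<^sup>+p. indicator U p * (1 - indicator U (p - - h k)) \<partial>lborel)) \<longlonglongrightarrow> 0 + 0"
      by (intro tendsto_add translation_open U Uf h h')
    then have "\<forall>\<^sub>F k in sequentially. (\<integral>\<^sup>+p. indicator U p * (1 - indicator U (p - h k)) \<partial>lborel) + (\<integral>\<^sup>+p. indicator U p * (1 - indicator U (p - - h k)) \<partial>lborel) < ennreal d"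
      using d by (intro order_tendstoD(2)[where y = "0 + 0"]) auto
    then show "\<forall>\<^sub>F k in sequentially. tr (\<lambda>x. indicator A x *\<^sub>R c) (h k) \<le> ennreal e"
    proof eventually_elim
      case (elim k)
      have "tr (\<lambda>x. indicator A x *\<^sub>R c) (h k) \<le> (\<integral>\<^sup>+p. ennreal (norm c) * ((indicator U p * (1 - indicator U (p - h k)) + indicator U (p - h k) * (1 - indicator U p)) + (indicator (U - A) (p - h k) + indicator (U - A) p)) \<partial>lborel)"
        unfolding tr_def using U(2) by (intro nn_integral_mono) (auto simp: indicator_def)
      also have "\<dots> = ennreal (norm c) * (((\<integral>\<^sup>+p. indicator U p * (1 - indicator U (p - h k)) \<partial>lborel) + (\<integral>\<^sup>+p. indicator U (p - h k) * (1 - indicator U p) \<partial>lborel)) + ((\<integral>\<^sup>+p. indicator (U - A) (p - h k) \<partial>lborel) + emeasure lborel (U - A)))"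
        by (subst nn_integral_cmult, measurable)+ (simp add: nn_integral_add)
      also have "(\<integral>\<^sup>+p. indicator U (p - h k) * (1 - indicator U p) \<partial>lborel) = (\<integral>\<^sup>+p. indicator U p * (1 - indicator U (p - - h k)) \<partial>lborel)"
        using nn_integral_lborel_shift[of "\<lambda>p. indicator U p * (1 - indicator U (p + h k))" "h k"] by simp
      also have "(\<integral>\<^sup>+p. indicator (U - A) (p - h k) \<partial>lborel) = emeasure lborel (U - A)"
        by (subst nn_integral_lborel_shift) auto
      also have "ennreal (norm c) * (((\<integral>\<^sup>+p. indicator U p * (1 - indicator U (p - h k)) \<partial>lborel) + (\<integral>\<^sup>+p. indicator U p * (1 - indicator U (p - - h k)) \<partial>lborel)) + (emeasure lborel (U - A) + emeasure lborel (U - A)))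
        \<le> ennreal (norm c) * (ennreal d + (ennreal d + ennreal d))"
        using elim U(3) by (intro mult_left_mono add_mono) auto
      also have "ennreal d + (ennreal d + ennreal d) = ennreal (3 * d)" using d by (simp flip: ennreal_plus)
      also have "ennreal (norm c) * ennreal (3 * d) = ennreal (norm c * (3 * d))" using d by (intro ennreal_mult[symmetric]) auto
      also have "\<dots> \<le> ennreal e" using d by (intro ennreal_leI order_trans[OF mult_left_mono[of "3 * d" "4 * d" "norm c"] d(1)]) auto
      finally show ?case .
    qed
  qed
next
  case (add f g)
  have [measurable]: "f \<in> borel_measurable borel" "g \<in> borel_measurable borel" using add by auto
  have "(\<lambda>k. tr f (h k) + tr g (h k)) \<longlonglongrightarrow> 0 + 0" by (intro tendsto_add add)
  then have s: "(\<lambda>k. tr f (h k) + tr g (h k)) \<longlonglongrightarrow> 0" by simp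
  show ?case
    by (rule tendsto_sandwich[OF _ _ tendsto_const s]) (auto intro!: always_eventually tr_add)
next
  case (lim f s)
  have [measurable]: "f \<in> borel_measurable borel" "\<And>i. s i \<in> borel_measurable borel" using lim by auto
  define d where "d i = (\<integral>\<^sup>+p. ennreal (norm (f p - s i p)) \<partial>lborel)" for i
  have "d \<longlonglongrightarrow> (\<integral>\<^sup>+p. 0 \<partial>(lborel :: 'a measure))"
    unfolding d_def
  proof (rule nn_integral_dominated_convergence[where w = "\<lambda>p. ennreal (3 * norm (f p))"])
    show "AE p in lborel. ennreal (norm (f p - s i p)) \<le> ennreal (3 * norm (f p))" for i
    proof (intro AE_I2 ennreal_leI)
      fix p show "norm (f p - s i p) \<le> 3 * norm (f p)"
      proof -
        have "norm (s i p) \<le> 2 * norm (f p)" by (rule lim.hyps(3)) simp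
        then show ?thesis using norm_triangle_ineq4[of "f p" "s i p"] by linarith
      qed
    qed
    show "AE p in lborel. (\<lambda>i. ennreal (norm (f p - s i p))) \<longlonglongrightarrow> 0"
    proof (rule AE_I2)
      fix p
      have "(\<lambda>i. ennreal (norm (f p - s i p))) \<longlonglongrightarrow> ennreal (norm (f p - f p))"
        by (intro tendsto_intros lim) simp
      then show "(\<lambda>i. ennreal (norm (f p - s i p))) \<longlonglongrightarrow> 0" by simp
    qed
    have "(\<integral>\<^sup>+p. ennreal (3 * norm (f p)) \<partial>lborel) = 3 * (\<integral>\<^sup>+p. ennreal (norm (f p)) \<partial>lborel)"
      by (simp add: ennreal_mult nn_integral_cmult)
    also have "\<dots> < \<infinity>" using lim.hyps(4) unfolding integrable_iff_bounded by (simp add: ennreal_mult_less_top)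
    finally show "(\<integral>\<^sup>+p. ennreal (3 * norm (f p)) \<partial>lborel) < \<infinity>" .
  qed measurable
  then have d0: "d \<longlonglongrightarrow> 0" by simp
  show ?case
  proof (rule tendsto_0_ennrealI)
    fix e :: real assume e: "e > 0"
    then have "\<forall>\<^sub>F i in sequentially. d i < ennreal (e / 4)" by (intro order_tendstoD(2)[OF d0]) auto
    then obtain i where i: "d i < ennreal (e / 4)" by (auto simp: eventually_sequentially)
    have "\<forall>\<^sub>F k in sequentially. tr (s i) (h k) < ennreal (e / 2)"
      using e by (intro order_tendstoD(2)[OF lim.IH]) auto
    then show "\<forall>\<^sub>F k in sequentially. tr f (h k) \<le> ennreal e"
    proof eventually_elim
      case (elim k)
      have "tr f (h k) \<le> tr (s i) (h k) + tr (\<lambda>p. f p - s i p) (h k)"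
        using tr_add[of "s i" "\<lambda>p. f p - s i p" "h k"] by simp
      also have "tr (\<lambda>p. f p - s i p) (h k) \<le> 2 * d i" unfolding d_def by (rule tr_le) measurable
      also have "tr (s i) (h k) + 2 * d i \<le> ennreal (e / 2) + 2 * ennreal (e / 4)"
        using elim i by (intro add_mono mult_left_mono) auto
      also have "\<dots> = ennreal e"
      proof -
        have "2 * ennreal (e / 4) = ennreal (e / 2)" using e by (subst mult_2, subst ennreal_plus[symmetric]) auto
        then show ?thesis using e by (simp add: ennreal_plus[symmetric] del: ennreal_plus)
      qed
      finally show ?case by (simp add: add_left_mono)
    qed
  qed
qed

definition gn :: "real \<Rightarrow> 'a::euclidean_space \<Rightarrow> real" where
  "gn \<epsilon> z = gk \<epsilon> z / (2 * pi) ^ DIM('a)"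

lemma gn_measurable[measurable]: "gn \<epsilon> \<in> borel_measurable borel" unfolding gn_def by measurable
lemma gn_nonneg: "\<epsilon> > 0 \<Longrightarrow> gn \<epsilon> z \<ge> 0" by (simp add: gn_def gk_nonneg)

lemma gn_nn_integral: "\<epsilon> > 0 \<Longrightarrow> (\<integral>\<^sup>+z. ennreal (gn \<epsilon> (c - (z::'a::euclidean_space))) \<partial>lborel) = 1"
proof -
  assume \<epsilon>: "\<epsilon> > 0"
  have "(\<integral>\<^sup>+z. ennreal (gn \<epsilon> (c - (z::'a))) \<partial>lborel) = (\<integral>\<^sup>+z. ennreal (gk \<epsilon> (c - (z::'a))) * ennreal (1 / (2 * pi) ^ DIM('a)) \<partial>lborel)"
    using gk_nonneg[OF \<epsilon>, where 'a = 'a] by (intro nn_integral_cong) (simp only: gn_def divide_inverse mult_1 ennreal_mult')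
  also have "\<dots> = ennreal ((2 * pi) ^ DIM('a)) * ennreal (1 / (2 * pi) ^ DIM('a))"
    by (subst nn_integral_multc) (simp_all only: gk_nn_integral[OF \<epsilon>], measurable)
  also have "\<dots> = ennreal ((2 * pi) ^ DIM('a) * (1 / (2 * pi) ^ DIM('a)))" by (rule ennreal_mult[symmetric]) simp_all
  also have "(2 * pi) ^ DIM('a) * (1 / (2 * pi) ^ DIM('a)) = 1" by simp
  finally show ?thesis by simp
qed

lemma gn_scale:
  assumes "\<epsilon> > 0"
  shows "sqrt \<epsilon> ^ DIM('a) * gn \<epsilon> (sqrt \<epsilon> *\<^sub>R (z::'a::euclidean_space)) = gn 1 z"
proof -
  have "sqrt \<epsilon> ^ DIM('a) * sqrt (2 * pi / \<epsilon>) ^ DIM('a) = sqrt (2 * pi) ^ DIM('a)"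
    using assms by (simp add: power_mult_distrib[symmetric] real_sqrt_mult[symmetric])
  moreover have "- ((sqrt \<epsilon> *\<^sub>R z) \<bullet> (sqrt \<epsilon> *\<^sub>R z)) / (2 * \<epsilon>) = - (z \<bullet> z) / 2"
    using assms by (simp add: mult.assoc[symmetric])
  ultimately show ?thesis unfolding gn_def gk_def by (simp add: mult.assoc[symmetric])
qed

text \<open>Translation costs half of the exponent: the squared norm of p + h is at least half that
  of p minus that of h, which restates that the squared norm of p + 2h is nonnegative.\<close>

lemma ge_shift:
  assumes "c \<ge> 0"
  shows "ge c (p + h) \<le> exp (c * (h \<bullet> h) / 2) * ge (c / 2) p"
proof -
  define x y z where "x = p \<bullet> p" "y = p \<bullet> h" "z = h \<bullet> h"
  have "0 \<le> (p + 2 *\<^sub>R h) \<bullet> (p + 2 *\<^sub>R h)" by simp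
  also have "\<dots> = x + 4 * y + 4 * z"
    by (simp add: inner_add_left inner_add_right inner_commute[of h p] x_y_z_def)
  finally have "0 \<le> c * (x + 4 * y + 4 * z)" using assms by simp
  then have 1: "0 \<le> c * x + 4 * (c * y) + 4 * (c * z)" by (simp add: algebra_simps)
  have "(p + h) \<bullet> (p + h) = x + 2 * y + z"
    by (simp add: inner_add_left inner_add_right inner_commute[of h p] x_y_z_def)
  then have 2: "c * ((p + h) \<bullet> (p + h)) = c * x + 2 * (c * y) + c * z" by (simp add: algebra_simps)
  have "- c * ((p + h) \<bullet> (p + h)) / 2 \<le> c * z / 2 + - (c / 2) * x / 2" using 1 2 by simp
  then show ?thesis unfolding ge_def exp_add[symmetric] x_y_z_def(1,3)[symmetric] by simp
qed

text \<open>As \<open>u\<close> is integrable only against Gaussians, convergence is proved in L1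
  with the weight \<open>ge 1\<close>; a subsequence then converges almost everywhere. The weighted
  modulus of continuity \<open>\<Omega>\<close> is allowed to grow like
  \<open>exp ((h \<bullet> h) / 2)\<close>. After rescaling h by \<open>sqrt (e k)\<close>, the
  assumption \<open>e k \<le> 1/2\<close> lets half of the Gaussian exponent absorb this
  growth.\<close>

lemma gauss_conv_AE:
  fixes u :: "'a::euclidean_space \<Rightarrow> complex" and e :: "nat \<Rightarrow> real"
  assumes um[measurable]: "u \<in> borel_measurable borel"
    and ug: "\<And>c. c > 0 \<Longrightarrow> integrable lborel (\<lambda>p. u p * complex_of_real (ge c p))"
    and e: "\<And>k. 0 < e k" "\<And>k. e k \<le> 1/2" "e \<longlonglongrightarrow> 0"
  shows "\<And>\<epsilon> p. \<epsilon> > 0 \<Longrightarrow> integrable lborel (\<lambda>q. u q * complex_of_real (gn \<epsilon> (p - q)))"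
    and "\<exists>r::nat\<Rightarrow>nat. strict_mono r \<and> (AE p in lborel. (\<lambda>k. \<integral>q. u q * complex_of_real (gn (e (r k)) (p - q)) \<partial>lborel) \<longlonglongrightarrow> u p)"
proof -
  show ui: "integrable lborel (\<lambda>q. u q * complex_of_real (gn \<epsilon> (p - q)))" if \<epsilon>: "\<epsilon> > 0" for \<epsilon> p
  proof -
    define C where "C = sqrt (2 * pi / \<epsilon>) ^ DIM('a) / (2 * pi) ^ DIM('a) * exp (1 / \<epsilon> * (p \<bullet> p) / 2)"
    have b: "gn \<epsilon> (p - q) \<le> C * ge (1 / \<epsilon> / 2) q" for q
    proof -
      have "ge (1 / \<epsilon>) (p - q) = ge (1 / \<epsilon>) (q + - p)" unfolding ge_def by (simp add: inner_diff_left inner_diff_right inner_commute)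
      also have "\<dots> \<le> exp (1 / \<epsilon> * (p \<bullet> p) / 2) * ge (1 / \<epsilon> / 2) q" using ge_shift[of "1 / \<epsilon>" q "- p"] \<epsilon> by simp
      finally have "ge (1 / \<epsilon>) (p - q) \<le> exp (1 / \<epsilon> * (p \<bullet> p) / 2) * ge (1 / \<epsilon> / 2) q" .
      then have "sqrt (2 * pi / \<epsilon>) ^ DIM('a) / (2 * pi) ^ DIM('a) * ge (1 / \<epsilon>) (p - q) \<le> sqrt (2 * pi / \<epsilon>) ^ DIM('a) / (2 * pi) ^ DIM('a) * (exp (1 / \<epsilon> * (p \<bullet> p) / 2) * ge (1 / \<epsilon> / 2) q)"
        using \<epsilon> by (intro mult_left_mono) auto
      then show ?thesis using \<epsilon> by (simp add: gn_def gk_eq_ge C_def mult.assoc)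
    qed
    have C0: "C \<ge> 0" using \<epsilon> by (simp add: C_def)
    show ?thesis
    proof (rule Bochner_Integration.integrable_bound[OF integrable_mult_right[OF ug[of "1 / \<epsilon> / 2"], of "complex_of_real C"]])
      show "AE q in lborel. norm (u q * complex_of_real (gn \<epsilon> (p - q))) \<le> norm (complex_of_real C * (u q * complex_of_real (ge (1 / \<epsilon> / 2) q)))"
      proof (rule AE_I2)
        fix q
        have "norm (u q) * gn \<epsilon> (p - q) \<le> norm (u q) * (C * ge (1 / \<epsilon> / 2) q)" by (intro mult_left_mono b) simp
        then show "norm (u q * complex_of_real (gn \<epsilon> (p - q))) \<le> norm (complex_of_real C * (u q * complex_of_real (ge (1 / \<epsilon> / 2) q)))"
          using gn_nonneg[OF \<epsilon>, of "p - q"] C0 ge_pos[of "1 / \<epsilon> / 2" q] by (simp add: norm_mult mult_ac)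
      qed
    qed (use \<epsilon> in auto)
  qed
  define f where "f p = u p * complex_of_real (ge 1 p)" for p
  have fi: "integrable lborel f" using ug[of 1] by (simp add: f_def[abs_def])
  have [measurable]: "f \<in> borel_measurable borel" unfolding f_def by measurable
  define \<Omega> where "\<Omega> h = (\<integral>\<^sup>+p. ennreal (norm (u (p - h) - u p) * ge 1 p) \<partial>lborel)" for h
  have [measurable]: "\<Omega> \<in> borel_measurable borel" unfolding \<Omega>_def by measurable
  define J where "J h = (\<integral>\<^sup>+p. ennreal (norm (u p) * \<bar>ge 1 (p + h) - ge 1 p\<bar>) \<partial>lborel)" for h
  define C1 where "C1 = (\<integral>\<^sup>+p. ennreal (norm (u p) * ge (1/2) p) \<partial>lborel)"
  have C1: "C1 < \<infinity>"
    using ug[of "1/2"] unfolding integrable_iff_bounded C1_def by (simp add: norm_mult less_imp_le[OF ge_pos])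
  \<comment> \<open>The weight is moved inside the difference. This leaves the plain modulus of the
    integrable function \<open>f\<close> and a term \<open>J\<close> caused by the variation of the
    weight.\<close>
  have \<Omega>J: "\<Omega> h \<le> tr f h + J h" for h
  proof -
    have "\<Omega> h \<le> (\<integral>\<^sup>+p. ennreal (norm (f (p - h) - f p)) + ennreal (norm (u (p - h)) * \<bar>ge 1 p - ge 1 (p - h)\<bar>) \<partial>lborel)"
      unfolding \<Omega>_def
    proof (intro nn_integral_mono)
      fix p
      have "(u (p - h) - u p) * complex_of_real (ge 1 p) = (f (p - h) - f p) + u (p - h) * complex_of_real (ge 1 p - ge 1 (p - h))"
        by (simp add: f_def algebra_simps)
      then have "norm ((u (p - h) - u p) * complex_of_real (ge 1 p)) \<le> norm (f (p - h) - f p) + norm (u (p - h) * complex_of_real (ge 1 p - ge 1 (p - h)))"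
        using norm_triangle_ineq by metis
      then have "norm (u (p - h) - u p) * ge 1 p \<le> norm (f (p - h) - f p) + norm (u (p - h)) * \<bar>ge 1 p - ge 1 (p - h)\<bar>"
        using ge_pos[of 1 p] by (simp only: norm_mult norm_of_real)
      then show "ennreal (norm (u (p - h) - u p) * ge 1 p) \<le> ennreal (norm (f (p - h) - f p)) + ennreal (norm (u (p - h)) * \<bar>ge 1 p - ge 1 (p - h)\<bar>)"
        by (simp add: ennreal_plus[symmetric] ennreal_leI del: ennreal_plus)
    qed
    also have "\<dots> = tr f h + (\<integral>\<^sup>+p. ennreal (norm (u (p - h)) * \<bar>ge 1 p - ge 1 (p - h)\<bar>) \<partial>lborel)"
      unfolding tr_def by (rule nn_integral_add) measurable
    also have "(\<integral>\<^sup>+p. ennreal (norm (u (p - h)) * \<bar>ge 1 p - ge 1 (p - h)\<bar>) \<partial>lborel) = J h"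
      unfolding J_def using nn_integral_lborel_shift[of "\<lambda>p. ennreal (norm (u p) * \<bar>ge 1 (p + h) - ge 1 p\<bar>)" h] by simp
    finally show ?thesis .
  qed
  have geb: "\<bar>ge 1 (p + h) - ge 1 p\<bar> \<le> (exp ((h \<bullet> h) / 2) + 1) * ge (1/2) p" for p h :: 'a
  proof -
    have "ge 1 (p + h) \<le> exp ((h \<bullet> h) / 2) * ge (1/2) p" using ge_shift[of 1 p h] by simp
    moreover have "ge 1 p \<le> ge (1/2) p" by (simp add: ge_def)
    moreover have "ge 1 (p + h) > 0" "ge 1 p > 0" by (rule ge_pos)+
    ultimately show ?thesis unfolding distrib_right abs_le_iff by linarith
  qed
  have J0: "(\<lambda>k. J (h k)) \<longlonglongrightarrow> 0" if h: "h \<longlonglongrightarrow> 0" for h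
  proof -
    have "(\<lambda>k. (h k \<bullet> h k) / 2) \<longlonglongrightarrow> ((0::'a) \<bullet> 0) / 2" by (intro tendsto_divide tendsto_inner h tendsto_const) simp
    then have "(\<lambda>k. exp ((h k \<bullet> h k) / 2)) \<longlonglongrightarrow> exp (((0::'a) \<bullet> 0) / 2)" by (rule tendsto_exp)
    \<comment> \<open>A convergent sequence of translations has bounded length, so one constant
      \<open>K\<close> serves for the dominating function.\<close>
    then have "Bseq (\<lambda>k. exp ((h k \<bullet> h k) / 2))" by (rule convergent_imp_Bseq[OF convergentI])
    then obtain K where K: "\<And>k. norm (exp ((h k \<bullet> h k) / 2)) \<le> K" by (auto simp: Bseq_def)
    have K': "\<bar>ge 1 (p + h k) - ge 1 p\<bar> \<le> (K + 1) * ge (1/2) p" for p k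
      using K[of k] by (intro order_trans[OF geb] mult_right_mono) (auto simp: less_imp_le[OF ge_pos])
    have "(\<lambda>k. J (h k)) \<longlonglongrightarrow> (\<integral>\<^sup>+p. 0 \<partial>(lborel :: 'a measure))"
      unfolding J_def
    proof (rule nn_integral_dominated_convergence[where w = "\<lambda>p. ennreal (norm (u p) * ((K + 1) * ge (1/2) p))"])
      show "AE p in lborel. ennreal (norm (u p) * \<bar>ge 1 (p + h k) - ge 1 p\<bar>) \<le> ennreal (norm (u p) * ((K + 1) * ge (1/2) p))" for k
        by (intro AE_I2 ennreal_leI mult_left_mono K') simp
      have K0: "K + 1 \<ge> 0" using K[of 0] by (smt (verit) norm_ge_zero)
      have "(\<integral>\<^sup>+p. ennreal (norm (u p) * ((K + 1) * ge (1/2) p)) \<partial>lborel) = (\<integral>\<^sup>+p. ennreal (K + 1) * ennreal (norm (u p) * ge (1/2) p) \<partial>lborel)"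
        using K0 by (intro nn_integral_cong) (simp add: ennreal_mult'[symmetric] mult_ac)
      also have "\<dots> = ennreal (K + 1) * C1" unfolding C1_def by (rule nn_integral_cmult) measurable
      also have "\<dots> < \<infinity>" using C1 by (simp add: ennreal_mult_less_top)
      finally show "(\<integral>\<^sup>+p. ennreal (norm (u p) * ((K + 1) * ge (1/2) p)) \<partial>lborel) < \<infinity>" .
      show "AE p in lborel. (\<lambda>k. ennreal (norm (u p) * \<bar>ge 1 (p + h k) - ge 1 p\<bar>)) \<longlonglongrightarrow> 0"
      proof (rule AE_I2)
        fix p
        have "(\<lambda>k. ennreal (norm (u p) * \<bar>ge 1 (p + h k) - ge 1 p\<bar>)) \<longlonglongrightarrow> ennreal (norm (u p) * \<bar>ge 1 (p + 0) - ge 1 p\<bar>)"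
          unfolding ge_def by (intro tendsto_intros h) simp
        then show "(\<lambda>k. ennreal (norm (u p) * \<bar>ge 1 (p + h k) - ge 1 p\<bar>)) \<longlonglongrightarrow> 0" by simp
      qed
    qed measurable
    then show ?thesis by simp
  qed
  have \<Omega>0: "(\<lambda>k. \<Omega> (h k)) \<longlonglongrightarrow> 0" if h: "h \<longlonglongrightarrow> 0" for h
  proof -
    have "(\<lambda>k. tr f (h k) + J (h k)) \<longlonglongrightarrow> 0 + 0" by (intro tendsto_add L1_translation fi J0 h)
    then have s: "(\<lambda>k. tr f (h k) + J (h k)) \<longlonglongrightarrow> 0" by simp
    show ?thesis
      by (rule tendsto_sandwich[OF _ _ tendsto_const s]) (auto intro!: always_eventually \<Omega>J)
  qed
  have \<Omega>b: "\<Omega> h \<le> ennreal (exp ((h \<bullet> h) / 2)) * (4 * C1)" for h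
  proof -
    have "tr f h \<le> 2 * (\<integral>\<^sup>+p. ennreal (norm (f p)) \<partial>lborel)" by (rule tr_le) measurable
    also have "(\<integral>\<^sup>+p. ennreal (norm (f p)) \<partial>lborel) \<le> C1"
      unfolding C1_def f_def
      by (intro nn_integral_mono ennreal_leI) (auto simp: norm_mult less_imp_le[OF ge_pos] ge_def intro!: mult_left_mono)
    finally have 1: "tr f h \<le> 2 * C1" by (simp add: mult_left_mono)
    have "J h \<le> (\<integral>\<^sup>+p. ennreal (exp ((h \<bullet> h) / 2) + 1) * ennreal (norm (u p) * ge (1/2) p) \<partial>lborel)"
      unfolding J_def
    proof (intro nn_integral_mono)
      fix p
      have "norm (u p) * \<bar>ge 1 (p + h) - ge 1 p\<bar> \<le> norm (u p) * ((exp ((h \<bullet> h) / 2) + 1) * ge (1/2) p)"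
        by (intro mult_left_mono geb) simp
      then have "ennreal (norm (u p) * \<bar>ge 1 (p + h) - ge 1 p\<bar>) \<le> ennreal ((exp ((h \<bullet> h) / 2) + 1) * (norm (u p) * ge (1/2) p))"
        by (intro ennreal_leI) (simp add: mult_ac)
      also have "\<dots> = ennreal (exp ((h \<bullet> h) / 2) + 1) * ennreal (norm (u p) * ge (1/2) p)" by (rule ennreal_mult') (simp add: add_nonneg_nonneg)
      finally show "ennreal (norm (u p) * \<bar>ge 1 (p + h) - ge 1 p\<bar>) \<le> \<dots>" .
    qed
    also have "\<dots> = ennreal (exp ((h \<bullet> h) / 2) + 1) * C1" unfolding C1_def by (rule nn_integral_cmult) measurable
    finally have "\<Omega> h \<le> 2 * C1 + ennreal (exp ((h \<bullet> h) / 2) + 1) * C1" using \<Omega>J[of h] 1 by (meson add_mono order_trans)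
    also have "\<dots> = ennreal (exp ((h \<bullet> h) / 2) + 3) * C1"
    proof -
      have "ennreal (exp ((h \<bullet> h) / 2) + 3) = 2 + ennreal (exp ((h \<bullet> h) / 2) + 1)"
        by (simp add: ennreal_plus[symmetric] add_nonneg_nonneg del: ennreal_plus flip: ennreal_numeral)
      then show ?thesis by (simp only: distrib_right)
    qed
    also have "\<dots> \<le> ennreal (exp ((h \<bullet> h) / 2) * 4) * C1"
      by (intro mult_right_mono ennreal_leI) auto
    also have "\<dots> = ennreal (exp ((h \<bullet> h) / 2)) * (4 * C1)"
      by (simp add: ennreal_mult mult.assoc)
    finally show ?thesis .
  qed
  define v where "v k p = (\<integral>q. u q * complex_of_real (gn (e k) (p - q)) \<partial>lborel)" for k p
  have vm[measurable]: "v k \<in> borel_measurable borel" for k unfolding v_def by measurable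
  \<comment> \<open>Since \<open>gn\<close> has mass 1, \<open>v k p - u p\<close> is an average of
    the differences \<open>u (p - h) - u p\<close>. After Fubini the inner integral is
    \<open>\<Omega> h\<close>, and the rescaling makes the Gaussian independent of
    \<open>k\<close>.\<close>
  have D: "(\<integral>\<^sup>+p. ennreal (norm (v k p - u p) * ge 1 p) \<partial>lborel) \<le> (\<integral>\<^sup>+z. ennreal (gn 1 z) * \<Omega> (sqrt (e k) *\<^sub>R z) \<partial>lborel)" for k
  proof -
    note ek = e(1)[of k]
    have gi: "integrable lborel (\<lambda>q. complex_of_real (gn (e k) (p - q)))" for p :: 'a
    proof -
      have "integrable lborel (\<lambda>q. gn (e k) (p - q))"
        unfolding integrable_iff_bounded using gn_nonneg[OF ek, where 'a = 'a] gn_nn_integral[OF ek, of p] by simp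
      then show ?thesis by simp
    qed
    have g1: "(\<integral>q. gn (e k) (p - q) \<partial>lborel) = 1" for p :: 'a
    proof -
      have "(\<integral>q. gn (e k) (p - q) \<partial>lborel) = enn2real (\<integral>\<^sup>+q. ennreal (gn (e k) (p - q)) \<partial>lborel)"
        by (rule integral_eq_nn_integral) (auto intro: gn_nonneg[OF ek])
      then show ?thesis by (simp add: gn_nn_integral[OF ek])
    qed
    have pt: "ennreal (norm (v k p - u p)) \<le> (\<integral>\<^sup>+q. ennreal (gn (e k) (p - q)) * ennreal (norm (u q - u p)) \<partial>lborel)" for p
    proof -
      have "v k p - u p = (\<integral>q. u q * complex_of_real (gn (e k) (p - q)) - u p * complex_of_real (gn (e k) (p - q)) \<partial>lborel)"
        unfolding v_def using ui[OF ek, of p] gi[of p] by (simp add: g1)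
      also have "\<dots> = (\<integral>q. (u q - u p) * complex_of_real (gn (e k) (p - q)) \<partial>lborel)" by (simp add: left_diff_distrib)
      also have "ennreal (norm \<dots>) \<le> (\<integral>\<^sup>+q. ennreal (norm ((u q - u p) * complex_of_real (gn (e k) (p - q)))) \<partial>lborel)"
        using ui[OF ek, of p] gi[of p] by (intro integral_norm_bound_ennreal) (simp add: left_diff_distrib)
      also have "\<dots> = (\<integral>\<^sup>+q. ennreal (gn (e k) (p - q)) * ennreal (norm (u q - u p)) \<partial>lborel)"
        using gn_nonneg[OF ek, where 'a = 'a] by (intro nn_integral_cong) (simp add: norm_mult ennreal_mult mult.commute)
      finally show ?thesis .
    qed
    have "(\<integral>\<^sup>+p. ennreal (norm (v k p - u p) * ge 1 p) \<partial>lborel) \<le> (\<integral>\<^sup>+p. (\<integral>\<^sup>+q. ennreal (gn (e k) (p - q)) * ennreal (norm (u q - u p)) \<partial>lborel) * ennreal (ge 1 p) \<partial>lborel)"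
      using pt by (intro nn_integral_mono) (simp add: ennreal_mult' less_imp_le[OF ge_pos] mult_right_mono)
    also have "\<dots> = (\<integral>\<^sup>+p. (\<integral>\<^sup>+h. ennreal (gn (e k) h) * ennreal (norm (u (p - h) - u p)) \<partial>lborel) * ennreal (ge 1 p) \<partial>lborel)"
    proof (intro nn_integral_cong)
      fix p
      have "(\<integral>\<^sup>+h. ennreal (gn (e k) (p - (p - h))) * ennreal (norm (u (p - h) - u p)) \<partial>lborel) = (\<integral>\<^sup>+q. ennreal (gn (e k) (p - q)) * ennreal (norm (u q - u p)) \<partial>lborel)"
        by (rule nn_integral_lborel_reflect) measurable
      then show "(\<integral>\<^sup>+q. ennreal (gn (e k) (p - q)) * ennreal (norm (u q - u p)) \<partial>lborel) * ennreal (ge 1 p) = (\<integral>\<^sup>+h. ennreal (gn (e k) h) * ennreal (norm (u (p - h) - u p)) \<partial>lborel) * ennreal (ge 1 p)"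
        by simp
    qed
    also have "\<dots> = (\<integral>\<^sup>+p. \<integral>\<^sup>+h. ennreal (gn (e k) h) * ennreal (norm (u (p - h) - u p)) * ennreal (ge 1 p) \<partial>lborel \<partial>lborel)"
      by (simp add: nn_integral_multc)
    also have "\<dots> = (\<integral>\<^sup>+h. \<integral>\<^sup>+p. ennreal (gn (e k) h) * ennreal (norm (u (p - h) - u p)) * ennreal (ge 1 p) \<partial>lborel \<partial>lborel)"
      by (rule lborel_Fubini) measurable
    also have "\<dots> = (\<integral>\<^sup>+h. ennreal (gn (e k) h) * \<Omega> h \<partial>lborel)"
      unfolding \<Omega>_def by (intro nn_integral_cong) (simp add: nn_integral_cmult[symmetric] ennreal_mult less_imp_le[OF ge_pos] mult.assoc)
    also have "\<dots> = ennreal (\<bar>sqrt (e k)\<bar> ^ DIM('a)) * (\<integral>\<^sup>+z. ennreal (gn (e k) (sqrt (e k) *\<^sub>R z)) * \<Omega> (sqrt (e k) *\<^sub>R z) \<partial>lborel)"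
      by (rule nn_integral_lborel_scale) (use ek in auto)
    also have "\<dots> = (\<integral>\<^sup>+z. ennreal (\<bar>sqrt (e k)\<bar> ^ DIM('a)) * (ennreal (gn (e k) (sqrt (e k) *\<^sub>R z)) * \<Omega> (sqrt (e k) *\<^sub>R z)) \<partial>lborel)"
      by (rule nn_integral_cmult[symmetric]) measurable
    also have "\<dots> = (\<integral>\<^sup>+z. ennreal (gn 1 z) * \<Omega> (sqrt (e k) *\<^sub>R z) \<partial>lborel)"
    proof (intro nn_integral_cong)
      fix z :: 'a
      have "ennreal (\<bar>sqrt (e k)\<bar> ^ DIM('a)) * ennreal (gn (e k) (sqrt (e k) *\<^sub>R z)) = ennreal (gn 1 z)"
        using ek gn_scale[OF ek, of z] by (simp add: ennreal_mult'[symmetric])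
      then show "ennreal (\<bar>sqrt (e k)\<bar> ^ DIM('a)) * (ennreal (gn (e k) (sqrt (e k) *\<^sub>R z)) * \<Omega> (sqrt (e k) *\<^sub>R z)) = ennreal (gn 1 z) * \<Omega> (sqrt (e k) *\<^sub>R z)"
        by (metis mult.assoc)
    qed
    finally show ?thesis .
  qed
  define w where "w z = ennreal (sqrt (2 * pi) ^ DIM('a) / (2 * pi) ^ DIM('a) * ge (1/2) z) * (4 * C1)" for z :: 'a
  have wb: "ennreal (gn 1 z) * \<Omega> (sqrt (e k) *\<^sub>R z) \<le> w z" for k z
  proof -
    have "ennreal (gn 1 z) * \<Omega> (sqrt (e k) *\<^sub>R z) \<le> ennreal (gn 1 z) * (ennreal (exp (((sqrt (e k) *\<^sub>R z) \<bullet> (sqrt (e k) *\<^sub>R z)) / 2)) * (4 * C1))"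
      by (intro mult_left_mono \<Omega>b) simp
    also have "\<dots> = ennreal (gn 1 z * exp (((sqrt (e k) *\<^sub>R z) \<bullet> (sqrt (e k) *\<^sub>R z)) / 2)) * (4 * C1)"
      using gn_nonneg[of 1 z] by (simp add: ennreal_mult mult.assoc)
    also have "\<dots> \<le> w z" unfolding w_def
    proof (intro mult_right_mono ennreal_leI)
      have "gn 1 z = sqrt (2 * pi) ^ DIM('a) / (2 * pi) ^ DIM('a) * ge 1 z" by (simp add: gn_def gk_eq_ge)
      moreover have "ge 1 z * exp (((sqrt (e k) *\<^sub>R z) \<bullet> (sqrt (e k) *\<^sub>R z)) / 2) \<le> ge (1/2) z"
      proof -
        have "e k * (z \<bullet> z) \<le> 1/2 * (z \<bullet> z)" using e(2)[of k] by (intro mult_right_mono) auto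
        moreover have eq: "(sqrt (e k) *\<^sub>R z) \<bullet> (sqrt (e k) *\<^sub>R z) = e k * (z \<bullet> z)" using e(1)[of k] by (simp add: mult.assoc[symmetric])
        ultimately show ?thesis unfolding eq ge_def exp_add[symmetric] by simp
      qed
      ultimately show "gn 1 z * exp (((sqrt (e k) *\<^sub>R z) \<bullet> (sqrt (e k) *\<^sub>R z)) / 2) \<le> sqrt (2 * pi) ^ DIM('a) / (2 * pi) ^ DIM('a) * ge (1/2) z"
        using mult_left_mono[of "ge 1 z * exp (((sqrt (e k) *\<^sub>R z) \<bullet> (sqrt (e k) *\<^sub>R z)) / 2)" "ge (1/2) z" "sqrt (2 * pi) ^ DIM('a) / (2 * pi) ^ DIM('a)"]
        by (simp only: mult.assoc) simp
    qed simp
    finally show ?thesis .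
  qed
  have [measurable]: "w \<in> borel_measurable borel" unfolding w_def by measurable
  have wf: "(\<integral>\<^sup>+z. w z \<partial>lborel) < \<infinity>"
  proof -
    have "integrable lborel (\<lambda>z::'a. sqrt (2 * pi) ^ DIM('a) / (2 * pi) ^ DIM('a) * ge (1/2) z)"
      by (intro integrable_mult_right ge_integrable) auto
    then have "(\<integral>\<^sup>+z. ennreal (sqrt (2 * pi) ^ DIM('a) / (2 * pi) ^ DIM('a) * ge (1/2) z) \<partial>(lborel :: 'a measure)) < \<infinity>"
      by (subst nn_integral_eq_integral) (auto simp: less_imp_le[OF ge_pos])
    then show ?thesis unfolding w_def using C1 by (subst nn_integral_multc) (auto simp: ennreal_mult_less_top)
  qed
  have lim0: "(\<lambda>k. \<integral>\<^sup>+z. ennreal (gn 1 z) * \<Omega> (sqrt (e k) *\<^sub>R z) \<partial>lborel) \<longlonglongrightarrow> (\<integral>\<^sup>+z. 0 \<partial>(lborel :: 'a measure))"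
  proof (rule nn_integral_dominated_convergence[where w = w])
    show "AE z in lborel. (\<lambda>k. ennreal (gn 1 z) * \<Omega> (sqrt (e k) *\<^sub>R z)) \<longlonglongrightarrow> 0"
    proof (rule AE_I2)
      fix z :: 'a
      have "(\<lambda>k. sqrt (e k) *\<^sub>R z) \<longlonglongrightarrow> sqrt 0 *\<^sub>R z" by (intro tendsto_intros e)
      then have "(\<lambda>k. \<Omega> (sqrt (e k) *\<^sub>R z)) \<longlonglongrightarrow> 0" by (intro \<Omega>0) simp
      from ennreal_tendsto_cmult[OF _ this, of "ennreal (gn 1 z)"]
      show "(\<lambda>k. ennreal (gn 1 z) * \<Omega> (sqrt (e k) *\<^sub>R z)) \<longlonglongrightarrow> 0" by simp
    qed
  qed (use wb wf in auto)
  have L0: "(\<lambda>k. \<integral>\<^sup>+p. ennreal (norm (v k p - u p) * ge 1 p) \<partial>lborel) \<longlonglongrightarrow> 0"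
    by (rule tendsto_sandwich[OF _ _ tendsto_const lim0[simplified]]) (auto intro!: always_eventually D)
  have fin: "(\<integral>\<^sup>+p. ennreal (norm (v k p - u p) * ge 1 p) \<partial>lborel) < \<infinity>" for k
  proof -
    have "(\<integral>\<^sup>+z. ennreal (gn 1 z) * \<Omega> (sqrt (e k) *\<^sub>R z) \<partial>lborel) \<le> (\<integral>\<^sup>+z. w z \<partial>lborel)" by (intro nn_integral_mono wb)
    then show ?thesis using D[of k] wf by (meson le_less_trans order_trans)
  qed
  define d where "d k p = (v k p - u p) * complex_of_real (ge 1 p)" for k p
  have nd: "norm (d k p) = norm (v k p - u p) * ge 1 p" for k p
    by (simp add: d_def norm_mult less_imp_le[OF ge_pos])
  have di: "integrable lborel (d k)" for k
  proof -
    have "d k \<in> borel_measurable lborel" unfolding d_def[abs_def] by measurable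
    then show ?thesis unfolding integrable_iff_bounded nd using fin by auto
  qed
  have "(\<lambda>k. \<integral>p. norm (d k p) \<partial>lborel) \<longlonglongrightarrow> 0"
  proof -
    have "(\<integral>p. norm (d k p) \<partial>lborel) = enn2real (\<integral>\<^sup>+p. ennreal (norm (v k p - u p) * ge 1 p) \<partial>lborel)" for k
      unfolding nd[symmetric] using di[of k] by (intro integral_eq_nn_integral) auto
    moreover have "(\<lambda>k. enn2real (\<integral>\<^sup>+p. ennreal (norm (v k p - u p) * ge 1 p) \<partial>lborel)) \<longlonglongrightarrow> 0"
      by (rule tendsto_enn2real) (use L0 in simp_all)
    ultimately show ?thesis by simp
  qed
  from tendsto_L1_AE_subseq[OF di this] obtain r :: "nat \<Rightarrow> nat" where r: "strict_mono r" "AE p in lborel. (\<lambda>k. d (r k) p) \<longlonglongrightarrow> 0" by blast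
  have "AE p in lborel. (\<lambda>k. v (r k) p) \<longlonglongrightarrow> u p"
    using r(2)
  proof eventually_elim
    case (elim p)
    have g: "complex_of_real (ge 1 p) \<noteq> 0" using ge_pos[of 1 p] by simp
    have "(\<lambda>k. d (r k) p / complex_of_real (ge 1 p) + u p) \<longlonglongrightarrow> 0 / complex_of_real (ge 1 p) + u p"
      by (intro tendsto_intros elim g)
    then show ?case using g by (simp add: d_def)
  qed
  then show "\<exists>r::nat\<Rightarrow>nat. strict_mono r \<and> (AE p in lborel. (\<lambda>k. \<integral>q. u q * complex_of_real (gn (e (r k)) (p - q)) \<partial>lborel) \<longlonglongrightarrow> u p)"
    using r(1) by (auto simp: v_def)
qed

section \<open>Gaussians as Schwartz functions\<close>

inductive pol :: "(R3 \<Rightarrow> complex) \<Rightarrow> bool" where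
  const: "pol (\<lambda>q. c)"
| lin: "pol (\<lambda>q. complex_of_real (q \<bullet> e))"
| add: "pol P \<Longrightarrow> pol Q \<Longrightarrow> pol (\<lambda>q. P q + Q q)"
| mult: "pol P \<Longrightarrow> pol Q \<Longrightarrow> pol (\<lambda>q. P q * Q q)"

lemma pol_deriv:
  assumes "pol P"
  shows "\<exists>D. (\<forall>q. (P has_derivative D q) (at q)) \<and> (\<forall>e. pol (\<lambda>q. D q e))"
  using assms
proof induction
  case (const c)
  show ?case by (intro exI[of _ "\<lambda>q h. 0"]) (auto intro: pol.const)
next
  case (lin e)
  show ?case
  proof (intro exI[of _ "\<lambda>q h. complex_of_real (h \<bullet> e)"] conjI allI)
    show "((\<lambda>q. complex_of_real (q \<bullet> e)) has_derivative (\<lambda>h. complex_of_real (h \<bullet> e))) (at q)" for q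
      by (rule bounded_linear.has_derivative[OF bounded_linear_of_real])
         (rule bounded_linear.has_derivative[OF bounded_linear_inner_left has_derivative_ident])
  qed (rule pol.const)
next
  case (add P Q)
  then obtain D1 D2 where D: "\<And>q. (P has_derivative D1 q) (at q)" "\<And>e. pol (\<lambda>q. D1 q e)"
    "\<And>q. (Q has_derivative D2 q) (at q)" "\<And>e. pol (\<lambda>q. D2 q e)" by blast
  show ?case
    by (intro exI[of _ "\<lambda>q h. D1 q h + D2 q h"] conjI allI has_derivative_add pol.add D)
next
  case (mult P Q)
  then obtain D1 D2 where D: "\<And>q. (P has_derivative D1 q) (at q)" "\<And>e. pol (\<lambda>q. D1 q e)"
    "\<And>q. (Q has_derivative D2 q) (at q)" "\<And>e. pol (\<lambda>q. D2 q e)" by blast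
  show ?case
    by (intro exI[of _ "\<lambda>q h. P q * D2 q h + D1 q h * Q q"] conjI allI has_derivative_mult pol.add pol.mult mult D)
qed

lemma pol_growth:
  assumes "pol P"
  shows "\<exists>C n. C \<ge> 0 \<and> (\<forall>q. norm (P q) \<le> C * (1 + norm q) ^ n)"
  using assms
proof induction
  case (const c)
  show ?case by (intro exI[of _ "norm c"] exI[of _ 0]) auto
next
  case (lin e)
  show ?case
  proof (intro exI[of _ "norm e"] exI[of _ 1] conjI allI)
    fix q :: R3
    have "\<bar>q \<bullet> e\<bar> \<le> norm q * norm e" by (rule Cauchy_Schwarz_ineq2)
    also have "\<dots> \<le> norm e * (1 + norm q)" by (simp add: algebra_simps)
    finally show "norm (complex_of_real (q \<bullet> e)) \<le> norm e * (1 + norm q) ^ 1" by simp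
  qed simp
next
  case (add P Q)
  then obtain C n D m where b: "C \<ge> 0" "\<And>q. norm (P q) \<le> C * (1 + norm q) ^ n" "D \<ge> 0" "\<And>q. norm (Q q) \<le> D * (1 + norm q) ^ m" by blast
  show ?case
  proof (intro exI[of _ "C + D"] exI[of _ "n + m"] conjI allI)
    fix q
    have "norm (P q + Q q) \<le> C * (1 + norm q) ^ n + D * (1 + norm q) ^ m"
      using norm_triangle_ineq[of "P q" "Q q"] b(2,4)[of q] by linarith
    also have "\<dots> \<le> C * (1 + norm q) ^ (n + m) + D * (1 + norm q) ^ (n + m)"
      using b by (intro add_mono mult_left_mono power_increasing) auto
    finally show "norm (P q + Q q) \<le> (C + D) * (1 + norm q) ^ (n + m)" by (simp add: algebra_simps)
  qed (use b in auto)
next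
  case (mult P Q)
  then obtain C n D m where b: "C \<ge> 0" "\<And>q. norm (P q) \<le> C * (1 + norm q) ^ n" "D \<ge> 0" "\<And>q. norm (Q q) \<le> D * (1 + norm q) ^ m" by blast
  show ?case
  proof (intro exI[of _ "C * D"] exI[of _ "n + m"] conjI allI)
    fix q
    have "norm (P q * Q q) \<le> (C * (1 + norm q) ^ n) * (D * (1 + norm q) ^ m)"
      unfolding norm_mult using b by (intro mult_mono) auto
    then show "norm (P q * Q q) \<le> C * D * (1 + norm q) ^ (n + m)" by (simp add: power_add mult_ac)
  qed (use b in auto)
qed

text \<open>One family that contains both kinds of test functions used later: modulated Gaussians
  (\<open>r = 0\<close>) and translated ones (\<open>p = 0\<close>, up to a constant
  factor).\<close>

definition gE :: "real \<Rightarrow> R3 \<Rightarrow> R3 \<Rightarrow> R3 \<Rightarrow> complex" where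
  "gE a r p q = exp (complex_of_real (- a * (q \<bullet> q) + r \<bullet> q) + \<i> * complex_of_real (p \<bullet> q))"

lemma gE_deriv:
  "(gE a r p has_derivative (\<lambda>h. gE a r p q * (complex_of_real (- 2 * a * (q \<bullet> h) + r \<bullet> h) + \<i> * complex_of_real (p \<bullet> h)))) (at q)"
proof -
  have 1: "((\<lambda>q. - a * (q \<bullet> q) + r \<bullet> q) has_derivative (\<lambda>h. - 2 * a * (q \<bullet> h) + r \<bullet> h)) (at q)"
    by (auto intro!: derivative_eq_intros simp: inner_commute algebra_simps)
  have 2: "((\<lambda>q. p \<bullet> q) has_derivative (\<lambda>h. p \<bullet> h)) (at q)"
    by (auto intro!: derivative_eq_intros)
  have "((\<lambda>q. complex_of_real (- a * (q \<bullet> q) + r \<bullet> q) + \<i> * complex_of_real (p \<bullet> q)) has_derivative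
      (\<lambda>h. complex_of_real (- 2 * a * (q \<bullet> h) + r \<bullet> h) + \<i> * complex_of_real (p \<bullet> h))) (at q)"
    by (intro has_derivative_add has_derivative_mult_right bounded_linear.has_derivative[OF bounded_linear_of_real] 1 2)
  from has_derivative_compose[OF this DERIV_exp[unfolded has_field_derivative_def]] show ?thesis
    unfolding gE_def[abs_def] .
qed

text \<open>Polynomial multiples of a fixed Gaussian are closed under partial derivatives, because
  the derivative of the exponent is affine. One decay bound for this class therefore covers all
  iterated derivatives.\<close>

lemma iter_partial_gE:
  assumes "pol P"
  shows "\<exists>Q. pol Q \<and> iter_partial es (\<lambda>q. P q * gE a r p q) = (\<lambda>q. Q q * gE a r p q)"
proof (induction es)
  case Nil
  then show ?case using assms by auto
next
  case (Cons e es)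
  then obtain Q where Q: "pol Q" "iter_partial es (\<lambda>q. P q * gE a r p q) = (\<lambda>q. Q q * gE a r p q)" by blast
  obtain D where D: "\<And>q. (Q has_derivative D q) (at q)" "\<And>e. pol (\<lambda>q. D q e)" using pol_deriv[OF Q(1)] by blast
  define l where "l q = complex_of_real (- 2 * a * (q \<bullet> e) + r \<bullet> e) + \<i> * complex_of_real (p \<bullet> e)" for q
  have "pol (\<lambda>q. complex_of_real (- 2 * a) * complex_of_real (q \<bullet> e) + (complex_of_real (r \<bullet> e) + \<i> * complex_of_real (p \<bullet> e)))"
    by (intro pol.intros)
  then have l: "pol l" unfolding l_def[abs_def] by (simp add: algebra_simps)
  have "frechet_derivative (\<lambda>q. Q q * gE a r p q) (at q) e = (Q q * l q + D q e) * gE a r p q" for q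
  proof -
    have "((\<lambda>q. Q q * gE a r p q) has_derivative
      (\<lambda>h. Q q * (gE a r p q * (complex_of_real (- 2 * a * (q \<bullet> h) + r \<bullet> h) + \<i> * complex_of_real (p \<bullet> h))) + D q h * gE a r p q)) (at q)"
      by (intro has_derivative_mult D gE_deriv)
    from frechet_derivative_at[OF this, symmetric] show ?thesis
      by (simp add: l_def algebra_simps)
  qed
  moreover have "pol (\<lambda>q. Q q * l q + D q e)" by (intro pol.intros Q l D)
  ultimately show ?case using Q(2) by (intro exI[of _ "\<lambda>q. Q q * l q + D q e"]) auto
qed

text \<open>The polynomial growth is absorbed by (1 + x)^k \<le> k! exp (1 + x), a single term of
  the exponential series. The exponent is then a concave quadratic in x and is bounded by completing
  the square.\<close>

lemma gE_decay:
  assumes a: "a > 0" and P: "pol P"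
  shows "\<exists>B. \<forall>q. norm q ^ n * norm (P q * gE a r p q) \<le> B"
proof -
  obtain C m where C: "C \<ge> 0" "\<And>q. norm (P q) \<le> C * (1 + norm q) ^ m" using pol_growth[OF P] by blast
  define k where "k = n + m"
  define R where "R = norm r + 1"
  show ?thesis
  proof (intro exI allI)
    fix q :: R3
    define x where "x = norm q"
    have x: "x \<ge> 0" by (simp add: x_def)
    have "norm (gE a r p q) = exp (- a * x\<^sup>2 + r \<bullet> q)"
      by (simp add: gE_def exp_add norm_mult x_def power2_norm_eq_inner flip: exp_of_real)
    also have "\<dots> \<le> exp (- a * x\<^sup>2 + norm r * x)"
      using norm_cauchy_schwarz[of r q] by (simp add: x_def)
    finally have g: "norm (gE a r p q) \<le> exp (- a * x\<^sup>2 + norm r * x)" .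
    have "(1 + x) ^ k / fact k \<le> exp (1 + x)"
    proof -
      have "(\<lambda>m. (1 + x) ^ m /\<^sub>R fact m) sums exp (1 + x)" by (rule exp_converges)
      then have "sum (\<lambda>m. (1 + x) ^ m /\<^sub>R fact m) {k} \<le> exp (1 + x)"
        using x by (intro sum_le_suminf[of _ "{k}", THEN order_trans[OF _ eq_refl]]) (auto simp: sums_iff)
      then show ?thesis by (simp add: divide_inverse mult.commute)
    qed
    then have k: "(1 + x) ^ k \<le> fact k * exp (1 + x)" by (simp add: field_simps)
    have "x ^ n * norm (P q * gE a r p q) \<le> (1 + x) ^ n * ((C * (1 + x) ^ m) * exp (- a * x\<^sup>2 + norm r * x))"
      unfolding norm_mult using x C(2)[of q] C(1) g by (intro mult_mono power_mono) (auto simp: x_def)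
    also have "\<dots> = C * (1 + x) ^ k * exp (- a * x\<^sup>2 + norm r * x)" by (simp add: k_def power_add mult_ac)
    also have "\<dots> \<le> C * (fact k * exp (1 + x)) * exp (- a * x\<^sup>2 + norm r * x)"
      using k C(1) by (intro mult_right_mono mult_left_mono) auto
    also have "\<dots> = C * fact k * exp (1 + R * x - a * x\<^sup>2)"
      by (simp add: mult.assoc exp_add[symmetric] R_def algebra_simps)
    also have "\<dots> \<le> C * fact k * exp (1 + R\<^sup>2 / (4 * a))"
    proof (intro mult_left_mono)
      have "0 \<le> (2 * a * x - R)\<^sup>2 / (4 * a)" using a by simp
      also have "\<dots> = a * x\<^sup>2 - R * x + R\<^sup>2 / (4 * a)" using a by (simp add: power2_eq_square field_simps)
      finally show "exp (1 + R * x - a * x\<^sup>2) \<le> exp (1 + R\<^sup>2 / (4 * a))" by simp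
    qed (use C(1) in auto)
    finally show "norm q ^ n * norm (P q * gE a r p q) \<le> C * fact k * exp (1 + R\<^sup>2 / (4 * a))" by (simp add: x_def)
  qed
qed

lemma schwartz_gE:
  assumes "a > 0"
  shows "schwartz (\<lambda>q. c * gE a r p q)"
  unfolding schwartz_def
proof (intro ballI conjI allI)
  fix es :: "R3 list" and q :: R3 and n :: nat
  obtain Q where Q: "pol Q" "iter_partial es (\<lambda>q. c * gE a r p q) = (\<lambda>q. Q q * gE a r p q)"
    using iter_partial_gE[OF pol.const] by blast
  obtain D where "\<And>q. (Q has_derivative D q) (at q)" using pol_deriv[OF Q(1)] by blast
  then have "((\<lambda>q. Q q * gE a r p q) has_derivative
      (\<lambda>h. Q q * (gE a r p q * (complex_of_real (- 2 * a * (q \<bullet> h) + r \<bullet> h) + \<i> * complex_of_real (p \<bullet> h))) + D q h * gE a r p q)) (at q)"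
    by (intro has_derivative_mult gE_deriv)
  then show "iter_partial es (\<lambda>q. c * gE a r p q) differentiable at q"
    unfolding Q(2) differentiable_def by blast
  obtain B where "\<And>q. norm q ^ n * norm (Q q * gE a r p q) \<le> B" using gE_decay[OF assms Q(1)] by blast
  then show "bounded (range (\<lambda>x. norm x ^ n *\<^sub>R iter_partial es (\<lambda>q. c * gE a r p q) x))"
    unfolding Q(2) bounded_iff by (intro exI[of _ B]) auto
qed

lemma schwartz_basic:
  assumes "schwartz \<phi>"
  shows "\<phi> \<in> borel_measurable borel" "continuous_on UNIV \<phi>" "\<exists>B. \<forall>q. norm q ^ n * norm (\<phi> q) \<le> B"
proof -
  have a: "\<And>p. \<phi> differentiable at p" "\<And>n. bounded (range (\<lambda>p. norm p ^ n *\<^sub>R \<phi> p))"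
    using assms unfolding schwartz_def by (auto dest: bspec[of _ _ "[]"])
  show "continuous_on UNIV \<phi>"
    using a(1) differentiable_imp_continuous_within continuous_at_imp_continuous_on by blast
  then show "\<phi> \<in> borel_measurable borel" by (rule borel_measurable_continuous_onI)
  from a(2)[of n] show "\<exists>B. \<forall>q. norm q ^ n * norm (\<phi> q) \<le> B"
    by (auto simp: bounded_iff)
qed

section \<open>Integrability of Schwartz functions and derivatives of their transforms\<close>

lemma nn_integral_inverse_square: "(\<integral>\<^sup>+x. ennreal (1 / (1 + x\<^sup>2)) \<partial>lborel) < \<infinity>"
proof -
  have d: "(arctan has_real_derivative 1 / (1 + x\<^sup>2)) (at x)" for x :: real
    using DERIV_arctan[of x] by (simp add: divide_inverse)
  have 1: "(\<integral>\<^sup>+x. ennreal (1 / (1 + x\<^sup>2)) * indicator {0..} x \<partial>lborel) = ennreal (pi / 2 - arctan 0)"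
    by (rule nn_integral_FTC_atLeast[OF _ d _ tendsto_arctan_at_top]) auto
  have 2: "(\<integral>\<^sup>+x. ennreal (1 / (1 + x\<^sup>2)) * indicator {0..} (0 - x) \<partial>lborel) = (\<integral>\<^sup>+x. ennreal (1 / (1 + x\<^sup>2)) * indicator {0..} x \<partial>lborel)"
    using nn_integral_lborel_reflect[of "\<lambda>x. ennreal (1 / (1 + x\<^sup>2)) * indicator {0..} x" "0::real"] by simp
  have "(\<integral>\<^sup>+x. ennreal (1 / (1 + x\<^sup>2)) \<partial>lborel) \<le> (\<integral>\<^sup>+x. ennreal (1 / (1 + x\<^sup>2)) * indicator {0..} x + ennreal (1 / (1 + x\<^sup>2)) * indicator {0..} (0 - x) \<partial>lborel)"
    by (intro nn_integral_mono) (auto simp: indicator_def)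
  also have "\<dots> = ennreal (pi / 2) + ennreal (pi / 2)" by (subst nn_integral_add) (simp_all add: 1 2[simplified])
  also have "\<dots> < \<infinity>" by simp
  finally show ?thesis .
qed

text \<open>Comparison with the product of 1 / (1 + x^2) over the three coordinates. Decay of order
  6 suffices: with s the squared norm, the product of the three denominators is at most (1 + s)^3
  \<le> 4 (1 + s^3).\<close>

lemma integrable_decay:
  fixes \<phi> :: "R3 \<Rightarrow> complex"
  assumes [measurable]: "\<phi> \<in> borel_measurable borel"
    and b: "\<And>q. norm (\<phi> q) \<le> B" "\<And>q. norm q ^ 6 * norm (\<phi> q) \<le> B"
  shows "integrable lborel \<phi>"
proof -
  define W where "W x = ennreal (1 / (1 + x\<^sup>2))" for x :: real
  have [measurable]: "W \<in> borel_measurable borel" unfolding W_def by measurable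
  have B: "B \<ge> 0" using b(1)[of 0] norm_ge_zero order_trans by blast
  have pt: "ennreal (norm (\<phi> q)) \<le> ennreal (8 * B) * (W (fst q) * (W (fst (snd q)) * W (snd (snd q))))" for q
  proof -
    define x y t where "x = (fst q)\<^sup>2" "y = (fst (snd q))\<^sup>2" "t = (snd (snd q))\<^sup>2"
    define s where "s = norm q ^ 2"
    have s: "s = x + y + t" unfolding s_def x_y_t_def by (cases q) (simp add: norm_Pair)
    have nn: "x \<ge> 0" "y \<ge> 0" "t \<ge> 0" by (auto simp: x_y_t_def)
    have "(1 + x) * ((1 + y) * (1 + t)) \<le> (1 + s) * ((1 + s) * (1 + s))"
      using nn s by (intro mult_mono) auto
    also have "\<dots> \<le> 4 * (1 + s ^ 3)"
    proof -
      have s0: "s \<ge> 0" using nn s by auto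
      have "0 \<le> (1 + s) * (1 - s)\<^sup>2" using s0 by simp
      then show ?thesis by (simp add: power2_eq_square power3_eq_cube algebra_simps)
    qed
    finally have p: "(1 + x) * ((1 + y) * (1 + t)) \<le> 4 * (1 + s ^ 3)" .
    have "s ^ 3 = norm q ^ 6" by (simp add: s_def power_mult[symmetric])
    then have "norm (\<phi> q) * ((1 + x) * ((1 + y) * (1 + t))) \<le> norm (\<phi> q) * (4 * (1 + norm q ^ 6))"
      using p by (intro mult_left_mono) auto
    also have "\<dots> = 4 * norm (\<phi> q) + 4 * (norm q ^ 6 * norm (\<phi> q))" by (simp add: algebra_simps)
    also have "\<dots> \<le> 8 * B" using b[of q] by simp
    finally have "norm (\<phi> q) \<le> 8 * B / ((1 + x) * ((1 + y) * (1 + t)))"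
      using nn by (subst pos_le_divide_eq) (auto intro!: mult_pos_pos)
    also have "\<dots> = 8 * B * (1 / (1 + x) * (1 / (1 + y) * (1 / (1 + t))))" by simp
    finally have "ennreal (norm (\<phi> q)) \<le> ennreal (8 * B * (1 / (1 + x) * (1 / (1 + y) * (1 / (1 + t)))))" by (rule ennreal_leI)
    also have "\<dots> = ennreal (8 * B) * (ennreal (1 / (1 + x)) * (ennreal (1 / (1 + y)) * ennreal (1 / (1 + t))))"
      using B nn by (subst ennreal_mult; (subst ennreal_mult; (subst ennreal_mult)?)?; simp)
    finally show ?thesis by (simp add: W_def x_y_t_def)
  qed
  have "(\<integral>\<^sup>+q. ennreal (norm (\<phi> q)) \<partial>lborel) \<le> (\<integral>\<^sup>+q. ennreal (8 * B) * (W (fst q) * (W (fst (snd q)) * W (snd (snd q)))) \<partial>lborel)"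
    by (intro nn_integral_mono pt)
  also have "\<dots> = (\<integral>\<^sup>+x. \<integral>\<^sup>+y. \<integral>\<^sup>+t. ennreal (8 * B) * (W x * (W y * W t)) \<partial>lborel \<partial>lborel \<partial>lborel)"
    by (subst nn_integral_R3) auto
  also have "\<dots> = ennreal (8 * B) * ((\<integral>\<^sup>+x. W x \<partial>lborel) * ((\<integral>\<^sup>+x. W x \<partial>lborel) * (\<integral>\<^sup>+x. W x \<partial>lborel)))"
    by (simp add: nn_integral_cmult nn_integral_multc)
  also have "\<dots> < \<infinity>" using nn_integral_inverse_square by (simp add: W_def ennreal_mult_less_top)
  finally show ?thesis unfolding integrable_iff_bounded by simp
qed

lemma schwartz_integrable:
  assumes "schwartz \<phi>"
  shows "integrable lborel (\<lambda>q. complex_of_real (norm q ^ k) * \<phi> q)"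
proof -
  have [measurable]: "\<phi> \<in> borel_measurable borel" by (rule schwartz_basic[OF assms])
  obtain B1 where B1: "\<And>q. norm q ^ k * norm (\<phi> q) \<le> B1" using schwartz_basic(3)[OF assms] by blast
  obtain B2 where B2: "\<And>q. norm q ^ (6 + k) * norm (\<phi> q) \<le> B2" using schwartz_basic(3)[OF assms] by blast
  show ?thesis
  proof (rule integrable_decay[where B = "max B1 B2"])
    show "norm (complex_of_real (norm q ^ k) * \<phi> q) \<le> max B1 B2" for q
      using B1[of q] by (simp add: norm_mult norm_power)
    show "norm q ^ 6 * norm (complex_of_real (norm q ^ k) * \<phi> q) \<le> max B1 B2" for q
      using B2[of q] by (simp add: norm_mult norm_power power_add mult.assoc)
  qed measurable
qed

text \<open>Needed because \<open>dist_dx\<close> differentiates the test function, here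
  \<open>fourier \<phi>\<close>. The integral is differentiated with the quadratic remainder of the
  exponential; \<bar>\<theta>\<bar> is at most \<open>norm p * norm (y - q)\<close>, so the second
  moment of \<open>\<phi>\<close> controls the remainder.\<close>

lemma fourier_deriv:
  assumes "schwartz \<phi>"
  shows "frechet_derivative (fourier \<phi>) (at q) e = fourier (\<lambda>p. - \<i> * complex_of_real (p \<bullet> e) * \<phi> p) q"
proof -
  have [measurable]: "\<phi> \<in> borel_measurable borel" by (rule schwartz_basic[OF assms])
  have i0: "integrable lborel \<phi>" using schwartz_integrable[OF assms, of 0] by simp
  have i1: "integrable lborel (\<lambda>p. complex_of_real (norm p) * \<phi> p)" using schwartz_integrable[OF assms, of 1] by simp
  have i2: "integrable lborel (\<lambda>p. complex_of_real ((norm p)\<^sup>2) * \<phi> p)" using schwartz_integrable[OF assms, of 2] by simp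
  define K where "K = (\<integral>p. (norm p)\<^sup>2 * norm (\<phi> p) \<partial>lborel)"
  have K: "integrable lborel (\<lambda>p. (norm p)\<^sup>2 * norm (\<phi> p))"
    using integrable_norm[OF i2] by (simp add: norm_mult norm_power)
  have e0: "integrable lborel (\<lambda>p. exp (- \<i> * complex_of_real (p \<bullet> q)) * \<phi> p)" for q
    by (rule Bochner_Integration.integrable_bound[OF i0]) (auto simp: norm_mult)
  have e1: "integrable lborel (\<lambda>p. exp (- \<i> * complex_of_real (p \<bullet> q)) * (- \<i> * complex_of_real (p \<bullet> h) * \<phi> p))" for q h
  proof (rule Bochner_Integration.integrable_bound[OF integrable_mult_right[OF i1, of "complex_of_real (norm h)"]])
    show "AE p in lborel. norm (exp (- \<i> * complex_of_real (p \<bullet> q)) * (- \<i> * complex_of_real (p \<bullet> h) * \<phi> p)) \<le> norm (complex_of_real (norm h) * (complex_of_real (norm p) * \<phi> p))"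
      using Cauchy_Schwarz_ineq2[of _ h] by (auto simp: norm_mult mult.assoc[symmetric] mult.commute[of "norm h"] intro!: mult_right_mono)
  qed measurable
  define L where "L h = (\<integral>p. exp (- \<i> * complex_of_real (p \<bullet> q)) * (- \<i> * complex_of_real (p \<bullet> h) * \<phi> p) \<partial>lborel)" for h
  define M1 where "M1 = (\<integral>p. norm p * norm (\<phi> p) \<partial>lborel)"
  have M1: "integrable lborel (\<lambda>p. norm p * norm (\<phi> p))"
    using integrable_norm[OF i1] by (simp add: norm_mult)
  have bl: "bounded_linear L"
  proof (rule bounded_linear_intro)
    show "L (x + y) = L x + L y" for x y
      unfolding L_def by (subst Bochner_Integration.integral_add[OF e1 e1, symmetric]) (simp add: inner_add_right algebra_simps)
    show "L (r *\<^sub>R x) = r *\<^sub>R L x" for r x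
      unfolding L_def by (subst integral_scaleR_right[symmetric]) (simp add: scaleR_conv_of_real mult_ac)
    show "norm (L h) \<le> norm h * M1" for h
    proof -
      have "norm (L h) \<le> (\<integral>p. norm h * (norm p * norm (\<phi> p)) \<partial>lborel)"
        unfolding L_def
      proof (rule Bochner_Integration.integral_norm_bound_integral[OF e1 integrable_mult_right[OF M1]])
        show "norm (exp (- \<i> * complex_of_real (p \<bullet> q)) * (- \<i> * complex_of_real (p \<bullet> h) * \<phi> p)) \<le> norm h * (norm p * norm (\<phi> p))" for p
          using Cauchy_Schwarz_ineq2[of p h] by (auto simp: norm_mult mult.assoc[symmetric] mult.commute[of "norm h"] intro!: mult_right_mono)
      qed
      then show ?thesis by (simp add: M1_def)
    qed
  qed
  have rem: "norm (fourier \<phi> y - fourier \<phi> q - L (y - q)) \<le> K / 2 * (norm (y - q))\<^sup>2" for y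
  proof -
    have "fourier \<phi> y - fourier \<phi> q - L (y - q) = (\<integral>p. exp (- \<i> * complex_of_real (p \<bullet> y)) * \<phi> p - exp (- \<i> * complex_of_real (p \<bullet> q)) * \<phi> p
        - exp (- \<i> * complex_of_real (p \<bullet> q)) * (- \<i> * complex_of_real (p \<bullet> (y - q)) * \<phi> p) \<partial>lborel)"
      unfolding fourier_def L_def using e0 e1 by (simp only: Bochner_Integration.integral_diff Bochner_Integration.integrable_diff)
    also have "norm \<dots> \<le> (\<integral>p. (norm (y - q))\<^sup>2 / 2 * ((norm p)\<^sup>2 * norm (\<phi> p)) \<partial>lborel)"
    proof (rule Bochner_Integration.integral_norm_bound_integral[OF _ integrable_mult_right[OF K]])
      fix p
      define \<theta> where "\<theta> = - (p \<bullet> (y - q))"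
      have "exp (- \<i> * complex_of_real (p \<bullet> y)) = exp (- \<i> * complex_of_real (p \<bullet> q)) * iexp \<theta>"
        by (simp add: \<theta>_def exp_add[symmetric] inner_diff_right algebra_simps)
      then have "exp (- \<i> * complex_of_real (p \<bullet> y)) * \<phi> p - exp (- \<i> * complex_of_real (p \<bullet> q)) * \<phi> p
        - exp (- \<i> * complex_of_real (p \<bullet> q)) * (- \<i> * complex_of_real (p \<bullet> (y - q)) * \<phi> p)
        = exp (- \<i> * complex_of_real (p \<bullet> q)) * (iexp \<theta> - (1 + \<i> * complex_of_real \<theta>)) * \<phi> p"
        by (simp add: \<theta>_def algebra_simps)
      moreover have "norm (iexp \<theta> - (1 + \<i> * complex_of_real \<theta>)) \<le> \<theta>\<^sup>2 / 2"
        using iexp_approx1[of \<theta> 1] by (simp add: power2_eq_square)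
      moreover have "\<theta>\<^sup>2 \<le> (norm p * norm (y - q))\<^sup>2"
        using Cauchy_Schwarz_ineq2[of p "y - q"] by (intro abs_le_square_iff[THEN iffD1]) (simp add: \<theta>_def abs_mult)
      ultimately show "norm (exp (- \<i> * complex_of_real (p \<bullet> y)) * \<phi> p - exp (- \<i> * complex_of_real (p \<bullet> q)) * \<phi> p
        - exp (- \<i> * complex_of_real (p \<bullet> q)) * (- \<i> * complex_of_real (p \<bullet> (y - q)) * \<phi> p)) \<le> (norm (y - q))\<^sup>2 / 2 * ((norm p)\<^sup>2 * norm (\<phi> p))"
        using mult_right_mono[of "norm (iexp \<theta> - (1 + \<i> * complex_of_real \<theta>))" "(norm p * norm (y - q))\<^sup>2 / 2" "norm (\<phi> p)"]
        by (simp add: norm_mult power_mult_distrib mult_ac)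
    qed (intro Bochner_Integration.integrable_diff e0 e1)
    also have "\<dots> = K / 2 * (norm (y - q))\<^sup>2" by (simp add: K_def)
    finally show ?thesis .
  qed
  have "(fourier \<phi> has_derivative L) (at q)"
  proof (rule has_derivativeI_sandwich[where e = 1 and H = "\<lambda>y. K / 2 * norm (y - q)"])
    show "norm (fourier \<phi> y - fourier \<phi> q - L (y - q)) / norm (y - q) \<le> K / 2 * norm (y - q)" if "y \<noteq> q" for y
      using rem[of y] that by (simp add: divide_simps power2_eq_square mult_ac)
    have "((\<lambda>y. K / 2 * norm (y - q)) \<longlongrightarrow> K / 2 * norm (q - q)) (at q)" by (intro tendsto_intros)
    then show "((\<lambda>y. K / 2 * norm (y - q)) \<longlongrightarrow> 0) (at q)" by simp
  qed (use bl in auto)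
  from frechet_derivative_at[OF this, symmetric] show ?thesis
    by (simp add: L_def fourier_def)
qed

section \<open>Fourier pairs tested with Gaussians\<close>

lemma fatou_norm2:
  fixes f :: "nat \<Rightarrow> 'a::euclidean_space \<Rightarrow> complex"
  assumes [measurable]: "\<And>k. f k \<in> borel_measurable borel"
    and lim: "AE p in lborel. (\<lambda>k. f k p) \<longlonglongrightarrow> u p"
    and ev: "\<forall>\<^sub>F k in sequentially. (\<integral>\<^sup>+p. ennreal ((norm (f k p))\<^sup>2) \<partial>lborel) \<le> B"
  shows "(\<integral>\<^sup>+p. ennreal ((norm (u p))\<^sup>2) \<partial>lborel) \<le> B"
proof -
  have "(\<integral>\<^sup>+p. ennreal ((norm (u p))\<^sup>2) \<partial>lborel) \<le> (\<integral>\<^sup>+p. liminf (\<lambda>k. ennreal ((norm (f k p))\<^sup>2)) \<partial>lborel)"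
  proof (rule nn_integral_mono_AE)
    show "AE p in lborel. ennreal ((norm (u p))\<^sup>2) \<le> liminf (\<lambda>k. ennreal ((norm (f k p))\<^sup>2))"
      using lim
    proof eventually_elim
      case (elim p)
      have "(\<lambda>k. ennreal ((norm (f k p))\<^sup>2)) \<longlonglongrightarrow> ennreal ((norm (u p))\<^sup>2)"
        by (intro tendsto_ennrealI tendsto_intros elim)
      from lim_imp_Liminf[OF sequentially_bot this] show ?case by (simp only: order_refl)
    qed
  qed
  also have "\<dots> \<le> liminf (\<lambda>k. \<integral>\<^sup>+p. ennreal ((norm (f k p))\<^sup>2) \<partial>lborel)"
    by (rule nn_integral_liminf) measurable
  also have "\<dots> \<le> B"
    by (rule order_trans[OF Liminf_le_Limsup Limsup_bounded[OF ev]]) simp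
  finally show ?thesis .
qed

lemma R3_DIM: "DIM(R3) = 3" by simp

lemma tendsto_0_le_ennreal:
  fixes X Y :: "nat \<Rightarrow> ennreal"
  assumes "\<And>k. X k \<le> Y k" "Y \<longlonglongrightarrow> 0"
  shows "X \<longlonglongrightarrow> 0"
  by (rule tendsto_sandwich[OF _ _ tendsto_const assms(2)]) (simp_all add: assms(1))

definition fpair :: "(R3 \<Rightarrow> complex) \<Rightarrow> (R3 \<Rightarrow> complex) \<Rightarrow> bool" where
  "fpair u U \<longleftrightarrow> tempered_fun u \<and> has_fourier (dist_of u) U"

lemma tempered_measurable: "tempered_fun u \<Longrightarrow> u \<in> borel_measurable borel"
  by (simp add: tempered_fun_def)

lemma fpair_measurable:
  assumes "fpair u U"
  shows "u \<in> borel_measurable borel" "U \<in> borel_measurable borel"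
  using assms tempered_measurable by (auto simp: fpair_def has_fourier_def)

lemma fpair_duality:
  "fpair u U \<Longrightarrow> schwartz \<phi> \<Longrightarrow> (\<integral>p. u p * fourier \<phi> p \<partial>lborel) = (\<integral>q. U q * \<phi> q \<partial>lborel)"
  by (simp add: fpair_def has_fourier_def dist_of_def)

lemma gE_ge: "gE (\<epsilon> / 2) 0 p q = cis' (p \<bullet> q) * complex_of_real (ge \<epsilon> q)"
  unfolding gE_def exp_add exp_of_real by (simp add: ge_def mult.commute)

lemma tempered_ge:
  assumes "tempered_fun u" "c > 0"
  shows "integrable lborel (\<lambda>q. u q * (cis' (p \<bullet> q) * complex_of_real (ge c q)))"
    "integrable lborel (\<lambda>q. u q * complex_of_real (ge c q))"
proof -
  have *: "integrable lborel (\<lambda>q. u q * (cis' (p \<bullet> q) * complex_of_real (ge c q)))" for p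
    using schwartz_gE[of "c / 2" 1 0 p] assms by (simp add: gE_ge tempered_fun_def)
  from *[of p] *[of 0] show "integrable lborel (\<lambda>q. u q * (cis' (p \<bullet> q) * complex_of_real (ge c q)))"
    "integrable lborel (\<lambda>q. u q * complex_of_real (ge c q))" by simp_all
qed

lemma cis'_mult: "cis' a * cis' b = cis' (a + b)" "cis' a * (cis' b * z) = cis' (a + b) * z"
  by (simp_all add: exp_add distrib_left)

lemma exp_uminus_cis': "exp (- \<i> * complex_of_real a) = cis' (- a)" by simp

lemma fourier_cis': "fourier \<phi> q = (\<integral>p. cis' (- (p \<bullet> q)) * \<phi> p \<partial>lborel)"
  unfolding fourier_def exp_uminus_cis' ..

lemma fourier_gauss:
  assumes "\<epsilon> > 0"
  shows "fourier (\<lambda>q. cis' (p \<bullet> q) * complex_of_real (ge \<epsilon> q)) p' = complex_of_real (gk \<epsilon> (p - p'))"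
proof -
  have "fourier (\<lambda>q. cis' (p \<bullet> q) * complex_of_real (ge \<epsilon> q)) p' = (\<integral>q. cis' (q \<bullet> (p - p')) * complex_of_real (ge \<epsilon> q) \<partial>lborel)"
    unfolding fourier_cis' cis'_mult
  proof (rule Bochner_Integration.integral_cong[OF refl])
    fix q
    have "- (q \<bullet> p') + p \<bullet> q = q \<bullet> (p - p')" by (simp add: inner_diff_right inner_commute)
    then show "cis' (- (q \<bullet> p') + p \<bullet> q) * complex_of_real (ge \<epsilon> q) = cis' (q \<bullet> (p - p')) * complex_of_real (ge \<epsilon> q)" by simp
  qed
  then show ?thesis using gauss_ft'(2)[OF assms, of "p - p'"] by simp
qed

text \<open>The inverse transform of \<open>reg U \<epsilon>\<close> is the convolution of \<open>u\<close> with the Gaussian \<open>gn \<epsilon>\<close>.\<close>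

definition reg :: "(R3 \<Rightarrow> complex) \<Rightarrow> real \<Rightarrow> R3 \<Rightarrow> complex" where
  "reg U \<epsilon> q = U q * complex_of_real (ge \<epsilon> q / (2 * pi) ^ 3)"

lemma reg_eq: "reg U \<epsilon> q = complex_of_real (1 / (2 * pi) ^ 3) * (U q * complex_of_real (ge \<epsilon> q))"
proof -
  have "complex_of_real (a / b) = complex_of_real (1 / b) * complex_of_real a" for a b :: real by simp
  from this[of "ge \<epsilon> q" "(2 * pi) ^ 3"] show ?thesis unfolding reg_def by (simp only: mult_ac)
qed

lemma reg_measurable[measurable]:
  assumes [measurable]: "U \<in> borel_measurable borel"
  shows "reg U \<epsilon> \<in> borel_measurable borel"
  unfolding reg_eq[abs_def] by measurable

lemma reg_integrable:
  assumes "fpair u U" "\<epsilon> > 0"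
  shows "integrable lborel (reg U \<epsilon>)"
proof -
  have "integrable lborel (\<lambda>q. U q * complex_of_real (ge \<epsilon> q))"
    using assms by (intro tempered_ge(2)) (auto simp: fpair_def has_fourier_def)
  from Bochner_Integration.integrable_mult_right[OF this, of "complex_of_real (1 / (2 * pi) ^ 3)"]
  show ?thesis unfolding reg_eq[abs_def] .
qed

text \<open>A regularised inversion formula. The duality is tested with a modulated Gaussian, whose
  transform is a Gaussian centred at \<open>p\<close>; neither \<open>u\<close> nor \<open>U\<close>
  has to be integrable.\<close>

lemma conv_eq_ift:
  assumes f: "fpair u U" and e: "\<epsilon> > 0"
  shows "(\<integral>p'. u p' * complex_of_real (gn \<epsilon> (p - p')) \<partial>lborel) = ift (reg U \<epsilon>) p"
proof -
  define c where "c = complex_of_real (1 / (2 * pi) ^ 3)"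
  have s: "schwartz (\<lambda>q. cis' (p \<bullet> q) * complex_of_real (ge \<epsilon> q))"
    using schwartz_gE[of "\<epsilon> / 2" 1 0 p] e by (simp add: gE_ge)
  have "(\<integral>p'. u p' * complex_of_real (gn \<epsilon> (p - p')) \<partial>lborel) = (\<integral>p'. c * (u p' * complex_of_real (gk \<epsilon> (p - p'))) \<partial>lborel)"
  proof (rule Bochner_Integration.integral_cong[OF refl])
    have "complex_of_real (a / b) = complex_of_real (1 / b) * complex_of_real a" for a b :: real by simp
    note d = this
    show "u p' * complex_of_real (gn \<epsilon> (p - p')) = c * (u p' * complex_of_real (gk \<epsilon> (p - p')))" for p'
      unfolding gn_def R3_DIM c_def d[of "gk \<epsilon> (p - p')"] by (simp only: mult_ac)
  qed
  also have "\<dots> = c * (\<integral>p'. u p' * complex_of_real (gk \<epsilon> (p - p')) \<partial>lborel)" by simp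
  also have "\<dots> = c * (\<integral>q. U q * (cis' (p \<bullet> q) * complex_of_real (ge \<epsilon> q)) \<partial>lborel)"
    using fpair_duality[OF f s] by (simp add: fourier_gauss[OF e])
  also have "\<dots> = (\<integral>q. c * (U q * (cis' (p \<bullet> q) * complex_of_real (ge \<epsilon> q))) \<partial>lborel)" by simp
  also have "\<dots> = ift (reg U \<epsilon>) p"
    unfolding ift_def reg_eq c_def[symmetric] by (simp only: mult_ac)
  finally show ?thesis .
qed

lemma distr_lborel_reflect: "distr lborel borel (\<lambda>x. c - x) = (lborel :: 'a::euclidean_space measure)"
proof -
  have "(lborel :: 'a measure) = density (distr lborel borel (\<lambda>x. c + (-1) *\<^sub>R x)) (\<lambda>_. \<bar>-1::real\<bar> ^ DIM('a))"
    by (rule lborel_affine) simp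
  then show ?thesis by (simp add: density_1)
qed

lemma integral_lborel_reflect:
  fixes f :: "'a::euclidean_space \<Rightarrow> complex"
  assumes [measurable]: "f \<in> borel_measurable borel"
  shows "(\<integral>x. f (c - x) \<partial>lborel) = (\<integral>x. f x \<partial>lborel)"
proof -
  have "(\<integral>x. f x \<partial>lborel) = (\<integral>x. f x \<partial>distr lborel borel (\<lambda>x. c - x))" by (simp only: distr_lborel_reflect)
  also have "\<dots> = (\<integral>x. f (c - x) \<partial>lborel)" by (rule integral_distr) measurable
  finally show ?thesis by simp
qed

lemma fourier_gn:
  fixes q :: R3
  assumes e: "\<eta> > 0"
  shows "fourier (\<lambda>q'. complex_of_real (gn \<eta> (q - q'))) p = cis' (- (p \<bullet> q)) * complex_of_real (ge \<eta> p)"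
proof -
  define K where "K = sqrt (2 * pi / \<eta>) ^ 3 / (2 * pi) ^ 3"
  have g: "gn \<eta> z = K * ge (1 / \<eta>) z" for z :: R3 by (simp only: gn_def R3_DIM gk_eq_ge[OF e] K_def times_divide_eq_left)
  have K: "K * gk (1 / \<eta>) p = ge \<eta> p"
  proof -
    have "sqrt (2 * pi / \<eta>) * sqrt (2 * pi * \<eta>) = sqrt ((2 * pi)\<^sup>2)"
      using e unfolding real_sqrt_mult[symmetric] by (simp add: power2_eq_square)
    then have "sqrt (2 * pi / \<eta>) * sqrt (2 * pi * \<eta>) = 2 * pi" by (simp only: real_sqrt_abs abs_mult) simp
    then have "sqrt (2 * pi / \<eta>) ^ 3 * sqrt (2 * pi * \<eta>) ^ 3 = (2 * pi) ^ 3" by (metis power_mult_distrib)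
    then have P: "sqrt (2 * pi / \<eta>) ^ 3 * sqrt (2 * pi * \<eta>) ^ 3 = (2 * pi) ^ 3" .
    have e2: "2 * pi / (1 / \<eta>) = 2 * pi * \<eta>" "- (p \<bullet> p) / (2 * (1 / \<eta>)) = - \<eta> * (p \<bullet> p) / 2" by simp_all
    have "K * gk (1 / \<eta>) p = (sqrt (2 * pi / \<eta>) ^ 3 * sqrt (2 * pi * \<eta>) ^ 3) / (2 * pi) ^ 3 * ge \<eta> p"
      unfolding K_def gk_def ge_def R3_DIM e2 by (simp only: times_divide_eq_left times_divide_eq_right mult_ac)
    then show ?thesis unfolding P by simp
  qed
  have "fourier (\<lambda>q'. complex_of_real (gn \<eta> (q - q'))) p = (\<integral>q'. cis' (- ((q - (q - q')) \<bullet> p)) * complex_of_real (gn \<eta> (q - q')) \<partial>lborel)"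
    by (simp add: fourier_cis')
  also have "\<dots> = (\<integral>z. cis' (- ((q - z) \<bullet> p)) * complex_of_real (gn \<eta> z) \<partial>lborel)"
    by (rule integral_lborel_reflect[where f = "\<lambda>z. cis' (- ((q - z) \<bullet> p)) * complex_of_real (gn \<eta> z)"]) measurable
  also have "\<dots> = (\<integral>z. (cis' (- (p \<bullet> q)) * complex_of_real K) * (cis' (z \<bullet> p) * complex_of_real (ge (1 / \<eta>) z)) \<partial>lborel)"
  proof (rule Bochner_Integration.integral_cong[OF refl])
    fix z :: R3
    have "cis' (- ((q - z) \<bullet> p)) = cis' (- (p \<bullet> q)) * cis' (z \<bullet> p)"
    proof -
      have "- ((q - z) \<bullet> p) = - (p \<bullet> q) + z \<bullet> p" by (simp add: inner_diff_left inner_diff_right inner_commute)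
      then show ?thesis unfolding cis'_mult by simp
    qed
    then show "cis' (- ((q - z) \<bullet> p)) * complex_of_real (gn \<eta> z) = (cis' (- (p \<bullet> q)) * complex_of_real K) * (cis' (z \<bullet> p) * complex_of_real (ge (1 / \<eta>) z))"
      by (simp only: g of_real_mult mult_ac)
  qed
  also have "\<dots> = cis' (- (p \<bullet> q)) * complex_of_real (K * gk (1 / \<eta>) p)"
    using gauss_ft'(2)[of "1 / \<eta>" p] e by simp
  finally show ?thesis by (simp only: K)
qed

lemma schwartz_gn:
  fixes q :: R3
  assumes e: "\<eta> > 0"
  shows "schwartz (\<lambda>q'. complex_of_real (gn \<eta> (q - q')))"
proof -
  define K where "K = sqrt (2 * pi / \<eta>) ^ 3 / (2 * pi) ^ 3 * exp (- (q \<bullet> q) / (2 * \<eta>))"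
  have "gn \<eta> (q - q') = K * exp (- (1 / (2 * \<eta>)) * (q' \<bullet> q') + ((1 / \<eta>) *\<^sub>R q) \<bullet> q')" for q'
  proof -
    have e': "- ((q - q') \<bullet> (q - q')) / (2 * \<eta>) = - (q \<bullet> q) / (2 * \<eta>) + (- (1 / (2 * \<eta>)) * (q' \<bullet> q') + ((1 / \<eta>) *\<^sub>R q) \<bullet> q')"
      using e by (simp add: inner_diff_left inner_diff_right inner_commute field_simps)
    show ?thesis unfolding gn_def gk_def R3_DIM e' K_def exp_add by (simp only: times_divide_eq_left times_divide_eq_right mult_ac)
  qed
  then have "(\<lambda>q'. complex_of_real (gn \<eta> (q - q'))) = (\<lambda>q'. complex_of_real K * gE (1 / (2 * \<eta>)) ((1 / \<eta>) *\<^sub>R q) 0 q')"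
    by (auto simp: gE_def exp_of_real[symmetric])
  then show ?thesis using schwartz_gE[of "1 / (2 * \<eta>)"] e by simp
qed

text \<open>The mirror image of \<open>conv_eq_ift\<close>: testing with a translated Gaussian
  regularises \<open>U\<close> and expresses the result through \<open>u\<close>.\<close>

lemma dual_conv_eq_ift:
  assumes f: "fpair u U" and e: "\<eta> > 0"
  shows "(\<integral>q'. U q' * complex_of_real (gn \<eta> (q - q')) \<partial>lborel) = ift (\<lambda>p. u p * complex_of_real (ge \<eta> p)) (0 - q)"
proof -
  have "(\<integral>q'. U q' * complex_of_real (gn \<eta> (q - q')) \<partial>lborel) = (\<integral>p. u p * (cis' (- (p \<bullet> q)) * complex_of_real (ge \<eta> p)) \<partial>lborel)"
    using fpair_duality[OF f schwartz_gn[OF e, of q]] by (simp only: fourier_gn[OF e])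
  also have "\<dots> = ift (\<lambda>p. u p * complex_of_real (ge \<eta> p)) (0 - q)"
    unfolding ift_def by (simp add: inner_commute mult_ac)
  finally show ?thesis .
qed

text \<open>The shift by 2 keeps all terms at most 1/2, as \<open>gauss_conv_AE\<close>
  requires.\<close>

definition eps :: "nat \<Rightarrow> real" where "eps k = 1 / (real k + 2)"

lemma eps: "0 < eps k" "eps k \<le> 1/2" "eps \<longlonglongrightarrow> 0" "m \<le> k \<Longrightarrow> eps k \<le> eps m"
proof -
  show "eps \<longlonglongrightarrow> 0" unfolding eps_def by real_asymp
qed (auto simp: eps_def frac_le)

lemma ift_approx_AE:
  assumes f: "fpair u U"
  obtains r :: "nat \<Rightarrow> nat" where "strict_mono r" "AE p in lborel. (\<lambda>k. ift (reg U (eps (r k))) p) \<longlonglongrightarrow> u p"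
proof -
  have "\<And>c. c > 0 \<Longrightarrow> integrable lborel (\<lambda>p. u p * complex_of_real (ge c p))"
    using f by (intro tempered_ge(2)) (auto simp: fpair_def)
  from gauss_conv_AE(2)[OF fpair_measurable(1)[OF f] this eps(1-3)] show ?thesis
    using that by (auto simp: conv_eq_ift[OF f eps(1)])
qed

lemma dual_approx_AE:
  assumes f: "fpair u U"
  obtains r :: "nat \<Rightarrow> nat" where "strict_mono r" "AE q in lborel. (\<lambda>k. ift (\<lambda>p. u p * complex_of_real (ge (eps (r k)) p)) (0 - q)) \<longlonglongrightarrow> U q"
proof -
  have "\<And>c. c > 0 \<Longrightarrow> integrable lborel (\<lambda>p. U p * complex_of_real (ge c p))"
    using f by (intro tempered_ge(2)) (auto simp: fpair_def has_fourier_def)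
  from gauss_conv_AE(2)[OF fpair_measurable(2)[OF f] this eps(1-3)] show ?thesis
    using that by (auto simp: dual_conv_eq_ift[OF f eps(1)])
qed

lemma norm_ge_le:
  assumes "\<epsilon> > 0"
  shows "ennreal ((norm (z * complex_of_real (ge \<epsilon> p)))\<^sup>2) \<le> ennreal ((norm z)\<^sup>2)"
proof -
  have "norm (z * complex_of_real (ge \<epsilon> p)) \<le> norm z * 1"
    unfolding norm_mult using ge_le_1[of \<epsilon> p] ge_pos[of \<epsilon> p] assms by (intro mult_left_mono) auto
  then show ?thesis by (intro ennreal_leI power_mono) auto
qed

text \<open>Bessel's inequality holds for \<open>u\<close> times a Gaussian; the transforms of these
  products converge to \<open>U\<close> almost everywhere along a subsequence, and Fatou's lemma
  passes to the limit.\<close>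

lemma dual_L2_bound:
  assumes f: "fpair u U"
  shows "(\<integral>\<^sup>+q. ennreal ((norm (U q))\<^sup>2) \<partial>lborel) \<le> ennreal ((2 * pi) ^ 3) * (\<integral>\<^sup>+p. ennreal ((norm (u p))\<^sup>2) \<partial>lborel)"
proof -
  note fpair_measurable[OF f, measurable]
  obtain r :: "nat \<Rightarrow> nat" where r: "AE q in lborel. (\<lambda>k. ift (\<lambda>p. u p * complex_of_real (ge (eps (r k)) p)) (0 - q)) \<longlonglongrightarrow> U q"
    using dual_approx_AE[OF f] by blast
  define G where "G k p = u p * complex_of_real (ge (eps (r k)) p)" for k p
  have [measurable]: "G k \<in> borel_measurable borel" for k unfolding G_def by measurable
  have G: "integrable lborel (G k)" for k unfolding G_def
    using f by (intro tempered_ge(2) eps) (auto simp: fpair_def)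
  show ?thesis
  proof (rule fatou_norm2[OF _ r])
    show "(\<lambda>q. ift (\<lambda>p. u p * complex_of_real (ge (eps (r k)) p)) (0 - q)) \<in> borel_measurable borel" for k
      by measurable
    show "\<forall>\<^sub>F k in sequentially. (\<integral>\<^sup>+q. ennreal ((norm (ift (\<lambda>p. u p * complex_of_real (ge (eps (r k)) p)) (0 - q)))\<^sup>2) \<partial>lborel)
      \<le> ennreal ((2 * pi) ^ 3) * (\<integral>\<^sup>+p. ennreal ((norm (u p))\<^sup>2) \<partial>lborel)"
    proof (intro always_eventually allI)
      fix k
      have "(\<integral>\<^sup>+q. ennreal ((norm (ift (G k) (0 - q)))\<^sup>2) \<partial>lborel) = (\<integral>\<^sup>+q. ennreal ((norm (ift (G k) q))\<^sup>2) \<partial>lborel)"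
        by (rule nn_integral_lborel_reflect[where f = "\<lambda>q. ennreal ((norm (ift (G k) q))\<^sup>2)"]) measurable
      also have "\<dots> \<le> ennreal ((2 * pi) ^ 3) * (\<integral>\<^sup>+p. ennreal ((norm (G k p))\<^sup>2) \<partial>lborel)"
        using bessel[OF G, of k] by (simp only: R3_DIM)
      also have "\<dots> \<le> ennreal ((2 * pi) ^ 3) * (\<integral>\<^sup>+p. ennreal ((norm (u p))\<^sup>2) \<partial>lborel)"
        unfolding G_def by (intro mult_left_mono nn_integral_mono norm_ge_le eps) auto
      finally show "(\<integral>\<^sup>+q. ennreal ((norm (ift (\<lambda>p. u p * complex_of_real (ge (eps (r k)) p)) (0 - q)))\<^sup>2) \<partial>lborel)
      \<le> ennreal ((2 * pi) ^ 3) * (\<integral>\<^sup>+p. ennreal ((norm (u p))\<^sup>2) \<partial>lborel)" by (simp add: G_def[abs_def])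
    qed
  qed
qed

text \<open>For \<open>m \<ge> k\<close> Bessel's inequality bounds the distance between two
  regularisations by the L2 norm of \<open>U\<close> times \<open>1 - ge (eps k)\<close>. Letting
  \<open>m\<close> tend to infinity along the subsequence that converges almost everywhere replaces
  the finer regularisation by \<open>u\<close>. The bound depends only on \<open>k\<close>, so the
  whole sequence converges in L2.\<close>

lemma L2_approx:
  assumes f: "fpair u U" and fin: "(\<integral>\<^sup>+q. ennreal ((norm (U q))\<^sup>2) \<partial>lborel) < \<infinity>"
  shows "(\<integral>\<^sup>+p. ennreal ((norm (u p - ift (reg U (eps k)) p))\<^sup>2) \<partial>lborel) \<le> (\<integral>\<^sup>+q. ennreal ((norm (U q))\<^sup>2 * (1 - ge (eps k) q)\<^sup>2) \<partial>lborel)"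
    "(\<lambda>k. \<integral>\<^sup>+p. ennreal ((norm (u p - ift (reg U (eps k)) p))\<^sup>2) \<partial>lborel) \<longlonglongrightarrow> 0"
    "(\<integral>\<^sup>+p. ennreal ((norm (u p))\<^sup>2) \<partial>lborel) < \<infinity>"
    "(\<integral>\<^sup>+p. ennreal ((norm (ift (reg U (eps k)) p))\<^sup>2) \<partial>lborel) \<le> (\<integral>\<^sup>+q. ennreal ((norm (U q))\<^sup>2) \<partial>lborel)"
proof -
  note fpair_measurable[OF f, measurable]
  obtain r :: "nat \<Rightarrow> nat" where r: "strict_mono r" "AE p in lborel. (\<lambda>k. ift (reg U (eps (r k))) p) \<longlonglongrightarrow> u p"
    using ift_approx_AE[OF f] by blast
  have p1: "(2 * pi) ^ 3 \<ge> (1::real)" using pi_ge_two by (intro one_le_power) linarith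
  \<comment> \<open>The factor of \<open>(2 * pi) ^ 3\<close> in \<open>reg\<close> enters squared
    and outweighs the one in Bessel's inequality, so the constant may be taken to be 1.\<close>
  have bes: "(\<integral>\<^sup>+p. ennreal ((norm (ift G p))\<^sup>2) \<partial>lborel) \<le> (\<integral>\<^sup>+q. ennreal ((norm (U q))\<^sup>2 * (h q)\<^sup>2) \<partial>lborel)"
    if G: "integrable lborel G" and Gh: "\<And>q. G q = U q * complex_of_real (h q / (2 * pi) ^ 3)" and [measurable]: "h \<in> borel_measurable borel" for G h
  proof -
    have "(\<integral>\<^sup>+p. ennreal ((norm (ift G p))\<^sup>2) \<partial>lborel) \<le> ennreal ((2 * pi) ^ 3) * (\<integral>\<^sup>+q. ennreal ((norm (G q))\<^sup>2) \<partial>lborel)"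
      using bessel[OF G] by (simp only: R3_DIM)
    also have "\<dots> = (\<integral>\<^sup>+q. ennreal ((2 * pi) ^ 3 * (norm (G q))\<^sup>2) \<partial>lborel)"
      using G by (subst nn_integral_cmult[symmetric]) (auto simp: ennreal_mult)
    also have "\<dots> \<le> (\<integral>\<^sup>+q. ennreal ((norm (U q))\<^sup>2 * (h q)\<^sup>2) \<partial>lborel)"
    proof (intro nn_integral_mono ennreal_leI)
      fix q
      have "norm (G q) = norm (U q) * \<bar>h q\<bar> / (2 * pi) ^ 3" unfolding Gh norm_mult norm_of_real abs_divide by simp
      then have "(2 * pi) ^ 3 * (norm (G q))\<^sup>2 = ((norm (U q))\<^sup>2 * (h q)\<^sup>2) / (2 * pi) ^ 3"
      proof -
        have gen: "c * (a * b / c)\<^sup>2 = (a\<^sup>2 * b\<^sup>2) / c" if "c \<ge> 1" for a b c :: real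
          using that by (simp add: power2_eq_square)
        assume "norm (G q) = norm (U q) * \<bar>h q\<bar> / (2 * pi) ^ 3"
        then show ?thesis using gen[OF p1, of "norm (U q)" "\<bar>h q\<bar>"] by (simp only: power2_abs)
      qed
      also have "\<dots> \<le> ((norm (U q))\<^sup>2 * (h q)\<^sup>2) / 1" using p1 by (intro divide_left_mono) auto
      finally show "(2 * pi) ^ 3 * (norm (G q))\<^sup>2 \<le> (norm (U q))\<^sup>2 * (h q)\<^sup>2" by simp
    qed
    finally show ?thesis .
  qed
  have ri: "integrable lborel (reg U (eps k))" for k by (rule reg_integrable[OF f eps(1)])
  have b0: "(\<integral>\<^sup>+p. ennreal ((norm (ift (reg U (eps k)) p))\<^sup>2) \<partial>lborel) \<le> (\<integral>\<^sup>+q. ennreal ((norm (U q))\<^sup>2) \<partial>lborel)" for k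
  proof (rule order_trans[OF bes[OF ri, where h = "ge (eps k)"]])
    show "(\<integral>\<^sup>+q. ennreal ((norm (U q))\<^sup>2 * (ge (eps k) q)\<^sup>2) \<partial>lborel) \<le> (\<integral>\<^sup>+q. ennreal ((norm (U q))\<^sup>2) \<partial>lborel)"
      using ge_le_1[of "eps k"] less_imp_le[OF ge_pos, of "eps k"] less_imp_le[OF eps(1), of k]
      by (intro nn_integral_mono ennreal_leI mult_left_le power_le_one) auto
  qed (simp_all add: reg_def)
  show "(\<integral>\<^sup>+p. ennreal ((norm (ift (reg U (eps k)) p))\<^sup>2) \<partial>lborel) \<le> (\<integral>\<^sup>+q. ennreal ((norm (U q))\<^sup>2) \<partial>lborel)" by (rule b0)
  have "(\<integral>\<^sup>+p. ennreal ((norm (u p))\<^sup>2) \<partial>lborel) \<le> (\<integral>\<^sup>+q. ennreal ((norm (U q))\<^sup>2) \<partial>lborel)"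
    by (rule fatou_norm2[OF _ r(2)]) (auto intro!: always_eventually b0)
  then show "(\<integral>\<^sup>+p. ennreal ((norm (u p))\<^sup>2) \<partial>lborel) < \<infinity>" using fin by (rule le_less_trans)
  have a: "(\<integral>\<^sup>+p. ennreal ((norm (u p - ift (reg U (eps k)) p))\<^sup>2) \<partial>lborel) \<le> (\<integral>\<^sup>+q. ennreal ((norm (U q))\<^sup>2 * (1 - ge (eps k) q)\<^sup>2) \<partial>lborel)" for k
  proof (rule fatou_norm2[where f = "\<lambda>m p. ift (reg U (eps (r m))) p - ift (reg U (eps k)) p"])
    show "AE p in lborel. (\<lambda>m. ift (reg U (eps (r m))) p - ift (reg U (eps k)) p) \<longlonglongrightarrow> u p - ift (reg U (eps k)) p"
      using r(2) by eventually_elim (intro tendsto_intros)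
    show "\<forall>\<^sub>F m in sequentially. (\<integral>\<^sup>+p. ennreal ((norm (ift (reg U (eps (r m))) p - ift (reg U (eps k)) p))\<^sup>2) \<partial>lborel)
      \<le> (\<integral>\<^sup>+q. ennreal ((norm (U q))\<^sup>2 * (1 - ge (eps k) q)\<^sup>2) \<partial>lborel)"
      using eventually_ge_at_top[of k]
    proof eventually_elim
      case (elim m)
      define G where "G q = reg U (eps (r m)) q - reg U (eps k) q" for q
      have e: "eps (r m) \<le> eps k" using elim seq_suble[OF r(1), of m] by (intro eps(4)) linarith
      have "ift (reg U (eps (r m))) p - ift (reg U (eps k)) p = ift G p" for p
        unfolding ift_def G_def left_diff_distrib
        by (intro Bochner_Integration.integral_diff[symmetric] integrable_mult_cis ri) measurable
      moreover have "(\<integral>\<^sup>+p. ennreal ((norm (ift G p))\<^sup>2) \<partial>lborel) \<le> (\<integral>\<^sup>+q. ennreal ((norm (U q))\<^sup>2 * (ge (eps (r m)) q - ge (eps k) q)\<^sup>2) \<partial>lborel)"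
      proof (rule bes)
        show "integrable lborel G" unfolding G_def[abs_def] by (intro Bochner_Integration.integrable_diff ri)
        show "G q = U q * complex_of_real ((ge (eps (r m)) q - ge (eps k) q) / (2 * pi) ^ 3)" for q
          unfolding G_def reg_def diff_divide_distrib of_real_diff by (simp only: right_diff_distrib)
      qed measurable
      moreover have "\<dots> \<le> (\<integral>\<^sup>+q. ennreal ((norm (U q))\<^sup>2 * (1 - ge (eps k) q)\<^sup>2) \<partial>lborel)"
      proof (intro nn_integral_mono ennreal_leI mult_left_mono power_mono)
        fix q :: R3
        show "0 \<le> ge (eps (r m)) q - ge (eps k) q"
          using e by (simp add: ge_def mult_right_mono)
        show "ge (eps (r m)) q - ge (eps k) q \<le> 1 - ge (eps k) q"
          using ge_le_1[of "eps (r m)" q] eps(1)[of "r m"] by simp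
      qed auto
      ultimately show ?case by simp
    qed
  qed measurable
  show "(\<integral>\<^sup>+p. ennreal ((norm (u p - ift (reg U (eps k)) p))\<^sup>2) \<partial>lborel) \<le> (\<integral>\<^sup>+q. ennreal ((norm (U q))\<^sup>2 * (1 - ge (eps k) q)\<^sup>2) \<partial>lborel)" by (rule a)
  have "(\<lambda>k. \<integral>\<^sup>+q. ennreal ((norm (U q))\<^sup>2 * (1 - ge (eps k) q)\<^sup>2) \<partial>lborel) \<longlonglongrightarrow> (\<integral>\<^sup>+q. 0 \<partial>(lborel::R3 measure))"
  proof (rule nn_integral_dominated_convergence[where w = "\<lambda>q. ennreal ((norm (U q))\<^sup>2)"])
    show "AE q in lborel. ennreal ((norm (U q))\<^sup>2 * (1 - ge (eps k) q)\<^sup>2) \<le> ennreal ((norm (U q))\<^sup>2)" for k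
      using ge_le_1[of "eps k"] less_imp_le[OF ge_pos, of "eps k"] less_imp_le[OF eps(1), of k]
      by (intro AE_I2 ennreal_leI mult_left_le power_le_one) auto
    show "AE q in lborel. (\<lambda>k. ennreal ((norm (U q))\<^sup>2 * (1 - ge (eps k) q)\<^sup>2)) \<longlonglongrightarrow> 0"
    proof (intro AE_I2)
      fix q
      have "(\<lambda>k. ennreal ((norm (U q))\<^sup>2 * (1 - ge (eps k) q)\<^sup>2)) \<longlonglongrightarrow> ennreal ((norm (U q))\<^sup>2 * (1 - 1)\<^sup>2)"
        by (intro tendsto_ennrealI tendsto_intros ge_tendsto_1 eps)
      then show "(\<lambda>k. ennreal ((norm (U q))\<^sup>2 * (1 - ge (eps k) q)\<^sup>2)) \<longlonglongrightarrow> 0" by simp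
    qed
  qed (use fin in auto)
  then have "(\<lambda>k. \<integral>\<^sup>+q. ennreal ((norm (U q))\<^sup>2 * (1 - ge (eps k) q)\<^sup>2) \<partial>lborel) \<longlonglongrightarrow> 0"
    by (simp only: nn_integral_const mult_zero_left)
  with a show "(\<lambda>k. \<integral>\<^sup>+p. ennreal ((norm (u p - ift (reg U (eps k)) p))\<^sup>2) \<partial>lborel) \<longlonglongrightarrow> 0"
    by (rule tendsto_0_le_ennreal)
qed

section \<open>Bessel's inequality in the space variables and Minkowski's inequality for
  series\<close>

lemma nn_integral_R2:
  fixes f :: "real \<times> real \<Rightarrow> ennreal"
  assumes [measurable]: "f \<in> borel_measurable borel"
  shows "(\<integral>\<^sup>+p. f p \<partial>lborel) = (\<integral>\<^sup>+x. \<integral>\<^sup>+y. f (x, y) \<partial>lborel \<partial>lborel)"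
  unfolding lborel_prod[symmetric] by (rule lborel.nn_integral_fst[symmetric]) (simp add: lborel_prod)

lemma bessel_real:
  fixes h :: "real \<Rightarrow> complex"
  assumes "integrable lborel h"
  shows "(\<integral>\<^sup>+x. ennreal ((norm (\<integral>\<xi>. h \<xi> * cis' (x * \<xi>) \<partial>lborel))\<^sup>2) \<partial>lborel) \<le> ennreal (2 * pi) * (\<integral>\<^sup>+\<xi>. ennreal ((norm (h \<xi>))\<^sup>2) \<partial>lborel)"
  using bessel[OF assms] by (simp add: ift_def)

text \<open>Bessel's inequality in \<open>x\<close> and \<open>y\<close> only, at fixed time.\<close>

lemma bessel_time_slab:
  fixes G :: "R3 \<Rightarrow> complex"
  assumes G: "integrable lborel G" and T: "T > 0"
  shows "(\<integral>\<^sup>+p. ennreal ((norm (complex_of_real (indicator {-T..T} (snd (snd p))) * ift G p))\<^sup>2) \<partial>lborel)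
    \<le> ennreal (2 * T * (2 * pi)\<^sup>2) * (\<integral>\<^sup>+p. (\<integral>\<^sup>+\<tau>. ennreal (norm (G (fst p, snd p, \<tau>))) \<partial>lborel)\<^sup>2 \<partial>lborel)"
proof -
  have [measurable]: "G \<in> borel_measurable borel" using G by auto
  have Gp[measurable]: "(\<lambda>(x, y, z). G (x, y, z)) \<in> borel_measurable (borel \<Otimes>\<^sub>M borel \<Otimes>\<^sub>M borel)"
    unfolding borel_prod by simp
  define h where "h y t \<xi> = (\<integral>w. G (\<xi>, w) * cis' (y * fst w + t * snd w) \<partial>lborel)" for y t \<xi>
  define S where "S \<xi> \<mu> = (\<integral>\<^sup>+\<tau>. ennreal (norm (G (\<xi>, \<mu>, \<tau>))) \<partial>lborel)" for \<xi> \<mu>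
  define g where "g t \<xi> \<mu> = (\<integral>\<tau>. G (\<xi>, \<mu>, \<tau>) * cis' (t * \<tau>) \<partial>lborel)" for t \<xi> \<mu>
  have hm[measurable]: "(\<lambda>(y, \<xi>). h y t \<xi>) \<in> borel_measurable (borel \<Otimes>\<^sub>M borel)" for t
    unfolding h_def split_def borel_prod by measurable
  have Sm[measurable]: "(\<lambda>(\<xi>, \<mu>). S \<xi> \<mu>) \<in> borel_measurable (borel \<Otimes>\<^sub>M borel)"
    unfolding S_def split_def borel_prod by measurable
  have 1: "ift G (x, y, t) = (\<integral>\<xi>. h y t \<xi> * cis' (x * \<xi>) \<partial>lborel)" and hi: "integrable lborel (h y t)" for x y t
  proof -
    have i: "integrable lborel (\<lambda>q. G q * cis' ((x, y, t) \<bullet> q))" for x by (rule integrable_mult_cis[OF G]) measurable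
    have e: "(\<integral>w. G (\<xi>, w) * cis' ((x, y, t) \<bullet> (\<xi>, w)) \<partial>lborel) = h y t \<xi> * cis' (x * \<xi>)" for \<xi> x
      unfolding h_def integral_mult_left_zero[symmetric] mult.assoc cis'_mult
      by (intro Bochner_Integration.integral_cong) (auto simp: add_ac inner_prod_def)
    show "ift G (x, y, t) = (\<integral>\<xi>. h y t \<xi> * cis' (x * \<xi>) \<partial>lborel)"
      unfolding ift_def integral_lborel_pair(1)[OF i] e ..
    show "integrable lborel (h y t)"
      using integral_lborel_pair(3)[OF i[of 0]] unfolding e by simp
  qed
  have 2: "(\<integral>\<^sup>+y. ennreal ((norm (h y t \<xi>))\<^sup>2) \<partial>lborel) \<le> ennreal (2 * pi) * (\<integral>\<^sup>+\<mu>. (S \<xi> \<mu>)\<^sup>2 \<partial>lborel)" for t \<xi>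
  proof (cases "integrable lborel (\<lambda>w. G (\<xi>, w))")
    case False
    \<comment> \<open>For the exceptional \<xi> whose fibre is not integrable, the integral that
      defines \<open>h\<close> has the default value 0.\<close>
    have "h y t \<xi> = 0" for y
    proof -
      have "\<not> integrable lborel (\<lambda>w. G (\<xi>, w) * cis' (y * fst w + t * snd w))"
      proof
        assume "integrable lborel (\<lambda>w. G (\<xi>, w) * cis' (y * fst w + t * snd w))"
        then have "integrable lborel (\<lambda>w. G (\<xi>, w))"
          by (rule Bochner_Integration.integrable_bound) (auto simp: norm_mult)
        then show False using False by simp
      qed
      then show ?thesis by (simp add: h_def not_integrable_integral_eq)
    qed
    then show ?thesis by simp
  next
    case True
    have i: "integrable lborel (\<lambda>w. G (\<xi>, w) * cis' (y * fst w + t * snd w))" for y by (rule integrable_mult_cis[OF True]) measurable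
    have e: "(\<integral>\<tau>. G (\<xi>, \<mu>, \<tau>) * cis' (y * \<mu> + t * \<tau>) \<partial>lborel) = g t \<xi> \<mu> * cis' (y * \<mu>)" for \<mu> y
      unfolding g_def integral_mult_left_zero[symmetric] mult.assoc cis'_mult
      by (intro Bochner_Integration.integral_cong) (auto simp: add_ac)
    have h: "h y t \<xi> = (\<integral>\<mu>. g t \<xi> \<mu> * cis' (y * \<mu>) \<partial>lborel)" for y
      using integral_lborel_pair(1)[OF i[of y]] by (simp only: h_def fst_conv snd_conv e)
    have gi: "integrable lborel (g t \<xi>)"
      using integral_lborel_pair(3)[OF i[of 0]] e[where y = 0] by simp
    have "(\<integral>\<^sup>+y. ennreal ((norm (h y t \<xi>))\<^sup>2) \<partial>lborel) \<le> ennreal (2 * pi) * (\<integral>\<^sup>+\<mu>. ennreal ((norm (g t \<xi> \<mu>))\<^sup>2) \<partial>lborel)"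
      unfolding h by (rule bessel_real[OF gi])
    also have "\<dots> \<le> ennreal (2 * pi) * (\<integral>\<^sup>+\<mu>. (S \<xi> \<mu>)\<^sup>2 \<partial>lborel)"
    proof (intro mult_left_mono nn_integral_mono)
      fix \<mu>
      have "ennreal (norm (g t \<xi> \<mu>)) \<le> (\<integral>\<^sup>+\<tau>. ennreal (norm (G (\<xi>, \<mu>, \<tau>) * cis' (t * \<tau>))) \<partial>lborel)"
        unfolding g_def
      proof (cases "integrable lborel (\<lambda>\<tau>. G (\<xi>, \<mu>, \<tau>) * cis' (t * \<tau>))")
        case True
        then show "ennreal (norm (\<integral>\<tau>. G (\<xi>, \<mu>, \<tau>) * cis' (t * \<tau>) \<partial>lborel)) \<le> (\<integral>\<^sup>+\<tau>. ennreal (norm (G (\<xi>, \<mu>, \<tau>) * cis' (t * \<tau>))) \<partial>lborel)"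
          by (rule integral_norm_bound_ennreal)
      qed (simp add: not_integrable_integral_eq)
      then have "ennreal (norm (g t \<xi> \<mu>)) \<le> S \<xi> \<mu>" by (simp add: norm_mult S_def)
      then have "(ennreal (norm (g t \<xi> \<mu>)))\<^sup>2 \<le> (S \<xi> \<mu>)\<^sup>2" by (intro power_mono) auto
      then show "ennreal ((norm (g t \<xi> \<mu>))\<^sup>2) \<le> (S \<xi> \<mu>)\<^sup>2" by (simp add: ennreal_power)
    qed auto
    finally show ?thesis .
  qed
  define SS where "SS = (\<integral>\<^sup>+\<xi>. \<integral>\<^sup>+\<mu>. (S \<xi> \<mu>)\<^sup>2 \<partial>lborel \<partial>lborel)"
  have 3: "(\<integral>\<^sup>+y. \<integral>\<^sup>+x. ennreal ((norm (ift G (x, y, t)))\<^sup>2) \<partial>lborel \<partial>lborel) \<le> ennreal ((2 * pi)\<^sup>2) * SS" for t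
  proof -
    have "(\<integral>\<^sup>+y. \<integral>\<^sup>+x. ennreal ((norm (ift G (x, y, t)))\<^sup>2) \<partial>lborel \<partial>lborel) \<le> (\<integral>\<^sup>+y. ennreal (2 * pi) * (\<integral>\<^sup>+\<xi>. ennreal ((norm (h y t \<xi>))\<^sup>2) \<partial>lborel) \<partial>lborel)"
      unfolding 1 by (intro nn_integral_mono bessel_real hi)
    also have "\<dots> = ennreal (2 * pi) * (\<integral>\<^sup>+y. \<integral>\<^sup>+\<xi>. ennreal ((norm (h y t \<xi>))\<^sup>2) \<partial>lborel \<partial>lborel)"
      by (rule nn_integral_cmult) measurable
    also have "(\<integral>\<^sup>+y. \<integral>\<^sup>+\<xi>. ennreal ((norm (h y t \<xi>))\<^sup>2) \<partial>lborel \<partial>lborel) = (\<integral>\<^sup>+\<xi>. \<integral>\<^sup>+y. ennreal ((norm (h y t \<xi>))\<^sup>2) \<partial>lborel \<partial>lborel)"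
      by (rule lborel_Fubini) measurable
    also have "\<dots> \<le> (\<integral>\<^sup>+\<xi>. ennreal (2 * pi) * (\<integral>\<^sup>+\<mu>. (S \<xi> \<mu>)\<^sup>2 \<partial>lborel) \<partial>lborel)"
      by (intro nn_integral_mono 2)
    also have "\<dots> = ennreal (2 * pi) * SS" unfolding SS_def by (rule nn_integral_cmult) measurable
    finally have "(\<integral>\<^sup>+y. \<integral>\<^sup>+x. ennreal ((norm (ift G (x, y, t)))\<^sup>2) \<partial>lborel \<partial>lborel) \<le> ennreal (2 * pi) * (ennreal (2 * pi) * SS)"
      by (simp only: mult_left_mono zero_le)
    moreover have "ennreal ((2 * pi)\<^sup>2) = ennreal (2 * pi) * ennreal (2 * pi)"
      by (subst ennreal_mult[symmetric]) (auto simp: power2_eq_square)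
    ultimately show ?thesis by (simp only: mult.assoc)
  qed
  define I where "I x y t = ennreal ((norm (complex_of_real (indicator {-T..T} t) * ift G (x, y, t)))\<^sup>2)" for x y t
  have I: "I x y t = indicator {-T..T} t * ennreal ((norm (ift G (x, y, t)))\<^sup>2)" for x y t
    by (auto simp: I_def indicator_def)
  have im: "ift G \<in> borel_measurable borel" by measurable
  have im'[measurable]: "(\<lambda>(x, y, z). ift G (x, y, z)) \<in> borel_measurable (borel \<Otimes>\<^sub>M borel \<Otimes>\<^sub>M borel)"
    unfolding borel_prod using im by simp
  \<comment> \<open>Time is moved outermost. The inner bound does not depend on \<open>t\<close>, so
    the indicator contributes its length \<open>2 * T\<close>.\<close>
  have "(\<integral>\<^sup>+p. ennreal ((norm (complex_of_real (indicator {-T..T} (snd (snd p))) * ift G p))\<^sup>2) \<partial>lborel) = (\<integral>\<^sup>+x. \<integral>\<^sup>+y. \<integral>\<^sup>+t. I x y t \<partial>lborel \<partial>lborel \<partial>lborel)"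
    unfolding I_def[abs_def] by (subst nn_integral_R3) auto
  also have "\<dots> = (\<integral>\<^sup>+x. \<integral>\<^sup>+t. \<integral>\<^sup>+y. I x y t \<partial>lborel \<partial>lborel \<partial>lborel)"
    unfolding I_def by (intro nn_integral_cong lborel_Fubini) measurable
  also have "\<dots> = (\<integral>\<^sup>+t. \<integral>\<^sup>+x. \<integral>\<^sup>+y. I x y t \<partial>lborel \<partial>lborel \<partial>lborel)"
    unfolding I_def by (rule lborel_Fubini) measurable
  also have "\<dots> = (\<integral>\<^sup>+t. \<integral>\<^sup>+y. \<integral>\<^sup>+x. I x y t \<partial>lborel \<partial>lborel \<partial>lborel)"
    unfolding I_def by (intro nn_integral_cong lborel_Fubini) measurable
  also have "\<dots> = (\<integral>\<^sup>+t. indicator {-T..T} t * (\<integral>\<^sup>+y. \<integral>\<^sup>+x. ennreal ((norm (ift G (x, y, t)))\<^sup>2) \<partial>lborel \<partial>lborel) \<partial>lborel)"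
    unfolding I by (simp add: nn_integral_cmult)
  also have "\<dots> \<le> (\<integral>\<^sup>+t. indicator {-T..T} t * (ennreal ((2 * pi)\<^sup>2) * SS) \<partial>lborel)"
    by (intro nn_integral_mono mult_left_mono 3) auto
  also have "\<dots> = ennreal (2 * T) * (ennreal ((2 * pi)\<^sup>2) * SS)"
    using T by (subst nn_integral_multc) auto
  also have "\<dots> = ennreal (2 * T * (2 * pi)\<^sup>2) * SS" 
  proof -
    have "ennreal (2 * T * (2 * pi)\<^sup>2) = ennreal (2 * T) * ennreal ((2 * pi)\<^sup>2)" using T by (intro ennreal_mult) auto
    then show ?thesis by (simp only: mult.assoc)
  qed
  also have "SS = (\<integral>\<^sup>+p. (S (fst p) (snd p))\<^sup>2 \<partial>lborel)"
    unfolding SS_def by (subst nn_integral_R2) (use Sm in \<open>auto simp: borel_prod split_def\<close>)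
  finally show ?thesis unfolding S_def .
qed

text \<open>The square of the series is a double series, integrated term by term. Cauchy--Schwarz
  bounds each mixed term by a product, and the double series of these products is again a
  square.\<close>

lemma minkowski_suminf:
  fixes f :: "nat \<Rightarrow> 'a::euclidean_space \<Rightarrow> ennreal"
  assumes [measurable]: "\<And>j. f j \<in> borel_measurable borel"
  shows "(\<integral>\<^sup>+x. (\<Sum>j. f j x)\<^sup>2 \<partial>lborel) \<le> (\<Sum>j. esqrt (sqint (f j)))\<^sup>2"
proof -
  have sq: "(\<Sum>j. a j)\<^sup>2 = (\<Sum>i. \<Sum>j. a i * a j)" for a :: "nat \<Rightarrow> ennreal"
    using suminf_prod_ennreal[of 1 a a 1] by (simp add: power2_eq_square)
  have "(\<integral>\<^sup>+x. (\<Sum>j. f j x)\<^sup>2 \<partial>lborel) = (\<Sum>i. \<Sum>j. \<integral>\<^sup>+x. f i x * f j x \<partial>lborel)"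
    unfolding sq by (subst nn_integral_suminf, measurable) (intro suminf_cong nn_integral_suminf, measurable)
  also have "\<dots> \<le> (\<Sum>i. \<Sum>j. esqrt (sqint (f i)) * esqrt (sqint (f j)))"
  proof (intro suminf_le allI)
    fix i j
    have "(\<integral>\<^sup>+x. f i x * f j x \<partial>lborel)\<^sup>2 \<le> (esqrt (sqint (f i)) * esqrt (sqint (f j)))\<^sup>2"
      unfolding power_mult_distrib esqrt_power2 by (rule Cauchy_Schwarz_nn_integral) measurable
    then show "(\<integral>\<^sup>+x. f i x * f j x \<partial>lborel) \<le> esqrt (sqint (f i)) * esqrt (sqint (f j))"
      by (simp add: ennreal_power2_le_iff)
  qed auto
  finally show ?thesis by (simp add: sq)
qed

section \<open>The Fourier transform of a product\<close>

lemma abs_ge [simp]: "\<bar>ge \<epsilon> p\<bar> = ge \<epsilon> p"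
  by (rule abs_of_pos[OF ge_pos])

lemma integral_lborel_shift:
  fixes f :: "'a::euclidean_space \<Rightarrow> 'b::{banach, second_countable_topology}"
  assumes [measurable]: "f \<in> borel_measurable borel"
  shows "(\<integral>x. f (x - a) \<partial>lborel) = (\<integral>x. f x \<partial>lborel)"
proof -
  have "(\<integral>x. f x \<partial>lborel) = (\<integral>x. f x \<partial>distr lborel borel ((+) (- a)))" by (simp only: lborel_distr_plus)
  also have "\<dots> = (\<integral>x. f (- a + x) \<partial>lborel)" by (rule integral_distr) measurable
  finally show ?thesis by simp
qed

lemma integrable_shift:
  fixes f :: "'a::euclidean_space \<Rightarrow> complex"
  assumes "integrable lborel f"
  shows "integrable lborel (\<lambda>x. f (x - a))"
proof -
  have [measurable]: "f \<in> borel_measurable borel" using assms by auto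
  have "(\<integral>\<^sup>+x. ennreal (norm (f (x - a))) \<partial>lborel) = (\<integral>\<^sup>+x. ennreal (norm (f x)) \<partial>lborel)"
    by (rule nn_integral_lborel_shift) measurable
  then show ?thesis using assms by (auto simp: integrable_iff_bounded)
qed

definition cv :: "(R3 \<Rightarrow> complex) \<Rightarrow> (R3 \<Rightarrow> complex) \<Rightarrow> R3 \<Rightarrow> complex" where
  "cv G H y = (\<integral>q. G q * H (y - q) \<partial>lborel)"

lemma cv_measurable[measurable]:
  assumes [measurable]: "G \<in> borel_measurable borel" "H \<in> borel_measurable borel"
  shows "cv G H \<in> borel_measurable borel"
  unfolding cv_def by measurable

lemma cv_ift:
  assumes G: "integrable lborel G" and H: "integrable lborel H"
  shows "integrable lborel (cv G H)" "ift (cv G H) p = ift G p * ift H p"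
proof -
  have [measurable]: "G \<in> borel_measurable borel" "H \<in> borel_measurable borel" using G H by auto
  define K where "K Q = G (fst Q) * H (snd Q - fst Q)" for Q :: "R3 \<times> R3"
  have K: "integrable lborel K"
  proof (rule integrable_lborel_pair)
    show "K \<in> borel_measurable borel" unfolding K_def by measurable
    have "(\<integral>y. norm (K (x, y)) \<partial>lborel) = norm (G x) * (\<integral>y. norm (H y) \<partial>lborel)" for x
      unfolding K_def norm_mult using integral_lborel_shift[of "\<lambda>y. norm (H y)" x] by simp
    then show "integrable lborel (\<lambda>x. \<integral>y. norm (K (x, y)) \<partial>lborel)"
      using integrable_norm[OF G] by simp
    show "integrable lborel (\<lambda>y. K (x, y))" for x
      unfolding K_def using integrable_shift[OF H] by simp
  qed
  have "integrable lborel (\<lambda>y. \<integral>x. K (x, y) \<partial>lborel)"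
    using lborel_pair.integrable_snd[of "\<lambda>x y. K (x, y)"] K by (simp add: lborel_prod)
  then show "integrable lborel (cv G H)" by (simp add: K_def cv_def[abs_def])
  have Kc: "integrable lborel (\<lambda>Q. K Q * cis' (p \<bullet> snd Q))" by (rule integrable_mult_cis[OF K]) measurable
  have "ift (cv G H) p = (\<integral>y. \<integral>x. K (x, y) * cis' (p \<bullet> snd (x, y)) \<partial>lborel \<partial>lborel)"
    unfolding ift_def K_def cv_def by simp
  also have "\<dots> = (\<integral>x. \<integral>y. K (x, y) * cis' (p \<bullet> snd (x, y)) \<partial>lborel \<partial>lborel)"
    using integral_lborel_pair(1,2)[OF Kc] by simp
  also have "\<dots> = (\<integral>x. (G x * cis' (p \<bullet> x)) * ift H p \<partial>lborel)"
  proof (rule Bochner_Integration.integral_cong[OF refl])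
    fix x
    have "(\<integral>y. K (x, y) * cis' (p \<bullet> snd (x, y)) \<partial>lborel) = (\<integral>y. (\<lambda>z. G x * (cis' (p \<bullet> x) * (H z * cis' (p \<bullet> z)))) (y - x) \<partial>lborel)"
    proof (rule Bochner_Integration.integral_cong[OF refl])
      fix y
      have "cis' (p \<bullet> y) = cis' (p \<bullet> x) * cis' (p \<bullet> (y - x))" unfolding cis'_mult by (simp add: inner_diff_right)
      then show "K (x, y) * cis' (p \<bullet> snd (x, y)) = (\<lambda>z. G x * (cis' (p \<bullet> x) * (H z * cis' (p \<bullet> z)))) (y - x)"
        by (simp only: K_def fst_conv snd_conv mult_ac)
    qed
    also have "\<dots> = (\<integral>z. G x * (cis' (p \<bullet> x) * (H z * cis' (p \<bullet> z))) \<partial>lborel)"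
      by (rule integral_lborel_shift) measurable
    finally show "(\<integral>y. K (x, y) * cis' (p \<bullet> snd (x, y)) \<partial>lborel) = (G x * cis' (p \<bullet> x)) * ift H p"
      by (simp add: ift_def mult.assoc)
  qed
  also have "\<dots> = ift G p * ift H p" by (simp add: ift_def)
  finally show "ift (cv G H) p = ift G p * ift H p" .
qed

lemma L2_mult:
  fixes f g :: "R3 \<Rightarrow> complex"
  assumes [measurable]: "f \<in> borel_measurable borel" "g \<in> borel_measurable borel"
  shows "(\<integral>\<^sup>+p. ennreal (norm (f p * g p)) \<partial>lborel)\<^sup>2 \<le> (\<integral>\<^sup>+p. ennreal ((norm (f p))\<^sup>2) \<partial>lborel) * (\<integral>\<^sup>+p. ennreal ((norm (g p))\<^sup>2) \<partial>lborel)"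
  using Cauchy_Schwarz_nn_integral[of "\<lambda>p. ennreal (norm (f p))" lborel "\<lambda>p. ennreal (norm (g p))"]
  by (simp add: norm_mult ennreal_mult ennreal_power)

lemma L2_mult_integrable:
  fixes f g :: "R3 \<Rightarrow> complex"
  assumes m[measurable]: "f \<in> borel_measurable borel" "g \<in> borel_measurable borel"
    and fin: "(\<integral>\<^sup>+p. ennreal ((norm (f p))\<^sup>2) \<partial>lborel) < \<infinity>" "(\<integral>\<^sup>+p. ennreal ((norm (g p))\<^sup>2) \<partial>lborel) < \<infinity>"
  shows "integrable lborel (\<lambda>p. f p * g p)"
proof -
  have "(\<integral>\<^sup>+p. ennreal (norm (f p * g p)) \<partial>lborel)\<^sup>2 < \<infinity>"
    by (rule le_less_trans[OF L2_mult[OF m]]) (use fin in \<open>simp add: ennreal_mult_less_top\<close>)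
  then have "(\<integral>\<^sup>+p. ennreal (norm (f p * g p)) \<partial>lborel) < \<infinity>"
    by (auto simp: power2_eq_square ennreal_mult_less_top)
  then show ?thesis unfolding integrable_iff_bounded by simp
qed

lemma fourier_ift: "fourier \<psi> p = ift \<psi> (0 - p)"
  unfolding fourier_cis' ift_def by (simp add: mult.commute inner_commute)

lemma norm_ift_le: "norm (ift G p) \<le> (\<integral>q. norm (G q) \<partial>lborel)"
proof -
  have "norm (ift G p) \<le> (\<integral>q. norm (G q * cis' (p \<bullet> q)) \<partial>lborel)" unfolding ift_def by (rule integral_norm_bound)
  then show ?thesis by (simp add: norm_mult)
qed

text \<open>Cauchy--Schwarz, uniformly in \<open>y\<close>. The first bound yields the pointwise
  finiteness of \<open>econv\<close> that \<open>bilinear_hat\<close> assumes; together they yield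
  the bounded convolution that makes the transform in \<open>has_fourier_dx_product\<close>
  tempered.\<close>

lemma cv_bound:
  assumes m[measurable]: "G \<in> borel_measurable borel" "H \<in> borel_measurable borel"
  shows "(econv (\<lambda>q. ennreal (norm (G q))) (\<lambda>q. ennreal (norm (H q))) y)\<^sup>2
    \<le> (\<integral>\<^sup>+p. ennreal ((norm (G p))\<^sup>2) \<partial>lborel) * (\<integral>\<^sup>+p. ennreal ((norm (H p))\<^sup>2) \<partial>lborel)"
    "ennreal (norm (cv G H y)) \<le> econv (\<lambda>q. ennreal (norm (G q))) (\<lambda>q. ennreal (norm (H q))) y"
proof -
  have e: "econv (\<lambda>q. ennreal (norm (G q))) (\<lambda>q. ennreal (norm (H q))) y = (\<integral>\<^sup>+q. ennreal (norm (G q * H (y - q))) \<partial>lborel)"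
    by (simp add: econv_def norm_mult ennreal_mult)
  have r: "(\<integral>\<^sup>+q. ennreal ((norm (H (y - q)))\<^sup>2) \<partial>lborel) = (\<integral>\<^sup>+p. ennreal ((norm (H p))\<^sup>2) \<partial>lborel)"
    by (rule nn_integral_lborel_reflect) measurable
  show "(econv (\<lambda>q. ennreal (norm (G q))) (\<lambda>q. ennreal (norm (H q))) y)\<^sup>2
    \<le> (\<integral>\<^sup>+p. ennreal ((norm (G p))\<^sup>2) \<partial>lborel) * (\<integral>\<^sup>+p. ennreal ((norm (H p))\<^sup>2) \<partial>lborel)"
    unfolding e using L2_mult[of G "\<lambda>q. H (y - q)"] by (simp add: r)
  show "ennreal (norm (cv G H y)) \<le> econv (\<lambda>q. ennreal (norm (G q))) (\<lambda>q. ennreal (norm (H q))) y"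
    unfolding e cv_def
  proof (cases "integrable lborel (\<lambda>q. G q * H (y - q))")
    case True
    then show "ennreal (norm (\<integral>q. G q * H (y - q) \<partial>lborel)) \<le> (\<integral>\<^sup>+q. ennreal (norm (G q * H (y - q))) \<partial>lborel)"
      by (rule integral_norm_bound_ennreal)
  qed (simp add: not_integrable_integral_eq)
qed

lemma bessel_finite:
  assumes "integrable lborel G" "(\<integral>\<^sup>+p. ennreal ((norm (G p))\<^sup>2) \<partial>lborel) < \<infinity>"
  shows "(\<integral>\<^sup>+p. ennreal ((norm (ift G p))\<^sup>2) \<partial>lborel) < \<infinity>"
  by (rule le_less_trans[OF bessel[OF assms(1)]]) (use assms(2) in \<open>simp add: ennreal_mult_less_top\<close>)

text \<open>The product of the two inverse transforms is that of the convolution \<open>W\<close>.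
  With the weight \<open>ge \<eta>\<close> inserted, \<open>gauss_fubini\<close> turns the integral
  into a pairing of \<open>W\<close> with the Gaussian mean \<open>\<Psi> \<eta>\<close> of
  \<open>\<psi>\<close>. These means are bounded by \<open>B\<close> and converge almost everywhere
  along a subsequence, so dominated convergence removes the weight on both sides. The L2 assumptions
  make the product of the inverse transforms integrable.\<close>

lemma product_ift:
  fixes G H \<psi> :: "R3 \<Rightarrow> complex"
  assumes G: "integrable lborel G" "(\<integral>\<^sup>+p. ennreal ((norm (G p))\<^sup>2) \<partial>lborel) < \<infinity>"
    and H: "integrable lborel H" "(\<integral>\<^sup>+p. ennreal ((norm (H p))\<^sup>2) \<partial>lborel) < \<infinity>"
    and \<psi>: "integrable lborel \<psi>" "\<And>q. norm (\<psi> q) \<le> B"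
  shows "(\<integral>p. ift G p * ift H p * fourier \<psi> p \<partial>lborel) = complex_of_real ((2 * pi) ^ 3) * (\<integral>y. cv G H y * \<psi> y \<partial>lborel)"
proof -
  have [measurable]: "G \<in> borel_measurable borel" "H \<in> borel_measurable borel" "\<psi> \<in> borel_measurable borel" using G H \<psi> by auto
  define W where "W = cv G H"
  have [measurable]: "W \<in> borel_measurable borel" unfolding W_def by measurable
  have W: "integrable lborel W" unfolding W_def by (rule cv_ift[OF G(1) H(1)])
  define P where "P p = ift W p * fourier \<psi> p" for p
  have P_eq: "P p = ift G p * ift H p * fourier \<psi> p" for p
    unfolding P_def W_def cv_ift[OF G(1) H(1)] ..
  have [measurable]: "fourier \<psi> \<in> borel_measurable borel" unfolding fourier_ift[abs_def] by measurable
  have [measurable]: "P \<in> borel_measurable borel" unfolding P_def by measurable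
  have P: "integrable lborel P"
  proof (rule Bochner_Integration.integrable_bound)
    show "integrable lborel (\<lambda>p. complex_of_real (\<integral>q. norm (\<psi> q) \<partial>lborel) * (ift G p * ift H p))"
      by (intro Bochner_Integration.integrable_mult_right L2_mult_integrable bessel_finite G H) measurable
    have a: "norm (fourier \<psi> p) \<le> (\<integral>q. norm (\<psi> q) \<partial>lborel)" for p unfolding fourier_ift by (rule norm_ift_le)
    show "AE p in lborel. norm (P p) \<le> norm (complex_of_real (\<integral>q. norm (\<psi> q) \<partial>lborel) * (ift G p * ift H p))"
    proof (intro AE_I2)
      fix p
      have "norm (P p) = norm (fourier \<psi> p) * norm (ift G p * ift H p)" unfolding P_eq norm_mult by (simp only: mult_ac)
      also have "\<dots> \<le> \<bar>\<integral>q. norm (\<psi> q) \<partial>lborel\<bar> * norm (ift G p * ift H p)"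
        using a[of p] by (intro mult_right_mono) auto
      finally show "norm (P p) \<le> norm (complex_of_real (\<integral>q. norm (\<psi> q) \<partial>lborel) * (ift G p * ift H p))"
        by (simp only: norm_mult norm_of_real)
    qed
  qed measurable
  define L where "L Q = W (fst Q) * \<psi> (snd Q)" for Q :: "R3 \<times> R3"
  define z where "z Q = fst Q - snd Q" for Q :: "R3 \<times> R3"
  have [measurable]: "z \<in> borel_measurable borel" unfolding z_def by measurable
  have L: "integrable lborel L" unfolding L_def by (rule integrable_prod_mult[OF W \<psi>(1)])
  have [measurable]: "L \<in> borel_measurable borel" using L by auto
  have I1: "(\<integral>Q. L Q * cis' (p \<bullet> z Q) \<partial>lborel) = P p" for p
  proof -
    have "L Q * cis' (p \<bullet> z Q) = (W (fst Q) * cis' (p \<bullet> fst Q)) * (\<psi> (snd Q) * cis' ((0 - p) \<bullet> snd Q))" for Q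
    proof -
      have "cis' (p \<bullet> z Q) = cis' (p \<bullet> fst Q) * cis' ((0 - p) \<bullet> snd Q)" unfolding cis'_mult by (simp add: z_def inner_diff_right)
      then show ?thesis by (simp only: L_def mult_ac)
    qed
    moreover have "(\<integral>Q. (W (fst Q) * cis' (p \<bullet> fst Q)) * (\<psi> (snd Q) * cis' ((0 - p) \<bullet> snd Q)) \<partial>lborel) = ift W p * ift \<psi> (0 - p)"
      unfolding ift_def by (rule integrable_prod_mult(2)) (intro integrable_mult_cis W \<psi>, measurable)+
    ultimately show ?thesis by (simp only: P_def fourier_ift)
  qed
  define \<Psi> where "\<Psi> \<eta> y = (\<integral>q. \<psi> q * complex_of_real (gn \<eta> (y - q)) \<partial>lborel)" for \<eta> y
  have \<psi>g: "integrable lborel (\<lambda>p. \<psi> p * complex_of_real (ge c p))" if "c > 0" for c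
  proof (rule Bochner_Integration.integrable_bound[OF \<psi>(1)])
    show "AE p in lborel. norm (\<psi> p * complex_of_real (ge c p)) \<le> norm (\<psi> p)"
      unfolding norm_mult norm_of_real abs_ge using that by (intro AE_I2 mult_left_le ge_le_1) auto
  qed measurable
  obtain r :: "nat \<Rightarrow> nat" where r: "strict_mono r" "AE y in lborel. (\<lambda>k. \<Psi> (eps (r k)) y) \<longlonglongrightarrow> \<psi> y"
    using gauss_conv_AE(2)[OF _ \<psi>g eps(1-3)] unfolding \<Psi>_def by auto
  have [measurable]: "\<Psi> \<eta> \<in> borel_measurable borel" for \<eta> unfolding \<Psi>_def by measurable
  have B: "B \<ge> 0" using \<psi>(2)[of 0] norm_ge_zero order_trans by blast
  have \<Psi>b: "norm (\<Psi> \<eta> y) \<le> B" if "\<eta> > 0" for \<eta> y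
  proof -
    have "ennreal (norm (\<Psi> \<eta> y)) \<le> (\<integral>\<^sup>+q. ennreal (norm (\<psi> q * complex_of_real (gn \<eta> (y - q)))) \<partial>lborel)"
      unfolding \<Psi>_def by (intro integral_norm_bound_ennreal gauss_conv_AE(1)[OF _ \<psi>g eps(1-3)] that) auto
    also have "\<dots> \<le> (\<integral>\<^sup>+q. ennreal B * ennreal (gn \<eta> (y - q)) \<partial>lborel)"
    proof (intro nn_integral_mono)
      fix q
      have "norm (\<psi> q * complex_of_real (gn \<eta> (y - q))) \<le> B * gn \<eta> (y - q)"
        unfolding norm_mult norm_of_real abs_of_nonneg[OF gn_nonneg[OF that]]
        by (intro mult_right_mono \<psi>(2) gn_nonneg that)
      then show "ennreal (norm (\<psi> q * complex_of_real (gn \<eta> (y - q)))) \<le> ennreal B * ennreal (gn \<eta> (y - q))"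
        unfolding ennreal_mult[OF B gn_nonneg[OF that], symmetric] by (rule ennreal_leI)
    qed
    also have "\<dots> = ennreal B" using gn_nn_integral[OF that, of y] by (simp add: nn_integral_cmult)
    finally show ?thesis using B by simp
  qed
  have key: "(\<integral>p. complex_of_real (ge \<eta> p) * P p \<partial>lborel) = complex_of_real ((2 * pi) ^ 3) * (\<integral>y. W y * \<Psi> \<eta> y \<partial>lborel)" if \<eta>: "\<eta> > 0" for \<eta>
  proof -
    have gkn: "gk \<eta> w = (2 * pi) ^ 3 * gn \<eta> w" for w :: R3 unfolding gn_def R3_DIM by simp
    have i: "integrable lborel (\<lambda>Q. L Q * complex_of_real (gk \<eta> (z Q)))"
    proof (rule Bochner_Integration.integrable_bound[OF Bochner_Integration.integrable_mult_right[OF L, of "complex_of_real (sqrt (2 * pi / \<eta>) ^ 3)"]])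
      show "AE Q in lborel. norm (L Q * complex_of_real (gk \<eta> (z Q))) \<le> norm (complex_of_real (sqrt (2 * pi / \<eta>) ^ 3) * L Q)"
      proof (intro AE_I2)
        fix Q
        have "norm (L Q * complex_of_real (gk \<eta> (z Q))) = gk \<eta> (z Q) * norm (L Q)"
          using gk_nonneg[OF \<eta>, of "z Q"] by (simp add: norm_mult)
        also have "\<dots> \<le> \<bar>sqrt (2 * pi / \<eta>) ^ 3\<bar> * norm (L Q)"
          using gk_le[OF \<eta>, of "z Q"] unfolding R3_DIM by (intro mult_right_mono) auto
        finally show "norm (L Q * complex_of_real (gk \<eta> (z Q))) \<le> norm (complex_of_real (sqrt (2 * pi / \<eta>) ^ 3) * L Q)"
          by (simp only: norm_mult norm_of_real)
      qed
    qed measurable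
    have "(\<integral>p. complex_of_real (ge \<eta> p) * P p \<partial>lborel) = (\<integral>Q. L Q * complex_of_real (gk \<eta> (z Q)) \<partial>lborel)"
      using gauss_fubini(2)[OF L _ \<eta>, of z] unfolding I1 by simp
    also have "\<dots> = (\<integral>y. \<integral>q. L (y, q) * complex_of_real (gk \<eta> (z (y, q))) \<partial>lborel \<partial>lborel)"
      by (rule integral_lborel_pair(1)[OF i])
    also have "\<dots> = (\<integral>y. complex_of_real ((2 * pi) ^ 3) * (W y * \<Psi> \<eta> y) \<partial>lborel)"
    proof (rule Bochner_Integration.integral_cong[OF refl])
      fix y
      have "(\<integral>q. L (y, q) * complex_of_real (gk \<eta> (z (y, q))) \<partial>lborel) = (\<integral>q. complex_of_real ((2 * pi) ^ 3) * (W y * (\<psi> q * complex_of_real (gn \<eta> (y - q)))) \<partial>lborel)"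
        unfolding L_def z_def gkn of_real_mult fst_conv snd_conv by (simp only: mult_ac)
      also have "\<dots> = complex_of_real ((2 * pi) ^ 3) * (W y * \<Psi> \<eta> y)"
        unfolding \<Psi>_def integral_mult_right_zero ..
      finally show "(\<integral>q. L (y, q) * complex_of_real (gk \<eta> (z (y, q))) \<partial>lborel) = complex_of_real ((2 * pi) ^ 3) * (W y * \<Psi> \<eta> y)" .
    qed
    also have "\<dots> = complex_of_real ((2 * pi) ^ 3) * (\<integral>y. W y * \<Psi> \<eta> y \<partial>lborel)" by (rule integral_mult_right_zero)
    finally show ?thesis .
  qed
  have l1: "(\<lambda>k. \<integral>p. complex_of_real (ge (eps (r k)) p) * P p \<partial>lborel) \<longlonglongrightarrow> (\<integral>p. P p \<partial>lborel)"
  proof (rule integral_dominated_convergence[where w = "\<lambda>p. norm (P p)"])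
    show "AE p in lborel. (\<lambda>k. complex_of_real (ge (eps (r k)) p) * P p) \<longlonglongrightarrow> P p"
    proof (intro AE_I2)
      fix p
      have "(\<lambda>k. eps (r k)) \<longlonglongrightarrow> 0" using LIMSEQ_subseq_LIMSEQ[OF eps(3) r(1)] by (simp add: o_def)
      then have "(\<lambda>k. complex_of_real (ge (eps (r k)) p) * P p) \<longlonglongrightarrow> complex_of_real 1 * P p"
        by (intro tendsto_intros ge_tendsto_1)
      then show "(\<lambda>k. complex_of_real (ge (eps (r k)) p) * P p) \<longlonglongrightarrow> P p" by simp
    qed
    show "AE p in lborel. norm (complex_of_real (ge (eps (r k)) p) * P p) \<le> norm (P p)" for k
      unfolding norm_mult norm_of_real abs_ge
      by (intro AE_I2 mult_left_le_one_le ge_le_1 less_imp_le[OF ge_pos] less_imp_le[OF eps(1)]) auto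
  qed (use integrable_norm[OF P] in auto)
  have l2: "(\<lambda>k. \<integral>y. W y * \<Psi> (eps (r k)) y \<partial>lborel) \<longlonglongrightarrow> (\<integral>y. W y * \<psi> y \<partial>lborel)"
  proof (rule integral_dominated_convergence[where w = "\<lambda>y. norm (W y) * B"])
    show "AE y in lborel. (\<lambda>k. W y * \<Psi> (eps (r k)) y) \<longlonglongrightarrow> W y * \<psi> y"
      using r(2) by eventually_elim (intro tendsto_intros)
    show "AE y in lborel. norm (W y * \<Psi> (eps (r k)) y) \<le> norm (W y) * B" for k
      using \<Psi>b[OF eps(1)] by (auto simp: norm_mult intro!: mult_left_mono)
  qed (use integrable_norm[OF W] in auto)
  have "(\<lambda>k. \<integral>p. complex_of_real (ge (eps (r k)) p) * P p \<partial>lborel) \<longlonglongrightarrow> complex_of_real ((2 * pi) ^ 3) * (\<integral>y. W y * \<psi> y \<partial>lborel)"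
    unfolding key[OF eps(1)] by (intro tendsto_mult tendsto_const l2)
  from LIMSEQ_unique[OF l1 this] show ?thesis by (simp only: P_eq W_def)
qed

lemma ennreal_square_tendsto_0:
  fixes X Y :: "nat \<Rightarrow> ennreal"
  assumes "\<And>k. (X k)\<^sup>2 \<le> Y k" "Y \<longlonglongrightarrow> 0"
  shows "X \<longlonglongrightarrow> 0"
proof (rule tendsto_0_ennrealI)
  fix e :: real assume e: "e > 0"
  have "\<forall>\<^sub>F k in sequentially. Y k < ennreal (e\<^sup>2)"
    using assms(2) e by (intro order_tendstoD(2)) auto
  then show "\<forall>\<^sub>F k in sequentially. X k \<le> ennreal e"
  proof eventually_elim
    case (elim k)
    then have "(X k)\<^sup>2 \<le> (ennreal e)\<^sup>2" using assms(1)[of k] e by (simp add: ennreal_power)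
    then show ?case by (simp add: ennreal_power2_le_iff)
  qed
qed

text \<open>Both factors are regularised and \<open>product_ift\<close> is applied. On the left, the
  regularisations converge in L2, so their products converge in L1, and
  \<open>fourier \<psi>\<close> is bounded. On the right, the convolutions converge pointwise and
  are bounded by the product of the L2 norms. The two regularisations and \<open>product_ift\<close>
  contribute the factors \<open>d\<close>, \<open>d\<close> and \<open>c\<close>, and c d =
  1.\<close>

lemma product_ft:
  assumes f: "fpair u U" "fpair v V"
    and fin: "(\<integral>\<^sup>+q. ennreal ((norm (U q))\<^sup>2) \<partial>lborel) < \<infinity>" "(\<integral>\<^sup>+q. ennreal ((norm (V q))\<^sup>2) \<partial>lborel) < \<infinity>"
    and \<psi>: "integrable lborel \<psi>" "\<And>q. norm (\<psi> q) \<le> B"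
  shows "(\<integral>p. (u p * v p) * fourier \<psi> p \<partial>lborel) = complex_of_real (1 / (2 * pi) ^ 3) * (\<integral>y. cv U V y * \<psi> y \<partial>lborel)"
proof -
  note fpair_measurable[OF f(1), measurable] fpair_measurable[OF f(2), measurable]
  have [measurable]: "\<psi> \<in> borel_measurable borel" using \<psi> by auto
  define c where "c = complex_of_real ((2 * pi) ^ 3)"
  define d where "d = complex_of_real (1 / (2 * pi) ^ 3)"
  have cd: "c * (d * (d * x)) = d * x" for x
  proof -
    have "c * d = 1" unfolding c_def d_def of_real_mult[symmetric] by simp
    then show ?thesis by (metis mult.assoc mult_1)
  qed
  define G where "G k = reg U (eps k)" for k
  define H where "H k = reg V (eps k)" for k
  have [measurable]: "G k \<in> borel_measurable borel" "H k \<in> borel_measurable borel" for k unfolding G_def H_def by measurable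
  have Gi: "integrable lborel (G k)" "integrable lborel (H k)" for k
    unfolding G_def H_def by (rule reg_integrable[OF f(1) eps(1)] reg_integrable[OF f(2) eps(1)])+
  have nb: "norm (reg F \<epsilon> q) \<le> norm (F q)" if "\<epsilon> > 0" for F \<epsilon> q
  proof -
    have "(2 * pi) ^ 3 \<ge> (1::real)" using pi_ge_two by (intro one_le_power) linarith
    then have "ge \<epsilon> q / (2 * pi) ^ 3 \<le> 1" "0 \<le> ge \<epsilon> q / (2 * pi) ^ 3"
      using ge_le_1[of \<epsilon> q] ge_pos[of \<epsilon> q] that by (auto simp: divide_le_eq_1 less_imp_le)
    then show ?thesis unfolding reg_def norm_mult norm_of_real by (intro mult_left_le) auto
  qed
  have Gf: "(\<integral>\<^sup>+q. ennreal ((norm (G k q))\<^sup>2) \<partial>lborel) < \<infinity>" "(\<integral>\<^sup>+q. ennreal ((norm (H k q))\<^sup>2) \<partial>lborel) < \<infinity>" for k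
    unfolding G_def H_def
    by (rule le_less_trans[OF nn_integral_mono fin(1)] le_less_trans[OF nn_integral_mono fin(2)], intro ennreal_leI power_mono nb eps norm_ge_zero)+
  define M where "M = (\<integral>q. norm (\<psi> q) \<partial>lborel)"
  have M: "norm (fourier \<psi> p) \<le> M" for p unfolding fourier_ift M_def by (rule norm_ift_le)
  have M0: "M \<ge> 0" using M[of 0] norm_ge_zero order_trans by blast
  have [measurable]: "fourier \<psi> \<in> borel_measurable borel" unfolding fourier_ift[abs_def] by measurable
  define A where "A = (\<lambda>p. u p * v p)"
  define Ak where "Ak k p = ift (G k) p * ift (H k) p" for k p
  have [measurable]: "A \<in> borel_measurable borel" "Ak k \<in> borel_measurable borel" for k unfolding A_def Ak_def by measurable
  have A: "integrable lborel A" unfolding A_def by (intro L2_mult_integrable L2_approx(3)[OF f(1) fin(1)] L2_approx(3)[OF f(2) fin(2)]) measurable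
  have Aki: "integrable lborel (Ak k)" for k unfolding Ak_def by (intro L2_mult_integrable bessel_finite Gi Gf) measurable
  have mf: "integrable lborel (\<lambda>p. h p * fourier \<psi> p)" if "integrable lborel h" for h
  proof (rule Bochner_Integration.integrable_bound[OF Bochner_Integration.integrable_mult_right[OF that, of "complex_of_real M"]])
    show "AE p in lborel. norm (h p * fourier \<psi> p) \<le> norm (complex_of_real M * h p)"
      using M M0 by (auto simp: norm_mult mult.commute[of "norm (h _)"] intro!: mult_right_mono)
  qed (use that in measurable)
  define E where "E k = (\<integral>\<^sup>+p. ennreal (norm (Ak k p - A p)) \<partial>lborel)" for k
  define E1 where "E1 k = (\<integral>\<^sup>+p. ennreal (norm ((ift (G k) p - u p) * ift (H k) p)) \<partial>lborel)" for k
  define E2 where "E2 k = (\<integral>\<^sup>+p. ennreal (norm ((ift (H k) p - v p) * u p)) \<partial>lborel)" for k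
  have E12: "E k \<le> E1 k + E2 k" for k
  proof -
    have "E k \<le> (\<integral>\<^sup>+p. ennreal (norm ((ift (G k) p - u p) * ift (H k) p)) + ennreal (norm ((ift (H k) p - v p) * u p)) \<partial>lborel)"
      unfolding E_def
    proof (intro nn_integral_mono)
      fix p
      have "Ak k p - A p = (ift (G k) p - u p) * ift (H k) p + (ift (H k) p - v p) * u p"
        by (simp add: Ak_def A_def algebra_simps)
      then have "norm (Ak k p - A p) \<le> norm ((ift (G k) p - u p) * ift (H k) p) + norm ((ift (H k) p - v p) * u p)"
        by (simp only: norm_triangle_ineq)
      then show "ennreal (norm (Ak k p - A p)) \<le> ennreal (norm ((ift (G k) p - u p) * ift (H k) p)) + ennreal (norm ((ift (H k) p - v p) * u p))"
        by (simp add: ennreal_plus[symmetric] ennreal_leI del: ennreal_plus)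
    qed
    also have "\<dots> = E1 k + E2 k" unfolding E1_def E2_def by (rule nn_integral_add) measurable
    finally show ?thesis .
  qed
  have E1: "E1 \<longlonglongrightarrow> 0"
  proof (rule ennreal_square_tendsto_0)
    show "(E1 k)\<^sup>2 \<le> (\<integral>\<^sup>+q. ennreal ((norm (V q))\<^sup>2) \<partial>lborel) * (\<integral>\<^sup>+p. ennreal ((norm (u p - ift (reg U (eps k)) p))\<^sup>2) \<partial>lborel)" for k
    proof -
      have "(E1 k)\<^sup>2 \<le> (\<integral>\<^sup>+p. ennreal ((norm (ift (G k) p - u p))\<^sup>2) \<partial>lborel) * (\<integral>\<^sup>+p. ennreal ((norm (ift (H k) p))\<^sup>2) \<partial>lborel)"
        unfolding E1_def by (rule L2_mult) measurable
      also have "\<dots> \<le> (\<integral>\<^sup>+p. ennreal ((norm (ift (G k) p - u p))\<^sup>2) \<partial>lborel) * (\<integral>\<^sup>+q. ennreal ((norm (V q))\<^sup>2) \<partial>lborel)"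
        unfolding H_def by (intro mult_left_mono L2_approx(4)[OF f(2) fin(2)]) auto
      finally show ?thesis unfolding G_def by (simp only: norm_minus_commute mult.commute)
    qed
    show "(\<lambda>k. (\<integral>\<^sup>+q. ennreal ((norm (V q))\<^sup>2) \<partial>lborel) * (\<integral>\<^sup>+p. ennreal ((norm (u p - ift (reg U (eps k)) p))\<^sup>2) \<partial>lborel)) \<longlonglongrightarrow> 0"
      using ennreal_tendsto_cmult[OF _ L2_approx(2)[OF f(1) fin(1)]] fin(2) by fastforce
  qed
  have E2: "E2 \<longlonglongrightarrow> 0"
  proof (rule ennreal_square_tendsto_0)
    show "(E2 k)\<^sup>2 \<le> (\<integral>\<^sup>+q. ennreal ((norm (u q))\<^sup>2) \<partial>lborel) * (\<integral>\<^sup>+p. ennreal ((norm (v p - ift (reg V (eps k)) p))\<^sup>2) \<partial>lborel)" for k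
    proof -
      have "(E2 k)\<^sup>2 \<le> (\<integral>\<^sup>+p. ennreal ((norm (ift (H k) p - v p))\<^sup>2) \<partial>lborel) * (\<integral>\<^sup>+p. ennreal ((norm (u p))\<^sup>2) \<partial>lborel)"
        unfolding E2_def by (rule L2_mult) measurable
      then show ?thesis unfolding H_def by (simp only: norm_minus_commute mult.commute)
    qed
    show "(\<lambda>k. (\<integral>\<^sup>+q. ennreal ((norm (u q))\<^sup>2) \<partial>lborel) * (\<integral>\<^sup>+p. ennreal ((norm (v p - ift (reg V (eps k)) p))\<^sup>2) \<partial>lborel)) \<longlonglongrightarrow> 0"
      using ennreal_tendsto_cmult[OF _ L2_approx(2)[OF f(2) fin(2)]] L2_approx(3)[OF f(1) fin(1)] by fastforce
  qed
  have E: "E \<longlonglongrightarrow> 0"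
  proof (rule tendsto_0_le_ennreal[OF E12])
    show "(\<lambda>k. E1 k + E2 k) \<longlonglongrightarrow> 0" using tendsto_add[OF E1 E2] by simp
  qed
  have l1: "(\<lambda>k. \<integral>p. Ak k p * fourier \<psi> p \<partial>lborel) \<longlonglongrightarrow> (\<integral>p. A p * fourier \<psi> p \<partial>lborel)"
  proof (rule tendsto_norm_zero_cancel[THEN LIM_zero_cancel])
    have b: "ennreal (norm ((\<integral>p. Ak k p * fourier \<psi> p \<partial>lborel) - (\<integral>p. A p * fourier \<psi> p \<partial>lborel))) \<le> ennreal M * E k" for k
    proof -
      have "(\<integral>p. Ak k p * fourier \<psi> p \<partial>lborel) - (\<integral>p. A p * fourier \<psi> p \<partial>lborel) = (\<integral>p. (Ak k p - A p) * fourier \<psi> p \<partial>lborel)"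
        unfolding left_diff_distrib by (intro Bochner_Integration.integral_diff[symmetric] mf A Aki)
      then have "ennreal (norm ((\<integral>p. Ak k p * fourier \<psi> p \<partial>lborel) - (\<integral>p. A p * fourier \<psi> p \<partial>lborel))) \<le> (\<integral>\<^sup>+p. ennreal (norm ((Ak k p - A p) * fourier \<psi> p)) \<partial>lborel)"
        by (simp only:) (intro integral_norm_bound_ennreal mf Bochner_Integration.integrable_diff A Aki)
      also have "\<dots> \<le> (\<integral>\<^sup>+p. ennreal M * ennreal (norm (Ak k p - A p)) \<partial>lborel)"
        using M M0 by (intro nn_integral_mono) (auto simp: norm_mult ennreal_mult[symmetric] mult.commute[of M] intro!: ennreal_leI mult_left_mono)
      also have "\<dots> = ennreal M * E k" unfolding E_def by (rule nn_integral_cmult) measurable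
      finally show ?thesis .
    qed
    have "(\<lambda>k. ennreal M * E k) \<longlonglongrightarrow> ennreal M * 0" by (intro ennreal_tendsto_cmult E) simp
    then have "(\<lambda>k. ennreal M * E k) \<longlonglongrightarrow> 0" by simp
    with b have "(\<lambda>k. ennreal (norm ((\<integral>p. Ak k p * fourier \<psi> p \<partial>lborel) - (\<integral>p. A p * fourier \<psi> p \<partial>lborel)))) \<longlonglongrightarrow> 0"
      by (rule tendsto_0_le_ennreal)
    then have "(\<lambda>k. enn2real (ennreal (norm ((\<integral>p. Ak k p * fourier \<psi> p \<partial>lborel) - (\<integral>p. A p * fourier \<psi> p \<partial>lborel))))) \<longlonglongrightarrow> 0"
      by (intro tendsto_enn2real) simp_all
    then show "(\<lambda>k. norm ((\<integral>p. Ak k p * fourier \<psi> p \<partial>lborel) - (\<integral>p. A p * fourier \<psi> p \<partial>lborel))) \<longlonglongrightarrow> 0"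
      by simp
  qed
  define N where "N = enn2real (esqrt ((\<integral>\<^sup>+p. ennreal ((norm (U p))\<^sup>2) \<partial>lborel) * (\<integral>\<^sup>+p. ennreal ((norm (V p))\<^sup>2) \<partial>lborel)))"
  have uvi: "integrable lborel (\<lambda>q. U q * V (y - q))" for y
  proof (rule L2_mult_integrable[OF _ _ fin(1)])
    have "(\<integral>\<^sup>+q. ennreal ((norm (V (y - q)))\<^sup>2) \<partial>lborel) = (\<integral>\<^sup>+p. ennreal ((norm (V p))\<^sup>2) \<partial>lborel)"
      by (rule nn_integral_lborel_reflect) measurable
    then show "(\<integral>\<^sup>+q. ennreal ((norm (V (y - q)))\<^sup>2) \<partial>lborel) < \<infinity>" using fin by simp
  qed measurable
  have cvn: "norm (cv (G k) (H k) y) \<le> N" for k y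
  proof -
    have "(ennreal (norm (cv (G k) (H k) y)))\<^sup>2 \<le> (econv (\<lambda>q. ennreal (norm (G k q))) (\<lambda>q. ennreal (norm (H k q))) y)\<^sup>2"
      by (intro power_mono cv_bound(2)) auto
    also have "\<dots> \<le> (\<integral>\<^sup>+p. ennreal ((norm (G k p))\<^sup>2) \<partial>lborel) * (\<integral>\<^sup>+p. ennreal ((norm (H k p))\<^sup>2) \<partial>lborel)"
      by (intro cv_bound(1)) auto
    also have "\<dots> \<le> (\<integral>\<^sup>+p. ennreal ((norm (U p))\<^sup>2) \<partial>lborel) * (\<integral>\<^sup>+p. ennreal ((norm (V p))\<^sup>2) \<partial>lborel)"
      unfolding G_def H_def by (intro mult_mono nn_integral_mono ennreal_leI power_mono nb eps norm_ge_zero) auto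
    also have "\<dots> = (ennreal N)\<^sup>2"
    proof -
      have "(\<integral>\<^sup>+p. ennreal ((norm (U p))\<^sup>2) \<partial>lborel) * (\<integral>\<^sup>+p. ennreal ((norm (V p))\<^sup>2) \<partial>lborel) < \<infinity>"
        using fin by (simp add: ennreal_mult_less_top)
      then have "esqrt ((\<integral>\<^sup>+p. ennreal ((norm (U p))\<^sup>2) \<partial>lborel) * (\<integral>\<^sup>+p. ennreal ((norm (V p))\<^sup>2) \<partial>lborel)) < \<infinity>"
        by (simp add: esqrt_def)
      then have "ennreal N = esqrt ((\<integral>\<^sup>+p. ennreal ((norm (U p))\<^sup>2) \<partial>lborel) * (\<integral>\<^sup>+p. ennreal ((norm (V p))\<^sup>2) \<partial>lborel))"
        unfolding N_def by (intro ennreal_enn2real) simp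
      then show ?thesis by (simp only: esqrt_power2)
    qed
    finally show ?thesis by (simp add: ennreal_power2_le_iff N_def)
  qed
  have cvl: "(\<lambda>k. cv (G k) (H k) y) \<longlonglongrightarrow> d * (d * cv U V y)" for y
  proof -
    have "(\<lambda>k. cv (G k) (H k) y) \<longlonglongrightarrow> (\<integral>q. d * (d * (U q * V (y - q))) \<partial>lborel)"
      unfolding cv_def
    proof (rule integral_dominated_convergence[where w = "\<lambda>q. norm (U q * V (y - q))"])
      have l: "(\<lambda>k. reg F (eps k) q) \<longlonglongrightarrow> d * F q" for F q
      proof -
        have "(\<lambda>k. d * (F q * complex_of_real (ge (eps k) q))) \<longlonglongrightarrow> d * (F q * complex_of_real 1)"
          by (intro tendsto_intros ge_tendsto_1 eps)
        then show ?thesis unfolding reg_eq d_def[symmetric] by simp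
      qed
      show "AE q in lborel. (\<lambda>k. G k q * H k (y - q)) \<longlonglongrightarrow> d * (d * (U q * V (y - q)))"
      proof (intro AE_I2)
        fix q
        have "(\<lambda>k. G k q * H k (y - q)) \<longlonglongrightarrow> (d * U q) * (d * V (y - q))"
          unfolding G_def H_def by (intro tendsto_mult l)
        then show "(\<lambda>k. G k q * H k (y - q)) \<longlonglongrightarrow> d * (d * (U q * V (y - q)))" by (simp only: mult_ac)
      qed
      show "AE q in lborel. norm (G k q * H k (y - q)) \<le> norm (U q * V (y - q))" for k
        unfolding G_def H_def norm_mult by (intro AE_I2 mult_mono nb eps) auto
      show "integrable lborel (\<lambda>q. norm (U q * V (y - q)))" by (rule integrable_norm[OF uvi])
    qed measurable
    then show ?thesis by (simp only: cv_def integral_mult_right_zero)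
  qed
  have l2: "(\<lambda>k. \<integral>y. cv (G k) (H k) y * \<psi> y \<partial>lborel) \<longlonglongrightarrow> (\<integral>y. d * (d * (cv U V y * \<psi> y)) \<partial>lborel)"
  proof (rule integral_dominated_convergence[where w = "\<lambda>y. N * norm (\<psi> y)"])
    show "AE y in lborel. (\<lambda>k. cv (G k) (H k) y * \<psi> y) \<longlonglongrightarrow> d * (d * (cv U V y * \<psi> y))"
    proof (intro AE_I2)
      fix y
      have "(\<lambda>k. cv (G k) (H k) y * \<psi> y) \<longlonglongrightarrow> (d * (d * cv U V y)) * \<psi> y" by (intro tendsto_intros cvl)
      then show "(\<lambda>k. cv (G k) (H k) y * \<psi> y) \<longlonglongrightarrow> d * (d * (cv U V y * \<psi> y))" by (simp only: mult.assoc)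
    qed
    show "AE y in lborel. norm (cv (G k) (H k) y * \<psi> y) \<le> N * norm (\<psi> y)" for k
      using cvn by (auto simp: norm_mult intro!: mult_right_mono)
  qed (use integrable_norm[OF \<psi>(1)] in auto)
  have "(\<lambda>k. \<integral>p. Ak k p * fourier \<psi> p \<partial>lborel) \<longlonglongrightarrow> c * (\<integral>y. d * (d * (cv U V y * \<psi> y)) \<partial>lborel)"
    unfolding Ak_def product_ift[OF Gi(1) Gf(1) Gi(2) Gf(2) \<psi>] c_def[symmetric] by (intro tendsto_mult tendsto_const l2)
  from LIMSEQ_unique[OF l1 this] show ?thesis
    unfolding A_def integral_mult_right_zero cd d_def[symmetric] .
qed

section \<open>Gain of a power of the time span\<close>

lemma wt_powr_ge_1: "s \<ge> 0 \<Longrightarrow> ennreal (wt x powr s) \<ge> 1"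
  using wt_ge_1[of x] by (simp add: one_ennreal_def[symmetric] ge_one_powr_ge_zero ennreal_1[symmetric] del: ennreal_1)

lemma nrm_cut_le_wt:
  assumes "s \<ge> 0"
  shows "nrm (\<lambda>x. cut \<alpha> j x * f x) \<le> nrm (\<lambda>x. cut \<alpha> j x * (ennreal (wt x powr s) * f x))"
proof (rule nrm_mono)
  fix x
  have "1 * f x \<le> ennreal (wt x powr s) * f x" by (intro mult_right_mono wt_powr_ge_1 assms) auto
  then show "cut \<alpha> j x * f x \<le> cut \<alpha> j x * (ennreal (wt x powr s) * f x)" by (intro mult_left_mono) auto
qed

lemma suminf_nrm_cut_le_Xn:
  assumes s: "s \<ge> 0" and b: "a \<le> b"
  shows "(\<Sum>j. ennreal (2 powr (real j * a)) * nrm (\<lambda>x. cut \<alpha> j x * f x)) \<le> Xn \<alpha> s b f"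
  unfolding Xn_def
  by (intro suminf_le allI mult_mono nrm_cut_le_wt s ennreal_leI powr_mono mult_left_mono b) auto

text \<open>The norm sums the L2 norms of the dyadic pieces with factors at least 1, so Minkowski's
  inequality applies.\<close>

lemma sqint_le_Xn:
  assumes [measurable]: "f \<in> borel_measurable borel" and s: "s \<ge> 0" and b: "b \<ge> 0"
  shows "sqint f \<le> (Xn \<alpha> s b f)\<^sup>2"
proof -
  have "sqint f \<le> (\<integral>\<^sup>+x. (\<Sum>j. cut \<alpha> j x * f x)\<^sup>2 \<partial>lborel)"
    by (intro nn_integral_mono power_mono le_suminf_cut) auto
  also have "\<dots> \<le> (\<Sum>j. esqrt (\<integral>\<^sup>+x. (cut \<alpha> j x * f x)\<^sup>2 \<partial>lborel))\<^sup>2"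
    by (rule minkowski_suminf) measurable
  also have "(\<Sum>j. esqrt (\<integral>\<^sup>+x. (cut \<alpha> j x * f x)\<^sup>2 \<partial>lborel)) = (\<Sum>j. ennreal (2 powr (real j * 0)) * nrm (\<lambda>x. cut \<alpha> j x * f x))"
    by (simp add: nrm_def)
  also have "\<dots>\<^sup>2 \<le> (Xn \<alpha> s b f)\<^sup>2" by (intro power_mono suminf_nrm_cut_le_Xn s b) auto
  finally show ?thesis .
qed

text \<open>On a dyadic piece \<tau> ranges over an interval of length 2 * 2^j, so Cauchy--Schwarz
  in \<tau> costs 2^(j/2). As the norm is a plain sum over j and not a square sum, the end point b =
  1/2 is admissible.\<close>

lemma tau_integral_le_Xn:
  assumes [measurable]: "f \<in> borel_measurable borel" and s: "s \<ge> 0" and b: "b \<ge> 1/2"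
  shows "(\<integral>\<^sup>+p. (\<integral>\<^sup>+\<tau>. f (fst p, snd p, \<tau>) \<partial>lborel)\<^sup>2 \<partial>lborel) \<le> 2 * (Xn \<alpha> s b f)\<^sup>2"
proof -
  have fm: "(\<lambda>(p, \<tau>). f (fst p, snd p, \<tau>)) \<in> borel_measurable (borel \<Otimes>\<^sub>M borel)"
    unfolding split_def borel_prod by measurable
  define h where "h j p = (\<integral>\<^sup>+\<tau>. cut \<alpha> j (fst p, snd p, \<tau>) * f (fst p, snd p, \<tau>) \<partial>lborel)" for j and p :: "real \<times> real"
  have [measurable]: "h j \<in> borel_measurable borel" for j unfolding h_def by measurable
  have t: "(\<lambda>\<tau>. f (fst p, snd p, \<tau>)) \<in> borel_measurable borel" for p by measurable
  have "(\<integral>\<^sup>+p. (\<integral>\<^sup>+\<tau>. f (fst p, snd p, \<tau>) \<partial>lborel)\<^sup>2 \<partial>lborel) \<le> (\<integral>\<^sup>+p. (\<Sum>j. h j p)\<^sup>2 \<partial>lborel)"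
  proof (intro nn_integral_mono power_mono)
    fix p
    have "(\<integral>\<^sup>+\<tau>. f (fst p, snd p, \<tau>) \<partial>lborel) \<le> (\<integral>\<^sup>+\<tau>. (\<Sum>j. cut \<alpha> j (fst p, snd p, \<tau>) * f (fst p, snd p, \<tau>)) \<partial>lborel)"
      by (intro nn_integral_mono le_suminf_cut)
    also have "\<dots> = (\<Sum>j. h j p)" unfolding h_def by (rule nn_integral_suminf) measurable
    finally show "(\<integral>\<^sup>+\<tau>. f (fst p, snd p, \<tau>) \<partial>lborel) \<le> (\<Sum>j. h j p)" .
  qed auto
  also have "\<dots> \<le> (\<Sum>j. esqrt (sqint (h j)))\<^sup>2" by (rule minkowski_suminf) measurable
  also have "\<dots> \<le> (\<Sum>j. ennreal (sqrt 2) * (ennreal (2 powr (real j * (1/2))) * nrm (\<lambda>x. cut \<alpha> j x * f x)))\<^sup>2"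
  proof (intro power_mono suminf_le allI)
    fix j
    have "(h j p)\<^sup>2 \<le> ennreal (2 * 2 ^ j) * (\<integral>\<^sup>+\<tau>. (cut \<alpha> j (fst p, snd p, \<tau>) * f (fst p, snd p, \<tau>))\<^sup>2 \<partial>lborel)" for p
    proof -
      define w where "w = \<omega> \<alpha> (fst p) (snd p)"
      have "h j p = (\<integral>\<^sup>+\<tau>. indicator {w - 2 ^ j..w + 2 ^ j} \<tau> * (cut \<alpha> j (fst p, snd p, \<tau>) * f (fst p, snd p, \<tau>)) \<partial>lborel)"
        unfolding h_def
      proof (rule nn_integral_cong)
        fix \<tau>
        show "cut \<alpha> j (fst p, snd p, \<tau>) * f (fst p, snd p, \<tau>) = indicator {w - 2 ^ j..w + 2 ^ j} \<tau> * (cut \<alpha> j (fst p, snd p, \<tau>) * f (fst p, snd p, \<tau>))"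
          using cut_slab[of "(fst p, snd p, \<tau>)" \<alpha> j] by (auto simp: slab_def w_def indicator_def abs_le_iff)
      qed
      then have "(h j p)\<^sup>2 \<le> (\<integral>\<^sup>+\<tau>. (indicator {w - 2 ^ j..w + 2 ^ j} \<tau>)\<^sup>2 \<partial>lborel) * (\<integral>\<^sup>+\<tau>. (cut \<alpha> j (fst p, snd p, \<tau>) * f (fst p, snd p, \<tau>))\<^sup>2 \<partial>lborel)"
        by (simp only:) (rule Cauchy_Schwarz_nn_integral; measurable)
      also have "(\<integral>\<^sup>+\<tau>. (indicator {w - 2 ^ j..w + 2 ^ j} \<tau>)\<^sup>2 \<partial>lborel) = (\<integral>\<^sup>+\<tau>. indicator {w - 2 ^ j..w + 2 ^ j} \<tau> \<partial>lborel)"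
        by (intro nn_integral_cong) (auto simp: indicator_def)
      also have "\<dots> = ennreal (2 * 2 ^ j)"
      proof -
        have "(\<integral>\<^sup>+\<tau>. indicator {w - d..w + d} \<tau> \<partial>lborel) = ennreal (2 * d)" if "d \<ge> 0" for d :: real
          using that by (subst nn_integral_indicator) auto
        then show ?thesis by simp
      qed
      finally show ?thesis .
    qed
    then have "sqint (h j) \<le> (\<integral>\<^sup>+p. ennreal (2 * 2 ^ j) * (\<integral>\<^sup>+\<tau>. (cut \<alpha> j (fst p, snd p, \<tau>) * f (fst p, snd p, \<tau>))\<^sup>2 \<partial>lborel) \<partial>lborel)"
      by (rule nn_integral_mono)
    also have "\<dots> = ennreal (2 * 2 ^ j) * (\<integral>\<^sup>+p. \<integral>\<^sup>+\<tau>. (cut \<alpha> j (fst p, snd p, \<tau>) * f (fst p, snd p, \<tau>))\<^sup>2 \<partial>lborel \<partial>lborel)"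
      by (rule nn_integral_cmult) measurable
    also have "(\<integral>\<^sup>+p. \<integral>\<^sup>+\<tau>. (cut \<alpha> j (fst p, snd p, \<tau>) * f (fst p, snd p, \<tau>))\<^sup>2 \<partial>lborel \<partial>lborel) = (\<integral>\<^sup>+x. (cut \<alpha> j x * f x)\<^sup>2 \<partial>lborel)"
      by (subst nn_integral_R2, measurable) (subst nn_integral_R3, auto)
    finally have "esqrt (sqint (h j)) \<le> esqrt (ennreal (2 * 2 ^ j)) * nrm (\<lambda>x. cut \<alpha> j x * f x)"
      unfolding nrm_def esqrt_mult[symmetric] by (rule esqrt_mono)
    also have "esqrt (ennreal (2 * 2 ^ j)) = ennreal (sqrt 2) * ennreal (2 powr (real j * (1/2)))"
    proof -
      have "sqrt (2 ^ j) = 2 powr (real j * (1/2))" by (simp add: powr_half_sqrt[symmetric] powr_realpow[symmetric] powr_powr)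
      then have "sqrt (2 * 2 ^ j) = sqrt 2 * 2 powr (real j * (1/2))" unfolding real_sqrt_mult by (rule arg_cong)
      moreover have "esqrt (ennreal (2 * 2 ^ j)) = ennreal (sqrt (2 * 2 ^ j))" by (rule esqrt_ennreal) simp
      ultimately show ?thesis by (simp only:) (rule ennreal_mult; simp)
    qed
    finally show "esqrt (sqint (h j)) \<le> ennreal (sqrt 2) * (ennreal (2 powr (real j * (1/2))) * nrm (\<lambda>x. cut \<alpha> j x * f x))"
      by (simp only: mult.assoc)
  qed auto
  also have "\<dots> = (ennreal (sqrt 2) * (\<Sum>j. ennreal (2 powr (real j * (1/2))) * nrm (\<lambda>x. cut \<alpha> j x * f x)))\<^sup>2" by simp
  also have "\<dots> \<le> (ennreal (sqrt 2) * Xn \<alpha> s b f)\<^sup>2"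
    by (intro power_mono mult_left_mono suminf_nrm_cut_le_Xn s b) auto
  also have "\<dots> = 2 * (Xn \<alpha> s b f)\<^sup>2" by (simp add: power_mult_distrib ennreal_power)
  finally show ?thesis .
qed

text \<open>The regularised inverse transforms are cut off in time before the limit is taken.
  \<open>bessel_time_slab\<close> and \<open>tau_integral_le_Xn\<close> then bound the L2 norm of
  \<open>u\<close>, and \<open>dual_L2_bound\<close> leads back to \<open>U\<close>.\<close>

lemma time_localized_L2:
  assumes f: "fpair u U" and T: "T > 0" and sup: "time_support_in {-T..T} u" and s: "s \<ge> 0" and b: "b \<ge> 1/2"
  shows "sqint (\<lambda>q. ennreal (norm (U q))) \<le> ennreal T * (Xn \<alpha> s b (\<lambda>q. ennreal (norm (U q))))\<^sup>2"
proof -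
  note fpair_measurable[OF f, measurable]
  define X where "X = Xn \<alpha> s b (\<lambda>q. ennreal (norm (U q)))"
  define c :: real where "c = (2 * pi) ^ 3"
  have c: "c > 0" by (simp add: c_def)
  obtain r :: "nat \<Rightarrow> nat" where r: "AE p in lborel. (\<lambda>k. ift (reg U (eps (r k))) p) \<longlonglongrightarrow> u p"
    using ift_approx_AE[OF f] by blast
  have "AE p in lborel. snd (snd p) \<notin> {-T..T} \<longrightarrow> u p = 0"
    using sup unfolding time_support_in_def by eventually_elim (auto simp: split_beta)
  \<comment> \<open>The indicator does not change the limit \<open>u\<close>, but on the
    approximants, which are not supported in the slab, it is what produces the factor
    \<open>T\<close>.\<close>
  with r have lim: "AE p in lborel. (\<lambda>k. complex_of_real (indicator {-T..T} (snd (snd p))) * ift (reg U (eps (r k))) p) \<longlonglongrightarrow> u p"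
  proof eventually_elim
    case (elim p)
    have "(\<lambda>k. complex_of_real (indicator {-T..T} (snd (snd p))) * ift (reg U (eps (r k))) p) \<longlonglongrightarrow> complex_of_real (indicator {-T..T} (snd (snd p))) * u p"
      by (intro tendsto_intros elim(1))
    moreover have "complex_of_real (indicator {-T..T} (snd (snd p))) * u p = u p" using elim(2) by (auto simp: indicator_def)
    ultimately show ?case by simp
  qed
  have "(\<integral>\<^sup>+p. ennreal ((norm (u p))\<^sup>2) \<partial>lborel) \<le> ennreal (2 * T * (2 * pi)\<^sup>2) * (ennreal ((1 / c)\<^sup>2) * (2 * X\<^sup>2))"
  proof (rule fatou_norm2[OF _ lim])
    show "\<forall>\<^sub>F k in sequentially. (\<integral>\<^sup>+p. ennreal ((norm (complex_of_real (indicator {-T..T} (snd (snd p))) * ift (reg U (eps (r k))) p))\<^sup>2) \<partial>lborel)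
      \<le> ennreal (2 * T * (2 * pi)\<^sup>2) * (ennreal ((1 / c)\<^sup>2) * (2 * X\<^sup>2))"
    proof (intro always_eventually allI)
      fix k
      define e where "e = eps (r k)"
      have e: "e > 0" by (simp add: e_def eps)
      have n: "ennreal (norm (reg U e q)) \<le> ennreal (1 / c) * ennreal (norm (U q))" for q
      proof -
        have "norm (reg U e q) = (1 / c) * (norm (U q) * ge e q)"
          unfolding reg_eq c_def[symmetric] norm_mult norm_of_real using c ge_pos[of e q] by simp
        also have "\<dots> \<le> (1 / c) * (norm (U q) * 1)"
          using ge_le_1[of e q] e c by (intro mult_left_mono) auto
        finally have "ennreal (norm (reg U e q)) \<le> ennreal ((1 / c) * norm (U q))" by (simp add: ennreal_leI)
        then show ?thesis using c by (simp add: ennreal_mult[symmetric])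
      qed
      have i: "(\<integral>\<^sup>+\<tau>. ennreal (norm (reg U e (fst p, snd p, \<tau>))) \<partial>lborel)\<^sup>2 \<le> ennreal ((1 / c)\<^sup>2) * (\<integral>\<^sup>+\<tau>. ennreal (norm (U (fst p, snd p, \<tau>))) \<partial>lborel)\<^sup>2" for p
      proof -
        have "(\<integral>\<^sup>+\<tau>. ennreal (norm (reg U e (fst p, snd p, \<tau>))) \<partial>lborel) \<le> (\<integral>\<^sup>+\<tau>. ennreal (1 / c) * ennreal (norm (U (fst p, snd p, \<tau>))) \<partial>lborel)"
          by (intro nn_integral_mono n)
        also have "\<dots> = ennreal (1 / c) * (\<integral>\<^sup>+\<tau>. ennreal (norm (U (fst p, snd p, \<tau>))) \<partial>lborel)"
          by (rule nn_integral_cmult) measurable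
        finally have "(\<integral>\<^sup>+\<tau>. ennreal (norm (reg U e (fst p, snd p, \<tau>))) \<partial>lborel)\<^sup>2 \<le> (ennreal (1 / c) * (\<integral>\<^sup>+\<tau>. ennreal (norm (U (fst p, snd p, \<tau>))) \<partial>lborel))\<^sup>2"
          by (intro power_mono) auto
        also have "\<dots> = ennreal ((1 / c)\<^sup>2) * (\<integral>\<^sup>+\<tau>. ennreal (norm (U (fst p, snd p, \<tau>))) \<partial>lborel)\<^sup>2"
          using c unfolding power_mult_distrib by (subst ennreal_power) auto
        finally show ?thesis .
      qed
      have "(\<integral>\<^sup>+p. ennreal ((norm (complex_of_real (indicator {-T..T} (snd (snd p))) * ift (reg U e) p))\<^sup>2) \<partial>lborel)
        \<le> ennreal (2 * T * (2 * pi)\<^sup>2) * (\<integral>\<^sup>+p. (\<integral>\<^sup>+\<tau>. ennreal (norm (reg U e (fst p, snd p, \<tau>))) \<partial>lborel)\<^sup>2 \<partial>lborel)"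
        by (rule bessel_time_slab[OF reg_integrable[OF f e] T])
      also have "\<dots> \<le> ennreal (2 * T * (2 * pi)\<^sup>2) * (\<integral>\<^sup>+p. ennreal ((1 / c)\<^sup>2) * (\<integral>\<^sup>+\<tau>. ennreal (norm (U (fst p, snd p, \<tau>))) \<partial>lborel)\<^sup>2 \<partial>lborel)"
        by (intro mult_left_mono nn_integral_mono i) auto
      also have "(\<integral>\<^sup>+p. ennreal ((1 / c)\<^sup>2) * (\<integral>\<^sup>+\<tau>. ennreal (norm (U (fst p, snd p, \<tau>))) \<partial>lborel)\<^sup>2 \<partial>lborel)
         = ennreal ((1 / c)\<^sup>2) * (\<integral>\<^sup>+p. (\<integral>\<^sup>+\<tau>. ennreal (norm (U (fst p, snd p, \<tau>))) \<partial>lborel)\<^sup>2 \<partial>lborel)"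
        by (rule nn_integral_cmult) measurable
      also have "ennreal (2 * T * (2 * pi)\<^sup>2) * \<dots> \<le> ennreal (2 * T * (2 * pi)\<^sup>2) * (ennreal ((1 / c)\<^sup>2) * (2 * X\<^sup>2))"
        unfolding X_def by (intro mult_left_mono tau_integral_le_Xn s b) auto
      finally show "(\<integral>\<^sup>+p. ennreal ((norm (complex_of_real (indicator {-T..T} (snd (snd p))) * ift (reg U (eps (r k))) p))\<^sup>2) \<partial>lborel)
      \<le> ennreal (2 * T * (2 * pi)\<^sup>2) * (ennreal ((1 / c)\<^sup>2) * (2 * X\<^sup>2))" by (simp only: e_def)
    qed
  qed measurable
  then have "ennreal c * (\<integral>\<^sup>+p. ennreal ((norm (u p))\<^sup>2) \<partial>lborel) \<le> ennreal c * (ennreal (2 * T * (2 * pi)\<^sup>2) * (ennreal ((1 / c)\<^sup>2) * (2 * X\<^sup>2)))"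
    by (rule mult_left_mono) auto
  also have "\<dots> = ennreal (c * (2 * T * (2 * pi)\<^sup>2 * ((1 / c)\<^sup>2 * 2))) * X\<^sup>2"
  proof -
    have "ennreal (c * (2 * T * (2 * pi)\<^sup>2 * ((1 / c)\<^sup>2 * 2))) = ennreal c * (ennreal (2 * T * (2 * pi)\<^sup>2) * (ennreal ((1 / c)\<^sup>2) * ennreal 2))"
      using c T by (subst ennreal_mult; (subst ennreal_mult; (subst ennreal_mult)?)?; simp)
    then show ?thesis by (simp only: mult.assoc ennreal_numeral)
  qed
  \<comment> \<open>The constants multiply to 4 (2 pi)^2 / (2 pi)^3 = 2 / pi, which is at most
    1.\<close>
  also have "\<dots> \<le> ennreal T * X\<^sup>2"
  proof (intro mult_right_mono ennreal_leI)
    have "c * (2 * T * (2 * pi)\<^sup>2 * ((1 / c)\<^sup>2 * 2)) = 4 * T * (2 * pi)\<^sup>2 / c" using c by (simp add: power2_eq_square)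
    also have "\<dots> = T * (4 / (2 * pi))" by (simp add: c_def power2_eq_square power3_eq_cube)
    also have "\<dots> \<le> T * 1" using pi_ge_two T by (intro mult_left_mono) (auto simp: divide_le_eq_1)
    finally show "c * (2 * T * (2 * pi)\<^sup>2 * ((1 / c)\<^sup>2 * 2)) \<le> T" by simp
  qed auto
  finally have "ennreal c * (\<integral>\<^sup>+p. ennreal ((norm (u p))\<^sup>2) \<partial>lborel) \<le> ennreal T * X\<^sup>2" .
  with dual_L2_bound[OF f] have "(\<integral>\<^sup>+q. ennreal ((norm (U q))\<^sup>2) \<partial>lborel) \<le> ennreal T * X\<^sup>2"
    unfolding c_def by (rule order_trans)
  then show ?thesis by (simp add: X_def ennreal_power)
qed

text \<open>Each dyadic piece is bounded by \<open>T\<^sup>1\<^sup>/\<^sup>2 X\<close> and by \<open>2\<^sup>-\<^sup>j\<^sup>b X\<close>; interpolating with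
  weight \<open>1/60\<close> gains a power of \<open>T\<close> and still leaves a summable factor.\<close>

lemma Zn_time_gain:
  "\<exists>K>0. \<forall>\<alpha> s b T u U. fpair u U \<longrightarrow> T > 0 \<longrightarrow> time_support_in {-T..T} u \<longrightarrow> s \<ge> 0 \<longrightarrow> b \<ge> 1/2 \<longrightarrow>
    Xn \<alpha> s b (\<lambda>q. ennreal (norm (U q))) < \<infinity> \<longrightarrow>
    Zn \<alpha> (\<lambda>q. ennreal (norm (U q))) \<le> ennreal (K * T powr (1/120)) * Xn \<alpha> s b (\<lambda>q. ennreal (norm (U q)))"
proof -
  have "(- 1/120 :: real) < 0" by simp
  from suminf_powr_finite[OF this]
  obtain K where K: "K > 0" "(\<Sum>j. ennreal (2 powr (real j * (- 1/120)))) = ennreal K" by blast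
  show ?thesis
  proof (intro exI[of _ K] conjI allI impI)
    fix \<alpha> s b T :: real and u U
    assume f: "fpair u U" and T: "T > 0" and sup: "time_support_in {-T..T} u" and s: "s \<ge> 0" and b: "b \<ge> 1/2"
      and fin: "Xn \<alpha> s b (\<lambda>q. ennreal (norm (U q))) < \<infinity>"
    define g where "g = (\<lambda>q. ennreal (norm (U q)))"
    obtain x where x: "x \<ge> 0" "Xn \<alpha> s b g = ennreal x" using fin unfolding g_def by (auto simp: less_top[symmetric] elim: ennreal_cases)
    have tm: "ennreal (2 powr (real j * (29/60))) * nrm (\<lambda>y. cut \<alpha> j y * g y) \<le> ennreal (2 powr (real j * (- 1/120))) * ennreal (T powr (1/120) * x)" for j
    proof -
      have "nrm (\<lambda>y. cut \<alpha> j y * g y) \<le> nrm g"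
      proof (rule nrm_mono)
        show "cut \<alpha> j y * g y \<le> g y" for y using cut_cases[of \<alpha> j y] by auto
      qed
      also have "\<dots> \<le> esqrt (ennreal T * (Xn \<alpha> s b g)\<^sup>2)"
        unfolding nrm_def g_def by (intro esqrt_mono time_localized_L2[OF f T sup s b])
      also have "\<dots> = ennreal (sqrt T * x)" using T x by (simp add: esqrt_mult esqrt_power2' esqrt_ennreal ennreal_mult)
      finally have 1: "nrm (\<lambda>y. cut \<alpha> j y * g y) \<le> ennreal (sqrt T * x)" .
      then obtain z where z: "z \<ge> 0" "nrm (\<lambda>y. cut \<alpha> j y * g y) = ennreal z"
        by (cases "nrm (\<lambda>y. cut \<alpha> j y * g y)") (auto simp: top_unique)
      have z1: "z \<le> sqrt T * x" using 1 z x T by (simp add: ennreal_le_iff)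
      have "(\<Sum>i\<in>{j}. ennreal (2 powr (real i * b)) * nrm (\<lambda>y. cut \<alpha> i y * g y)) \<le> (\<Sum>i. ennreal (2 powr (real i * b)) * nrm (\<lambda>y. cut \<alpha> i y * g y))"
        by (rule sum_le_suminf) auto
      also have "\<dots> \<le> ennreal x" using suminf_nrm_cut_le_Xn[OF s order_refl, of b \<alpha> g] x by simp
      finally have z2: "2 powr (real j * b) * z \<le> x" using z x by (simp add: ennreal_mult[symmetric] ennreal_le_iff)
      have "2 powr (real j * (29/60)) * z \<le> 2 powr (real j * (- 1/120)) * (T powr (1/120) * x)"
      proof (cases "z = 0")
        case False
        then have zp: "z > 0" using z by simp
        have xp: "x > 0"
        proof (rule ccontr)
          assume "\<not> x > 0"
          then have "x = 0" using x by simp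
          then show False using z1 zp by simp
        qed
        have z3: "z \<le> 2 powr (- (real j * b)) * x"
        proof -
          have "2 powr (- (real j * b)) * (2 powr (real j * b) * z) \<le> 2 powr (- (real j * b)) * x" by (intro mult_left_mono z2) auto
          then show ?thesis by (simp add: mult.assoc[symmetric] powr_add[symmetric])
        qed
        have "z = z powr (1/60) * z powr (59/60)" using zp by (simp add: powr_add[symmetric])
        also have "\<dots> \<le> (sqrt T * x) powr (1/60) * (2 powr (- (real j * b)) * x) powr (59/60)"
          using zp by (intro mult_mono powr_mono2 z1 z3) auto
        also have "\<dots> = T powr (1/120) * (2 powr (- (real j * b) * (59/60)) * (x powr (1/60) * x powr (59/60)))"
          using T xp by (simp add: powr_mult powr_powr powr_half_sqrt[symmetric])
        also have "x powr (1/60) * x powr (59/60) = x" using xp by (simp add: powr_add[symmetric])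
        finally have "2 powr (real j * (29/60)) * z \<le> 2 powr (real j * (29/60)) * (T powr (1/120) * (2 powr (- (real j * b) * (59/60)) * x))"
          by (rule mult_left_mono) auto
        also have "\<dots> = 2 powr (real j * (29/60) + - (real j * b) * (59/60)) * (T powr (1/120) * x)"
          by (simp only: powr_add mult_ac)
        also have "\<dots> \<le> 2 powr (real j * (- 1/120)) * (T powr (1/120) * x)"
        proof (intro mult_right_mono powr_mono)
          \<comment> \<open>29/60 - (1/2) (59/60) = -1/120, the exponent of the geometric series
            that defines \<open>K\<close>.\<close>
          have "real j * (1/2) \<le> real j * b" using b by (intro mult_left_mono) auto
          then show "real j * (29/60) + - (real j * b) * (59/60) \<le> real j * (- 1/120)" by linarith
        qed (use x in auto)
        finally show ?thesis .
      qed (use x in auto)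
      then show ?thesis using z x by (simp add: ennreal_mult[symmetric] ennreal_leI)
    qed
    have "Zn \<alpha> g \<le> (\<Sum>j. ennreal (2 powr (real j * (- 1/120))) * ennreal (T powr (1/120) * x))"
      unfolding Zn_def by (intro suminf_le allI tm) auto
    also have "\<dots> = ennreal K * ennreal (T powr (1/120) * x)" by (simp only: ennreal_suminf_multc K(2))
    also have "\<dots> = ennreal (K * T powr (1/120)) * Xn \<alpha> s b g"
      using K x by (simp add: ennreal_mult mult.assoc)
    finally show "Zn \<alpha> (\<lambda>q. ennreal (norm (U q))) \<le> ennreal (K * T powr (1/120)) * Xn \<alpha> s b (\<lambda>q. ennreal (norm (U q)))"
      by (simp only: g_def)
  qed (use K in simp)
qed

section \<open>The transform of the differentiated product and the conclusion\<close>

lemma has_fourier_dx_product: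
  assumes f: "fpair u U" "fpair v V"
    and fin: "(\<integral>\<^sup>+q. ennreal ((norm (U q))\<^sup>2) \<partial>lborel) < \<infinity>" "(\<integral>\<^sup>+q. ennreal ((norm (V q))\<^sup>2) \<partial>lborel) < \<infinity>"
  shows "has_fourier (dist_dx (dist_of (\<lambda>p. u p * v p))) (\<lambda>q. \<i> * complex_of_real (fst q) * (complex_of_real (1 / (2 * pi) ^ 3) * cv U V q))"
proof -
  note fpair_measurable[OF f(1), measurable] fpair_measurable[OF f(2), measurable]
  define d where "d = complex_of_real (1 / (2 * pi) ^ 3)"
  define F where "F q = \<i> * complex_of_real (fst q) * (d * cv U V q)" for q
  define N where "N = enn2real (esqrt ((\<integral>\<^sup>+p. ennreal ((norm (U p))\<^sup>2) \<partial>lborel) * (\<integral>\<^sup>+p. ennreal ((norm (V p))\<^sup>2) \<partial>lborel)))"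
  have N: "norm (cv U V q) \<le> N" for q
  proof -
    have "(\<integral>\<^sup>+p. ennreal ((norm (U p))\<^sup>2) \<partial>lborel) * (\<integral>\<^sup>+p. ennreal ((norm (V p))\<^sup>2) \<partial>lborel) < \<infinity>"
      using fin by (simp add: ennreal_mult_less_top)
    then have "esqrt ((\<integral>\<^sup>+p. ennreal ((norm (U p))\<^sup>2) \<partial>lborel) * (\<integral>\<^sup>+p. ennreal ((norm (V p))\<^sup>2) \<partial>lborel)) < \<infinity>"
      by (simp add: esqrt_def)
    then have e: "ennreal N = esqrt ((\<integral>\<^sup>+p. ennreal ((norm (U p))\<^sup>2) \<partial>lborel) * (\<integral>\<^sup>+p. ennreal ((norm (V p))\<^sup>2) \<partial>lborel))"
      unfolding N_def by (intro ennreal_enn2real) simp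
    have "(ennreal (norm (cv U V q)))\<^sup>2 \<le> (econv (\<lambda>q. ennreal (norm (U q))) (\<lambda>q. ennreal (norm (V q))) q)\<^sup>2"
      by (intro power_mono cv_bound(2)) auto
    also have "\<dots> \<le> (\<integral>\<^sup>+p. ennreal ((norm (U p))\<^sup>2) \<partial>lborel) * (\<integral>\<^sup>+p. ennreal ((norm (V p))\<^sup>2) \<partial>lborel)"
      by (intro cv_bound(1)) auto
    also have "\<dots> = (ennreal N)\<^sup>2" by (simp only: e esqrt_power2)
    finally show ?thesis by (simp add: ennreal_power2_le_iff N_def)
  qed
  have Fm: "F \<in> borel_measurable borel" unfolding F_def by measurable
  note Fm[measurable]
  have fst_le: "\<bar>fst q\<bar> \<le> norm q" for q :: R3 using norm_fst_le[of "fst q" "snd q"] by simp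
  \<comment> \<open>\<open>N\<close> bounds the convolution, so \<open>F\<close> grows at most
    linearly.\<close>
  have "tempered_fun F" unfolding tempered_fun_def
  proof (intro conjI allI impI)
    fix \<phi> assume \<phi>: "schwartz \<phi>"
    have [measurable]: "\<phi> \<in> borel_measurable borel" by (rule schwartz_basic[OF \<phi>])
    show "integrable lborel (\<lambda>p. F p * \<phi> p)"
    proof (rule Bochner_Integration.integrable_bound[OF Bochner_Integration.integrable_mult_right[OF schwartz_integrable[OF \<phi>, of 1], of "complex_of_real (norm d * N)"]])
      show "AE p in lborel. norm (F p * \<phi> p) \<le> norm (complex_of_real (norm d * N) * (complex_of_real (norm p ^ 1) * \<phi> p))"
      proof (intro AE_I2)
        fix p
        have N0: "N \<ge> 0" by (simp add: N_def)
        have "norm (F p * \<phi> p) = (\<bar>fst p\<bar> * (norm d * norm (cv U V p))) * norm (\<phi> p)" by (simp add: F_def norm_mult)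
        also have "\<dots> \<le> (norm p * (norm d * N)) * norm (\<phi> p)"
          by (intro mult_right_mono mult_mono fst_le N mult_left_mono) auto
        also have "\<dots> = norm (complex_of_real (norm d * N) * (complex_of_real (norm p ^ 1) * \<phi> p))"
          using N0 by (simp add: norm_mult)
        finally show "norm (F p * \<phi> p) \<le> norm (complex_of_real (norm d * N) * (complex_of_real (norm p ^ 1) * \<phi> p))" .
      qed
    qed measurable
  qed (use Fm in simp)
  moreover have "dist_dx (dist_of (\<lambda>p. u p * v p)) (fourier \<phi>) = dist_of F \<phi>" if \<phi>: "schwartz \<phi>" for \<phi>
  proof -
    have [measurable]: "\<phi> \<in> borel_measurable borel" by (rule schwartz_basic[OF \<phi>])
    \<comment> \<open>\<open>fourier_deriv\<close> turns the x-derivative of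
      \<open>fourier \<phi>\<close> into the transform of this function. It is integrable and
      bounded because \<open>\<phi>\<close> decays rapidly, so \<open>product_ft\<close> applies to
      it.\<close>
    define \<psi> where "\<psi> p = - \<i> * complex_of_real (p \<bullet> (1, 0, 0)) * \<phi> p" for p :: R3
    have n: "norm (\<psi> p) = \<bar>fst p\<bar> * norm (\<phi> p)" for p by (cases p) (simp add: \<psi>_def norm_mult)
    have \<psi>1: "integrable lborel \<psi>"
    proof (rule Bochner_Integration.integrable_bound[OF schwartz_integrable[OF \<phi>, of 1]])
      show "\<psi> \<in> borel_measurable lborel" unfolding \<psi>_def by measurable
      show "AE p in lborel. norm (\<psi> p) \<le> norm (complex_of_real (norm p ^ 1) * \<phi> p)"
        unfolding n using fst_le by (auto simp: norm_mult simp del: fst_le intro!: mult_right_mono)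
    qed
    obtain B where "\<And>q. norm q ^ 1 * norm (\<phi> q) \<le> B" using schwartz_basic(3)[OF \<phi>] by blast
    then have \<psi>2: "norm (\<psi> q) \<le> B" for q
      unfolding n using mult_right_mono[OF fst_le[of q], of "norm (\<phi> q)"] by (metis norm_ge_zero order_trans power_one_right)
    have "dist_dx (dist_of (\<lambda>p. u p * v p)) (fourier \<phi>) = - (\<integral>p. (u p * v p) * fourier \<psi> p \<partial>lborel)"
      unfolding dist_dx_def dist_of_def fourier_deriv[OF \<phi>] \<psi>_def ..
    also have "\<dots> = - (d * (\<integral>y. cv U V y * \<psi> y \<partial>lborel))"
      unfolding product_ft[OF f fin \<psi>1 \<psi>2] d_def ..
    also have "\<dots> = (\<integral>y. - d * (cv U V y * \<psi> y) \<partial>lborel)" by (subst integral_mult_right_zero) (rule mult_minus_left[symmetric])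
    also have "\<dots> = (\<integral>y. F y * \<phi> y \<partial>lborel)"
    proof (rule Bochner_Integration.integral_cong[OF refl])
      fix y :: R3
      show "- d * (cv U V y * \<psi> y) = F y * \<phi> y" by (cases y) (simp add: F_def \<psi>_def)
    qed
    finally show ?thesis by (simp only: dist_of_def)
  qed
  ultimately show ?thesis unfolding has_fourier_def F_def d_def by blast
qed

text \<open>\<open>Xnorm\<close> is an infimum over the functions that represent the transform,
  whereas the estimate is proved for each such pair separately. Both infima are finite, so the
  product can be approached with error 1 / (n + 1) in each factor; a product of 0 and infinity does
  not occur.\<close>

lemma ennreal_le_mult_INF:
  fixes C :: real and f :: "'a \<Rightarrow> ennreal" and g :: "'b \<Rightarrow> ennreal"
  assumes C: "C \<ge> 0" and fin: "(INF a\<in>A. f a) < \<infinity>" "(INF b\<in>B. g b) < \<infinity>"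
    and le: "\<And>a b. a \<in> A \<Longrightarrow> b \<in> B \<Longrightarrow> f a < \<infinity> \<Longrightarrow> g b < \<infinity> \<Longrightarrow> M \<le> ennreal C * f a * g b"
  shows "M \<le> ennreal C * (INF a\<in>A. f a) * (INF b\<in>B. g b)"
proof -
  obtain x where x: "x \<ge> 0" "(INF a\<in>A. f a) = ennreal x" using fin(1) by (auto simp: less_top[symmetric] elim: ennreal_cases)
  obtain y where y: "y \<ge> 0" "(INF b\<in>B. g b) = ennreal y" using fin(2) by (auto simp: less_top[symmetric] elim: ennreal_cases)
  have b: "M \<le> ennreal (C * (x + 1 / real (Suc n)) * (y + 1 / real (Suc n)))" for n
  proof -
    have "(INF a\<in>A. f a) < ennreal (x + 1 / real (Suc n))" unfolding x(2) using x(1) by (intro ennreal_lessI add_nonneg_pos) auto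
    then obtain a where a: "a \<in> A" "f a < ennreal (x + 1 / real (Suc n))" by (auto simp: INF_less_iff)
    have "(INF b\<in>B. g b) < ennreal (y + 1 / real (Suc n))" unfolding y(2) using y(1) by (intro ennreal_lessI add_nonneg_pos) auto
    then obtain b where b: "b \<in> B" "g b < ennreal (y + 1 / real (Suc n))" by (auto simp: INF_less_iff)
    have "M \<le> ennreal C * f a * g b"
      using a b by (intro le) (auto intro: less_trans[OF _ ennreal_less_top])
    also have "\<dots> \<le> ennreal C * ennreal (x + 1 / real (Suc n)) * ennreal (y + 1 / real (Suc n))"
      using a b by (intro mult_mono) (auto simp: less_imp_le)
    also have "\<dots> = ennreal (C * (x + 1 / real (Suc n)) * (y + 1 / real (Suc n)))"
      using C x y by (simp add: ennreal_mult)
    finally show ?thesis .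
  qed
  have "(\<lambda>n. C * (x + 1 / real (Suc n)) * (y + 1 / real (Suc n))) \<longlonglongrightarrow> C * (x + 0) * (y + 0)"
    by (intro tendsto_intros LIMSEQ_Suc[OF lim_1_over_n])
  then have "(\<lambda>n. ennreal (C * (x + 1 / real (Suc n)) * (y + 1 / real (Suc n)))) \<longlonglongrightarrow> ennreal (C * (x + 0) * (y + 0))"
    by (rule tendsto_ennrealI)
  then have "M \<le> ennreal (C * (x + 0) * (y + 0))" by (rule LIMSEQ_le_const) (use b in blast)
  then show ?thesis using C x y by (simp add: ennreal_mult)
qed

theorem theorem3p1:
  fixes \<alpha> s :: real
  assumes "0 < s" and "s \<le> 1"
  shows "\<exists>\<epsilon>>0. \<forall>b. 1/2 < b \<and> b < 1/2 + \<epsilon> \<longrightarrow>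
    (\<exists>\<sigma>>0. \<exists>C>0. \<forall>T. 0 < T \<and> T < 1 \<longrightarrow>
      (\<forall>u\<in>Xspace \<alpha> s b. \<forall>v\<in>Xspace \<alpha> s b.
        time_support_in {-T..T} u \<and> time_support_in {-T..T} v \<longrightarrow>
        Xnorm \<alpha> s (b - 1) (dist_dx (dist_of (\<lambda>p. u p * v p)))
          \<le> ennreal (C * T powr \<sigma>) * Xnorm \<alpha> s b (dist_of u) * Xnorm \<alpha> s b (dist_of v)))"
proof -
  obtain K where K: "K > 0" and Z: "\<And>\<alpha> s b T u U. fpair u U \<Longrightarrow> T > 0 \<Longrightarrow> time_support_in {-T..T} u \<Longrightarrow> s \<ge> 0 \<Longrightarrow> b \<ge> 1/2 \<Longrightarrow>
    Xn \<alpha> s b (\<lambda>q. ennreal (norm (U q))) < \<infinity> \<Longrightarrow>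
    Zn \<alpha> (\<lambda>q. ennreal (norm (U q))) \<le> ennreal (K * T powr (1/120)) * Xn \<alpha> s b (\<lambda>q. ennreal (norm (U q)))"
    using Zn_time_gain by metis
  show ?thesis
  \<comment> \<open>The range of \<open>b\<close> in which the series in \<open>bilinear_hat\<close>
    converges; it depends on neither \<open>s\<close> nor \<open>\<alpha>\<close>.\<close>
  proof (rule exI[of _ "1/60"], rule conjI, simp, intro allI impI)
    fix b :: real assume b: "1/2 < b \<and> b < 1/2 + 1/60"
    obtain C where C: "C > 0" and BH: "\<forall>f g. f \<in> borel_measurable borel \<longrightarrow> g \<in> borel_measurable borel \<longrightarrow> (\<forall>q. econv f g q < \<infinity>) \<longrightarrow>
      Xn \<alpha> s (b - 1) (\<lambda>q. ennreal \<bar>fst q\<bar> * econv f g q) \<le> ennreal C * (Xn \<alpha> s b f * Zn \<alpha> g + Zn \<alpha> f * Xn \<alpha> s b g)"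
      using bilinear_hat[OF assms, of b \<alpha>] b by blast
    show "\<exists>\<sigma>>0. \<exists>C>0. \<forall>T. 0 < T \<and> T < 1 \<longrightarrow>
      (\<forall>u\<in>Xspace \<alpha> s b. \<forall>v\<in>Xspace \<alpha> s b.
        time_support_in {-T..T} u \<and> time_support_in {-T..T} v \<longrightarrow>
        Xnorm \<alpha> s (b - 1) (dist_dx (dist_of (\<lambda>p. u p * v p)))
          \<le> ennreal (C * T powr \<sigma>) * Xnorm \<alpha> s b (dist_of u) * Xnorm \<alpha> s b (dist_of v))"
    \<comment> \<open>The power is that of \<open>Zn_time_gain\<close>. The factor 2 counts the two
      terms of \<open>bilinear_hat\<close>, in each of which one input gains.\<close>
    proof (rule exI[of _ "1/120"], rule conjI, simp, rule exI[of _ "C * (2 * K)"], rule conjI, use C K in simp, intro allI impI ballI)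
      fix T u v
      assume T: "0 < T \<and> T < 1" and u: "u \<in> Xspace \<alpha> s b" and v: "v \<in> Xspace \<alpha> s b"
        and sup: "time_support_in {-T..T} u \<and> time_support_in {-T..T} v"
      show "Xnorm \<alpha> s (b - 1) (dist_dx (dist_of (\<lambda>p. u p * v p)))
          \<le> ennreal (C * (2 * K) * T powr (1/120)) * Xnorm \<alpha> s b (dist_of u) * Xnorm \<alpha> s b (dist_of v)"
        unfolding Xnorm_def[of \<alpha> s b]
      proof (rule ennreal_le_mult_INF)
        fix U V
        assume "U \<in> {F. has_fourier (dist_of u) F}" "V \<in> {F. has_fourier (dist_of v) F}"
          and Xf: "Xnorm_hat \<alpha> s b U < \<infinity>" "Xnorm_hat \<alpha> s b V < \<infinity>"
        then have f: "fpair u U" "fpair v V" using u v by (auto simp: fpair_def Xspace_def)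
        note fpair_measurable[OF f(1), measurable] fpair_measurable[OF f(2), measurable]
        define g where "g q = ennreal (norm (U q))" for q
        define h where "h q = ennreal (norm (V q))" for q
        have gm[measurable]: "g \<in> borel_measurable borel" "h \<in> borel_measurable borel" unfolding g_def h_def by measurable
        have gX: "Xnorm_hat \<alpha> s b U = Xn \<alpha> s b g" "Xnorm_hat \<alpha> s b V = Xn \<alpha> s b h"
          unfolding Xnorm_hat_eq g_def h_def by simp_all
        have sq: "sqint g < \<infinity>" "sqint h < \<infinity>"
          using sqint_le_Xn[OF gm(1), of s b \<alpha>] sqint_le_Xn[OF gm(2), of s b \<alpha>] Xf assms b unfolding gX
          by (auto simp: power2_eq_square ennreal_mult_less_top elim!: le_less_trans)
        then have fin: "(\<integral>\<^sup>+q. ennreal ((norm (U q))\<^sup>2) \<partial>lborel) < \<infinity>" "(\<integral>\<^sup>+q. ennreal ((norm (V q))\<^sup>2) \<partial>lborel) < \<infinity>"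
          by (simp_all add: g_def h_def ennreal_power)
        have ec: "econv g h q < \<infinity>" for q
        proof -
          have "(econv g h q)\<^sup>2 < \<infinity>"
            using cv_bound(1)[of U V q] fin unfolding g_def[abs_def] h_def[abs_def]
            by (auto simp: ennreal_mult_less_top elim!: le_less_trans)
          then show ?thesis by (auto simp: power2_eq_square ennreal_mult_less_top)
        qed
        define F where "F q = \<i> * complex_of_real (fst q) * (complex_of_real (1 / (2 * pi) ^ 3) * cv U V q)" for q
        have F: "has_fourier (dist_dx (dist_of (\<lambda>p. u p * v p))) F"
          unfolding F_def[abs_def] by (rule has_fourier_dx_product[OF f fin])
        have Fle: "ennreal (norm (F q)) \<le> ennreal \<bar>fst q\<bar> * econv g h q" for q
        proof -
          have p1: "(2 * pi) ^ 3 \<ge> (1::real)" using pi_ge_two by (intro one_le_power) linarith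
          have "norm (F q) = \<bar>fst q\<bar> * (\<bar>1 / (2 * pi) ^ 3\<bar> * norm (cv U V q))"
            unfolding F_def norm_mult norm_of_real by simp
          also have "\<dots> \<le> \<bar>fst q\<bar> * (1 * norm (cv U V q))"
            using p1 by (intro mult_left_mono mult_right_mono) (auto simp: divide_le_eq_1)
          finally have "ennreal (norm (F q)) \<le> ennreal \<bar>fst q\<bar> * ennreal (norm (cv U V q))"
            by (simp add: ennreal_mult[symmetric] ennreal_leI)
          also have "\<dots> \<le> ennreal \<bar>fst q\<bar> * econv g h q"
            unfolding g_def[abs_def] h_def[abs_def] by (intro mult_left_mono cv_bound(2)) auto
          finally show ?thesis .
        qed
        have zg: "Zn \<alpha> g \<le> ennreal (K * T powr (1/120)) * Xn \<alpha> s b g"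
          using Z[OF f(1), of T s b \<alpha>] T sup assms b Xf unfolding gX g_def[abs_def] by simp
        have zh: "Zn \<alpha> h \<le> ennreal (K * T powr (1/120)) * Xn \<alpha> s b h"
          using Z[OF f(2), of T s b \<alpha>] T sup assms b Xf unfolding gX h_def[abs_def] by simp
        have "Xnorm \<alpha> s (b - 1) (dist_dx (dist_of (\<lambda>p. u p * v p))) \<le> Xnorm_hat \<alpha> s (b - 1) F"
          unfolding Xnorm_def by (rule INF_lower) (use F in simp)
        also have "\<dots> \<le> Xn \<alpha> s (b - 1) (\<lambda>q. ennreal \<bar>fst q\<bar> * econv g h q)"
          unfolding Xnorm_hat_eq by (intro Xn_mono Fle)
        also have "\<dots> \<le> ennreal C * (Xn \<alpha> s b g * Zn \<alpha> h + Zn \<alpha> g * Xn \<alpha> s b h)"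
          using BH gm ec by blast
        also have "\<dots> \<le> ennreal C * (Xn \<alpha> s b g * (ennreal (K * T powr (1/120)) * Xn \<alpha> s b h) + (ennreal (K * T powr (1/120)) * Xn \<alpha> s b g) * Xn \<alpha> s b h)"
          by (intro mult_left_mono add_mono mult_right_mono zg zh) auto
        also have "\<dots> = (ennreal C * (2 * ennreal (K * T powr (1/120)))) * Xn \<alpha> s b g * Xn \<alpha> s b h"
          unfolding mult_2 by (simp only: distrib_left distrib_right mult_ac)
        also have "ennreal C * (2 * ennreal (K * T powr (1/120))) = ennreal (C * (2 * K) * T powr (1/120))"
        proof -
          have "ennreal (C * (2 * (K * T powr (1/120)))) = ennreal C * (ennreal 2 * ennreal (K * T powr (1/120)))"
            using C K by (subst ennreal_mult; (subst ennreal_mult)?; simp)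
          then show ?thesis by (simp only: ennreal_numeral mult.assoc)
        qed
        finally show "Xnorm \<alpha> s (b - 1) (dist_dx (dist_of (\<lambda>p. u p * v p))) \<le> ennreal (C * (2 * K) * T powr (1/120)) * Xnorm_hat \<alpha> s b U * Xnorm_hat \<alpha> s b V"
          by (simp only: gX)
      qed (use C K u v in \<open>auto simp: Xspace_def Xnorm_def\<close>)
    qed
  qed
qed

end
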